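(* Let $\Omega$ be the Fraïssé limit of the class of boron tree structures, let $G=\mathrm{Aut}(\Omega)$, let $\mathscr E$ be the collection of all pointwise stabilizers $G(A)$ of finite subsets $A\subset\Omega$, let $k$ be a field of characteristic $\neq2,3$, and let $\mu_1$ be the ($\mathbb Z[1/6]$-valued, regarded as $k$-valued) measure for $(G,\mathscr E)$ defined in the context. Then the Karoubi envelope of $\underline{\mathrm{Perm}}_k(G,\mathscr E;\mu_1)$ is a semi-simple pre-Tannakian category.
   Context: A boron tree is a finite tree in which all internal vertices have valence three; leaves are called hydrogen atoms (the empty tree and the one-vertex tree are allowed). For a boron tree $T$, its set $T_H$ of hydrogen atoms carries the quaternary relation $R$: $R(w,x;y,z)$ holds if the geodesic joining $w,x$ meets the geodesic joining $y,z$. Let $\mathfrak A$ be the class of finite structures (on one quaternary relation) isomorphic to some $(T_H,R)$. It is a Fraïssé class; its Fraïssé limit $\Omega$ is the unique countable structure whose finite substructures are, up to isomorphism, exactly the members of $\mathfrak A$ and which is homogeneous (isomorphisms between finite substructures extend to automorphisms). $G=\mathrm{Aut}(\Omega)$ has the topology in which the subgroups $G(A)$ ($A\subset\Omega$ finite) form a neighborhood basis of the identity. All actions are smooth (open stabilizers); finitary means finitely many orbits. A $\hat G$-set is a set with a smooth action of some open subgroup $U$ (a group of definition), where shrinking $U$ does not change the $\hat G$-set; it is finitary if $U$ has finitely many orbits. Maps of $\hat G$-sets are functions equivariant for some common open group of definition. For $g\in G$, $X^g$ is the same set with action $h\bullet x=(g^{-1}hg)\cdot x$. For an open subgroup $U$,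 a $U$-set is $\mathscr E$-smooth if every stabilizer has the form $U\cap V$ with $V\in\mathscr E$; a $\hat G$-set is $\mathscr E$-smooth if it is so for some group of definition. A measure for $(G,\mathscr E)$ valued in a commutative ring $k$ is a rule $\mu$ assigning to each finitary $\mathscr E$-smooth $\hat G$-set $X$ an element $\mu(X)\in k$ such that: isomorphic sets have equal measure; a one-point set has measure $1$; $\mu(X\amalg Y)=\mu(X)+\mu(Y)$; $\mu(X^g)=\mu(X)$; and $\mu(X)=\mu(F)\mu(Y)$ if $X\to Y$ is a map of transitive $\mathscr E$-smooth $U$-sets ($U$ open) with fiber $F$ over some point. Put $\nu(0)=1$, $\nu(1)=\tfrac32$, and $\nu(n)=3\cdot(-\tfrac12)^n$ for $n\ge2$. The measure $\mu_1$ is the unique $\mathbb Z[1/6]$-valued measure for $(G,\mathscr E)$ such that $\mu_1(G(A)/G(B))=\nu(\#B)/\nu(\#A)$ for all finite subsets $A\subset B$ of $\Omega$ (such a measure exists); it is regarded as $k$-valued via $\mathbb Z[1/6]\to k$. A Schwartz function on an $\mathscr E$-smooth $\hat G$-set $X$ is a function $\phi\colon X\to k$ invariant under some group of definition and with finitary support; it takes finitely many non-zero values $c_i$ and $\int_X\phi(x)\,dx=\sum_i c_i\,\mu_1(\phi^{-1}(c_i))$. A tensor category is a $k$-linear additive symmetric monoidal category with $k$-bilinear product. $\underline{\mathrm{Perm}}_k(G,\mathscr E;\mu_1)$ is the tensor category with an object $\mathrm{Vec}_X$ for each finitary $\mathscr E$-smooth $G$-set $X$; $\mathrm{Hom}(\mathrm{Vec}_X,\mathrm{Vec}_Y)$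 the set of $G$-invariant functions $Y\times X\to k$; composition $(BA)(z,x)=\int_Y B(z,y)A(y,x)\,dy$; $\mathrm{Vec}_X\oplus\mathrm{Vec}_Y=\mathrm{Vec}_{X\amalg Y}$; $\mathrm{Vec}_X\underline\otimes\mathrm{Vec}_Y=\mathrm{Vec}_{X\times Y}$, $(A_1\underline\otimes A_2)(y_1,y_2,x_1,x_2)=A_1(y_1,x_1)A_2(y_2,x_2)$, with constraints induced from cartesian product of $G$-sets. The Karoubi envelope is the idempotent completion, with its induced tensor structure. A $k$-linear tensor category is pre-Tannakian if: it is abelian with all objects of finite length; all $\mathrm{Hom}$ spaces are finite dimensional over $k$; the unit $\mathbb 1$ is simple with $\mathrm{End}(\mathbb 1)=k$; every object has a dual. *)

theory Defs
  imports Complex_Main "HOL-Library.Countable_Set" "HOL-Algebra.Group_Action" "HOL-Algebra.Module"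
begin

section \<open>Boron trees and their Fraisse limit\<close>

text \<open>A finite simple graph is a vertex set together with a set of two-element subsets of it.\<close>

record 'v graph =
  verts :: "'v set"
  edges :: "'v set set"

definition is_walk :: "'v graph \<Rightarrow> 'v list \<Rightarrow> 'v \<Rightarrow> 'v \<Rightarrow> bool" where
  "is_walk T p u v \<longleftrightarrow> p \<noteq> [] \<and> set p \<subseteq> verts T \<and>
     successively (\<lambda>a b. {a, b} \<in> edges T) p \<and> hd p = u \<and> last p = v"

definition is_cycle :: "'v graph \<Rightarrow> 'v list \<Rightarrow> bool" where
  "is_cycle T p \<longleftrightarrow> length p \<ge> 3 \<and> distinct p \<and> is_walk T p (hd p) (last p) \<and>
     {last p, hd p} \<in> edges T"

definition finite_tree :: "'v graph \<Rightarrow> bool" where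
  "finite_tree T \<longleftrightarrow> finite (verts T) \<and>
     edges T \<subseteq> {{u, v} | u v. u \<in> verts T \<and> v \<in> verts T \<and> u \<noteq> v} \<and>
     (\<forall>u\<in>verts T. \<forall>v\<in>verts T. \<exists>p. is_walk T p u v) \<and>
     (\<nexists>p. is_cycle T p)"

definition valence :: "'v graph \<Rightarrow> 'v \<Rightarrow> nat" where
  "valence T v = card {e \<in> edges T. v \<in> e}"

text \<open>The vertex of the one-vertex tree has valence 0 and counts as a leaf (hydrogen atom).\<close>

definition hydrogens :: "'v graph \<Rightarrow> 'v set" where
  "hydrogens T = {v \<in> verts T. valence T v \<le> 1}"

definition boron_tree :: "'v graph \<Rightarrow> bool" where
  "boron_tree T \<longleftrightarrow> finite_tree T \<and> (\<forall>v\<in>verts T. v \<notin> hydrogens T \<longrightarrow> valence T v = 3)"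

definition is_geodesic :: "'v graph \<Rightarrow> 'v list \<Rightarrow> 'v \<Rightarrow> 'v \<Rightarrow> bool" where
  "is_geodesic T p u v \<longleftrightarrow> is_walk T p u v \<and> (\<forall>q. is_walk T q u v \<longrightarrow> length p \<le> length q)"

definition boron_rel :: "'v graph \<Rightarrow> 'v \<Rightarrow> 'v \<Rightarrow> 'v \<Rightarrow> 'v \<Rightarrow> bool" where
  "boron_rel T w x y z \<longleftrightarrow>
     (\<exists>p q. is_geodesic T p w x \<and> is_geodesic T q y z \<and> set p \<inter> set q \<noteq> {})"

definition rel_iso ::
  "('b \<Rightarrow> 'c) \<Rightarrow> 'b set \<Rightarrow> ('b \<Rightarrow> 'b \<Rightarrow> 'b \<Rightarrow> 'b \<Rightarrow> bool) \<Rightarrow>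
     'c set \<Rightarrow> ('c \<Rightarrow> 'c \<Rightarrow> 'c \<Rightarrow> 'c \<Rightarrow> bool) \<Rightarrow> bool" where
  "rel_iso f A R B S \<longleftrightarrow> bij_betw f A B \<and>
     (\<forall>w\<in>A. \<forall>x\<in>A. \<forall>y\<in>A. \<forall>z\<in>A. R w x y z \<longleftrightarrow> S (f w) (f x) (f y) (f z))"

text \<open>Up to isomorphism every finite tree has its vertices in \<^typ>\<open>nat\<close>.\<close>

definition boron_structure :: "'b set \<Rightarrow> ('b \<Rightarrow> 'b \<Rightarrow> 'b \<Rightarrow> 'b \<Rightarrow> bool) \<Rightarrow> bool" where
  "boron_structure A R \<longleftrightarrow>
     (\<exists>(T :: nat graph) f. boron_tree T \<and> rel_iso f A R (hydrogens T) (boron_rel T))"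

definition aut :: "('w \<Rightarrow> 'w \<Rightarrow> 'w \<Rightarrow> 'w \<Rightarrow> bool) \<Rightarrow> ('w \<Rightarrow> 'w) set" where
  "aut R = {g. rel_iso g UNIV R UNIV R}"

text \<open>The underlying set of the limit structure is the whole type \<open>'w\<close>.\<close>

definition boron_fraisse_limit :: "('w \<Rightarrow> 'w \<Rightarrow> 'w \<Rightarrow> 'w \<Rightarrow> bool) \<Rightarrow> bool" where
  "boron_fraisse_limit R \<longleftrightarrow>
     countable (UNIV :: 'w set) \<and>
     (\<forall>A. finite A \<longrightarrow> boron_structure A R) \<and>
     (\<forall>(B :: nat set) S. boron_structure B S \<longrightarrow> (\<exists>A f. finite A \<and> rel_iso f B S A R)) \<and>
     (\<forall>A B f. finite A \<and> finite B \<and> rel_iso f A R B R \<longrightarrow>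
        (\<exists>g\<in>aut R. \<forall>a\<in>A. g a = f a))"

section \<open>Smooth actions\<close>

text \<open>Throughout, \<open>G\<close> is a set of permutations of \<open>'w\<close> closed under the group operations.\<close>

definition perm_grp :: "('w \<Rightarrow> 'w) set \<Rightarrow> ('w \<Rightarrow> 'w) monoid" where
  "perm_grp U = \<lparr>carrier = U, mult = (\<circ>), one = id\<rparr>"

definition pstab :: "('w \<Rightarrow> 'w) set \<Rightarrow> 'w set \<Rightarrow> ('w \<Rightarrow> 'w) set" where
  "pstab G A = {g \<in> G. \<forall>a\<in>A. g a = a}"

definition stab_class :: "('w \<Rightarrow> 'w) set \<Rightarrow> ('w \<Rightarrow> 'w) set set" where
  "stab_class G = {pstab G A | A. finite A}"

definition open_subgroup :: "('w \<Rightarrow> 'w) set \<Rightarrow> ('w \<Rightarrow> 'w) set \<Rightarrow> bool" where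
  "open_subgroup G U \<longleftrightarrow> subgroup U (perm_grp G) \<and> (\<exists>A. finite A \<and> pstab G A \<subseteq> U)"

text \<open>
  A \<open>G\<close>-hat set is presented by a group of definition, a set and an action of that group.
  Different presentations of the same \<open>G\<close>-hat set are identified by \<open>hat_iso\<close> below, which
  only asks for equivariance under some smaller common group of definition.
\<close>

record ('w, 'x) gset =
  grp :: "('w \<Rightarrow> 'w) set"
  pts :: "'x set"
  act :: "('w \<Rightarrow> 'w) \<Rightarrow> 'x \<Rightarrow> 'x"

definition hat_set :: "('w \<Rightarrow> 'w) set \<Rightarrow> ('w, 'x) gset \<Rightarrow> bool" where
  "hat_set G X \<longleftrightarrow> open_subgroup G (grp X) \<and>
     group_action (perm_grp (grp X)) (pts X) (act X) \<and>
     (\<forall>x\<in>pts X. open_subgroup G (stabilizer (perm_grp (grp X)) (act X) x))"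

definition sub_gset :: "('w, 'x) gset \<Rightarrow> ('w \<Rightarrow> 'w) set \<Rightarrow> 'x set \<Rightarrow> ('w, 'x) gset" where
  "sub_gset X V S = \<lparr>grp = V, pts = S, act = (\<lambda>h. restrict (act X h) S)\<rparr>"

definition finitary :: "('w, 'x) gset \<Rightarrow> bool" where
  "finitary X \<longleftrightarrow> finite (orbits (perm_grp (grp X)) (pts X) (act X))"

definition E_smooth_act :: "('w \<Rightarrow> 'w) set set \<Rightarrow> ('w, 'x) gset \<Rightarrow> bool" where
  "E_smooth_act E X \<longleftrightarrow>
     (\<forall>x\<in>pts X. \<exists>V\<in>E. stabilizer (perm_grp (grp X)) (act X) x = grp X \<inter> V)"

definition E_smooth_hat ::
  "('w \<Rightarrow> 'w) set \<Rightarrow> ('w \<Rightarrow> 'w) set set \<Rightarrow> ('w, 'x) gset \<Rightarrow> bool" where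
  "E_smooth_hat G E X \<longleftrightarrow>
     (\<exists>V. open_subgroup G V \<and> V \<subseteq> grp X \<and> E_smooth_act E (sub_gset X V (pts X)))"

definition fin_smooth_hat ::
  "('w \<Rightarrow> 'w) set \<Rightarrow> ('w \<Rightarrow> 'w) set set \<Rightarrow> ('w, 'x) gset \<Rightarrow> bool" where
  "fin_smooth_hat G E X \<longleftrightarrow> hat_set G X \<and> finitary X \<and> E_smooth_hat G E X"

definition hat_iso :: "('w \<Rightarrow> 'w) set \<Rightarrow> ('w, 'x) gset \<Rightarrow> ('w, 'y) gset \<Rightarrow> bool" where
  "hat_iso G X Y \<longleftrightarrow>
     (\<exists>f V. bij_betw f (pts X) (pts Y) \<and> open_subgroup G V \<and> V \<subseteq> grp X \<inter> grp Y \<and>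
        (\<forall>h\<in>V. \<forall>x\<in>pts X. f (act X h x) = act Y h (f x)))"

definition conj_gset :: "('w \<Rightarrow> 'w) set \<Rightarrow> ('w \<Rightarrow> 'w) \<Rightarrow> ('w, 'x) gset \<Rightarrow> ('w, 'x) gset" where
  "conj_gset G g X = (let g' = inv\<^bsub>perm_grp G\<^esub> g in
     \<lparr>grp = (\<lambda>u. g \<circ> u \<circ> g') ` grp X, pts = pts X, act = (\<lambda>h. act X (g' \<circ> h \<circ> g))\<rparr>)"

definition coset_gset ::
  "('w \<Rightarrow> 'w) set \<Rightarrow> 'w set \<Rightarrow> 'w set \<Rightarrow> ('w, ('w \<Rightarrow> 'w) set) gset" where
  "coset_gset G A B = (let Q = (\<lambda>g. g <#\<^bsub>perm_grp G\<^esub> pstab G B) ` pstab G A in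
     \<lparr>grp = pstab G A, pts = Q, act = (\<lambda>h. \<lambda>C\<in>Q. h <#\<^bsub>perm_grp G\<^esub> C)\<rparr>)"

text \<open>
  A universe of points containing an arbitrary type \<open>'a\<close> and closed under the formation of a
  one-point set, products and disjoint unions. It is always infinite, and the finitary sets for
  the automorphism group of a countable structure are countable; so for every choice of \<open>'a\<close>,
  each of them is isomorphic to one with points in \<open>'a univ\<close>.
\<close>

datatype 'a univ = UAtom 'a | UPoint | UPair "'a univ" "'a univ" | UInl "'a univ" | UInr "'a univ"

definition point_gset :: "('w \<Rightarrow> 'w) set \<Rightarrow> ('w, 'a univ) gset" where
  "point_gset U = \<lparr>grp = U, pts = {UPoint}, act = (\<lambda>h. \<lambda>x\<in>{UPoint}. x)\<rparr>"

definition sum_gset :: "('w, 'a univ) gset \<Rightarrow> ('w, 'a univ) gset \<Rightarrow> ('w, 'a univ) gset" where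
  "sum_gset X Y = (let S = UInl ` pts X \<union> UInr ` pts Y in
     \<lparr>grp = grp X \<inter> grp Y, pts = S,
      act = (\<lambda>h. \<lambda>s\<in>S. case s of UInl x \<Rightarrow> UInl (act X h x) | UInr y \<Rightarrow> UInr (act Y h y))\<rparr>)"

definition prod_gset :: "('w, 'a univ) gset \<Rightarrow> ('w, 'a univ) gset \<Rightarrow> ('w, 'a univ) gset" where
  "prod_gset X Y = (let S = {UPair x y | x y. x \<in> pts X \<and> y \<in> pts Y} in
     \<lparr>grp = grp X \<inter> grp Y, pts = S,
      act = (\<lambda>h. \<lambda>s\<in>S. case s of UPair x y \<Rightarrow> UPair (act X h x) (act Y h y))\<rparr>)"

section \<open>Measures and integration\<close>

locale gset_measure =
  fixes G :: "('w \<Rightarrow> 'w) set"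
    and E :: "('w \<Rightarrow> 'w) set set"
    and \<mu> :: "('w, 'a univ) gset \<Rightarrow> 'r::comm_ring_1"
  assumes iso_invariant:
      "\<lbrakk>fin_smooth_hat G E X; fin_smooth_hat G E Y; hat_iso G X Y\<rbrakk> \<Longrightarrow> \<mu> X = \<mu> Y"
    and one_point:
      "\<lbrakk>fin_smooth_hat G E X; pts X = {x}\<rbrakk> \<Longrightarrow> \<mu> X = 1"
    and additive:
      "\<lbrakk>fin_smooth_hat G E X; fin_smooth_hat G E Y\<rbrakk> \<Longrightarrow> \<mu> (sum_gset X Y) = \<mu> X + \<mu> Y"
    and conj_invariant:
      "\<lbrakk>fin_smooth_hat G E X; g \<in> G\<rbrakk> \<Longrightarrow> \<mu> (conj_gset G g X) = \<mu> X"
    and fibration: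
      "\<lbrakk>open_subgroup G U;
        hat_set G X; grp X = U; E_smooth_act E X;
        transitive_action (perm_grp U) (pts X) (act X); pts X \<noteq> {};
        hat_set G Y; grp Y = U; E_smooth_act E Y;
        transitive_action (perm_grp U) (pts Y) (act Y); pts Y \<noteq> {};
        f \<in> pts X \<rightarrow> pts Y; \<And>h x. \<lbrakk>h \<in> U; x \<in> pts X\<rbrakk> \<Longrightarrow> f (act X h x) = act Y h (f x);
        y \<in> pts Y\<rbrakk>
       \<Longrightarrow> \<mu> X = \<mu> (sub_gset X (stabilizer (perm_grp U) (act Y) y) {x \<in> pts X. f x = y}) * \<mu> Y"

text \<open>
  The group below is the largest group of definition leaving \<open>\<phi>\<close> invariant; it is open exactly
  when \<open>\<phi>\<close> is invariant under some group of definition. By isomorphism invariance of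
  measures, passing to a smaller group does not change the integral of a Schwartz function.
\<close>

definition invariance_group :: "('w, 'x) gset \<Rightarrow> ('x \<Rightarrow> 'k) \<Rightarrow> ('w \<Rightarrow> 'w) set" where
  "invariance_group X \<phi> = {h \<in> grp X. \<forall>x\<in>pts X. \<phi> (act X h x) = \<phi> x}"

definition gset_integral ::
  "(('w, 'x) gset \<Rightarrow> 'k::field) \<Rightarrow> ('w, 'x) gset \<Rightarrow> ('x \<Rightarrow> 'k) \<Rightarrow> 'k" where
  "gset_integral \<mu> X \<phi> =
     (\<Sum>c\<in>\<phi> ` pts X - {0}. c * \<mu> (sub_gset X (invariance_group X \<phi>) {x \<in> pts X. \<phi> x = c}))"

definition nu :: "nat \<Rightarrow> rat" where
  "nu n = (if n = 0 then 1 else if n = 1 then 3/2 else 3 * (- 1/2) ^ n)"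

definition Z_sixth :: "rat set" where
  "Z_sixth = {of_int a / 6 ^ n | (a :: int) (n :: nat). True}"

definition is_mu1 ::
  "('w \<Rightarrow> 'w \<Rightarrow> 'w \<Rightarrow> 'w \<Rightarrow> bool) \<Rightarrow> (('w, 'a univ) gset \<Rightarrow> rat) \<Rightarrow> bool" where
  "is_mu1 R \<mu> \<longleftrightarrow>
     gset_measure (aut R) (stab_class (aut R)) \<mu> \<and>
     (\<forall>X. fin_smooth_hat (aut R) (stab_class (aut R)) X \<longrightarrow> \<mu> X \<in> Z_sixth) \<and>
     (\<forall>A B X. finite B \<and> A \<subseteq> B \<and> fin_smooth_hat (aut R) (stab_class (aut R)) X \<and>
        hat_iso (aut R) X (coset_gset (aut R) A B) \<longrightarrow> \<mu> X = nu (card B) / nu (card A))"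

text \<open>
  The ring homomorphism from \<open>Z_sixth\<close> to a field of characteristic different from 2 and 3: the
  reduced denominator of an element of \<open>Z_sixth\<close> only has prime factors 2 and 3.
\<close>

definition of_Z_sixth :: "rat \<Rightarrow> 'k::field" where
  "of_Z_sixth r = of_int (fst (quotient_of r)) / of_int (snd (quotient_of r))"

section \<open>Linear tensor categories\<close>

definition field_ring :: "'k::field ring" where
  "field_ring = \<lparr>carrier = UNIV, mult = (*), one = 1, zero = 0, add = (+)\<rparr>"

text \<open>
  Hom sets are \<^type>\<open>module\<close> records over \<^const>\<open>field_ring\<close>, whose multiplicative fields are
  irrelevant. Hom sets for different pairs of objects need not be disjoint.
  \<open>cassoc X Y Z\<close> goes from \<open>(X \<otimes> Y) \<otimes> Z\<close> to \<open>X \<otimes> (Y \<otimes> Z)\<close>.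
\<close>

record ('o, 'a, 'k) tensor_cat =
  cob :: "'o set"
  cHom :: "'o \<Rightarrow> 'o \<Rightarrow> ('k, 'a) module"
  cid :: "'o \<Rightarrow> 'a"
  ccomp :: "'a \<Rightarrow> 'a \<Rightarrow> 'a"  (infixr \<open>\<cdot>\<index>\<close> 55)
  tob :: "'o \<Rightarrow> 'o \<Rightarrow> 'o"  (infixr \<open>\<otimes>\<^sub>o\<index>\<close> 70)
  tmor :: "'a \<Rightarrow> 'a \<Rightarrow> 'a"  (infixr \<open>\<otimes>\<^sub>m\<index>\<close> 70)
  cunit :: 'o
  cassoc :: "'o \<Rightarrow> 'o \<Rightarrow> 'o \<Rightarrow> 'a"
  clunit :: "'o \<Rightarrow> 'a"
  crunit :: "'o \<Rightarrow> 'a"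
  cbraid :: "'o \<Rightarrow> 'o \<Rightarrow> 'a"

abbreviation chom :: "('o, 'a, 'k) tensor_cat \<Rightarrow> 'o \<Rightarrow> 'o \<Rightarrow> 'a set" where
  "chom C X Y \<equiv> carrier (cHom C X Y)"

locale cat_data =
  fixes C :: "('o, 'a, 'k::field) tensor_cat" (structure)
begin

definition inverse_maps :: "'o \<Rightarrow> 'o \<Rightarrow> 'a \<Rightarrow> 'a \<Rightarrow> bool" where
  "inverse_maps X Y f g \<longleftrightarrow> f \<in> chom C X Y \<and> g \<in> chom C Y X \<and> g \<cdot> f = cid C X \<and> f \<cdot> g = cid C Y"

definition is_iso :: "'o \<Rightarrow> 'o \<Rightarrow> 'a \<Rightarrow> bool" where
  "is_iso X Y f \<longleftrightarrow> (\<exists>g. inverse_maps X Y f g)"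

definition is_mono :: "'o \<Rightarrow> 'o \<Rightarrow> 'a \<Rightarrow> bool" where
  "is_mono X Y f \<longleftrightarrow> f \<in> chom C X Y \<and>
     (\<forall>W\<in>cob C. \<forall>g\<in>chom C W X. \<forall>h\<in>chom C W X. f \<cdot> g = f \<cdot> h \<longrightarrow> g = h)"

definition is_epi :: "'o \<Rightarrow> 'o \<Rightarrow> 'a \<Rightarrow> bool" where
  "is_epi X Y f \<longleftrightarrow> f \<in> chom C X Y \<and>
     (\<forall>Z\<in>cob C. \<forall>g\<in>chom C Y Z. \<forall>h\<in>chom C Y Z. g \<cdot> f = h \<cdot> f \<longrightarrow> g = h)"

definition zero_object :: "'o \<Rightarrow> bool" where
  "zero_object Z \<longleftrightarrow> Z \<in> cob C \<and>
     (\<forall>X\<in>cob C. (\<exists>!f. f \<in> chom C X Z) \<and> (\<exists>!f. f \<in> chom C Z X))"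

text \<open>\<open>Y\<close> is a biproduct of the finite (possibly empty) family \<open>Xs\<close>.\<close>

definition direct_sum :: "'o list \<Rightarrow> 'o \<Rightarrow> bool" where
  "direct_sum Xs Y \<longleftrightarrow> Y \<in> cob C \<and> set Xs \<subseteq> cob C \<and>
     (\<exists>i p. (\<forall>j<length Xs. i j \<in> chom C (Xs ! j) Y \<and> p j \<in> chom C Y (Xs ! j)) \<and>
        (\<forall>j<length Xs. \<forall>l<length Xs. p j \<cdot> i l =
           (if j = l then cid C (Xs ! j) else \<zero>\<^bsub>cHom C (Xs ! l) (Xs ! j)\<^esub>)) \<and>
        finsum (cHom C Y Y) (\<lambda>j. i j \<cdot> p j) {..<length Xs} = cid C Y)"

definition is_kernel :: "'o \<Rightarrow> 'a \<Rightarrow> 'o \<Rightarrow> 'a \<Rightarrow> 'o \<Rightarrow> bool" where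
  "is_kernel K k X f Y \<longleftrightarrow> K \<in> cob C \<and> X \<in> cob C \<and> Y \<in> cob C \<and>
     k \<in> chom C K X \<and> f \<in> chom C X Y \<and> f \<cdot> k = \<zero>\<^bsub>cHom C K Y\<^esub> \<and>
     (\<forall>W\<in>cob C. \<forall>w\<in>chom C W X. f \<cdot> w = \<zero>\<^bsub>cHom C W Y\<^esub> \<longrightarrow> (\<exists>!u. u \<in> chom C W K \<and> k \<cdot> u = w))"

definition is_cokernel :: "'o \<Rightarrow> 'a \<Rightarrow> 'o \<Rightarrow> 'a \<Rightarrow> 'o \<Rightarrow> bool" where
  "is_cokernel X f Y q Q \<longleftrightarrow> X \<in> cob C \<and> Y \<in> cob C \<and> Q \<in> cob C \<and>
     f \<in> chom C X Y \<and> q \<in> chom C Y Q \<and> q \<cdot> f = \<zero>\<^bsub>cHom C X Q\<^esub> \<and>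
     (\<forall>W\<in>cob C. \<forall>w\<in>chom C Y W. w \<cdot> f = \<zero>\<^bsub>cHom C X W\<^esub> \<longrightarrow> (\<exists>!u. u \<in> chom C Q W \<and> u \<cdot> q = w))"

definition short_exact :: "'o \<Rightarrow> 'a \<Rightarrow> 'o \<Rightarrow> 'a \<Rightarrow> 'o \<Rightarrow> bool" where
  "short_exact X i Y p Z \<longleftrightarrow> is_kernel X i Y p Z \<and> is_cokernel X i Y p Z"

definition simple_object :: "'o \<Rightarrow> bool" where
  "simple_object S \<longleftrightarrow> S \<in> cob C \<and> \<not> zero_object S \<and>
     (\<forall>Y\<in>cob C. \<forall>f. is_mono Y S f \<longrightarrow> zero_object Y \<or> is_iso Y S f)"

text \<open>Objects with a finite composition series.\<close>

inductive finite_length :: "'o \<Rightarrow> bool" where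
  zero: "zero_object X \<Longrightarrow> finite_length X"
| extend: "\<lbrakk>finite_length X; short_exact X i Y p S; simple_object S\<rbrakk> \<Longrightarrow> finite_length Y"

definition fin_dim_hom :: "'o \<Rightarrow> 'o \<Rightarrow> bool" where
  "fin_dim_hom X Y \<longleftrightarrow> (\<exists>B. finite B \<and> B \<subseteq> chom C X Y \<and>
     (\<forall>f\<in>chom C X Y. \<exists>c. f = finsum (cHom C X Y) (\<lambda>b. c b \<odot>\<^bsub>cHom C X Y\<^esub> b) B))"

definition is_dual :: "'o \<Rightarrow> 'o \<Rightarrow> bool" where
  "is_dual X Y \<longleftrightarrow> Y \<in> cob C \<and>
     (\<exists>ev\<in>chom C (Y \<otimes>\<^sub>o X) (cunit C). \<exists>cv\<in>chom C (cunit C) (X \<otimes>\<^sub>o Y).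
        crunit C X \<cdot> (cid C X \<otimes>\<^sub>m ev) \<cdot> cassoc C X Y X \<cdot> (cv \<otimes>\<^sub>m cid C X) = clunit C X \<and>
        (\<exists>a. inverse_maps ((Y \<otimes>\<^sub>o X) \<otimes>\<^sub>o Y) (Y \<otimes>\<^sub>o (X \<otimes>\<^sub>o Y)) (cassoc C Y X Y) a \<and>
           clunit C Y \<cdot> (ev \<otimes>\<^sub>m cid C Y) \<cdot> a \<cdot> (cid C Y \<otimes>\<^sub>m cv) = crunit C Y))"

end

locale linear_category = cat_data C for C :: "('o, 'a, 'k::field) tensor_cat" (structure) +
  assumes hom_module: "\<lbrakk>X \<in> cob C; Y \<in> cob C\<rbrakk> \<Longrightarrow> module field_ring (cHom C X Y)"
    and id_closed: "X \<in> cob C \<Longrightarrow> cid C X \<in> chom C X X"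
    and comp_closed:
      "\<lbrakk>X \<in> cob C; Y \<in> cob C; Z \<in> cob C; f \<in> chom C X Y; g \<in> chom C Y Z\<rbrakk> \<Longrightarrow> g \<cdot> f \<in> chom C X Z"
    and id_left: "\<lbrakk>X \<in> cob C; Y \<in> cob C; f \<in> chom C X Y\<rbrakk> \<Longrightarrow> cid C Y \<cdot> f = f"
    and id_right: "\<lbrakk>X \<in> cob C; Y \<in> cob C; f \<in> chom C X Y\<rbrakk> \<Longrightarrow> f \<cdot> cid C X = f"
    and comp_assoc:
      "\<lbrakk>W \<in> cob C; X \<in> cob C; Y \<in> cob C; Z \<in> cob C;
        f \<in> chom C W X; g \<in> chom C X Y; h \<in> chom C Y Z\<rbrakk> \<Longrightarrow> (h \<cdot> g) \<cdot> f = h \<cdot> (g \<cdot> f)"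
    and comp_add_left:
      "\<lbrakk>X \<in> cob C; Y \<in> cob C; Z \<in> cob C; f \<in> chom C X Y; g \<in> chom C Y Z; g' \<in> chom C Y Z\<rbrakk>
       \<Longrightarrow> (g \<oplus>\<^bsub>cHom C Y Z\<^esub> g') \<cdot> f = (g \<cdot> f) \<oplus>\<^bsub>cHom C X Z\<^esub> (g' \<cdot> f)"
    and comp_add_right:
      "\<lbrakk>X \<in> cob C; Y \<in> cob C; Z \<in> cob C; f \<in> chom C X Y; f' \<in> chom C X Y; g \<in> chom C Y Z\<rbrakk>
       \<Longrightarrow> g \<cdot> (f \<oplus>\<^bsub>cHom C X Y\<^esub> f') = (g \<cdot> f) \<oplus>\<^bsub>cHom C X Z\<^esub> (g \<cdot> f')"
    and comp_smult_left:
      "\<lbrakk>X \<in> cob C; Y \<in> cob C; Z \<in> cob C; f \<in> chom C X Y; g \<in> chom C Y Z\<rbrakk>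
       \<Longrightarrow> (c \<odot>\<^bsub>cHom C Y Z\<^esub> g) \<cdot> f = c \<odot>\<^bsub>cHom C X Z\<^esub> (g \<cdot> f)"
    and comp_smult_right:
      "\<lbrakk>X \<in> cob C; Y \<in> cob C; Z \<in> cob C; f \<in> chom C X Y; g \<in> chom C Y Z\<rbrakk>
       \<Longrightarrow> g \<cdot> (c \<odot>\<^bsub>cHom C X Y\<^esub> f) = c \<odot>\<^bsub>cHom C X Z\<^esub> (g \<cdot> f)"

locale additive_category = linear_category +
  assumes direct_sums_exist: "set Xs \<subseteq> cob C \<Longrightarrow> \<exists>Y. direct_sum Xs Y"

locale tensor_category = additive_category +
  assumes unit_ob: "cunit C \<in> cob C"
    and tob_closed: "\<lbrakk>X \<in> cob C; Y \<in> cob C\<rbrakk> \<Longrightarrow> X \<otimes>\<^sub>o Y \<in> cob C"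
    and tmor_closed:
      "\<lbrakk>X \<in> cob C; Y \<in> cob C; X' \<in> cob C; Y' \<in> cob C; f \<in> chom C X Y; f' \<in> chom C X' Y'\<rbrakk>
       \<Longrightarrow> f \<otimes>\<^sub>m f' \<in> chom C (X \<otimes>\<^sub>o X') (Y \<otimes>\<^sub>o Y')"
    and tmor_id:
      "\<lbrakk>X \<in> cob C; Y \<in> cob C\<rbrakk> \<Longrightarrow> cid C X \<otimes>\<^sub>m cid C Y = cid C (X \<otimes>\<^sub>o Y)"
    and tmor_comp:
      "\<lbrakk>X \<in> cob C; Y \<in> cob C; Z \<in> cob C; X' \<in> cob C; Y' \<in> cob C; Z' \<in> cob C;
        f \<in> chom C X Y; g \<in> chom C Y Z; f' \<in> chom C X' Y'; g' \<in> chom C Y' Z'\<rbrakk>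
       \<Longrightarrow> (g \<cdot> f) \<otimes>\<^sub>m (g' \<cdot> f') = (g \<otimes>\<^sub>m g') \<cdot> (f \<otimes>\<^sub>m f')"
    and tmor_add_left:
      "\<lbrakk>X \<in> cob C; Y \<in> cob C; X' \<in> cob C; Y' \<in> cob C;
        f \<in> chom C X Y; g \<in> chom C X Y; f' \<in> chom C X' Y'\<rbrakk>
       \<Longrightarrow> (f \<oplus>\<^bsub>cHom C X Y\<^esub> g) \<otimes>\<^sub>m f' =
           (f \<otimes>\<^sub>m f') \<oplus>\<^bsub>cHom C (X \<otimes>\<^sub>o X') (Y \<otimes>\<^sub>o Y')\<^esub> (g \<otimes>\<^sub>m f')"
    and tmor_add_right:
      "\<lbrakk>X \<in> cob C; Y \<in> cob C; X' \<in> cob C; Y' \<in> cob C;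
        f \<in> chom C X Y; f' \<in> chom C X' Y'; g' \<in> chom C X' Y'\<rbrakk>
       \<Longrightarrow> f \<otimes>\<^sub>m (f' \<oplus>\<^bsub>cHom C X' Y'\<^esub> g') =
           (f \<otimes>\<^sub>m f') \<oplus>\<^bsub>cHom C (X \<otimes>\<^sub>o X') (Y \<otimes>\<^sub>o Y')\<^esub> (f \<otimes>\<^sub>m g')"
    and tmor_smult_left:
      "\<lbrakk>X \<in> cob C; Y \<in> cob C; X' \<in> cob C; Y' \<in> cob C; f \<in> chom C X Y; f' \<in> chom C X' Y'\<rbrakk>
       \<Longrightarrow> (c \<odot>\<^bsub>cHom C X Y\<^esub> f) \<otimes>\<^sub>m f' = c \<odot>\<^bsub>cHom C (X \<otimes>\<^sub>o X') (Y \<otimes>\<^sub>o Y')\<^esub> (f \<otimes>\<^sub>m f')"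
    and tmor_smult_right:
      "\<lbrakk>X \<in> cob C; Y \<in> cob C; X' \<in> cob C; Y' \<in> cob C; f \<in> chom C X Y; f' \<in> chom C X' Y'\<rbrakk>
       \<Longrightarrow> f \<otimes>\<^sub>m (c \<odot>\<^bsub>cHom C X' Y'\<^esub> f') = c \<odot>\<^bsub>cHom C (X \<otimes>\<^sub>o X') (Y \<otimes>\<^sub>o Y')\<^esub> (f \<otimes>\<^sub>m f')"
    and assoc_iso:
      "\<lbrakk>X \<in> cob C; Y \<in> cob C; Z \<in> cob C\<rbrakk>
       \<Longrightarrow> is_iso ((X \<otimes>\<^sub>o Y) \<otimes>\<^sub>o Z) (X \<otimes>\<^sub>o (Y \<otimes>\<^sub>o Z)) (cassoc C X Y Z)"
    and lunit_iso: "X \<in> cob C \<Longrightarrow> is_iso (cunit C \<otimes>\<^sub>o X) X (clunit C X)"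
    and runit_iso: "X \<in> cob C \<Longrightarrow> is_iso (X \<otimes>\<^sub>o cunit C) X (crunit C X)"
    and braid_iso:
      "\<lbrakk>X \<in> cob C; Y \<in> cob C\<rbrakk> \<Longrightarrow> is_iso (X \<otimes>\<^sub>o Y) (Y \<otimes>\<^sub>o X) (cbraid C X Y)"
    and assoc_natural:
      "\<lbrakk>X \<in> cob C; Y \<in> cob C; Z \<in> cob C; X' \<in> cob C; Y' \<in> cob C; Z' \<in> cob C;
        f \<in> chom C X X'; g \<in> chom C Y Y'; h \<in> chom C Z Z'\<rbrakk>
       \<Longrightarrow> cassoc C X' Y' Z' \<cdot> ((f \<otimes>\<^sub>m g) \<otimes>\<^sub>m h) = (f \<otimes>\<^sub>m (g \<otimes>\<^sub>m h)) \<cdot> cassoc C X Y Z"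
    and lunit_natural:
      "\<lbrakk>X \<in> cob C; Y \<in> cob C; f \<in> chom C X Y\<rbrakk>
       \<Longrightarrow> clunit C Y \<cdot> (cid C (cunit C) \<otimes>\<^sub>m f) = f \<cdot> clunit C X"
    and runit_natural:
      "\<lbrakk>X \<in> cob C; Y \<in> cob C; f \<in> chom C X Y\<rbrakk>
       \<Longrightarrow> crunit C Y \<cdot> (f \<otimes>\<^sub>m cid C (cunit C)) = f \<cdot> crunit C X"
    and braid_natural:
      "\<lbrakk>X \<in> cob C; Y \<in> cob C; X' \<in> cob C; Y' \<in> cob C; f \<in> chom C X X'; g \<in> chom C Y Y'\<rbrakk>
       \<Longrightarrow> cbraid C X' Y' \<cdot> (f \<otimes>\<^sub>m g) = (g \<otimes>\<^sub>m f) \<cdot> cbraid C X Y"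
    and pentagon:
      "\<lbrakk>W \<in> cob C; X \<in> cob C; Y \<in> cob C; Z \<in> cob C\<rbrakk>
       \<Longrightarrow> cassoc C W X (Y \<otimes>\<^sub>o Z) \<cdot> cassoc C (W \<otimes>\<^sub>o X) Y Z =
           (cid C W \<otimes>\<^sub>m cassoc C X Y Z) \<cdot> cassoc C W (X \<otimes>\<^sub>o Y) Z \<cdot> (cassoc C W X Y \<otimes>\<^sub>m cid C Z)"
    and triangle:
      "\<lbrakk>X \<in> cob C; Y \<in> cob C\<rbrakk>
       \<Longrightarrow> (cid C X \<otimes>\<^sub>m clunit C Y) \<cdot> cassoc C X (cunit C) Y = crunit C X \<otimes>\<^sub>m cid C Y"
    and hexagon:
      "\<lbrakk>X \<in> cob C; Y \<in> cob C; Z \<in> cob C\<rbrakk>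
       \<Longrightarrow> cassoc C Y Z X \<cdot> cbraid C X (Y \<otimes>\<^sub>o Z) \<cdot> cassoc C X Y Z =
           (cid C Y \<otimes>\<^sub>m cbraid C X Z) \<cdot> cassoc C Y X Z \<cdot> (cbraid C X Y \<otimes>\<^sub>m cid C Z)"
    and symmetry:
      "\<lbrakk>X \<in> cob C; Y \<in> cob C\<rbrakk> \<Longrightarrow> cbraid C Y X \<cdot> cbraid C X Y = cid C (X \<otimes>\<^sub>o Y)"

locale abelian_category = additive_category +
  assumes kernels_exist:
      "\<lbrakk>X \<in> cob C; Y \<in> cob C; f \<in> chom C X Y\<rbrakk> \<Longrightarrow> \<exists>K k. is_kernel K k X f Y"
    and cokernels_exist:
      "\<lbrakk>X \<in> cob C; Y \<in> cob C; f \<in> chom C X Y\<rbrakk> \<Longrightarrow> \<exists>Q q. is_cokernel X f Y q Q"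
    and mono_is_kernel:
      "\<lbrakk>X \<in> cob C; Y \<in> cob C; is_mono X Y f\<rbrakk> \<Longrightarrow> \<exists>Z g. is_kernel X f Y g Z"
    and epi_is_cokernel:
      "\<lbrakk>X \<in> cob C; Y \<in> cob C; is_epi X Y f\<rbrakk> \<Longrightarrow> \<exists>W g. is_cokernel W g X f Y"

locale pre_tannakian = tensor_category + abelian_category +
  assumes all_finite_length: "X \<in> cob C \<Longrightarrow> finite_length X"
    and hom_fin_dim: "\<lbrakk>X \<in> cob C; Y \<in> cob C\<rbrakk> \<Longrightarrow> fin_dim_hom X Y"
    and unit_simple: "simple_object (cunit C)"
    and unit_end:
      "bij_betw (\<lambda>c. c \<odot>\<^bsub>cHom C (cunit C) (cunit C)\<^esub> cid C (cunit C)) UNIV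
         (chom C (cunit C) (cunit C))"
    and duals_exist: "X \<in> cob C \<Longrightarrow> \<exists>Y. is_dual X Y"

locale semisimple_pre_tannakian = pre_tannakian +
  assumes semisimple: "X \<in> cob C \<Longrightarrow> \<exists>Ss. (\<forall>S\<in>set Ss. simple_object S) \<and> direct_sum Ss X"

text \<open>
  The objects of the Karoubi envelope are pairs \<open>(X, e)\<close> with \<open>e\<close> an idempotent
  endomorphism of \<open>X\<close>; the structure maps are those of \<open>C\<close> cut down by the idempotents.
\<close>

definition karoubi :: "('o, 'a, 'k::field) tensor_cat \<Rightarrow> ('o \<times> 'a, 'a, 'k) tensor_cat" where
  "karoubi C = \<lparr>
     cob = {(X, e). X \<in> cob C \<and> e \<in> chom C X X \<and> e \<cdot>\<^bsub>C\<^esub> e = e},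
     cHom = (\<lambda>(X, e) (Y, f). (cHom C X Y)
        \<lparr>carrier := {a \<in> chom C X Y. f \<cdot>\<^bsub>C\<^esub> a \<cdot>\<^bsub>C\<^esub> e = a}\<rparr>),
     cid = (\<lambda>(X, e). e),
     ccomp = ccomp C,
     tob = (\<lambda>(X, e) (Y, f). (X \<otimes>\<^sub>o\<^bsub>C\<^esub> Y, e \<otimes>\<^sub>m\<^bsub>C\<^esub> f)),
     tmor = tmor C,
     cunit = (cunit C, cid C (cunit C)),
     cassoc = (\<lambda>(X, e) (Y, f) (Z, g). cassoc C X Y Z \<cdot>\<^bsub>C\<^esub> ((e \<otimes>\<^sub>m\<^bsub>C\<^esub> f) \<otimes>\<^sub>m\<^bsub>C\<^esub> g)),
     clunit = (\<lambda>(X, e). clunit C X \<cdot>\<^bsub>C\<^esub> (cid C (cunit C) \<otimes>\<^sub>m\<^bsub>C\<^esub> e)),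
     crunit = (\<lambda>(X, e). crunit C X \<cdot>\<^bsub>C\<^esub> (e \<otimes>\<^sub>m\<^bsub>C\<^esub> cid C (cunit C))),
     cbraid = (\<lambda>(X, e) (Y, f). cbraid C X Y \<cdot>\<^bsub>C\<^esub> (e \<otimes>\<^sub>m\<^bsub>C\<^esub> f))\<rparr>"

section \<open>The permutation category\<close>

text \<open>
  A morphism \<open>Vec\<^sub>X \<rightarrow> Vec\<^sub>Y\<close> is a matrix with rows in \<open>Y\<close> and columns in \<open>X\<close>, extended by zero
  outside \<open>Y \<times> X\<close>.
\<close>

datatype ('w, 'x, 'k) pmat =
  PMat (msrc: "('w, 'x) gset") (mtgt: "('w, 'x) gset") (ment: "'x \<Rightarrow> 'x \<Rightarrow> 'k")

definition perm_Hom ::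
  "('w \<Rightarrow> 'w) set \<Rightarrow> ('w, 'x) gset \<Rightarrow> ('w, 'x) gset \<Rightarrow> ('k::field, ('w, 'x, 'k) pmat) module" where
  "perm_Hom G X Y = \<lparr>
     carrier = {PMat X Y A | A.
        (\<forall>y x. (y, x) \<notin> pts Y \<times> pts X \<longrightarrow> A y x = 0) \<and>
        (\<forall>g\<in>G. \<forall>y\<in>pts Y. \<forall>x\<in>pts X. A (act Y g y) (act X g x) = A y x)},
     mult = undefined, one = undefined,
     zero = PMat X Y (\<lambda>y x. 0),
     add = (\<lambda>M N. PMat X Y (\<lambda>y x. ment M y x + ment N y x)),
     smult = (\<lambda>c M. PMat X Y (\<lambda>y x. c * ment M y x))\<rparr>"

definition graph_mat ::
  "('w, 'x) gset \<Rightarrow> ('w, 'x) gset \<Rightarrow> ('x \<Rightarrow> 'x) \<Rightarrow> ('w, 'x, 'k::field) pmat" where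
  "graph_mat X Y f = PMat X Y (\<lambda>y x. if x \<in> pts X \<and> y = f x then 1 else 0)"

definition mat_comp ::
  "(('w, 'x) gset \<Rightarrow> 'k::field) \<Rightarrow> ('w, 'x, 'k) pmat \<Rightarrow> ('w, 'x, 'k) pmat \<Rightarrow> ('w, 'x, 'k) pmat" where
  "mat_comp \<mu> B A = PMat (msrc A) (mtgt B)
     (\<lambda>z x. gset_integral \<mu> (mtgt A) (\<lambda>y. ment B z y * ment A y x))"

definition mat_tensor ::
  "('w, 'a univ, 'k::field) pmat \<Rightarrow> ('w, 'a univ, 'k) pmat \<Rightarrow> ('w, 'a univ, 'k) pmat" where
  "mat_tensor A B = PMat (prod_gset (msrc A) (msrc B)) (prod_gset (mtgt A) (mtgt B))
     (\<lambda>y x. case (y, x) of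
        (UPair y1 y2, UPair x1 x2) \<Rightarrow> ment A y1 x1 * ment B y2 x2
      | _ \<Rightarrow> 0)"

definition perm_cat ::
  "('w \<Rightarrow> 'w) set \<Rightarrow> ('w \<Rightarrow> 'w) set set \<Rightarrow> (('w, 'a univ) gset \<Rightarrow> 'k::field) \<Rightarrow>
     (('w, 'a univ) gset, ('w, 'a univ, 'k) pmat, 'k) tensor_cat" where
  "perm_cat G E \<mu> = \<lparr>
     cob = {X. grp X = G \<and> hat_set G X \<and> finitary X \<and> E_smooth_act E X},
     cHom = perm_Hom G,
     cid = (\<lambda>X. graph_mat X X id),
     ccomp = mat_comp \<mu>,
     tob = prod_gset,
     tmor = mat_tensor,
     cunit = point_gset G,
     cassoc = (\<lambda>X Y Z. graph_mat (prod_gset (prod_gset X Y) Z) (prod_gset X (prod_gset Y Z))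
        (\<lambda>s. case s of UPair (UPair x y) z \<Rightarrow> UPair x (UPair y z))),
     clunit = (\<lambda>X. graph_mat (prod_gset (point_gset G) X) X (\<lambda>s. case s of UPair t x \<Rightarrow> x)),
     crunit = (\<lambda>X. graph_mat (prod_gset X (point_gset G)) X (\<lambda>s. case s of UPair x t \<Rightarrow> x)),
     cbraid = (\<lambda>X Y. graph_mat (prod_gset X Y) (prod_gset Y X)
        (\<lambda>s. case s of UPair x y \<Rightarrow> UPair y x))\<rparr>"

end

theory Submission
  imports Defs "HOL-Computational_Algebra.Primes" "HOL-Computational_Algebra.Polynomial"
begin

text \<open>Matrices are multiplied by integration, and an integral is a sum over orbits weighted by quotients of
  values of \<open>\<nu>\<close>. Transposition gives duals. A category with finite-dimensional hom spaces in which every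
  nonzero \<open>f\<close> has some \<open>g\<close> with \<open>g f\<close> not nilpotent is von Neumann regular, and the Karoubi envelope of a
  regular category is abelian and semisimple. So it remains to find \<open>g\<close>.

  Let \<open>p \<ge> 5\<close> be the characteristic of \<open>k\<close> if that is positive, and \<open>p = 5\<close> otherwise, and let \<open>V\<close> be a valuation
  ring of \<open>k\<close> in which \<open>p\<close> is not invertible. The weights are units of \<open>V\<close> and fixed by Frobenius modulo \<open>p\<close>.
  For a matrix \<open>A\<close> over \<open>V\<close> this gives \<open>tr (A\<^sup>p) \<equiv> (tr A)\<^sup>p\<close> modulo \<open>p\<close>: write the left side as a sum over orbits
  of \<open>p\<close>-tuples and rotate the tuples. An orbit fixed by the rotation consists of constant tuples, because
  otherwise an automorphism would permute \<open>p\<close> points of \<open>\<Omega>\<close> cyclically, and hence the hydrogen atoms of a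
  boron tree. Consequently a matrix over \<open>V\<close> whose trace is a unit is not nilpotent. Scale \<open>f\<close> such that its
  entries lie in \<open>V\<close> and one of them is \<open>1\<close>, and let \<open>g\<close> be the transposed indicator of the orbit of that entry;
  then \<open>tr (g f)\<close> is a value of \<open>\<nu>\<close>.\<close>

text \<open>The characteristics 2 and 3 are excluded for two reasons. The values of
  \<open>nu\<close> are defined and invertible only when 2 and 3 are, and rotations of these orders
  do exist: two leaves on one boron atom can be exchanged, and the three leaves of the tree with a
  single boron atom can be rotated.

  The obstacle is that a measure with values in a field knows no positivity. The trace of the
  transpose of \<open>f\<close> times \<open>f\<close> is a weighted sum of squares and may vanish;
  concentrating \<open>g\<close> on a single orbit turns the trace into one value of
  \<open>nu\<close>. Nor is it clear beforehand that a nilpotent matrix has trace zero, and this is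
  what the congruence modulo \<open>p\<close> supplies. A field of characteristic 0 has no Frobenius
  map, so a place of residue characteristic \<open>p\<close> is chosen first; 5 is merely the least
  prime that avoids 2 and 3. One application of the congruence only reaches the exponent
  \<open>p\<close>, hence it is iterated until \<open>p ^ n\<close> exceeds the order of
  nilpotence.\<close>

section \<open>Automorphisms of boron trees\<close>

context
  fixes T :: "'v graph"
  assumes T: "finite_tree T"
begin

abbreviation adj :: "'v \<Rightarrow> 'v \<Rightarrow> bool" where
  "adj u v \<equiv> {u, v} \<in> edges T"

definition simple_path :: "'v list \<Rightarrow> bool" where
  "simple_path p \<longleftrightarrow> p \<noteq> [] \<and> set p \<subseteq> verts T \<and> successively adj p \<and> distinct p"

lemma adj_sym: "adj u v \<Longrightarrow> adj v u"
  by (simp add: insert_commute)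

lemma adj_verts: assumes "adj u v" shows "u \<in> verts T" "v \<in> verts T" "u \<noteq> v"
proof -
  have "edges T \<subseteq> {{u, v} | u v. u \<in> verts T \<and> v \<in> verts T \<and> u \<noteq> v}"
    using T by (simp add: finite_tree_def)
  with assms obtain a b where "{u, v} = {a, b}" "a \<in> verts T" "b \<in> verts T" "a \<noteq> b" by blast
  then show "u \<in> verts T" "v \<in> verts T" "u \<noteq> v" by (auto simp: doubleton_eq_iff)
qed

lemma finite_verts: "finite (verts T)"
  using T by (simp add: finite_tree_def)

lemma finite_neighbours: "finite {w. adj v w}"
  by (rule finite_subset[OF _ finite_verts]) (auto dest: adj_verts)

lemma valence_eq: "valence T v = card {w. adj v w}"
proof -
  have "{e \<in> edges T. v \<in> e} = (\<lambda>w. {v, w}) ` {w. adj v w}"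
  proof (intro equalityI subsetI)
    fix e assume e: "e \<in> {e \<in> edges T. v \<in> e}"
    have "edges T \<subseteq> {{u, v} | u v. u \<in> verts T \<and> v \<in> verts T \<and> u \<noteq> v}"
      using T by (simp add: finite_tree_def)
    with e obtain a b where "e = {a, b}" "a \<noteq> b" by blast
    with e show "e \<in> (\<lambda>w. {v, w}) ` {w. adj v w}" by (auto simp: insert_commute)
  qed auto
  moreover have "inj_on (\<lambda>w. {v, w}) {w. adj v w}"
    by (auto simp: inj_on_def doubleton_eq_iff)
  ultimately show ?thesis by (simp add: valence_def card_image)
qed

lemma hydrogen_neighbour_unique:
  assumes "x \<in> hydrogens T" "adj x u" "adj x v" shows "u = v"
proof -
  have "card {w. adj x w} \<le> 1" using assms(1) by (simp add: hydrogens_def valence_eq)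
  with assms(2,3) finite_neighbours show ?thesis by (auto simp: card_le_Suc0_iff_eq)
qed

lemma no_cycle:
  assumes "simple_path p" "length p \<ge> 3" "adj (last p) (hd p)" shows False
proof -
  have "is_cycle T p" using assms by (auto simp: is_cycle_def is_walk_def simple_path_def)
  then show False using T by (auto simp: finite_tree_def)
qed

lemma simple_path_sublist:
  assumes "simple_path (xs @ ys @ zs)" "ys \<noteq> []" shows "simple_path ys"
  using assms by (auto simp: simple_path_def successively_append_iff)

text \<open>If \<open>w\<close> lay further along the path, the segment from \<open>a\<close> to
  \<open>w\<close> together with the edge back to \<open>a\<close> would be a cycle. The only
  neighbour of \<open>a\<close> on the path is therefore \<open>b\<close>.\<close>

lemma extend_fresh:
  assumes "simple_path (a # b # r)" "adj w a" "w \<noteq> b" shows "simple_path (w # a # b # r)"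
proof -
  have "w \<notin> set r"
  proof
    assume "w \<in> set r"
    then obtain ys zs where r: "r = ys @ w # zs" by (auto dest: split_list)
    have "simple_path (a # b # ys @ [w])"
      using assms(1) simple_path_sublist[of "[]" "a # b # ys @ [w]" zs] by (simp add: r)
    then show False using assms(2) no_cycle by fastforce
  qed
  then show ?thesis using assms adj_verts[OF assms(2)] by (auto simp: simple_path_def)
qed

text \<open>Cutting out the stretch between two visits to the same vertex leaves a shorter walk with
  the same ends.\<close>

lemma geodesic_simple:
  assumes "is_geodesic T p u v" shows "simple_path p" "hd p = u" "last p = v"
proof -
  have w: "is_walk T p u v" and min: "\<And>q. is_walk T q u v \<Longrightarrow> length p \<le> length q"
    using assms by (auto simp: is_geodesic_def)
  show "hd p = u" "last p = v" using w by (auto simp: is_walk_def)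
  have "distinct p"
  proof (rule ccontr)
    assume "\<not> distinct p"
    then obtain xs ys zs y where p: "p = xs @ [y] @ ys @ [y] @ zs"
      using not_distinct_decomp by blast
    have "is_walk T (xs @ [y] @ zs) u v"
      using w unfolding p is_walk_def
      by (cases xs; cases zs) (auto simp: successively_append_iff successively_Cons hd_append split: if_splits)
    from min[OF this] show False by (simp add: p)
  qed
  then show "simple_path p" using w by (auto simp: is_walk_def simple_path_def)
qed

lemma geodesic_exists:
  assumes "u \<in> verts T" "v \<in> verts T" shows "\<exists>p. is_geodesic T p u v"
proof -
  obtain p where "is_walk T p u v" using T assms unfolding finite_tree_def by metis
  from ex_has_least_nat[of "\<lambda>p. is_walk T p u v", OF this, of length] show ?thesis
    by (auto simp: is_geodesic_def)
qed

lemma interior_neighbours: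
  assumes "simple_path p" "v \<in> set p" "v \<noteq> hd p" "v \<noteq> last p"
  shows "\<exists>a b. a \<noteq> b \<and> adj v a \<and> adj v b \<and> a \<in> set p \<and> b \<in> set p"
proof -
  obtain xs ys where p: "p = xs @ v # ys" using assms(2) by (auto dest: split_list)
  have "xs \<noteq> []" "ys \<noteq> []" using assms(3,4) by (auto simp: p)
  then obtain xs' a b ys' where "xs = xs' @ [a]" "ys = b # ys'"
    by (metis neq_Nil_conv rev_exhaust)
  with assms(1) show ?thesis
    by (intro exI[of _ a] exI[of _ b])
       (auto simp: p simple_path_def successively_append_iff intro: adj_sym)
qed

lemma path_from_hydrogen:
  assumes "x \<in> hydrogens T" "adj x u" "simple_path p" "hd p = x" "last p \<noteq> x"
  shows "u \<in> set p"
proof -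
  obtain r where p: "p = x # r" using assms(3,4) by (cases p) (auto simp: simple_path_def)
  then obtain v r' where r: "r = v # r'" using assms(5) by (cases r) auto
  have "adj x v" using assms(3) by (simp add: simple_path_def p r)
  with hydrogen_neighbour_unique[OF assms(1,2)] show ?thesis by (simp add: p r)
qed

lemma hydrogen_not_interior:
  assumes "x \<in> hydrogens T" "simple_path p" "x \<in> set p" shows "x = hd p \<or> x = last p"
  using interior_neighbours[OF assms(2,3)] hydrogen_neighbour_unique[OF assms(1)] by blast

text \<open>Look at the end of a longest simple path. Its first vertex \<open>x\<close> is a leaf,
  as otherwise the path could be extended. The next vertex \<open>u\<close> is a boron atom, and its
  neighbour \<open>q\<close> off the path can replace \<open>x\<close> in a path of the same length,
  so \<open>q\<close> is a leaf too. The leaves \<open>x\<close> and \<open>q\<close> on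
  \<open>u\<close> form the cherry.\<close>

lemma cherry_exists:
  assumes B: "boron_tree T" and h: "card (hydrogens T) \<ge> 3"
  shows "\<exists>p q u z. p \<in> hydrogens T \<and> q \<in> hydrogens T \<and> p \<noteq> q \<and> adj u p \<and> adj u q \<and>
    u \<notin> hydrogens T \<and> {w. adj u w} = {p, q, z}"
proof -
  have three: "card {w. adj v w} = 3" if "v \<in> verts T" "v \<notin> hydrogens T" for v
    using B that by (auto simp: boron_tree_def valence_eq)
  have hv: "hydrogens T \<subseteq> verts T" by (auto simp: hydrogens_def)
  obtain S where S: "S \<subseteq> hydrogens T" "card S = 3" using obtain_subset_with_card_n[OF h] by blast
  obtain a b c where "S = {a, b, c}" "a \<noteq> b" "b \<noteq> c" "a \<noteq> c"
    using S(2) unfolding card_3_iff by blast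
  with S(1) have abc: "a \<in> hydrogens T" "b \<in> hydrogens T" "c \<in> hydrogens T"
      "a \<noteq> b" "a \<noteq> c" by blast+
  \<comment> \<open>The vertex \<open>u\<close> next to the end must have a neighbour on either
    side. If simple paths had at most two vertices, the leaf \<open>a\<close> would be adjacent to
    both \<open>b\<close> and \<open>c\<close>.\<close>
  have long: "\<exists>p. simple_path p \<and> length p \<ge> 3"
  proof (rule ccontr)
    assume short: "\<not> ?thesis"
    have "adj a x" if x: "x \<in> hydrogens T" "a \<noteq> x" for x
    proof -
      obtain p where p: "is_geodesic T p a x" using geodesic_exists[of a x] abc(1) x(1) hv by blast
      note g = geodesic_simple[OF p]
      have "length p < 3" using short g(1) by auto
      moreover have "p \<noteq> []" using g by (simp add: simple_path_def)
      ultimately have "p = [a, x]" using g x(2)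
        by (cases p; cases "tl p") (auto split: if_splits)
      with g(1) show ?thesis by (simp add: simple_path_def)
    qed
    then show False using hydrogen_neighbour_unique[OF abc(1), of b c] abc \<open>b \<noteq> c\<close> by blast
  qed
  then obtain p1 where p1: "simple_path p1" "length p1 \<ge> 3" by blast
  \<comment> \<open>A simple path visits each vertex at most once; this bound makes a longest one
    exist.\<close>
  have "\<forall>p. simple_path p \<longrightarrow> length p < Suc (card (verts T))"
    using finite_verts by (auto simp: simple_path_def distinct_card[symmetric] less_Suc_eq_le intro!: card_mono)
  from ex_has_greatest_nat[of simple_path, OF p1(1) this]
  obtain p where p: "simple_path p" and max: "\<And>q. simple_path q \<Longrightarrow> length q \<le> length p" by blast
  have "length p \<ge> 3" using max[OF p1(1)] p1(2) by simp
  then obtain x u y r where pe: "p = x # u # y # r"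
    by (auto simp: numeral_3_eq_3 Suc_le_length_iff)
  have adjs: "adj x u" "adj u y" "x \<noteq> y" "x \<noteq> u" and xv: "x \<in> verts T" "u \<in> verts T"
    using p by (auto simp: pe simple_path_def)
  have xh: "x \<in> hydrogens T"
  proof (rule ccontr)
    assume "x \<notin> hydrogens T"
    then have "card {w. adj x w} = 3" using three xv by blast
    then have "\<not> {w. adj x w} \<subseteq> {u}" using card_mono[of "{u}" "{w. adj x w}"] by auto
    then obtain w where "adj x w" "w \<noteq> u" by blast
    then have "simple_path (w # p)" using extend_fresh p adj_sym unfolding pe by blast
    from max[OF this] show False by simp
  qed
  have uh: "u \<notin> hydrogens T"
    using hydrogen_neighbour_unique[of u x y] adjs adj_sym by blast
  have cu: "card {w. adj u w} = 3" using three uh xv by blast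
  then have "\<not> {w. adj u w} \<subseteq> {x, y}" using card_mono[of "{x, y}" "{w. adj u w}"]
    by (auto simp: card_insert_if split: if_splits)
  then obtain q where q: "adj u q" "q \<noteq> x" "q \<noteq> y" by blast
  have "{x, q, y} \<subseteq> {w. adj u w}" using q adjs adj_sym by auto
  then have N: "{w. adj u w} = {x, q, y}"
    using card_subset_eq[OF finite_neighbours, of "{x, q, y}" u] cu q adjs by auto
  have pq: "simple_path (q # u # y # r)"
    using extend_fresh[of u y r q] simple_path_sublist[of "[x]" "u # y # r" "[]"] p q adj_sym
    by (auto simp: pe)
  have qh: "q \<in> hydrogens T"
  proof (rule ccontr)
    assume "q \<notin> hydrogens T"
    then have "card {w. adj q w} = 3" using three adj_verts(2)[OF q(1)] by blast
    then have "\<not> {w. adj q w} \<subseteq> {u}" using card_mono[of "{u}" "{w. adj q w}"] by auto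
    then obtain w where "adj q w" "w \<noteq> u" by blast
    then have "simple_path (w # q # u # y # r)" using extend_fresh pq adj_sym by blast
    from max[OF this] show False by (simp add: pe)
  qed
  show ?thesis using xh qh uh N q adjs adj_sym by blast
qed

text \<open>The geodesic from \<open>p\<close> to \<open>q\<close> is \<open>p, u, q\<close>. A
  geodesic between two other leaves avoids the leaves \<open>p\<close> and \<open>q\<close>, and it
  cannot pass through \<open>u\<close>, where it would need two neighbours of \<open>u\<close>
  besides them. Conversely, every geodesic that leaves \<open>p\<close> or \<open>q\<close> starts
  through \<open>u\<close>. This expresses cherries by the relation alone.\<close>

lemma cherry_rel:
  assumes pq: "p \<in> hydrogens T" "q \<in> hydrogens T" "p \<noteq> q" "adj u p" "adj u q"
    and u: "u \<notin> hydrogens T" "{w. adj u w} = {p, q, z}"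
  shows "\<lbrakk>c \<in> hydrogens T; d \<in> hydrogens T; c \<notin> {p, q}; d \<notin> {p, q}\<rbrakk> \<Longrightarrow> \<not> boron_rel T p q c d"
    and "\<lbrakk>c \<in> hydrogens T; d \<in> hydrogens T; c \<noteq> q; d \<noteq> p\<rbrakk> \<Longrightarrow> boron_rel T q c p d"
proof -
  have hv: "hydrogens T \<subseteq> verts T" by (auto simp: hydrogens_def)
  {
    assume cd: "c \<in> hydrogens T" "d \<in> hydrogens T" "c \<notin> {p, q}" "d \<notin> {p, q}"
    show "\<not> boron_rel T p q c d"
    proof
      assume "boron_rel T p q c d"
      then obtain P Q where P: "is_geodesic T P p q" and Q: "is_geodesic T Q c d"
        and i: "set P \<inter> set Q \<noteq> {}" by (auto simp: boron_rel_def)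
      have "is_walk T [p, u, q] p q"
        using pq adj_sym adj_verts[OF pq(4)] hv by (auto simp: is_walk_def)
      then have "length P \<le> 3" using P by (auto simp: is_geodesic_def)
      note g = geodesic_simple[OF P] and g' = geodesic_simple[OF Q]
      have uP: "u \<in> set P" using path_from_hydrogen[OF pq(1) _ g(1,2)] pq g(3) adj_sym by auto
      have "p \<in> set P" "q \<in> set P" using g by (auto simp: simple_path_def)
      then have sub: "{p, u, q} \<subseteq> set P" using uP by auto
      have "u \<noteq> p" "u \<noteq> q" using pq u by blast+
      then have "card {p, u, q} = 3" using pq(3) by simp
      moreover have "card (set P) \<le> 3" using \<open>length P \<le> 3\<close> card_length[of P] by linarith
      ultimately have "set P = {p, u, q}" using card_seteq[OF _ sub] by simp
      moreover have "p \<notin> set Q" "q \<notin> set Q"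
        using hydrogen_not_interior[OF _ g'(1)] pq(1,2) cd g'(2,3) by blast+
      ultimately have "u \<in> set Q" using i by auto
      from interior_neighbours[OF g'(1) this] obtain a b where "a \<noteq> b" "adj u a" "adj u b"
        "a \<in> set Q" "b \<in> set Q" using g' u cd by auto
      moreover from this have "a \<in> {p, q, z}" "b \<in> {p, q, z}" using u(2) by auto
      ultimately show False using \<open>p \<notin> set Q\<close> \<open>q \<notin> set Q\<close> by auto
    qed
  }
  {
    assume cd: "c \<in> hydrogens T" "d \<in> hydrogens T" "c \<noteq> q" "d \<noteq> p"
    obtain P Q where P: "is_geodesic T P q c" and Q: "is_geodesic T Q p d"
      using geodesic_exists hv cd pq by (meson subsetD)
    note g = geodesic_simple[OF P] and g' = geodesic_simple[OF Q]
    have "u \<in> set P" using path_from_hydrogen[OF pq(2) _ g(1,2)] pq g(3) cd adj_sym by auto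
    moreover have "u \<in> set Q" using path_from_hydrogen[OF pq(1) _ g'(1,2)] pq g'(3) cd adj_sym by auto
    ultimately show "boron_rel T q c p d" using P Q by (auto simp: boron_rel_def)
  }
qed

end

text \<open>The cherries of the tree are visible in \<open>R\<close>, and two distinct cherries are disjoint. A rotation
  of all the leaves would therefore make the cherries a perfect matching of an odd number of leaves.\<close>

lemma no_prime_rotation:
  fixes R :: "'b \<Rightarrow> 'b \<Rightarrow> 'b \<Rightarrow> 'b \<Rightarrow> bool"
  assumes C: "boron_structure C R" and p: "prime p" "p \<ge> 5" "card C = p"
    and transitive: "\<And>a c. a \<in> C \<Longrightarrow> c \<in> C \<Longrightarrow> \<exists>i. c = (g ^^ i) a"
    and closed: "g ` C \<subseteq> C"
    and period: "\<And>a. a \<in> C \<Longrightarrow> (g ^^ p) a = a"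
    and invariant: "\<And>w x y z. R (g w) (g x) (g y) (g z) \<longleftrightarrow> R w x y z"
  shows False
proof -
  obtain T :: "nat graph" and f where B: "boron_tree T" and iso: "rel_iso f C R (hydrogens T) (boron_rel T)"
    using C by (auto simp: boron_structure_def)
  have T: "finite_tree T" using B by (simp add: boron_tree_def)
  have bij: "bij_betw f C (hydrogens T)"
    and fR: "\<And>w x y z. \<lbrakk>w \<in> C; x \<in> C; y \<in> C; z \<in> C\<rbrakk> \<Longrightarrow> R w x y z \<longleftrightarrow> boron_rel T (f w) (f x) (f y) (f z)"
    using iso by (auto simp: rel_iso_def)
  have finC: "finite C" using p by (metis card.infinite not_numeral_le_zero)
  have "card (hydrogens T) \<ge> 3" using bij_betw_same_card[OF bij] p by simp
  from cherry_exists[OF T B this] obtain p0 q0 u z where ch: "p0 \<in> hydrogens T" "q0 \<in> hydrogens T"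
    "p0 \<noteq> q0" "{u, p0} \<in> edges T" "{u, q0} \<in> edges T" "u \<notin> hydrogens T" "{w. {u, w} \<in> edges T} = {p0, q0, z}"
    by blast
  from ch(1,2) bij obtain a c where ac: "a \<in> C" "c \<in> C" "f a = p0" "f c = q0"
    by (metis bij_betw_def imageE)
  note inj = bij_betw_imp_inj_on[OF bij]
  have a_c: "a \<noteq> c" using ac ch by auto
  have fh: "\<And>x. x \<in> C \<Longrightarrow> f x \<in> hydrogens T" using bij by (auto simp: bij_betw_def)
  have iter_closed: "(g ^^ i) x \<in> C" if "x \<in> C" for x i
    using that closed by (induction i) auto
  have iter_inv: "R ((g ^^ i) w) ((g ^^ i) x) ((g ^^ i) y) ((g ^^ i) z) \<longleftrightarrow> R w x y z" for i w x y z
    by (induction i) (auto simp: invariant)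
  \<comment> \<open>The power of \<open>g\<close> that takes \<open>a\<close> to \<open>c\<close>
    takes the cherry \<open>{a, c}\<close> to \<open>{c, r}\<close>. The relation would then see two
    cherries that share the leaf \<open>c\<close>.\<close>
  obtain i where i: "c = (g ^^ i) a" using transitive ac by blast
  define r where "r = (g ^^ i) c"
  have rC: "r \<in> C" using iter_closed ac by (simp add: r_def)
  have mult: "(g ^^ (m * p)) a = a" for m
    by (induction m) (auto simp: funpow_add period ac)
  have modp: "(g ^^ n) a = (g ^^ (n mod p)) a" for n
    using mult[of "n div p"] funpow_add[of "n mod p" "n div p * p" g]
    by (metis comp_apply mod_div_mult_eq)
  have C_eq: "C = (\<lambda>j. (g ^^ j) a) ` {..<p}"
  proof (intro equalityI subsetI)
    fix x assume "x \<in> C"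
    then obtain n where "x = (g ^^ n) a" using transitive ac by blast
    then have "x = (g ^^ (n mod p)) a" by (simp only: modp[symmetric])
    moreover have "n mod p < p" using p by simp
    ultimately show "x \<in> (\<lambda>j. (g ^^ j) a) ` {..<p}" by blast
  qed (use iter_closed ac in auto)
  then have inj_j: "inj_on (\<lambda>j. (g ^^ j) a) {..<p}"
    by (metis C_eq card_lessThan eq_card_imp_inj_on finite_lessThan p(3))
  have fixes_iff: "(g ^^ n) a = a \<longleftrightarrow> p dvd n" for n
  proof -
    have p0: "p > 0" using p by simp
    have "n mod p = 0" if "(g ^^ n) a = a"
      using inj_onD[OF inj_j, of "n mod p" 0] that modp[of n, symmetric] p0 by simp
    moreover have "(g ^^ n) a = a" if "n mod p = 0"
      using that by (subst modp) simp
    ultimately show ?thesis by (metis dvd_eq_mod_eq_0)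
  qed
  have ndvd: "\<not> p dvd i" using fixes_iff[of i] i a_c by auto
  \<comment> \<open>A return to \<open>a\<close> would mean that \<open>p\<close> divides
    \<open>2 * i\<close>, but it divides neither factor.\<close>
  have r_a: "r \<noteq> a"
  proof
    assume "r = a"
    then have "(g ^^ (i + i)) a = a" by (simp add: funpow_add r_def i)
    then have "p dvd 2 * i" by (simp add: fixes_iff mult_2)
    then show False using p ndvd prime_dvd_mult_iff[of p 2 i] by (auto dest: dvd_imp_le)
  qed
  have gi_surj: "\<exists>y\<in>C. x = (g ^^ i) y" if x: "x \<in> C" for x
  proof -
    have "(g ^^ (i * (p - 1) + i)) x = x" 
    proof -
      have "i * (p - 1) + i = i * p" using p by (cases p) auto
      moreover have "(g ^^ (m * p)) x = x" for m
        by (induction m) (auto simp: funpow_add period x)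
      ultimately show ?thesis by simp
    qed
    then have "x = (g ^^ i) ((g ^^ (i * (p - 1))) x)"
      by (metis add.commute comp_apply funpow_add)
    then show ?thesis using iter_closed x by blast
  qed
  have inj_gi: "inj_on (g ^^ i) C"
    by (rule eq_card_imp_inj_on[OF finC], rule arg_cong[where f = card]) (use gi_surj iter_closed in auto)
  have split: "\<not> R c r x y" if "x \<in> C" "y \<in> C" "x \<notin> {c, r}" "y \<notin> {c, r}" for x y
  proof -
    obtain x' y' where xy: "x' \<in> C" "y' \<in> C" "x = (g ^^ i) x'" "y = (g ^^ i) y'"
      using gi_surj \<open>x \<in> C\<close> \<open>y \<in> C\<close> by blast
    then have "x' \<notin> {a, c}" "y' \<notin> {a, c}" using that i r_def by auto
    then have "\<not> R a c x' y'"
      using fR[OF ac(1,2) xy(1,2)] cherry_rel(1)[OF T ch fh[OF xy(1)] fh[OF xy(2)]] ac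
        inj_onD[OF inj _ xy(1)] inj_onD[OF inj _ xy(2)] by (metis insert_iff singletonD)
    then show ?thesis using iter_inv[of i a c x' y'] xy i r_def by simp
  qed
  have r_c: "r \<noteq> c" using inj_onD[OF inj_gi, of c a] ac a_c i r_def by auto
  \<comment> \<open>Here the size of \<open>C\<close> enters: three leaves on one boron atom do
    admit a rotation, while a fourth leaf \<open>d\<close> makes the two cherries contradict each
    other.\<close>
  have "\<not> C \<subseteq> {a, c, r}"
    using card_mono[of "{a, c, r}" C] p card_length[of "[a, c, r]"] by auto
  then obtain d where d: "d \<in> C" "d \<notin> {a, c, r}" by blast
  have "R c r a d"
  proof -
    have "f r \<noteq> q0" "f d \<noteq> p0"
      using inj_onD[OF inj, of r c] inj_onD[OF inj, of d a] ac rC d r_c by auto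
    then show ?thesis
      using fR[OF ac(2) rC ac(1) d(1)] cherry_rel(2)[OF T ch fh[OF rC] fh[OF d(1)]] ac by simp
  qed
  moreover have "\<not> R c r a d" by (rule split) (use ac d a_c r_a in auto)
  ultimately show False by contradiction
qed

section \<open>Places of residue characteristic \<open>p\<close>\<close>

definition subring_set :: "'k::field set \<Rightarrow> bool" where
  "subring_set V \<longleftrightarrow> 1 \<in> V \<and> (\<forall>x\<in>V. \<forall>y\<in>V. x - y \<in> V \<and> x * y \<in> V)"

context
  fixes V :: "'k::field set"
  assumes V: "subring_set V"
begin

lemma subring_one: "1 \<in> V" using V by (simp add: subring_set_def)
lemma subring_diff: "x \<in> V \<Longrightarrow> y \<in> V \<Longrightarrow> x - y \<in> V" using V by (simp add: subring_set_def)
lemma subring_mult: "x \<in> V \<Longrightarrow> y \<in> V \<Longrightarrow> x * y \<in> V" using V by (simp add: subring_set_def)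
lemma subring_zero: "0 \<in> V" using subring_diff[OF subring_one subring_one] by simp
lemma subring_uminus: "x \<in> V \<Longrightarrow> - x \<in> V" using subring_diff[OF subring_zero] by force
lemma subring_add: "x \<in> V \<Longrightarrow> y \<in> V \<Longrightarrow> x + y \<in> V" using subring_diff[OF _ subring_uminus] by force
lemma subring_power: "x \<in> V \<Longrightarrow> x ^ n \<in> V"
  by (induction n) (auto intro: subring_one subring_mult)
lemma subring_of_nat: "of_nat n \<in> V"
  by (induction n) (auto intro: subring_zero subring_one subring_add)
lemma subring_sum: "(\<And>i. i \<in> A \<Longrightarrow> f i \<in> V) \<Longrightarrow> sum f A \<in> V"
  by (induction A rule: infinite_finite_induct) (auto intro: subring_zero subring_add)
lemma subring_prod: "(\<And>i. i \<in> A \<Longrightarrow> f i \<in> V) \<Longrightarrow> prod f A \<in> V"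
  by (induction A rule: infinite_finite_induct) (auto intro: subring_one subring_mult)

lemmas subring_closed = subring_one subring_zero subring_diff subring_uminus subring_add subring_mult
  subring_power subring_of_nat subring_sum subring_prod

end

text \<open>\<open>V\<close> is a valuation ring of \<open>'k\<close> whose maximal ideal contains
  \<open>p\<close>; \<open>local_unit\<close> is the form in which this yields units. In
  characteristic \<open>p\<close> the element \<open>of_nat p\<close> is 0 and \<open>V\<close> may
  be the whole field. In characteristic 0 the valuation extends the \<open>p\<close>-adic one of the
  rationals.\<close>

locale place =
  fixes V :: "'k::field set" and p :: nat
  assumes prime_p: "prime p" and p_ge_5: "p \<ge> 5"
    and subring: "subring_set V"
    and p_nonunit: "v \<in> V \<Longrightarrow> of_nat p * v \<noteq> 1"
    and valuation: "x \<in> V \<or> inverse x \<in> V"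
    and local_unit: "b \<in> V \<Longrightarrow> inverse (1 - of_nat p * b) \<in> V"

text \<open>A subring that is maximal among those in which \<open>p\<close> is not invertible is a valuation ring.\<close>

lemma place_exists:
  assumes p: "prime p" "p \<ge> 5" and char: "CHAR('k::field) = 0 \<or> CHAR('k) = p"
  shows "\<exists>V :: 'k set. place V p"
proof -
  define \<V> where "\<V> = {V :: 'k set. subring_set V \<and> (\<forall>v\<in>V. of_nat p * v \<noteq> 1)}"
  \<comment> \<open>The image of the integers is the starting point for Zorn's lemma. An inverse of
    \<open>p\<close> in it would make the characteristic, which is 0 or \<open>p\<close>, divide
    \<open>p * z - 1\<close>, and then \<open>p\<close> would divide 1.\<close>
  have "range of_int \<in> \<V>"
  proof -
    have "subring_set (range of_int :: 'k set)"
      unfolding subring_set_def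
      by (auto intro: range_eqI[of _ _ 1] simp flip: of_int_diff of_int_mult)
    moreover have "of_nat p * v \<noteq> 1" if v: "v \<in> range of_int" for v :: 'k
    proof
      assume 1: "of_nat p * v = 1"
      from v obtain z where "v = of_int z" by auto
      with 1 have "(of_int (int p * z - 1) :: 'k) = 0" by simp
      then have "int CHAR('k) dvd int p * z - 1" by (simp only: of_int_eq_0_iff_char_dvd)
      have "int p dvd 1"
      proof (cases "CHAR('k) = 0")
        case True
        then have "int p * z = 1" using \<open>int CHAR('k) dvd int p * z - 1\<close> by simp
        then show ?thesis by (metis dvdI)
      next
        case False
        then have c: "CHAR('k) = p" using char by simp
        have "int p dvd int p * z - 1" using \<open>int CHAR('k) dvd int p * z - 1\<close> unfolding c .
        from dvd_diff[OF dvd_triv_left[of "int p" z] this] show ?thesis by simp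
      qed
      then show False using p by simp
    qed
    ultimately show ?thesis by (simp add: \<V>_def)
  qed
  moreover have "\<Union>\<C> \<in> \<V>" if "\<C> \<noteq> {}" "subset.chain \<V> \<C>" for \<C>
  proof -
    have sub: "\<And>V. V \<in> \<C> \<Longrightarrow> subring_set V" and nu: "\<And>V v. V \<in> \<C> \<Longrightarrow> v \<in> V \<Longrightarrow> of_nat p * v \<noteq> 1"
      using that(2) by (auto simp: subset.chain_def \<V>_def)
    have total: "\<And>V W. V \<in> \<C> \<Longrightarrow> W \<in> \<C> \<Longrightarrow> V \<subseteq> W \<or> W \<subseteq> V"
      using that(2) unfolding subset_chain_def by blast
    have "x - y \<in> \<Union>\<C> \<and> x * y \<in> \<Union>\<C>" if xy: "x \<in> \<Union>\<C>" "y \<in> \<Union>\<C>" for x y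
    proof -
      obtain W\<^sub>1 W\<^sub>2 where "W\<^sub>1 \<in> \<C>" "W\<^sub>2 \<in> \<C>" "x \<in> W\<^sub>1" "y \<in> W\<^sub>2" using xy by blast
      then obtain W where "W \<in> \<C>" "x \<in> W" "y \<in> W" using total by blast
      then show ?thesis using sub[of W] unfolding subring_set_def by blast
    qed
    moreover have "1 \<in> \<Union>\<C>" using that(1) sub by (auto simp: subring_set_def)
    ultimately show ?thesis using nu by (auto simp: \<V>_def subring_set_def)
  qed
  ultimately have "\<exists>V\<in>\<V>. \<forall>W\<in>\<V>. V \<subseteq> W \<longrightarrow> W = V"
    by (intro subset_Zorn_nonempty) blast+
  then obtain V where "V \<in> \<V>" and max: "\<And>W. W \<in> \<V> \<Longrightarrow> V \<subseteq> W \<Longrightarrow> W = V" by blast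
  then have sub: "subring_set V" and nonunit: "\<And>v. v \<in> V \<Longrightarrow> of_nat p * v \<noteq> 1" by (auto simp: \<V>_def)
  note cl = subring_closed[OF sub]
  define P where "P = (of_nat p :: 'k)"
  have PV: "P \<in> V" by (simp add: P_def cl)
  \<comment> \<open>Adjoin the inverse of \<open>u = 1 - P * b\<close>. Powers of \<open>u\<close>
    are again of the form \<open>1 - P * c\<close>, so \<open>P\<close> does not become invertible,
    and maximality puts the inverse into \<open>V\<close>.\<close>
  have unit: "inverse (1 - P * b) \<in> V" if b: "b \<in> V" for b
  proof -
    define u where "u = 1 - P * b"
    have u0: "u \<noteq> 0" using nonunit[OF b] by (simp add: u_def P_def)
    have uV: "u \<in> V" using b PV by (auto simp: u_def intro!: cl)
    define W where "W = {v * inverse u ^ n | v n. v \<in> V}"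
    have "v = v * inverse u ^ 0" for v by simp
    then have VW: "V \<subseteq> W" unfolding W_def by blast
    have "x - y \<in> W \<and> x * y \<in> W" if xy: "x \<in> W" "y \<in> W" for x y
    proof -
      obtain v n w m where vw: "x = v * inverse u ^ n" "y = w * inverse u ^ m" "v \<in> V" "w \<in> V"
        using xy by (auto simp: W_def)
      have "x - y = (v * u ^ m - w * u ^ n) * inverse u ^ (n + m)"
        using u0 by (simp add: vw field_simps power_add)
      moreover have "x * y = (v * w) * inverse u ^ (n + m)" by (simp add: vw power_add mult_ac)
      moreover have "v * u ^ m - w * u ^ n \<in> V" "v * w \<in> V" using vw uV by (auto intro!: cl)
      ultimately show ?thesis unfolding W_def by blast
    qed
    then have "subring_set W" using VW cl(1) by (auto simp: subring_set_def)
    moreover have "P * x \<noteq> 1" if xW: "x \<in> W" for x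
    proof
      assume 1: "P * x = 1"
      obtain v n where x: "x = v * inverse u ^ n" "v \<in> V" using xW by (auto simp: W_def)
      have "\<exists>c\<in>V. u ^ n = 1 - P * c" for n
      proof (induction n)
        case 0 then show ?case using cl by (intro bexI[of _ 0]) auto
      next
        case (Suc n)
        then obtain c where c: "c \<in> V" "u ^ n = 1 - P * c" by auto
        have "u ^ Suc n = (1 - P * b) * (1 - P * c)" unfolding power_Suc c(2) by (simp only: u_def)
        then show ?case using b PV c(1)
          by (intro bexI[of _ "b + c - P * b * c"]) (auto simp: algebra_simps intro!: cl)
      qed
      then obtain c where "c \<in> V" "u ^ n = 1 - P * c" by blast
      moreover have "P * v = u ^ n" using 1 u0 by (simp add: x field_simps)
      ultimately have "P * (v + c) = 1" by (simp add: algebra_simps)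
      moreover have "v + c \<in> V" using x \<open>c \<in> V\<close> by (intro cl)
      ultimately show False using nonunit by (auto simp: P_def)
    qed
    ultimately have "W = V" using max VW by (auto simp: \<V>_def P_def)
    moreover have "inverse u \<in> W" using cl(1) by (auto simp: W_def intro!: exI[of _ 1])
    ultimately show ?thesis by (simp add: u_def)
  qed
  define inV where "inV q \<longleftrightarrow> (\<forall>i. coeff q i \<in> V)" for q :: "'k poly"
  \<comment> \<open>The values \<open>poly q x\<close> form the ring generated by \<open>V\<close>
    and \<open>x\<close>. If \<open>x\<close> is outside \<open>V\<close>, this ring is strictly
    larger, so by maximality \<open>P\<close> is invertible in it.\<close>
  have adjoin: "\<exists>q. inV q \<and> P * poly q x = 1" if "x \<notin> V" for x
  proof (rule ccontr)
    assume none: "\<not> ?thesis"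
    define W where "W = {poly q x | q. inV q}"
    have VW: "V \<subseteq> W"
    proof
      fix v assume "v \<in> V"
      then have "inV [:v:]" using cl by (auto simp: inV_def coeff_pCons split: nat.splits)
      then show "v \<in> W" by (auto simp: W_def intro!: exI[of _ "[:v:]"])
    qed
    have "y - z \<in> W \<and> y * z \<in> W" if yz: "y \<in> W" "z \<in> W" for y z
    proof -
      obtain q r where "inV q" "inV r" "y = poly q x" "z = poly r x" using yz by (auto simp: W_def)
      moreover from this have "inV (q - r)" "inV (q * r)"
        by (auto simp: inV_def coeff_mult intro!: cl)
      ultimately show ?thesis by (auto simp: W_def intro: exI[of _ "q - r"] exI[of _ "q * r"])
    qed
    moreover have "1 \<in> W" using VW cl(1) by blast
    ultimately have "subring_set W" by (simp add: subring_set_def)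
    moreover have "\<forall>v\<in>W. of_nat p * v \<noteq> 1" using none by (auto simp: W_def P_def)
    ultimately have "W \<in> \<V>" by (simp add: \<V>_def)
    then have "W = V" using max VW by blast
    moreover have "x \<in> W"
      using cl by (auto simp: W_def inV_def coeff_pCons split: nat.splits intro!: exI[of _ "[:0, 1:]"])
    ultimately show False using that by simp
  qed
  \<comment> \<open>Suppose that \<open>P\<close> is invertible both in \<open>V[x]\<close> and in
    \<open>V[1/x]\<close>. In the relation for \<open>1/x\<close>, the constant terms combine to the
    unit \<open>1 - P * coeff r 0\<close>; division by it and multiplication by \<open>x ^ n\<close>
    express \<open>x ^ n\<close> through lower powers of \<open>x\<close>. Substituting this for the
    leading monomial of \<open>q\<close> lowers a degree that was minimal. The condition on the
    degrees keeps the exponents \<open>n - j\<close> honest.\<close>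
  have descent: False
    if x: "x \<noteq> 0" and q: "inV q" "P * poly q x = 1" and r: "inV r" "P * poly r (inverse x) = 1"
      and le: "degree r \<le> degree q"
      and min: "\<And>q'. inV q' \<Longrightarrow> P * poly q' x = 1 \<Longrightarrow> degree q \<le> degree q'" for x q r
  proof -
    define n m where "n = degree q" and "m = degree r"
    have n0: "n > 0"
    proof (rule ccontr)
      assume "\<not> n > 0"
      then have "poly q x = coeff q 0" by (simp add: n_def poly_altdef)
      then show False using q nonunit by (auto simp: inV_def P_def)
    qed
    define u where "u = 1 - P * coeff r 0"
    have u0: "u \<noteq> 0" using nonunit r by (auto simp: u_def P_def inV_def)
    define c where "c j = coeff r j * inverse u" for j
    have cV: "c j \<in> V" for j using r unit unfolding c_def u_def inV_def by (intro cl) auto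
    have "1 = P * coeff r 0 + P * (\<Sum>j=1..m. coeff r j * inverse x ^ j)"
      using r(2) by (simp add: poly_altdef m_def algebra_simps sum.atLeast_Suc_atMost[of 0] flip: atLeast0AtMost)
    then have "u = P * (\<Sum>j=1..m. coeff r j * inverse x ^ j)" by (simp add: u_def algebra_simps)
    then have "u * inverse u = P * (\<Sum>j=1..m. coeff r j * inverse x ^ j) * inverse u" by (rule arg_cong)
    then have "1 = P * (\<Sum>j=1..m. coeff r j * inverse x ^ j) * inverse u" by (simp only: right_inverse[OF u0])
    also have "\<dots> = P * (\<Sum>j=1..m. c j * inverse x ^ j)"
      by (simp add: c_def sum_distrib_left sum_distrib_right mult_ac)
    finally have "x ^ n = x ^ n * (P * (\<Sum>j=1..m. c j * inverse x ^ j))" by simp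
    also have "\<dots> = P * (\<Sum>j=1..m. c j * (x ^ n * inverse x ^ j))"
      by (simp add: sum_distrib_left mult_ac)
    also have "\<dots> = P * (\<Sum>j=1..m. c j * x ^ (n - j))"
      using x le by (intro arg_cong[where f = "\<lambda>s. P * s"] sum.cong refl)
        (simp add: n_def m_def power_diff field_simps)
    finally have xn: "x ^ n = P * (\<Sum>j=1..m. c j * x ^ (n - j))" .
    define a where "a = coeff q n"
    define s where "s = (\<Sum>j=1..m. monom (c j) (n - j))"
    define q' where "q' = q - monom a n + smult (P * a) s"
    have aV: "a \<in> V" using q by (simp add: a_def inV_def)
    have "inV s" using cV cl by (auto simp: inV_def s_def coeff_sum intro!: cl)
    then have "inV q'" using q aV PV cl(2) by (auto simp: q'_def inV_def intro!: cl)
    moreover have "poly s x = (\<Sum>j=1..m. c j * x ^ (n - j))"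
      by (simp add: s_def poly_sum poly_monom)
    then have "poly q' x = poly q x" using xn by (simp add: q'_def poly_monom algebra_simps)
    moreover have "coeff q' i = 0" if "i > n - 1" for i
    proof -
      have "coeff s i = 0" using that n0 by (auto simp: s_def coeff_sum intro!: sum.neutral)
      moreover have "coeff q i = 0" if "i \<noteq> n" using that \<open>i > n - 1\<close> by (auto simp: n_def intro: coeff_eq_0)
      ultimately show ?thesis by (auto simp: q'_def a_def)
    qed
    then have "degree q' \<le> n - 1" by (intro degree_le) auto
    ultimately show False using min[of q'] q n0 by (auto simp: n_def)
  qed
  have val: "x \<in> V \<or> inverse x \<in> V" for x
  proof (rule ccontr)
    assume n: "\<not> ?thesis"
    then have x0: "x \<noteq> 0" using cl(2) by auto
    obtain q where q: "inV q" "P * poly q x = 1" "\<And>q'. inV q' \<Longrightarrow> P * poly q' x = 1 \<Longrightarrow> degree q \<le> degree q'"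
      using adjoin[of x] n ex_has_least_nat[of "\<lambda>q. inV q \<and> P * poly q x = 1" _ degree] by blast
    obtain r where r: "inV r" "P * poly r (inverse x) = 1"
        "\<And>q'. inV q' \<Longrightarrow> P * poly q' (inverse x) = 1 \<Longrightarrow> degree r \<le> degree q'"
      using adjoin[of "inverse x"] n ex_has_least_nat[of "\<lambda>q. inV q \<and> P * poly q (inverse x) = 1" _ degree]
      by blast
    show False
    \<comment> \<open>The hypothesis is symmetric in \<open>x\<close> and \<open>inverse x\<close>,
      so the relation of larger degree is the one to be shortened.\<close>
    proof (cases "degree r \<le> degree q")
      case True
      then show ?thesis using descent[OF x0 q(1,2) r(1,2)] q(3) by blast
    next
      case False
      then show ?thesis using descent[of "inverse x" r q] x0 q(1,2) r by auto
    qed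
  qed
  have "place V p" using p sub nonunit val unit by unfold_locales (auto simp: P_def)
  then show ?thesis by blast
qed

section \<open>Congruences modulo p and the Frobenius map\<close>

context place
begin

lemmas V_closed = subring_closed[OF subring]

definition cong_p :: "'k \<Rightarrow> 'k \<Rightarrow> bool" where
  "cong_p x y \<longleftrightarrow> (\<exists>v\<in>V. x - y = of_nat p * v)"

lemma cong_refl [simp]: "cong_p x x"
  using V_closed(2) by (auto simp: cong_p_def intro!: bexI[of _ 0])

lemma cong_sym: "cong_p x y \<Longrightarrow> cong_p y x"
  unfolding cong_p_def by (metis V_closed(4) minus_diff_eq mult_minus_right)

lemma cong_trans: "cong_p x y \<Longrightarrow> cong_p y z \<Longrightarrow> cong_p x z"
  unfolding cong_p_def by (metis V_closed(5) diff_add_cancel diff_diff_eq2 diff_right_commute distrib_left add_diff_eq)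

lemma cong_add: "cong_p x y \<Longrightarrow> cong_p x' y' \<Longrightarrow> cong_p (x + x') (y + y')"
  unfolding cong_p_def by (metis V_closed(5) add_diff_add distrib_left)

lemma cong_mult_left: "cong_p x y \<Longrightarrow> z \<in> V \<Longrightarrow> cong_p (z * x) (z * y)"
  unfolding cong_p_def by (metis V_closed(6) mult.left_commute right_diff_distrib)

lemma cong_mult: "cong_p x y \<Longrightarrow> cong_p x' y' \<Longrightarrow> x' \<in> V \<Longrightarrow> y \<in> V \<Longrightarrow> cong_p (x * x') (y * y')"
  using cong_trans[of "x * x'" "y * x'" "y * y'"] cong_mult_left[of x y x'] cong_mult_left[of x' y' y]
  by (simp add: mult.commute)

lemma cong_sum: "(\<And>i. i \<in> A \<Longrightarrow> cong_p (f i) (g i)) \<Longrightarrow> cong_p (sum f A) (sum g A)"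
  by (induction A rule: infinite_finite_induct) (auto intro: cong_add)

lemma cong_multiple: "v \<in> V \<Longrightarrow> cong_p (x + of_nat p * v) x"
  by (auto simp: cong_p_def)

lemma cong_power: "cong_p x y \<Longrightarrow> x \<in> V \<Longrightarrow> y \<in> V \<Longrightarrow> cong_p (x ^ n) (y ^ n)"
  by (induction n) (auto intro!: cong_mult V_closed)

text \<open>All binomial coefficients except the two outer ones are multiples of
  \<open>p\<close>.\<close>

lemma frobenius_add:
  assumes "a \<in> V" "b \<in> V" shows "cong_p ((a + b) ^ p) (a ^ p + b ^ p)"
proof -
  have p0: "p > 0" using p_ge_5 by simp
  have "(a + b) ^ p = (\<Sum>i\<le>p. of_nat (p choose i) * a ^ i * b ^ (p - i))" by (rule binomial_ring)
  also have "{..p} = insert 0 (insert p {1..<p})" using p0 by auto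
  also have "(\<Sum>i\<in>\<dots>. of_nat (p choose i) * a ^ i * b ^ (p - i)) =
      b ^ p + a ^ p + (\<Sum>i=1..<p. of_nat (p choose i) * a ^ i * b ^ (p - i))"
    using p0 by (simp add: add.assoc)
  also have "(\<Sum>i=1..<p. of_nat (p choose i) * a ^ i * b ^ (p - i)) =
      of_nat p * (\<Sum>i=1..<p. of_nat ((p choose i) div p) * a ^ i * b ^ (p - i))"
    unfolding sum_distrib_left
  proof (intro sum.cong refl)
    fix i assume "i \<in> {1..<p}"
    then have "p dvd p choose i" using prime_p by (intro dvd_choose_prime) auto
    then have "(of_nat (p choose i) :: 'k) = of_nat p * of_nat ((p choose i) div p)"
      by (metis dvd_mult_div_cancel of_nat_mult)
    then show "of_nat (p choose i) * a ^ i * b ^ (p - i) =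
        of_nat p * (of_nat ((p choose i) div p) * a ^ i * b ^ (p - i))" by (simp add: mult.assoc)
  qed
  finally have "(a + b) ^ p = (a ^ p + b ^ p) +
      of_nat p * (\<Sum>i=1..<p. of_nat ((p choose i) div p) * a ^ i * b ^ (p - i))" by (simp add: add.commute)
  moreover have "(\<Sum>i=1..<p. of_nat ((p choose i) div p) * a ^ i * b ^ (p - i)) \<in> V"
    using assms by (auto intro!: V_closed)
  ultimately show ?thesis using cong_multiple by metis
qed

lemma frobenius_sum:
  assumes "\<And>i. i \<in> A \<Longrightarrow> f i \<in> V" shows "cong_p (sum f A ^ p) (\<Sum>i\<in>A. f i ^ p)"
  using assms
proof (induction A rule: infinite_finite_induct)
  case (insert x A)
  then have "cong_p ((f x + sum f A) ^ p) (f x ^ p + sum f A ^ p)" by (intro frobenius_add V_closed) auto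
  then show ?case using insert cong_trans[OF _ cong_add[OF cong_refl]] by simp
qed (use p_ge_5 in \<open>auto simp: power_0_left\<close>)

text \<open>These elements form a subring containing the integers. The weights of orbits turn out to
  lie in it, which is what allows a \<open>p\<close>-th power to be taken of the entries of a matrix
  without disturbing the weights.\<close>

definition frob_fixed :: "'k set" where
  "frob_fixed = {x \<in> V. cong_p (x ^ p) x}"

lemma frob_fixed_mult: "x \<in> frob_fixed \<Longrightarrow> y \<in> frob_fixed \<Longrightarrow> x * y \<in> frob_fixed"
  by (auto simp: frob_fixed_def power_mult_distrib intro!: cong_mult V_closed)

lemma frob_fixed_add: "x \<in> frob_fixed \<Longrightarrow> y \<in> frob_fixed \<Longrightarrow> x + y \<in> frob_fixed"
  by (auto simp: frob_fixed_def intro!: V_closed intro: cong_trans[OF frobenius_add] cong_add)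

lemma frob_fixed_of_nat: "of_nat n \<in> frob_fixed"
proof (induction n)
  case 0
  then show ?case using V_closed(2) p_ge_5 by (simp add: frob_fixed_def power_0_left)
next
  case (Suc n)
  have "1 \<in> frob_fixed" using V_closed(1) by (simp add: frob_fixed_def)
  with Suc show ?case using frob_fixed_add by simp
qed

lemma frob_fixed_uminus: "x \<in> frob_fixed \<Longrightarrow> - x \<in> frob_fixed"
proof -
  have "odd p" using prime_p p_ge_5 by (simp add: prime_odd_nat)
  then have "(- x) ^ p = - (x ^ p)" by (simp add: power_minus_odd)
  moreover have "cong_p (- a) (- b)" if "cong_p a b" for a b
    using cong_mult_left[OF that, of "- 1"] V_closed(1,4) by simp
  ultimately show "x \<in> frob_fixed \<Longrightarrow> - x \<in> frob_fixed"
    by (auto simp: frob_fixed_def intro: V_closed)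
qed

text \<open>Multiply the congruence between \<open>x\<close> and \<open>x ^ p\<close> by
  \<open>inverse x ^ p * inverse x\<close>, which lies in \<open>V\<close>.\<close>

lemma frob_fixed_inverse:
  assumes "x \<in> frob_fixed" "inverse x \<in> V" shows "inverse x \<in> frob_fixed"
proof (cases "x = 0")
  case False
  have "cong_p ((inverse x ^ p * inverse x) * x) ((inverse x ^ p * inverse x) * x ^ p)"
    using assms by (intro cong_mult_left[OF cong_sym]) (auto simp: frob_fixed_def intro!: V_closed)
  moreover have "(inverse x ^ p * inverse x) * x = inverse x ^ p"
      "(inverse x ^ p * inverse x) * x ^ p = inverse x"
    using False by (simp_all add: power_inverse)
  ultimately have "cong_p (inverse x ^ p) (inverse x)" by simp
  with assms show ?thesis by (simp add: frob_fixed_def)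
qed (use assms in simp)

text \<open>Since \<open>p\<close> is 1 or 5 modulo 6, one of \<open>1 - p\<close> and
  \<open>1 + p\<close> is a multiple of 6. Both are units by \<open>local_unit\<close>, and a
  divisor of a unit is a unit.\<close>

lemma inverse_6: "inverse 6 \<in> V" "(6 :: 'k) \<noteq> 0"
proof -
  have "prime (2::nat)" "prime (3::nat)" by simp_all
  then have "\<not> 2 dvd p" "\<not> 3 dvd p"
    using prime_p p_ge_5 primes_dvd_imp_eq[of 2 p] primes_dvd_imp_eq[of 3 p] by linarith+
  then have "p mod 6 = 1 \<or> p mod 6 = 5" by presburger
  then consider q where "p = 6 * q + 1" | q where "p = 6 * q + 5" by (metis mult_div_mod_eq)
  then have "\<exists>b t. b \<in> V \<and> t \<in> V \<and> 1 - of_nat p * b = 6 * (t::'k)"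
  proof cases
    case 1
    then have "1 - of_nat p * 1 = 6 * (- of_nat q :: 'k)" by (simp add: algebra_simps)
    then show ?thesis using V_closed(1) V_closed(4)[OF V_closed(8), of q]
      by (intro exI[of _ 1] exI[of _ "- of_nat q"] conjI)
  next
    case 2
    then have "1 - of_nat p * (- 1) = 6 * (of_nat (q + 1) :: 'k)" by (simp add: algebra_simps)
    then show ?thesis using V_closed(4)[OF V_closed(1)] V_closed(8)[of "q + 1"]
      by (intro exI[of _ "- 1"] exI[of _ "of_nat (q + 1)"] conjI)
  qed
  then obtain b t where bt: "b \<in> V" "t \<in> V" "1 - of_nat p * b = 6 * (t::'k)" by blast
  have "1 - of_nat p * b \<noteq> 0" using p_nonunit[OF bt(1)] by auto
  then have ne: "(6::'k) \<noteq> 0" "t \<noteq> 0" using bt by auto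
  show "(6::'k) \<noteq> 0" by (rule ne)
  have "inverse (6 * t) \<in> V" using local_unit[OF bt(1)] bt(3) by simp
  then have "t * inverse (6 * t) \<in> V" by (rule V_closed(6)[OF bt(2)])
  then show "inverse 6 \<in> V" using ne by (simp add: field_simps)
qed

lemma two_three_units: "inverse 2 \<in> frob_fixed" "inverse 3 \<in> frob_fixed" "(2 :: 'k) \<noteq> 0" "(3 :: 'k) \<noteq> 0"
proof -
  have 6: "(6 :: 'k) = 2 * 3" by simp
  show ne: "(2 :: 'k) \<noteq> 0" "(3 :: 'k) \<noteq> 0"
    using inverse_6(2) 6 by (metis mult_zero_left, metis mult_zero_right)
  have "inverse 2 = of_nat 3 * (inverse 6 :: 'k)" "inverse 3 = of_nat 2 * (inverse 6 :: 'k)"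
    using ne inverse_6(2) by (simp_all add: field_simps)
  then have "inverse 2 \<in> V" "inverse 3 \<in> V"
    by (simp_all only: V_closed(6)[OF V_closed(8) inverse_6(1)])
  then show "inverse 2 \<in> frob_fixed" "inverse 3 \<in> frob_fixed"
    using frob_fixed_inverse[of 2] frob_fixed_inverse[of 3] frob_fixed_of_nat[of 2] frob_fixed_of_nat[of 3]
    by auto
qed

end

section \<open>Finite-dimensional modules over a field\<close>

lemma field_ring_simps [simp]:
  "carrier field_ring = UNIV" "\<one>\<^bsub>field_ring\<^esub> = 1" "\<zero>\<^bsub>field_ring\<^esub> = 0"
  "x \<oplus>\<^bsub>field_ring\<^esub> y = x + y" "x \<otimes>\<^bsub>field_ring\<^esub> y = x * y"
  by (simp_all add: field_ring_def)

lemma cring_field_ring: "cring (field_ring :: 'k::field ring)"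
proof (intro cringI abelian_groupI comm_monoidI)
  fix x :: 'k
  show "\<exists>y\<in>carrier field_ring. y \<oplus>\<^bsub>field_ring\<^esub> x = \<zero>\<^bsub>field_ring\<^esub>"
    by (intro bexI[of _ "- x"]) auto
qed (auto simp: algebra_simps)

definition linear_subset :: "(nat \<Rightarrow> 'k::field) set \<Rightarrow> bool" where
  "linear_subset S \<longleftrightarrow> (\<lambda>i. 0) \<in> S \<and> (\<forall>u\<in>S. \<forall>v\<in>S. \<forall>c. (\<lambda>i. u i + c * v i) \<in> S)"

text \<open>The positions of leading entries, as in an echelon form. For a subspace of vectors of
  bounded length their number is the dimension; used in this way, it needs neither bases nor
  independence.\<close>

definition pivots :: "(nat \<Rightarrow> 'k::field) set \<Rightarrow> nat set" where
  "pivots S = {i. \<exists>u\<in>S. u i \<noteq> 0 \<and> (\<forall>j<i. u j = 0)}"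

text \<open>Gaussian elimination: a vector of \<open>S'\<close> whose first nonzero entry is at
  \<open>m\<close> can be cleared there by a vector of \<open>S\<close> with the same pivot. The
  induction runs on the number of positions left.\<close>

lemma pivots_eq_imp_eq:
  assumes S: "linear_subset S" and S': "linear_subset S'" and sub: "S \<subseteq> S'"
    and n: "\<And>u i. u \<in> S' \<Longrightarrow> i \<ge> n \<Longrightarrow> u i = 0" and eq: "pivots S = pivots S'"
  shows "S = S'"
proof -
  have "u \<in> S" if "u \<in> S'" "\<forall>j<m. u j = 0" for u m
    using that
  proof (induction "n - m" arbitrary: u m)
    case 0
    then have "u i = 0" for i using n[of u i] by (cases "i < m") auto
    then have "u = (\<lambda>i. 0)" by blast
    then show ?case using S by (simp add: linear_subset_def)
  next
    case (Suc d)
    then have d: "d = n - Suc m" by simp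
    show ?case
    proof (cases "u m = 0")
      case True
      then show ?thesis using Suc.hyps(1)[OF d Suc.prems(1)] Suc.prems(2) by (auto simp: less_Suc_eq)
    next
      case False
      then have "m \<in> pivots S" using Suc.prems eq by (auto simp: pivots_def)
      then obtain v where v: "v \<in> S" "v m \<noteq> 0" "\<forall>j<m. v j = 0" by (auto simp: pivots_def)
      define u' where "u' = (\<lambda>i. u i + (- u m / v m) * v i)"
      have "v \<in> S'" using v(1) sub by blast
      then have "u' \<in> S'" using S' Suc.prems(1) unfolding u'_def linear_subset_def by metis
      moreover have "\<forall>j<Suc m. u' j = 0" using v Suc.prems(2) by (auto simp: u'_def less_Suc_eq)
      ultimately have "u' \<in> S" by (rule Suc.hyps(1)[OF d])
      then have "(\<lambda>i. u' i + (u m / v m) * v i) \<in> S"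
        using S v(1) unfolding linear_subset_def by metis
      then show ?thesis by (simp add: u'_def)
    qed
  qed
  from this[of _ 0] sub show ?thesis by blast
qed

lemma card_pivots_strict_mono:
  assumes "linear_subset S" "linear_subset S'" "S \<subset> S'" "\<And>u i. u \<in> S' \<Longrightarrow> i \<ge> n \<Longrightarrow> u i = 0"
  shows "card (pivots S) < card (pivots S')"
proof (rule psubset_card_mono)
  have "pivots S' \<subseteq> {..<n}" using assms(4) by (force simp: pivots_def not_less[symmetric])
  then show "finite (pivots S')" by (rule finite_subset) simp
  have "pivots S \<subseteq> pivots S'" using assms(3) by (auto simp: pivots_def)
  moreover have "pivots S \<noteq> pivots S'" using pivots_eq_imp_eq[OF assms(1,2)] assms(3,4) by blast
  ultimately show "pivots S \<subset> pivots S'" by blast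
qed

text \<open>Finite dimensionality as an injective linear map into vectors of length
  \<open>n\<close>. In this form it passes to every subspace with the same map, in particular to the
  hom spaces of the Karoubi envelope.\<close>

definition coordinates :: "('k::field, 'a) module \<Rightarrow> nat \<Rightarrow> ('a \<Rightarrow> nat \<Rightarrow> 'k) \<Rightarrow> bool" where
  "coordinates M n \<phi> \<longleftrightarrow> inj_on \<phi> (carrier M) \<and>
     (\<forall>f\<in>carrier M. \<forall>g\<in>carrier M. \<forall>c. \<phi> (f \<oplus>\<^bsub>M\<^esub> c \<odot>\<^bsub>M\<^esub> g) = (\<lambda>i. \<phi> f i + c * \<phi> g i)) \<and>
     (\<forall>f\<in>carrier M. \<forall>i\<ge>n. \<phi> f i = 0)"

text \<open>A hom space of the Karoubi envelope is a hom space of the original category with a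
  smaller carrier; this lets sums be computed in the latter.\<close>

lemma finsum_carrier_update:
  assumes M: "abelian_monoid M" and N: "abelian_monoid (M\<lparr>carrier := H\<rparr>)" and H: "H \<subseteq> carrier M"
    and fin: "finite A" and f: "f \<in> A \<rightarrow> H"
  shows "finsum (M\<lparr>carrier := H\<rparr>) f A = finsum M f A"
proof -
  interpret M: abelian_monoid M by (rule M)
  interpret N: abelian_monoid "M\<lparr>carrier := H\<rparr>" by (rule N)
  show ?thesis using fin f
  proof (induction A)
    case empty
    then show ?case using M.finsum_empty N.finsum_empty by simp
  next
    case (insert x A)
    moreover have "f \<in> A \<rightarrow> carrier M" "f x \<in> carrier M" using insert.prems H by auto
    ultimately show ?case
      using M.finsum_insert[of A x f] N.finsum_insert[of A x f] by auto
  qed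
qed

lemma finsum_hom:
  assumes M: "abelian_monoid M" and N: "abelian_monoid N" and fin: "finite A" and f: "f \<in> A \<rightarrow> carrier M"
    and h: "h \<in> carrier M \<rightarrow> carrier N" "h \<zero>\<^bsub>M\<^esub> = \<zero>\<^bsub>N\<^esub>"
      "\<And>x y. x \<in> carrier M \<Longrightarrow> y \<in> carrier M \<Longrightarrow> h (x \<oplus>\<^bsub>M\<^esub> y) = h x \<oplus>\<^bsub>N\<^esub> h y"
  shows "h (finsum M f A) = finsum N (\<lambda>j. h (f j)) A"
proof -
  interpret M: abelian_monoid M by (rule M)
  interpret N: abelian_monoid N by (rule N)
  show ?thesis using fin f
  proof (induction A)
    case empty
    then show ?case using M.finsum_empty N.finsum_empty h by simp
  next
    case (insert x A)
    have fA: "f \<in> A \<rightarrow> carrier M" "f x \<in> carrier M" using insert.prems by auto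
    moreover have "(\<lambda>j. h (f j)) \<in> A \<rightarrow> carrier N" "h (f x) \<in> carrier N" using fA h(1) by auto
    ultimately show ?case using insert M.finsum_closed[of f A]
      by (simp add: h(3))
  qed
qed

context
  fixes M :: "('k::field, 'a) module"
  assumes M: "module field_ring M"
begin

interpretation M: module field_ring M by (rule M)

lemma fmod_zero_smult: "x \<in> carrier M \<Longrightarrow> 0 \<odot>\<^bsub>M\<^esub> x = \<zero>\<^bsub>M\<^esub>"
  using M.smult_l_null[of x] by simp

lemma fmod_uminus: "x \<in> carrier M \<Longrightarrow> \<ominus>\<^bsub>M\<^esub> x = (- 1) \<odot>\<^bsub>M\<^esub> x"
proof -
  assume x: "x \<in> carrier M"
  have "(- 1) \<odot>\<^bsub>M\<^esub> x \<oplus>\<^bsub>M\<^esub> x = (- 1) \<odot>\<^bsub>M\<^esub> x \<oplus>\<^bsub>M\<^esub> 1 \<odot>\<^bsub>M\<^esub> x" using M.smult_one[of x] x by simp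
  also have "\<dots> = (- 1 + 1) \<odot>\<^bsub>M\<^esub> x" using M.smult_l_distr[of "- 1" 1 x] x by simp
  finally show ?thesis using x M.minus_equality[of "(- 1) \<odot>\<^bsub>M\<^esub> x" x] M.smult_closed[of "- 1" x]
    by (simp add: fmod_zero_smult)
qed

lemma fmod_minus: "x \<in> carrier M \<Longrightarrow> y \<in> carrier M \<Longrightarrow> x \<ominus>\<^bsub>M\<^esub> y = x \<oplus>\<^bsub>M\<^esub> (- 1) \<odot>\<^bsub>M\<^esub> y"
  by (simp add: a_minus_def fmod_uminus)

lemma fmod_closed:
  "x \<in> carrier M \<Longrightarrow> y \<in> carrier M \<Longrightarrow> x \<oplus>\<^bsub>M\<^esub> y \<in> carrier M"
  "x \<in> carrier M \<Longrightarrow> y \<in> carrier M \<Longrightarrow> x \<ominus>\<^bsub>M\<^esub> y \<in> carrier M"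
  "x \<in> carrier M \<Longrightarrow> c \<odot>\<^bsub>M\<^esub> x \<in> carrier M"
  "\<zero>\<^bsub>M\<^esub> \<in> carrier M"
  by (auto simp: fmod_minus M.smult_closed)

lemma fmod_minus_eq_zero: "x \<in> carrier M \<Longrightarrow> y \<in> carrier M \<Longrightarrow> x \<ominus>\<^bsub>M\<^esub> y = \<zero>\<^bsub>M\<^esub> \<longleftrightarrow> x = y"
  unfolding a_minus_def by (metis M.a_assoc M.a_inv_closed M.l_neg M.r_neg M.l_zero M.r_zero)

lemma fmod_minus_add: "x \<in> carrier M \<Longrightarrow> y \<in> carrier M \<Longrightarrow> y \<oplus>\<^bsub>M\<^esub> (x \<ominus>\<^bsub>M\<^esub> y) = x"
  unfolding a_minus_def by (metis M.a_assoc M.a_comm M.a_inv_closed M.r_neg M.r_zero)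

lemma fmod_minus_zero: "x \<in> carrier M \<Longrightarrow> x \<ominus>\<^bsub>M\<^esub> \<zero>\<^bsub>M\<^esub> = x"
  by (simp add: a_minus_def)

lemma coordinates_zero: "coordinates M n \<phi> \<Longrightarrow> \<phi> \<zero>\<^bsub>M\<^esub> = (\<lambda>i. 0)"
proof -
  assume c: "coordinates M n \<phi>"
  then have "\<phi> (\<zero>\<^bsub>M\<^esub> \<oplus>\<^bsub>M\<^esub> (- 1) \<odot>\<^bsub>M\<^esub> \<zero>\<^bsub>M\<^esub>) = (\<lambda>i. \<phi> \<zero>\<^bsub>M\<^esub> i + (- 1) * \<phi> \<zero>\<^bsub>M\<^esub> i)"
    using M.zero_closed unfolding coordinates_def by blast
  then show ?thesis using M.smult_r_null[of "- 1"] by simp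
qed

text \<open>For growing \<open>k\<close>, a finite set is built whose combinations match every
  element in the first \<open>k\<close> coordinates. It has to be enlarged only if some element has
  its leading entry at position \<open>k\<close>. At \<open>k = n\<close> injectivity turns matching
  into equality.\<close>

lemma finite_spanning_set:
  assumes c: "coordinates M n \<phi>"
  shows "\<exists>B. finite B \<and> B \<subseteq> carrier M \<and>
    (\<forall>f\<in>carrier M. \<exists>c. f = finsum M (\<lambda>b. c b \<odot>\<^bsub>M\<^esub> b) B)"
proof -
  define sp where "sp B = {finsum M (\<lambda>b. c b \<odot>\<^bsub>M\<^esub> b) B | c. True}" for B
  have \<phi>: "\<And>f g c. f \<in> carrier M \<Longrightarrow> g \<in> carrier M \<Longrightarrow> \<phi> (f \<oplus>\<^bsub>M\<^esub> c \<odot>\<^bsub>M\<^esub> g) = (\<lambda>i. \<phi> f i + c * \<phi> g i)"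
    using c by (simp add: coordinates_def)
  have sm: "(\<lambda>b. c b \<odot>\<^bsub>M\<^esub> b) \<in> B \<rightarrow> carrier M" if "B \<subseteq> carrier M" for B c
    using that by (auto intro: M.smult_closed)
  have sp_closed: "sp B \<subseteq> carrier M" if "B \<subseteq> carrier M" for B
    using M.finsum_closed[OF sm[OF that]] by (auto simp: sp_def)
  have insert: "h \<oplus>\<^bsub>M\<^esub> d \<odot>\<^bsub>M\<^esub> g \<in> sp (insert g B)"
    if B: "finite B" "B \<subseteq> carrier M" "g \<in> carrier M" "h \<in> sp B" for B g h d
  proof -
    obtain c where h: "h = finsum M (\<lambda>b. c b \<odot>\<^bsub>M\<^esub> b) B" using B(4) by (auto simp: sp_def)
    show ?thesis
    proof (cases "g \<in> B")
      case False
      have "finsum M (\<lambda>b. (c(g := d)) b \<odot>\<^bsub>M\<^esub> b) (insert g B) =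
          d \<odot>\<^bsub>M\<^esub> g \<oplus>\<^bsub>M\<^esub> finsum M (\<lambda>b. (c(g := d)) b \<odot>\<^bsub>M\<^esub> b) B"
        using B False sm[of B "c(g := d)"] by (subst M.finsum_insert) (auto intro: M.smult_closed)
      also have "finsum M (\<lambda>b. (c(g := d)) b \<odot>\<^bsub>M\<^esub> b) B = h"
        unfolding h using False sm[OF B(2), of c] by (intro M.finsum_cong') auto
      also have "d \<odot>\<^bsub>M\<^esub> g \<oplus>\<^bsub>M\<^esub> h = h \<oplus>\<^bsub>M\<^esub> d \<odot>\<^bsub>M\<^esub> g"
        using B sp_closed by (intro M.a_comm) (auto intro: M.smult_closed)
      finally show ?thesis unfolding sp_def by (intro CollectI exI[of _ "c(g := d)"]) simp
    next
      \<comment> \<open>The sum runs over a set, so for a \<open>g\<close> already in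
        \<open>B\<close> the new coefficient is added to the old one.\<close>
      case True
      have g: "(\<lambda>b. if g = b then d \<odot>\<^bsub>M\<^esub> b else \<zero>\<^bsub>M\<^esub>) \<in> B \<rightarrow> carrier M"
        using B by (auto intro: M.smult_closed)
      have "h \<oplus>\<^bsub>M\<^esub> d \<odot>\<^bsub>M\<^esub> g =
          h \<oplus>\<^bsub>M\<^esub> finsum M (\<lambda>b. if g = b then d \<odot>\<^bsub>M\<^esub> b else \<zero>\<^bsub>M\<^esub>) B"
        using M.finsum_singleton[OF True B(1) sm[OF B(2), of "\<lambda>_. d"]] by simp
      also have "\<dots> = finsum M (\<lambda>b. c b \<odot>\<^bsub>M\<^esub> b \<oplus>\<^bsub>M\<^esub> (if g = b then d \<odot>\<^bsub>M\<^esub> b else \<zero>\<^bsub>M\<^esub>)) B"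
        unfolding h using M.finsum_addf[OF sm[OF B(2)] g] by simp
      also have "\<dots> = finsum M (\<lambda>b. (c b + (if g = b then d else 0)) \<odot>\<^bsub>M\<^esub> b) B"
      proof (intro M.finsum_cong' refl sm[OF B(2)])
        fix b assume "b \<in> B"
        then have b: "b \<in> carrier M" using B by auto
        show "c b \<odot>\<^bsub>M\<^esub> b \<oplus>\<^bsub>M\<^esub> (if g = b then d \<odot>\<^bsub>M\<^esub> b else \<zero>\<^bsub>M\<^esub>) =
            (c b + (if g = b then d else 0)) \<odot>\<^bsub>M\<^esub> b"
          using b M.smult_l_distr[of "c b" d b] M.smult_closed[of "c b" b] by auto
      qed
      finally show ?thesis using True by (auto simp: sp_def insert_absorb)
    qed
  qed
  have "\<exists>B. finite B \<and> B \<subseteq> carrier M \<and> (\<forall>f\<in>carrier M. \<exists>h\<in>sp B. \<forall>j<k. \<phi> f j = \<phi> h j)" for k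
  proof (induction k)
    case 0
    have "sp {} = {\<zero>\<^bsub>M\<^esub>}" by (auto simp: sp_def)
    then show ?case by (intro exI[of _ "{}"]) auto
  next
    case (Suc k)
    then obtain B where B: "finite B" "B \<subseteq> carrier M"
      and red: "\<And>f. f \<in> carrier M \<Longrightarrow> \<exists>h\<in>sp B. \<forall>j<k. \<phi> f j = \<phi> h j" by blast
    show ?case
    proof (cases "\<exists>g\<in>carrier M. \<phi> g k \<noteq> 0 \<and> (\<forall>j<k. \<phi> g j = 0)")
      case True
      then obtain g where g: "g \<in> carrier M" "\<phi> g k \<noteq> 0" "\<forall>j<k. \<phi> g j = 0" by blast
      have "\<exists>h\<in>sp (insert g B). \<forall>j<Suc k. \<phi> f j = \<phi> h j" if f: "f \<in> carrier M" for f
      proof -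
        obtain h where h: "h \<in> sp B" "\<forall>j<k. \<phi> f j = \<phi> h j" using red[OF f] by blast
        let ?d = "(\<phi> f k - \<phi> h k) / \<phi> g k"
        have hM: "h \<in> carrier M" using h(1) sp_closed[OF B(2)] by blast
        have "\<phi> (h \<oplus>\<^bsub>M\<^esub> ?d \<odot>\<^bsub>M\<^esub> g) j = \<phi> f j" if "j < Suc k" for j
          using h g that by (cases "j = k") (auto simp: \<phi>[OF hM g(1)] less_Suc_eq)
        then show ?thesis by (intro bexI[OF _ insert[OF B g(1) h(1), of ?d]]) simp
      qed
      then show ?thesis using B g(1) by (intro exI[of _ "insert g B"]) auto
    next
      case False
      have "\<exists>h\<in>sp B. \<forall>j<Suc k. \<phi> f j = \<phi> h j" if f: "f \<in> carrier M" for f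
      proof -
        obtain h where h: "h \<in> sp B" "\<forall>j<k. \<phi> f j = \<phi> h j" using red[OF f] by blast
        have hM: "h \<in> carrier M" using h(1) sp_closed[OF B(2)] by blast
        have "f \<oplus>\<^bsub>M\<^esub> (- 1) \<odot>\<^bsub>M\<^esub> h \<in> carrier M" using f hM by (auto intro: M.smult_closed)
        then have "\<phi> f k = \<phi> h k" using False h(2) by (auto simp: \<phi>[OF f hM])
        then show ?thesis using h by (auto simp: less_Suc_eq)
      qed
      then show ?thesis using B by blast
    qed
  qed
  from this[of n] obtain B where B: "finite B" "B \<subseteq> carrier M"
    and red: "\<And>f. f \<in> carrier M \<Longrightarrow> \<exists>h\<in>sp B. \<forall>j<n. \<phi> f j = \<phi> h j" by blast
  have "f \<in> sp B" if f: "f \<in> carrier M" for f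
  proof -
    obtain h where h: "h \<in> sp B" "\<forall>j<n. \<phi> f j = \<phi> h j" using red[OF f] by blast
    have hM: "h \<in> carrier M" using h(1) sp_closed[OF B(2)] by blast
    have "\<phi> f = \<phi> h"
    proof
      fix j show "\<phi> f j = \<phi> h j"
        using c f hM h(2) by (cases "j < n") (auto simp: coordinates_def)
    qed
    then show ?thesis using c f hM h(1) unfolding coordinates_def inj_on_def by metis
  qed
  then show ?thesis using B by (auto simp: sp_def)
qed

end

section \<open>The Karoubi envelope of a linear tensor category\<close>

text \<open>When hom sets are disjoint, the side conditions of the category laws can be discharged by rewriting.\<close>

locale typed_category = tensor_category C
  for C :: "('o, 'a, 'k::field) tensor_cat" (structure) +
  fixes src tgt :: "'a \<Rightarrow> 'o"
  assumes src_eq: "\<lbrakk>X \<in> cob C; Y \<in> cob C; f \<in> chom C X Y\<rbrakk> \<Longrightarrow> src f = X"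
    and tgt_eq: "\<lbrakk>X \<in> cob C; Y \<in> cob C; f \<in> chom C X Y\<rbrakk> \<Longrightarrow> tgt f = Y"
begin

section \<open>Rewriting rules for typed arrows\<close>

definition arr :: "'a \<Rightarrow> bool" where
  "arr f \<longleftrightarrow> src f \<in> cob C \<and> tgt f \<in> cob C \<and> f \<in> chom C (src f) (tgt f)"

lemma hom_iff: "X \<in> cob C \<Longrightarrow> Y \<in> cob C \<Longrightarrow> f \<in> chom C X Y \<longleftrightarrow> arr f \<and> src f = X \<and> tgt f = Y"
  using src_eq tgt_eq by (auto simp: arr_def)

lemma arr_ob [simp]: "arr f \<Longrightarrow> src f \<in> cob C" "arr f \<Longrightarrow> tgt f \<in> cob C"
  by (auto simp: arr_def)

lemma arr_homI: "arr f \<Longrightarrow> src f = X \<Longrightarrow> tgt f = Y \<Longrightarrow> f \<in> chom C X Y"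
  by (auto simp: arr_def)

lemma arrI: "f \<in> chom C X Y \<Longrightarrow> X \<in> cob C \<Longrightarrow> Y \<in> cob C \<Longrightarrow> arr f \<and> src f = X \<and> tgt f = Y"
  by (simp add: hom_iff)

lemma arr_id [simp]: assumes "X \<in> cob C"
  shows "arr (cid C X)" "src (cid C X) = X" "tgt (cid C X) = X"
  using arrI[OF id_closed[OF assms]] assms by auto

lemma arr_comp [simp]:
  assumes "arr f" "arr g" "tgt f = src g"
  shows "arr (g \<cdot> f)" "src (g \<cdot> f) = src f" "tgt (g \<cdot> f) = tgt g"
proof -
  have "g \<cdot> f \<in> chom C (src f) (tgt g)"
    using assms by (intro comp_closed[of "src f" "src g" "tgt g"]) (auto simp: arr_homI)
  from arrI[OF this] assms show "arr (g \<cdot> f)" "src (g \<cdot> f) = src f" "tgt (g \<cdot> f) = tgt g" by simp_all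
qed

lemma arr_tensor [simp]:
  assumes "arr f" "arr g"
  shows "arr (f \<otimes>\<^sub>m g)" "src (f \<otimes>\<^sub>m g) = src f \<otimes>\<^sub>o src g" "tgt (f \<otimes>\<^sub>m g) = tgt f \<otimes>\<^sub>o tgt g"
proof -
  have "f \<otimes>\<^sub>m g \<in> chom C (src f \<otimes>\<^sub>o src g) (tgt f \<otimes>\<^sub>o tgt g)"
    using assms by (intro tmor_closed) (auto simp: arr_homI)
  from arrI[OF this] assms
  show "arr (f \<otimes>\<^sub>m g)" "src (f \<otimes>\<^sub>m g) = src f \<otimes>\<^sub>o src g" "tgt (f \<otimes>\<^sub>m g) = tgt f \<otimes>\<^sub>o tgt g"
    by (simp_all add: tob_closed)
qed

lemmas [simp] = tob_closed unit_ob

lemma comp_id_left [simp]: "arr f \<Longrightarrow> tgt f = Y \<Longrightarrow> cid C Y \<cdot> f = f"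
  using id_left[of "src f" "tgt f" f] by (auto simp: arr_homI)

lemma comp_id_right [simp]: "arr f \<Longrightarrow> src f = X \<Longrightarrow> f \<cdot> cid C X = f"
  using id_right[of "src f" "tgt f" f] by (auto simp: arr_homI)

lemma assoc [simp]:
  "arr f \<Longrightarrow> arr g \<Longrightarrow> arr h \<Longrightarrow> tgt f = src g \<Longrightarrow> tgt g = src h \<Longrightarrow> (h \<cdot> g) \<cdot> f = h \<cdot> g \<cdot> f"
  using comp_assoc[of "src f" "tgt f" "tgt g" "tgt h" f g h] by (auto simp: arr_homI)

lemma tensor_comp:
  "\<lbrakk>arr f; arr g; tgt f = src g; arr f'; arr g'; tgt f' = src g'\<rbrakk>
    \<Longrightarrow> (g \<otimes>\<^sub>m g') \<cdot> (f \<otimes>\<^sub>m f') = (g \<cdot> f) \<otimes>\<^sub>m (g' \<cdot> f')"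
  using tmor_comp[of "src f" "tgt f" "tgt g" "src f'" "tgt f'" "tgt g'" f g f' g'] by (auto simp: arr_homI)

text \<open>Rewriting nests composites to the right, so that a law about a composite of two arrows
  also has to be available with a tail \<open>r\<close>. The same holds for the naturality laws
  below.\<close>

lemma tensor_comp_assoc:
  "\<lbrakk>arr f; arr g; tgt f = src g; arr f'; arr g'; tgt f' = src g'; arr r; tgt r = src f \<otimes>\<^sub>o src f'\<rbrakk>
    \<Longrightarrow> (g \<otimes>\<^sub>m g') \<cdot> (f \<otimes>\<^sub>m f') \<cdot> r = ((g \<cdot> f) \<otimes>\<^sub>m (g' \<cdot> f')) \<cdot> r"
  by (simp add: tensor_comp[symmetric])

lemma iso_arr: "is_iso X Y f \<Longrightarrow> X \<in> cob C \<Longrightarrow> Y \<in> cob C \<Longrightarrow> arr f \<and> src f = X \<and> tgt f = Y"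
  by (auto simp: is_iso_def inverse_maps_def hom_iff)

lemma arr_assoc [simp]:
  assumes "X \<in> cob C" "Y \<in> cob C" "Z \<in> cob C"
  shows "arr (cassoc C X Y Z)" "src (cassoc C X Y Z) = (X \<otimes>\<^sub>o Y) \<otimes>\<^sub>o Z"
    "tgt (cassoc C X Y Z) = X \<otimes>\<^sub>o Y \<otimes>\<^sub>o Z"
  using iso_arr[OF assoc_iso[OF assms]] assms by auto

lemma arr_lunit [simp]:
  assumes "X \<in> cob C"
  shows "arr (clunit C X)" "src (clunit C X) = cunit C \<otimes>\<^sub>o X" "tgt (clunit C X) = X"
  using iso_arr[OF lunit_iso[OF assms]] assms by auto

lemma arr_runit [simp]:
  assumes "X \<in> cob C"
  shows "arr (crunit C X)" "src (crunit C X) = X \<otimes>\<^sub>o cunit C" "tgt (crunit C X) = X"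
  using iso_arr[OF runit_iso[OF assms]] assms by auto

lemma arr_braid [simp]:
  assumes "X \<in> cob C" "Y \<in> cob C"
  shows "arr (cbraid C X Y)" "src (cbraid C X Y) = X \<otimes>\<^sub>o Y" "tgt (cbraid C X Y) = Y \<otimes>\<^sub>o X"
  using iso_arr[OF braid_iso[OF assms]] assms by auto

lemma assoc_nat:
  "\<lbrakk>arr f; arr g; arr h; src f = X; src g = Y; src h = Z\<rbrakk> \<Longrightarrow>
    (f \<otimes>\<^sub>m g \<otimes>\<^sub>m h) \<cdot> cassoc C X Y Z = cassoc C (tgt f) (tgt g) (tgt h) \<cdot> ((f \<otimes>\<^sub>m g) \<otimes>\<^sub>m h)"
  using assoc_natural[of "src f" "src g" "src h" "tgt f" "tgt g" "tgt h" f g h] by (auto simp: arr_homI)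

lemma assoc_nat_assoc:
  assumes "arr f" "arr g" "arr h" "src f = X" "src g = Y" "src h = Z" "arr r" "tgt r = (X \<otimes>\<^sub>o Y) \<otimes>\<^sub>o Z"
  shows "(f \<otimes>\<^sub>m g \<otimes>\<^sub>m h) \<cdot> cassoc C X Y Z \<cdot> r =
    cassoc C (tgt f) (tgt g) (tgt h) \<cdot> ((f \<otimes>\<^sub>m g) \<otimes>\<^sub>m h) \<cdot> r"
proof -
  have "((f \<otimes>\<^sub>m g \<otimes>\<^sub>m h) \<cdot> cassoc C X Y Z) \<cdot> r =
      (cassoc C (tgt f) (tgt g) (tgt h) \<cdot> ((f \<otimes>\<^sub>m g) \<otimes>\<^sub>m h)) \<cdot> r"
    using assms by (subst assoc_nat) auto
  moreover have "X \<in> cob C" "Y \<in> cob C" "Z \<in> cob C" using assms by auto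
  ultimately show ?thesis using assms by simp
qed

lemma lunit_nat: "arr f \<Longrightarrow> src f = X \<Longrightarrow>
    f \<cdot> clunit C X = clunit C (tgt f) \<cdot> (cid C (cunit C) \<otimes>\<^sub>m f)"
  using lunit_natural[of "src f" "tgt f" f] by (auto simp: arr_homI)

lemma runit_nat: "arr f \<Longrightarrow> src f = X \<Longrightarrow>
    f \<cdot> crunit C X = crunit C (tgt f) \<cdot> (f \<otimes>\<^sub>m cid C (cunit C))"
  using runit_natural[of "src f" "tgt f" f] by (auto simp: arr_homI)

lemma braid_nat: "\<lbrakk>arr f; arr g; src f = X; src g = Y\<rbrakk> \<Longrightarrow>
    (g \<otimes>\<^sub>m f) \<cdot> cbraid C X Y = cbraid C (tgt f) (tgt g) \<cdot> (f \<otimes>\<^sub>m g)"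
  using braid_natural[of "src f" "src g" "tgt f" "tgt g" f g] by (auto simp: arr_homI)

lemma braid_nat_assoc:
  assumes "arr f" "arr g" "src f = X" "src g = Y" "arr r" "tgt r = X \<otimes>\<^sub>o Y"
  shows "(g \<otimes>\<^sub>m f) \<cdot> cbraid C X Y \<cdot> r = cbraid C (tgt f) (tgt g) \<cdot> (f \<otimes>\<^sub>m g) \<cdot> r"
proof -
  have "((g \<otimes>\<^sub>m f) \<cdot> cbraid C X Y) \<cdot> r = (cbraid C (tgt f) (tgt g) \<cdot> (f \<otimes>\<^sub>m g)) \<cdot> r"
    using assms by (subst braid_nat) auto
  moreover have "X \<in> cob C" "Y \<in> cob C" using assms by auto
  ultimately show ?thesis using assms by simp
qed

lemma hom_mod: "X \<in> cob C \<Longrightarrow> Y \<in> cob C \<Longrightarrow> module field_ring (cHom C X Y)"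
  by (rule hom_module)

lemma arr_zero [simp]:
  assumes "X \<in> cob C" "Y \<in> cob C"
  shows "arr \<zero>\<^bsub>cHom C X Y\<^esub>" "src \<zero>\<^bsub>cHom C X Y\<^esub> = X" "tgt \<zero>\<^bsub>cHom C X Y\<^esub> = Y"
  using arrI[OF fmod_closed(4)[OF hom_mod[OF assms]] assms] by auto

lemma arr_add [simp]:
  assumes "arr f" "arr g" "src f = X" "src g = X" "tgt f = Y" "tgt g = Y"
  shows "arr (f \<oplus>\<^bsub>cHom C X Y\<^esub> g)" "src (f \<oplus>\<^bsub>cHom C X Y\<^esub> g) = X" "tgt (f \<oplus>\<^bsub>cHom C X Y\<^esub> g) = Y"
proof -
  have XY: "X \<in> cob C" "Y \<in> cob C" using assms by auto
  show "arr (f \<oplus>\<^bsub>cHom C X Y\<^esub> g)" "src (f \<oplus>\<^bsub>cHom C X Y\<^esub> g) = X" "tgt (f \<oplus>\<^bsub>cHom C X Y\<^esub> g) = Y"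
    using arrI[OF fmod_closed(1)[OF hom_mod[OF XY], of f g] XY] assms XY by (auto simp: hom_iff)
qed

lemma arr_minus [simp]:
  assumes "arr f" "arr g" "src f = X" "src g = X" "tgt f = Y" "tgt g = Y"
  shows "arr (f \<ominus>\<^bsub>cHom C X Y\<^esub> g)" "src (f \<ominus>\<^bsub>cHom C X Y\<^esub> g) = X" "tgt (f \<ominus>\<^bsub>cHom C X Y\<^esub> g) = Y"
proof -
  have XY: "X \<in> cob C" "Y \<in> cob C" using assms by auto
  show "arr (f \<ominus>\<^bsub>cHom C X Y\<^esub> g)" "src (f \<ominus>\<^bsub>cHom C X Y\<^esub> g) = X" "tgt (f \<ominus>\<^bsub>cHom C X Y\<^esub> g) = Y"
    using arrI[OF fmod_closed(2)[OF hom_mod[OF XY], of f g] XY] assms XY by (auto simp: hom_iff)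
qed

lemma arr_smult [simp]:
  assumes "arr f" "src f = X" "tgt f = Y"
  shows "arr (c \<odot>\<^bsub>cHom C X Y\<^esub> f)" "src (c \<odot>\<^bsub>cHom C X Y\<^esub> f) = X" "tgt (c \<odot>\<^bsub>cHom C X Y\<^esub> f) = Y"
proof -
  have XY: "X \<in> cob C" "Y \<in> cob C" using assms by auto
  show "arr (c \<odot>\<^bsub>cHom C X Y\<^esub> f)" "src (c \<odot>\<^bsub>cHom C X Y\<^esub> f) = X" "tgt (c \<odot>\<^bsub>cHom C X Y\<^esub> f) = Y"
    using arrI[OF fmod_closed(3)[OF hom_mod[OF XY], of f c] XY] assms XY by (auto simp: hom_iff)
qed

lemma comp_add_l [simp]:
  assumes "arr f" "arr g" "arr g'" "tgt f = Y" "src g = Y" "src g' = Y" "tgt g = Z" "tgt g' = Z"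
  shows "(g \<oplus>\<^bsub>cHom C Y Z\<^esub> g') \<cdot> f = (g \<cdot> f) \<oplus>\<^bsub>cHom C (src f) Z\<^esub> (g' \<cdot> f)"
  using comp_add_left[of "src f" Y Z f g g'] assms by (auto simp: hom_iff)

lemma comp_add_r [simp]:
  assumes "arr f" "arr f'" "arr g" "src f = X" "src f' = X" "tgt f = Y" "tgt f' = Y" "src g = Y"
  shows "g \<cdot> (f \<oplus>\<^bsub>cHom C X Y\<^esub> f') = (g \<cdot> f) \<oplus>\<^bsub>cHom C X (tgt g)\<^esub> (g \<cdot> f')"
  using comp_add_right[of X Y "tgt g" f f' g] assms by (auto simp: hom_iff)

lemma comp_smult_l [simp]:
  assumes "arr f" "arr g" "tgt f = Y" "src g = Y" "tgt g = Z"
  shows "(c \<odot>\<^bsub>cHom C Y Z\<^esub> g) \<cdot> f = c \<odot>\<^bsub>cHom C (src f) Z\<^esub> (g \<cdot> f)"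
  using comp_smult_left[of "src f" Y Z f g c] assms by (auto simp: hom_iff)

lemma comp_smult_r [simp]:
  assumes "arr f" "arr g" "src f = X" "tgt f = Y" "src g = Y"
  shows "g \<cdot> (c \<odot>\<^bsub>cHom C X Y\<^esub> f) = c \<odot>\<^bsub>cHom C X (tgt g)\<^esub> (g \<cdot> f)"
  using comp_smult_right[of X Y "tgt g" f g c] assms by (auto simp: hom_iff)

lemma minus_eq:
  assumes "arr f" "arr g" "src f = X" "src g = X" "tgt f = Y" "tgt g = Y"
  shows "f \<ominus>\<^bsub>cHom C X Y\<^esub> g = f \<oplus>\<^bsub>cHom C X Y\<^esub> (- 1) \<odot>\<^bsub>cHom C X Y\<^esub> g"
proof -
  have XY: "X \<in> cob C" "Y \<in> cob C" using assms by auto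
  show ?thesis using fmod_minus[OF hom_mod[OF XY], of f g] assms XY by (auto simp: hom_iff)
qed

lemma comp_minus_l [simp]:
  assumes "arr f" "arr g" "arr g'" "tgt f = Y" "src g = Y" "src g' = Y" "tgt g = Z" "tgt g' = Z"
  shows "(g \<ominus>\<^bsub>cHom C Y Z\<^esub> g') \<cdot> f = (g \<cdot> f) \<ominus>\<^bsub>cHom C (src f) Z\<^esub> (g' \<cdot> f)"
  using assms by (simp add: minus_eq)

lemma comp_minus_r [simp]:
  assumes "arr f" "arr f'" "arr g" "src f = X" "src f' = X" "tgt f = Y" "tgt f' = Y" "src g = Y"
  shows "g \<cdot> (f \<ominus>\<^bsub>cHom C X Y\<^esub> f') = (g \<cdot> f) \<ominus>\<^bsub>cHom C X (tgt g)\<^esub> (g \<cdot> f')"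
  using assms by (simp add: minus_eq)

text \<open>The axioms of composition speak of sums and scalar multiples only; in this form a zero
  arrow is carried through a composite by them.\<close>

lemma zero_eq_smult: "X \<in> cob C \<Longrightarrow> Y \<in> cob C \<Longrightarrow> \<zero>\<^bsub>cHom C X Y\<^esub> = 0 \<odot>\<^bsub>cHom C X Y\<^esub> \<zero>\<^bsub>cHom C X Y\<^esub>"
  using fmod_zero_smult[OF hom_mod] fmod_closed(4)[OF hom_mod] by metis

lemma zero_smult: "arr f \<Longrightarrow> src f = X \<Longrightarrow> tgt f = Y \<Longrightarrow> 0 \<odot>\<^bsub>cHom C X Y\<^esub> f = \<zero>\<^bsub>cHom C X Y\<^esub>"
  using fmod_zero_smult[OF hom_mod, of X Y f] by (auto simp: hom_iff)

lemma comp_zero_l [simp]: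
  assumes "arr f" "tgt f = Y" "Z \<in> cob C"
  shows "\<zero>\<^bsub>cHom C Y Z\<^esub> \<cdot> f = \<zero>\<^bsub>cHom C (src f) Z\<^esub>"
proof -
  have "Y \<in> cob C" using assms by auto
  then have "\<zero>\<^bsub>cHom C Y Z\<^esub> \<cdot> f = (0 \<odot>\<^bsub>cHom C Y Z\<^esub> \<zero>\<^bsub>cHom C Y Z\<^esub>) \<cdot> f"
    using assms by (simp only: zero_eq_smult[symmetric])
  also have "\<dots> = 0 \<odot>\<^bsub>cHom C (src f) Z\<^esub> (\<zero>\<^bsub>cHom C Y Z\<^esub> \<cdot> f)"
    using assms \<open>Y \<in> cob C\<close> by (intro comp_smult_l) simp_all
  also have "\<dots> = \<zero>\<^bsub>cHom C (src f) Z\<^esub>" using assms \<open>Y \<in> cob C\<close> by (intro zero_smult) simp_all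
  finally show ?thesis .
qed

lemma comp_zero_r [simp]:
  assumes "arr g" "src g = Y" "X \<in> cob C"
  shows "g \<cdot> \<zero>\<^bsub>cHom C X Y\<^esub> = \<zero>\<^bsub>cHom C X (tgt g)\<^esub>"
proof -
  have "Y \<in> cob C" using assms by auto
  then have "g \<cdot> \<zero>\<^bsub>cHom C X Y\<^esub> = g \<cdot> (0 \<odot>\<^bsub>cHom C X Y\<^esub> \<zero>\<^bsub>cHom C X Y\<^esub>)"
    using assms by (simp only: zero_eq_smult[symmetric])
  also have "\<dots> = 0 \<odot>\<^bsub>cHom C X (tgt g)\<^esub> (g \<cdot> \<zero>\<^bsub>cHom C X Y\<^esub>)"
    using assms \<open>Y \<in> cob C\<close> by (intro comp_smult_r) simp_all
  also have "\<dots> = \<zero>\<^bsub>cHom C X (tgt g)\<^esub>" using assms \<open>Y \<in> cob C\<close> by (intro zero_smult) simp_all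
  finally show ?thesis .
qed

lemma minus_self [simp]: "\<lbrakk>arr f; src f = X; tgt f = Y\<rbrakk> \<Longrightarrow> f \<ominus>\<^bsub>cHom C X Y\<^esub> f = \<zero>\<^bsub>cHom C X Y\<^esub>"
  using fmod_minus_eq_zero[OF hom_mod, of X Y f f] by (auto simp: hom_iff)

lemma minus_eq_zero_iff:
  assumes "arr f" "arr g" "src f = X" "src g = X" "tgt f = Y" "tgt g = Y"
  shows "f \<ominus>\<^bsub>cHom C X Y\<^esub> g = \<zero>\<^bsub>cHom C X Y\<^esub> \<longleftrightarrow> f = g"
  using fmod_minus_eq_zero[OF hom_mod, of X Y f g] assms by (auto simp: hom_iff)

lemma minus_zero [simp]: "\<lbrakk>arr f; src f = X; tgt f = Y\<rbrakk> \<Longrightarrow> f \<ominus>\<^bsub>cHom C X Y\<^esub> \<zero>\<^bsub>cHom C X Y\<^esub> = f"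
  using fmod_minus_zero[OF hom_mod, of X Y f] by (auto simp: hom_iff)

lemma add_minus [simp]:
  assumes "arr f" "arr g" "src f = X" "src g = X" "tgt f = Y" "tgt g = Y"
  shows "g \<oplus>\<^bsub>cHom C X Y\<^esub> (f \<ominus>\<^bsub>cHom C X Y\<^esub> g) = f"
  using fmod_minus_add[OF hom_mod, of X Y f g] assms by (auto simp: hom_iff)

lemma arr_finsum:
  assumes "finite A" "\<And>j. j \<in> A \<Longrightarrow> arr (f j) \<and> src (f j) = X \<and> tgt (f j) = Y"
    and XY: "X \<in> cob C" "Y \<in> cob C"
  shows "arr (finsum (cHom C X Y) f A)" "src (finsum (cHom C X Y) f A) = X"
    "tgt (finsum (cHom C X Y) f A) = Y"
proof -
  interpret M: module field_ring "cHom C X Y" using XY by (rule hom_mod)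
  have "f \<in> A \<rightarrow> chom C X Y" using assms by (simp add: hom_iff)
  from arrI[OF M.finsum_closed[OF this] XY]
  show "arr (finsum (cHom C X Y) f A)" "src (finsum (cHom C X Y) f A) = X"
    "tgt (finsum (cHom C X Y) f A) = Y" by auto
qed

lemma comp_finsum_r:
  assumes A: "finite A" "\<And>j. j \<in> A \<Longrightarrow> arr (f j) \<and> src (f j) = X \<and> tgt (f j) = Y"
    and g: "arr g" "src g = Y" "tgt g = Z" and X: "X \<in> cob C"
  shows "g \<cdot> finsum (cHom C X Y) f A = finsum (cHom C X Z) (\<lambda>j. g \<cdot> f j) A"
proof -
  have YZ: "Y \<in> cob C" "Z \<in> cob C" using arr_ob[OF g(1)] g by simp_all
  interpret M: module field_ring "cHom C X Y" using X YZ by (intro hom_mod)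
  interpret N: module field_ring "cHom C X Z" using X YZ by (intro hom_mod)
  show ?thesis
    by (rule finsum_hom[OF M.abelian_monoid_axioms N.abelian_monoid_axioms A(1)])
      (use A g X YZ in \<open>auto simp: hom_iff\<close>)
qed

lemma comp_finsum_l:
  assumes A: "finite A" "\<And>j. j \<in> A \<Longrightarrow> arr (f j) \<and> src (f j) = X \<and> tgt (f j) = Y"
    and g: "arr g" "src g = W" "tgt g = X" and Y: "Y \<in> cob C"
  shows "finsum (cHom C X Y) f A \<cdot> g = finsum (cHom C W Y) (\<lambda>j. f j \<cdot> g) A"
proof -
  have XW: "X \<in> cob C" "W \<in> cob C" using arr_ob[OF g(1)] g by simp_all
  interpret M: module field_ring "cHom C X Y" using Y XW by (intro hom_mod)
  interpret N: module field_ring "cHom C W Y" using Y XW by (intro hom_mod)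
  show ?thesis
    by (rule finsum_hom[OF M.abelian_monoid_axioms N.abelian_monoid_axioms A(1), of _ "\<lambda>f. f \<cdot> g"])
      (use A g Y XW in \<open>auto simp: hom_iff\<close>)
qed

section \<open>Objects, hom spaces and biproducts of the envelope\<close>

abbreviation "K \<equiv> karoubi C"

definition idem :: "'o \<Rightarrow> 'a \<Rightarrow> bool" where
  "idem X e \<longleftrightarrow> X \<in> cob C \<and> arr e \<and> src e = X \<and> tgt e = X \<and> e \<cdot> e = e"

lemma absorb_l [simp]:
  "f \<cdot> a = a \<Longrightarrow> arr f \<Longrightarrow> arr a \<Longrightarrow> arr r \<Longrightarrow> tgt a = src f \<Longrightarrow> tgt r = src a \<Longrightarrow> f \<cdot> a \<cdot> r = a \<cdot> r"
  using assoc[of r a f] by simp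

lemma absorb_r [simp]:
  "a \<cdot> e = a \<Longrightarrow> arr e \<Longrightarrow> arr a \<Longrightarrow> arr r \<Longrightarrow> tgt e = src a \<Longrightarrow> tgt r = src e \<Longrightarrow> a \<cdot> e \<cdot> r = a \<cdot> r"
  using assoc[of r e a] by simp

lemma K_simps [simp]:
  "ccomp K = ccomp C" "tmor K = tmor C" "cid K (X, e) = e"
  "tob K (X, e) (Y, f) = (X \<otimes>\<^sub>o Y, e \<otimes>\<^sub>m f)"
  "cunit K = (cunit C, cid C (cunit C))"
  "cassoc K (X, e) (Y, f) (Z, g) = cassoc C X Y Z \<cdot> ((e \<otimes>\<^sub>m f) \<otimes>\<^sub>m g)"
  "clunit K (X, e) = clunit C X \<cdot> (cid C (cunit C) \<otimes>\<^sub>m e)"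
  "crunit K (X, e) = crunit C X \<cdot> (e \<otimes>\<^sub>m cid C (cunit C))"
  "cbraid K (X, e) (Y, f) = cbraid C X Y \<cdot> (e \<otimes>\<^sub>m f)"
  "a \<oplus>\<^bsub>cHom K (X, e) (Y, f)\<^esub> b = a \<oplus>\<^bsub>cHom C X Y\<^esub> b"
  "\<zero>\<^bsub>cHom K (X, e) (Y, f)\<^esub> = \<zero>\<^bsub>cHom C X Y\<^esub>"
  "c \<odot>\<^bsub>cHom K (X, e) (Y, f)\<^esub> a = c \<odot>\<^bsub>cHom C X Y\<^esub> a"
  by (simp_all add: karoubi_def)

lemma K_ob: "(X, e) \<in> cob K \<longleftrightarrow> idem X e"
  by (auto simp: karoubi_def idem_def hom_iff)

text \<open>The single condition \<open>f a e = a\<close> is equivalent to two absorption laws,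
  since \<open>e\<close> and \<open>f\<close> are idempotent. The separate laws are usable as
  rewrite rules.\<close>

lemma K_hom: "idem X e \<Longrightarrow> idem Y f \<Longrightarrow>
    a \<in> chom K (X, e) (Y, f) \<longleftrightarrow> arr a \<and> src a = X \<and> tgt a = Y \<and> f \<cdot> a = a \<and> a \<cdot> e = a"
proof -
  assume "idem X e" "idem Y f"
  then have i: "X \<in> cob C" "Y \<in> cob C" "arr e" "arr f" "src e = X" "tgt e = X" "src f = Y" "tgt f = Y"
    "e \<cdot> e = e" "f \<cdot> f = f" by (auto simp: idem_def)
  have "f \<cdot> a = a \<and> a \<cdot> e = a" if a: "arr a" "src a = X" "tgt a = Y" "f \<cdot> a \<cdot> e = a"
  proof -
    have "f \<cdot> (f \<cdot> a \<cdot> e) = f \<cdot> a \<cdot> e" "(f \<cdot> a \<cdot> e) \<cdot> e = f \<cdot> a \<cdot> e" using a(1-3) i by simp_all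
    then show ?thesis by (simp only: a(4))
  qed
  then show ?thesis using i by (auto simp: karoubi_def hom_iff)
qed

lemma K_mod:
  assumes "idem X e" "idem Y f" shows "module field_ring (cHom K (X, e) (Y, f))"
proof -
  have i: "X \<in> cob C" "Y \<in> cob C" "arr e" "arr f" "src e = X" "tgt e = X" "src f = Y" "tgt f = Y"
    using assms by (auto simp: idem_def)
  interpret M: module field_ring "cHom C X Y" using i by (intro hom_mod)
  have H: "cHom K (X, e) (Y, f) = (cHom C X Y)\<lparr>carrier := chom K (X, e) (Y, f)\<rparr>"
    by (simp add: karoubi_def)
  have "submodule (chom K (X, e) (Y, f)) field_ring (cHom C X Y)"
  proof (rule M.submoduleI)
    show "chom K (X, e) (Y, f) \<subseteq> chom C X Y" by (auto simp: karoubi_def)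
    show "\<zero>\<^bsub>cHom C X Y\<^esub> \<in> chom K (X, e) (Y, f)" using i assms by (simp add: K_hom)
    fix a assume a: "a \<in> chom K (X, e) (Y, f)"
    then have "a \<in> chom C X Y" by (auto simp: karoubi_def)
    then show "\<ominus>\<^bsub>cHom C X Y\<^esub> a \<in> chom K (X, e) (Y, f)"
      using a i assms by (simp add: K_hom fmod_uminus[OF hom_mod])
  qed (use i assms in \<open>auto simp: K_hom\<close>)
  then show ?thesis
    by (subst H) (rule submodule.submodule_is_module, auto intro: M.module_axioms hom_mod i)
qed

lemma karoubi_linear: "linear_category K"
proof (intro linear_category.intro, goal_cases)
  case (1 P Q)
  then show ?case by (cases P; cases Q) (auto simp: K_ob K_mod)
next
  case (2 P)
  then show ?case by (cases P) (auto simp: K_ob K_hom, auto simp: idem_def)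
next
  case (3 P Q S f g)
  then show ?case by (cases P; cases Q; cases S) (auto simp: K_ob K_hom, auto simp: idem_def)
next
  case (4 P Q f)
  then show ?case by (cases P; cases Q) (auto simp: K_ob K_hom)
next
  case (5 P Q f)
  then show ?case by (cases P; cases Q) (auto simp: K_ob K_hom)
next
  case (6 P Q S T f g h)
  then show ?case by (cases P; cases Q; cases S; cases T) (auto simp: K_ob K_hom)
next
  case (7 P Q S f g h)
  then show ?case by (cases P; cases Q; cases S) (auto simp: K_ob K_hom)
next
  case (8 P Q S f g h)
  then show ?case by (cases P; cases Q; cases S) (auto simp: K_ob K_hom)
next
  case (9 P Q S f g c)
  then show ?case by (cases P; cases Q; cases S) (auto simp: K_ob K_hom)
next
  case (10 P Q S f g c)
  then show ?case by (cases P; cases Q; cases S) (auto simp: K_ob K_hom)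
qed

lemma K_finsum:
  assumes "idem X e" "idem Y f" "finite A" "g \<in> A \<rightarrow> chom K (X, e) (Y, f)"
  shows "finsum (cHom K (X, e) (Y, f)) g A = finsum (cHom C X Y) g A"
proof -
  have i: "X \<in> cob C" "Y \<in> cob C" using assms by (auto simp: idem_def)
  interpret M: module field_ring "cHom C X Y" using i by (intro hom_mod)
  interpret N: module field_ring "cHom K (X, e) (Y, f)" using assms by (intro K_mod)
  have H: "cHom K (X, e) (Y, f) = (cHom C X Y)\<lparr>carrier := chom K (X, e) (Y, f)\<rparr>"
    by (simp add: karoubi_def)
  have sub: "chom K (X, e) (Y, f) \<subseteq> chom C X Y" by (auto simp: karoubi_def)
  show ?thesis using N.abelian_monoid_axioms
    by (subst H, subst (asm) H) (rule finsum_carrier_update[OF M.abelian_monoid_axioms _ sub assms(3,4)])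
qed

text \<open>The biproduct \<open>Y\<close> of the underlying objects is cut down by the idempotent
  \<open>E\<close>, the sum of the \<open>i j \<cdot> es ! j \<cdot> p j\<close>. The new injections
  and projections are the old ones composed with the \<open>es ! j\<close>.\<close>

lemma K_direct_sums:
  assumes Ps: "set Ps \<subseteq> cob K" shows "\<exists>Q. cat_data.direct_sum K Ps Q"
proof -
  define Xs es n where "Xs = map fst Ps" and "es = map snd Ps" and "n = length Ps"
  have P: "Ps ! j = (Xs ! j, es ! j)" if "j < n" for j using that by (simp add: Xs_def es_def n_def)
  have idem: "idem (Xs ! j) (es ! j)" if "j < n" for j
    using Ps P[OF that] that by (metis K_ob n_def nth_mem subsetD)
  have "set Xs \<subseteq> cob C" using Ps by (auto simp: Xs_def karoubi_def)
  then obtain Y where DS: "direct_sum Xs Y" using direct_sums_exist by blast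
  have len: "length Xs = n" by (simp add: Xs_def n_def)
  from DS obtain i p where Y: "Y \<in> cob C"
    and ip: "\<And>j. j < n \<Longrightarrow> i j \<in> chom C (Xs ! j) Y \<and> p j \<in> chom C Y (Xs ! j)"
    and orth: "\<And>j l. j < n \<Longrightarrow> l < n \<Longrightarrow>
      p j \<cdot> i l = (if j = l then cid C (Xs ! j) else \<zero>\<^bsub>cHom C (Xs ! l) (Xs ! j)\<^esub>)"
    and total: "finsum (cHom C Y Y) (\<lambda>j. i j \<cdot> p j) {..<n} = cid C Y"
    unfolding direct_sum_def len by blast
  have e: "Xs ! j \<in> cob C" "arr (es ! j)" "src (es ! j) = Xs ! j" "tgt (es ! j) = Xs ! j"
    "es ! j \<cdot> es ! j = es ! j" if "j < n" for j
    using idem[OF that] by (auto simp: idem_def)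
  have t: "arr (i j)" "src (i j) = Xs ! j" "tgt (i j) = Y" "arr (p j)" "src (p j) = Y" "tgt (p j) = Xs ! j"
    if "j < n" for j using ip[OF that] e(1)[OF that] Y by (auto simp: hom_iff)
  note te = t e
  define E where "E = finsum (cHom C Y Y) (\<lambda>j. i j \<cdot> es ! j \<cdot> p j) {..<n}"
  have E: "arr E" "src E = Y" "tgt E = Y"
    unfolding E_def by (rule arr_finsum; use te Y in simp)+
  \<comment> \<open>\<open>E\<close> acts on the \<open>l\<close>-th summand as
    \<open>es ! l\<close>. This single fact gives both the idempotence of \<open>E\<close> and the
    absorption laws for the injections.\<close>
  have Ei: "E \<cdot> i l = i l \<cdot> es ! l" if l: "l < n" for l
  proof -
    interpret M: module field_ring "cHom C (Xs ! l) Y" using te l Y by (intro hom_mod)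
    have "E \<cdot> i l = finsum (cHom C (Xs ! l) Y) (\<lambda>j. (i j \<cdot> es ! j \<cdot> p j) \<cdot> i l) {..<n}"
      unfolding E_def by (rule comp_finsum_l) (use te l Y in auto)
    also have "\<dots> = finsum (cHom C (Xs ! l) Y)
        (\<lambda>j. if l = j then i j \<cdot> es ! j else \<zero>\<^bsub>cHom C (Xs ! l) Y\<^esub>) {..<n}"
      by (rule M.finsum_cong') (use te l Y orth in \<open>auto simp: hom_iff\<close>)
    also have "\<dots> = i l \<cdot> es ! l"
      using M.finsum_singleton[of l "{..<n}" "\<lambda>j. if l = j then i j \<cdot> es ! j else \<zero>\<^bsub>cHom C (Xs ! l) Y\<^esub>"] te l Y
      by (simp add: hom_iff Pi_def cong: if_cong)
    finally show ?thesis .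
  qed
  have pE: "p l \<cdot> E = es ! l \<cdot> p l" if l: "l < n" for l
  proof -
    interpret M: module field_ring "cHom C Y (Xs ! l)" using te l Y by (intro hom_mod)
    have "p l \<cdot> E = finsum (cHom C Y (Xs ! l)) (\<lambda>j. p l \<cdot> i j \<cdot> es ! j \<cdot> p j) {..<n}"
      unfolding E_def by (rule comp_finsum_r) (use te l Y in auto)
    also have "\<dots> = finsum (cHom C Y (Xs ! l))
        (\<lambda>j. if l = j then es ! j \<cdot> p j else \<zero>\<^bsub>cHom C Y (Xs ! l)\<^esub>) {..<n}"
    proof (rule M.finsum_cong')
      fix j assume j: "j \<in> {..<n}"
      have "p l \<cdot> i j \<cdot> es ! j \<cdot> p j = (p l \<cdot> i j) \<cdot> es ! j \<cdot> p j" using te l j by simp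
      also have "\<dots> = (if l = j then es ! j \<cdot> p j else \<zero>\<^bsub>cHom C Y (Xs ! l)\<^esub>)"
        using te l j Y by (simp add: orth)
      finally show "p l \<cdot> i j \<cdot> es ! j \<cdot> p j = (if l = j then es ! j \<cdot> p j else \<zero>\<^bsub>cHom C Y (Xs ! l)\<^esub>)" .
    qed (use te l Y in \<open>auto simp: hom_iff\<close>)
    also have "\<dots> = es ! l \<cdot> p l"
      using M.finsum_singleton[of l "{..<n}" "\<lambda>j. if l = j then es ! j \<cdot> p j else \<zero>\<^bsub>cHom C Y (Xs ! l)\<^esub>"] te l Y
      by (simp add: hom_iff Pi_def cong: if_cong)
    finally show ?thesis .
  qed
  have "E \<cdot> finsum (cHom C Y Y) (\<lambda>j. i j \<cdot> es ! j \<cdot> p j) {..<n} =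
      finsum (cHom C Y Y) (\<lambda>j. E \<cdot> i j \<cdot> es ! j \<cdot> p j) {..<n}"
    by (rule comp_finsum_r) (use te Y E in auto)
  also have "\<dots> = finsum (cHom C Y Y) (\<lambda>j. i j \<cdot> es ! j \<cdot> p j) {..<n}"
  proof -
    interpret M: module field_ring "cHom C Y Y" using Y by (intro hom_mod)
    show ?thesis
    proof (rule M.finsum_cong')
      fix j assume j: "j \<in> {..<n}"
      have "E \<cdot> i j \<cdot> es ! j \<cdot> p j = (E \<cdot> i j) \<cdot> es ! j \<cdot> p j" using te E j by simp
      then show "E \<cdot> i j \<cdot> es ! j \<cdot> p j = i j \<cdot> es ! j \<cdot> p j" using te E j by (simp add: Ei)
    qed (use te Y in \<open>auto simp: hom_iff\<close>)
  qed
  finally have "E \<cdot> E = E" by (simp only: E_def[symmetric])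
  then have idE: "idem Y E" using E Y by (simp add: idem_def)
  have iH: "i j \<cdot> es ! j \<in> chom K (Ps ! j) (Y, E)" if j: "j < n" for j
  proof -
    have "E \<cdot> i j \<cdot> es ! j = (E \<cdot> i j) \<cdot> es ! j" using te E j by simp
    also have "\<dots> = i j \<cdot> es ! j" using te j by (simp add: Ei)
    finally show ?thesis unfolding P[OF j] using te j by (simp add: K_hom[OF idem[OF j] idE])
  qed
  have pH: "es ! j \<cdot> p j \<in> chom K (Y, E) (Ps ! j)" if j: "j < n" for j
    unfolding P[OF j] using te j E by (simp add: K_hom[OF idE idem[OF j]] pE)
  have tot: "finsum (cHom K (Y, E) (Y, E)) (\<lambda>j. (i j \<cdot> es ! j) \<cdot> es ! j \<cdot> p j) {..<n} = E"
  proof -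
    interpret M: module field_ring "cHom C Y Y" using Y by (intro hom_mod)
    interpret N: linear_category K by (rule karoubi_linear)
    have "(i j \<cdot> es ! j) \<cdot>\<^bsub>K\<^esub> (es ! j \<cdot> p j) \<in> chom K (Y, E) (Y, E)" if "j < n" for j
      using that idE Ps by (intro N.comp_closed[OF _ _ _ pH iH]) (auto simp: K_ob n_def)
    then have "(\<lambda>j. (i j \<cdot> es ! j) \<cdot> es ! j \<cdot> p j) \<in> {..<n} \<rightarrow> chom K (Y, E) (Y, E)" by simp
    then have "finsum (cHom K (Y, E) (Y, E)) (\<lambda>j. (i j \<cdot> es ! j) \<cdot> es ! j \<cdot> p j) {..<n} =
      finsum (cHom C Y Y) (\<lambda>j. (i j \<cdot> es ! j) \<cdot> es ! j \<cdot> p j) {..<n}"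
      by (rule K_finsum[OF idE idE finite_lessThan])
    also have "\<dots> = E" unfolding E_def
      by (rule M.finsum_cong') (use te Y in \<open>auto simp: hom_iff\<close>)
    finally show ?thesis .
  qed
  have orthK: "(es ! j \<cdot> p j) \<cdot> i l \<cdot> es ! l =
      (if j = l then cid K (Ps ! j) else \<zero>\<^bsub>cHom K (Ps ! l) (Ps ! j)\<^esub>)" if jl: "j < n" "l < n" for j l
  proof -
    have "(es ! j \<cdot> p j) \<cdot> i l \<cdot> es ! l = es ! j \<cdot> (p j \<cdot> i l) \<cdot> es ! l" using te jl by simp
    then show ?thesis using te jl by (simp add: orth P)
  qed
  show ?thesis
    unfolding cat_data.direct_sum_def
    using idE Ps iH pH orthK tot
    by (intro exI[of _ "(Y, E)"] conjI exI[of _ "\<lambda>j. i j \<cdot> es ! j"] exI[of _ "\<lambda>j. es ! j \<cdot> p j"])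
       (auto simp: K_ob n_def)
qed

lemma karoubi_additive: "additive_category K"
  by (intro additive_category.intro karoubi_linear additive_category_axioms.intro K_direct_sums)

section \<open>Tensor structure of the envelope\<close>

lemma K_inverse:
  assumes inverse: "inverse_maps S T a b" and E: "idem S E" and E': "idem T E'" and nat: "E' \<cdot> a = a \<cdot> E"
  shows "cat_data.inverse_maps K (S, E) (T, E') (a \<cdot> E) (E \<cdot> b)"
proof -
  have ob: "S \<in> cob C" "T \<in> cob C" using E E' by (auto simp: idem_def)
  have "a \<in> chom C S T" "b \<in> chom C T S" "b \<cdot> a = cid C S" "a \<cdot> b = cid C T"
    using inverse by (auto simp: inverse_maps_def)
  then have ab: "arr a" "src a = S" "tgt a = T" "arr b" "src b = T" "tgt b = S"
    and inv: "b \<cdot> a = cid C S" "a \<cdot> b = cid C T" using ob by (auto simp: hom_iff)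
  have ie: "arr E" "src E = S" "tgt E = S" "E \<cdot> E = E" "arr E'" "src E' = T" "tgt E' = T" "E' \<cdot> E' = E'"
    using E E' by (auto simp: idem_def)
  have ba: "b \<cdot> a \<cdot> r = r" if "arr r" "tgt r = S" for r
    using assoc[of r a b] ab that inv(1) by simp
  have na: "E' \<cdot> a \<cdot> r = a \<cdot> E \<cdot> r" if "arr r" "tgt r = S" for r
    using assoc[of r a E'] assoc[of r E a] ab that ie nat by simp
  \<comment> \<open>The intertwining law \<open>nat\<close> passes from \<open>a\<close> to its
    inverse, so that \<open>b\<close> is compatible with the idempotents as well.\<close>
  have bE: "b \<cdot> E' = E \<cdot> b"
  proof -
    have "b \<cdot> E' = b \<cdot> E' \<cdot> a \<cdot> b" using ab ie inv by simp
    also have "\<dots> = E \<cdot> b" using ab ie by (simp add: na ba)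
    finally show ?thesis .
  qed
  have aEb: "a \<cdot> E \<cdot> b = E'" using na[of b] ab ie inv by simp
  show ?thesis
    unfolding cat_data.inverse_maps_def
    using ab ie by (simp add: K_hom[OF E E'] K_hom[OF E' E] na bE ba aEb)
qed

lemma K_iso:
  assumes "is_iso S T a" "idem S E" "idem T E'" "E' \<cdot> a = a \<cdot> E"
  shows "cat_data.is_iso K (S, E) (T, E') (a \<cdot> E)"
proof -
  obtain b where "inverse_maps S T a b" using assms(1) by (auto simp: is_iso_def)
  from K_inverse[OF this assms(2-4)] show ?thesis by (auto simp: cat_data.is_iso_def)
qed

lemma idem_tensor: "idem X e \<Longrightarrow> idem Y f \<Longrightarrow> idem (X \<otimes>\<^sub>o Y) (e \<otimes>\<^sub>m f)"
  by (auto simp: idem_def tensor_comp)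

lemma idem_id: "X \<in> cob C \<Longrightarrow> idem X (cid C X)"
  by (simp add: idem_def)

text \<open>This leaves a bare identity beside \<open>g\<close>, as the coherence axioms require,
  and sends the idempotent \<open>w\<close> to the right.\<close>

lemma tensor_l_split: "arr g \<Longrightarrow> arr f \<Longrightarrow> tgt f = src g \<Longrightarrow> w \<cdot> w = w \<Longrightarrow> arr w \<Longrightarrow> src w = W \<Longrightarrow> tgt w = W \<Longrightarrow>
    w \<otimes>\<^sub>m (g \<cdot> f) = (cid C W \<otimes>\<^sub>m g) \<cdot> (w \<otimes>\<^sub>m f)"
  by (subst tensor_comp) auto

text \<open>By naturality of the associator all idempotents can be moved to the far right, where
  they merge into one. What remains on their left is the pentagon of the original category. The
  triangle and the hexagon below follow the same pattern.\<close>

lemma K_pentagon: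
  assumes "idem W w" "idem X x" "idem Y y" "idem Z z"
  shows "(cassoc C W X (Y \<otimes>\<^sub>o Z) \<cdot> ((w \<otimes>\<^sub>m x) \<otimes>\<^sub>m (y \<otimes>\<^sub>m z))) \<cdot>
      cassoc C (W \<otimes>\<^sub>o X) Y Z \<cdot> (((w \<otimes>\<^sub>m x) \<otimes>\<^sub>m y) \<otimes>\<^sub>m z) =
    (w \<otimes>\<^sub>m (cassoc C X Y Z \<cdot> ((x \<otimes>\<^sub>m y) \<otimes>\<^sub>m z))) \<cdot>
      (cassoc C W (X \<otimes>\<^sub>o Y) Z \<cdot> ((w \<otimes>\<^sub>m (x \<otimes>\<^sub>m y)) \<otimes>\<^sub>m z)) \<cdot>
      ((cassoc C W X Y \<cdot> ((w \<otimes>\<^sub>m x) \<otimes>\<^sub>m y)) \<otimes>\<^sub>m z)"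
proof -
  note i = assms[unfolded idem_def]
  let ?R = "((w \<otimes>\<^sub>m x) \<otimes>\<^sub>m y) \<otimes>\<^sub>m z"
  have R: "?R \<cdot> ?R = ?R" using i by (simp add: tensor_comp)
  have "(cassoc C W X (Y \<otimes>\<^sub>o Z) \<cdot> ((w \<otimes>\<^sub>m x) \<otimes>\<^sub>m (y \<otimes>\<^sub>m z))) \<cdot> cassoc C (W \<otimes>\<^sub>o X) Y Z \<cdot> ?R =
      cassoc C W X (Y \<otimes>\<^sub>o Z) \<cdot> cassoc C (W \<otimes>\<^sub>o X) Y Z \<cdot> ?R"
    using i by (simp add: assoc_nat_assoc R)
  also have "\<dots> = (cassoc C W X (Y \<otimes>\<^sub>o Z) \<cdot> cassoc C (W \<otimes>\<^sub>o X) Y Z) \<cdot> ?R" using i by simp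
  also have "\<dots> = (cid C W \<otimes>\<^sub>m cassoc C X Y Z) \<cdot> cassoc C W (X \<otimes>\<^sub>o Y) Z \<cdot> (cassoc C W X Y \<otimes>\<^sub>m cid C Z) \<cdot> ?R"
    using i by (subst pentagon) simp_all
  also have "(cassoc C W X Y \<otimes>\<^sub>m cid C Z) \<cdot> ?R = (cassoc C W X Y \<cdot> ((w \<otimes>\<^sub>m x) \<otimes>\<^sub>m y)) \<otimes>\<^sub>m z"
    using i by (simp add: tensor_comp)
  finally have L: "(cassoc C W X (Y \<otimes>\<^sub>o Z) \<cdot> ((w \<otimes>\<^sub>m x) \<otimes>\<^sub>m (y \<otimes>\<^sub>m z))) \<cdot> cassoc C (W \<otimes>\<^sub>o X) Y Z \<cdot> ?R =
      (cid C W \<otimes>\<^sub>m cassoc C X Y Z) \<cdot> cassoc C W (X \<otimes>\<^sub>o Y) Z \<cdot> ((cassoc C W X Y \<cdot> ((w \<otimes>\<^sub>m x) \<otimes>\<^sub>m y)) \<otimes>\<^sub>m z)" .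
  let ?S = "(w \<otimes>\<^sub>m (x \<otimes>\<^sub>m y)) \<otimes>\<^sub>m z" and ?V = "(cassoc C W X Y \<cdot> ((w \<otimes>\<^sub>m x) \<otimes>\<^sub>m y)) \<otimes>\<^sub>m z"
  \<comment> \<open>The tensor product of idempotents \<open>?S\<close> is absorbed by the arrow
    \<open>?V\<close>, whose target it cuts.\<close>
  have SV: "?S \<cdot> ?V = ?V"
    using i by (simp add: tensor_comp assoc_nat_assoc)
  have "w \<otimes>\<^sub>m (cassoc C X Y Z \<cdot> ((x \<otimes>\<^sub>m y) \<otimes>\<^sub>m z)) =
      (cid C W \<otimes>\<^sub>m cassoc C X Y Z) \<cdot> (w \<otimes>\<^sub>m ((x \<otimes>\<^sub>m y) \<otimes>\<^sub>m z))"
    using i by (intro tensor_l_split) simp_all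
  then have "(w \<otimes>\<^sub>m (cassoc C X Y Z \<cdot> ((x \<otimes>\<^sub>m y) \<otimes>\<^sub>m z))) \<cdot> (cassoc C W (X \<otimes>\<^sub>o Y) Z \<cdot> ?S) \<cdot> ?V =
      ((cid C W \<otimes>\<^sub>m cassoc C X Y Z) \<cdot> (w \<otimes>\<^sub>m ((x \<otimes>\<^sub>m y) \<otimes>\<^sub>m z))) \<cdot> (cassoc C W (X \<otimes>\<^sub>o Y) Z \<cdot> ?S) \<cdot> ?V"
    by (simp only:)
  also have "\<dots> = (cid C W \<otimes>\<^sub>m cassoc C X Y Z) \<cdot> (w \<otimes>\<^sub>m ((x \<otimes>\<^sub>m y) \<otimes>\<^sub>m z)) \<cdot> cassoc C W (X \<otimes>\<^sub>o Y) Z \<cdot> ?S \<cdot> ?V"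
    using i by simp
  also have "(w \<otimes>\<^sub>m ((x \<otimes>\<^sub>m y) \<otimes>\<^sub>m z)) \<cdot> cassoc C W (X \<otimes>\<^sub>o Y) Z \<cdot> ?S \<cdot> ?V = cassoc C W (X \<otimes>\<^sub>o Y) Z \<cdot> ?S \<cdot> ?S \<cdot> ?V"
    using i by (subst assoc_nat_assoc) simp_all
  finally show ?thesis using L SV by simp
qed

lemma K_triangle:
  assumes "idem X x" "idem Y y"
  shows "(x \<otimes>\<^sub>m (clunit C Y \<cdot> (cid C (cunit C) \<otimes>\<^sub>m y))) \<cdot>
      cassoc C X (cunit C) Y \<cdot> ((x \<otimes>\<^sub>m cid C (cunit C)) \<otimes>\<^sub>m y) =
    (crunit C X \<cdot> (x \<otimes>\<^sub>m cid C (cunit C))) \<otimes>\<^sub>m y"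
proof -
  note i = assms[unfolded idem_def]
  let ?I = "cid C (cunit C)"
  let ?R = "(x \<otimes>\<^sub>m ?I) \<otimes>\<^sub>m y"
  have "x \<otimes>\<^sub>m (clunit C Y \<cdot> (?I \<otimes>\<^sub>m y)) = (cid C X \<otimes>\<^sub>m clunit C Y) \<cdot> (x \<otimes>\<^sub>m (?I \<otimes>\<^sub>m y))"
    using i by (intro tensor_l_split) simp_all
  then have "(x \<otimes>\<^sub>m (clunit C Y \<cdot> (?I \<otimes>\<^sub>m y))) \<cdot> cassoc C X (cunit C) Y \<cdot> ?R =
      (cid C X \<otimes>\<^sub>m clunit C Y) \<cdot> (x \<otimes>\<^sub>m (?I \<otimes>\<^sub>m y)) \<cdot> cassoc C X (cunit C) Y \<cdot> ?R"
    using i by simp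
  also have "(x \<otimes>\<^sub>m (?I \<otimes>\<^sub>m y)) \<cdot> cassoc C X (cunit C) Y \<cdot> ?R = cassoc C X (cunit C) Y \<cdot> ?R"
    using i by (simp add: assoc_nat_assoc tensor_comp)
  also have "(cid C X \<otimes>\<^sub>m clunit C Y) \<cdot> cassoc C X (cunit C) Y \<cdot> ?R =
      ((cid C X \<otimes>\<^sub>m clunit C Y) \<cdot> cassoc C X (cunit C) Y) \<cdot> ?R" using i by simp
  also have "\<dots> = (crunit C X \<otimes>\<^sub>m cid C Y) \<cdot> ?R" using i by (subst triangle) simp_all
  also have "\<dots> = (crunit C X \<cdot> (x \<otimes>\<^sub>m ?I)) \<otimes>\<^sub>m y" using i by (simp add: tensor_comp)
  finally show ?thesis .
qed

lemma K_hexagon: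
  assumes "idem X x" "idem Y y" "idem Z z"
  shows "(cassoc C Y Z X \<cdot> ((y \<otimes>\<^sub>m z) \<otimes>\<^sub>m x)) \<cdot> (cbraid C X (Y \<otimes>\<^sub>o Z) \<cdot> (x \<otimes>\<^sub>m (y \<otimes>\<^sub>m z))) \<cdot>
      cassoc C X Y Z \<cdot> ((x \<otimes>\<^sub>m y) \<otimes>\<^sub>m z) =
    (y \<otimes>\<^sub>m (cbraid C X Z \<cdot> (x \<otimes>\<^sub>m z))) \<cdot> (cassoc C Y X Z \<cdot> ((y \<otimes>\<^sub>m x) \<otimes>\<^sub>m z)) \<cdot>
      ((cbraid C X Y \<cdot> (x \<otimes>\<^sub>m y)) \<otimes>\<^sub>m z)"
proof -
  note i = assms[unfolded idem_def]
  let ?R = "(x \<otimes>\<^sub>m y) \<otimes>\<^sub>m z"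
  have R: "?R \<cdot> ?R = ?R" using i by (simp add: tensor_comp)
  have "(cassoc C Y Z X \<cdot> ((y \<otimes>\<^sub>m z) \<otimes>\<^sub>m x)) \<cdot> (cbraid C X (Y \<otimes>\<^sub>o Z) \<cdot> (x \<otimes>\<^sub>m (y \<otimes>\<^sub>m z))) \<cdot> cassoc C X Y Z \<cdot> ?R =
      cassoc C Y Z X \<cdot> cbraid C X (Y \<otimes>\<^sub>o Z) \<cdot> cassoc C X Y Z \<cdot> ?R"
    using i by (simp add: braid_nat_assoc assoc_nat_assoc R)
  also have "\<dots> = (cassoc C Y Z X \<cdot> cbraid C X (Y \<otimes>\<^sub>o Z) \<cdot> cassoc C X Y Z) \<cdot> ?R" using i by simp
  also have "\<dots> = (cid C Y \<otimes>\<^sub>m cbraid C X Z) \<cdot> cassoc C Y X Z \<cdot> (cbraid C X Y \<otimes>\<^sub>m cid C Z) \<cdot> ?R"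
    using i by (subst hexagon) simp_all
  also have "(cbraid C X Y \<otimes>\<^sub>m cid C Z) \<cdot> ?R = (cbraid C X Y \<cdot> (x \<otimes>\<^sub>m y)) \<otimes>\<^sub>m z"
    using i by (simp add: tensor_comp)
  finally have L: "(cassoc C Y Z X \<cdot> ((y \<otimes>\<^sub>m z) \<otimes>\<^sub>m x)) \<cdot> (cbraid C X (Y \<otimes>\<^sub>o Z) \<cdot> (x \<otimes>\<^sub>m (y \<otimes>\<^sub>m z))) \<cdot>
        cassoc C X Y Z \<cdot> ?R =
      (cid C Y \<otimes>\<^sub>m cbraid C X Z) \<cdot> cassoc C Y X Z \<cdot> ((cbraid C X Y \<cdot> (x \<otimes>\<^sub>m y)) \<otimes>\<^sub>m z)" .
  let ?S = "(y \<otimes>\<^sub>m x) \<otimes>\<^sub>m z" and ?V = "(cbraid C X Y \<cdot> (x \<otimes>\<^sub>m y)) \<otimes>\<^sub>m z"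
  have SV: "?S \<cdot> ?V = ?V" using i by (simp add: tensor_comp braid_nat_assoc)
  have "y \<otimes>\<^sub>m (cbraid C X Z \<cdot> (x \<otimes>\<^sub>m z)) = (cid C Y \<otimes>\<^sub>m cbraid C X Z) \<cdot> (y \<otimes>\<^sub>m (x \<otimes>\<^sub>m z))"
    using i by (intro tensor_l_split) simp_all
  then have "(y \<otimes>\<^sub>m (cbraid C X Z \<cdot> (x \<otimes>\<^sub>m z))) \<cdot> (cassoc C Y X Z \<cdot> ?S) \<cdot> ?V =
      ((cid C Y \<otimes>\<^sub>m cbraid C X Z) \<cdot> (y \<otimes>\<^sub>m (x \<otimes>\<^sub>m z))) \<cdot> (cassoc C Y X Z \<cdot> ?S) \<cdot> ?V" by (simp only:)
  also have "\<dots> = (cid C Y \<otimes>\<^sub>m cbraid C X Z) \<cdot> (y \<otimes>\<^sub>m (x \<otimes>\<^sub>m z)) \<cdot> cassoc C Y X Z \<cdot> ?S \<cdot> ?V"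
    using i by simp
  also have "(y \<otimes>\<^sub>m (x \<otimes>\<^sub>m z)) \<cdot> cassoc C Y X Z \<cdot> ?S \<cdot> ?V = cassoc C Y X Z \<cdot> ?S \<cdot> ?S \<cdot> ?V"
    using i by (subst assoc_nat_assoc) simp_all
  finally show ?thesis using L SV by simp
qed

lemma arr_tensor_add:
  assumes "arr f" "arr g" "arr h" "src f = X" "src g = X" "tgt f = Y" "tgt g = Y"
  shows "(f \<oplus>\<^bsub>cHom C X Y\<^esub> g) \<otimes>\<^sub>m h = (f \<otimes>\<^sub>m h) \<oplus>\<^bsub>cHom C (X \<otimes>\<^sub>o src h) (Y \<otimes>\<^sub>o tgt h)\<^esub> (g \<otimes>\<^sub>m h)"
    "h \<otimes>\<^sub>m (f \<oplus>\<^bsub>cHom C X Y\<^esub> g) = (h \<otimes>\<^sub>m f) \<oplus>\<^bsub>cHom C (src h \<otimes>\<^sub>o X) (tgt h \<otimes>\<^sub>o Y)\<^esub> (h \<otimes>\<^sub>m g)"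
proof -
  have XY: "X \<in> cob C" "Y \<in> cob C" using arr_ob[OF assms(1)] assms by simp_all
  show "(f \<oplus>\<^bsub>cHom C X Y\<^esub> g) \<otimes>\<^sub>m h = (f \<otimes>\<^sub>m h) \<oplus>\<^bsub>cHom C (X \<otimes>\<^sub>o src h) (Y \<otimes>\<^sub>o tgt h)\<^esub> (g \<otimes>\<^sub>m h)"
    using assms XY by (intro tmor_add_left) (simp_all add: arr_homI)
  show "h \<otimes>\<^sub>m (f \<oplus>\<^bsub>cHom C X Y\<^esub> g) = (h \<otimes>\<^sub>m f) \<oplus>\<^bsub>cHom C (src h \<otimes>\<^sub>o X) (tgt h \<otimes>\<^sub>o Y)\<^esub> (h \<otimes>\<^sub>m g)"
    using assms XY by (intro tmor_add_right) (simp_all add: arr_homI)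
qed

lemma arr_tensor_smult:
  assumes "arr f" "arr h" "src f = X" "tgt f = Y"
  shows "(c \<odot>\<^bsub>cHom C X Y\<^esub> f) \<otimes>\<^sub>m h = c \<odot>\<^bsub>cHom C (X \<otimes>\<^sub>o src h) (Y \<otimes>\<^sub>o tgt h)\<^esub> (f \<otimes>\<^sub>m h)"
    "h \<otimes>\<^sub>m (c \<odot>\<^bsub>cHom C X Y\<^esub> f) = c \<odot>\<^bsub>cHom C (src h \<otimes>\<^sub>o X) (tgt h \<otimes>\<^sub>o Y)\<^esub> (h \<otimes>\<^sub>m f)"
proof -
  have XY: "X \<in> cob C" "Y \<in> cob C" using arr_ob[OF assms(1)] assms by simp_all
  show "(c \<odot>\<^bsub>cHom C X Y\<^esub> f) \<otimes>\<^sub>m h = c \<odot>\<^bsub>cHom C (X \<otimes>\<^sub>o src h) (Y \<otimes>\<^sub>o tgt h)\<^esub> (f \<otimes>\<^sub>m h)"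
    using assms XY by (intro tmor_smult_left) (simp_all add: arr_homI)
  show "h \<otimes>\<^sub>m (c \<odot>\<^bsub>cHom C X Y\<^esub> f) = c \<odot>\<^bsub>cHom C (src h \<otimes>\<^sub>o X) (tgt h \<otimes>\<^sub>o Y)\<^esub> (h \<otimes>\<^sub>m f)"
    using assms XY by (intro tmor_smult_right) (simp_all add: arr_homI)
qed

lemma lunit_nat_assoc:
  assumes "arr f" "src f = X" "arr r" "tgt r = cunit C \<otimes>\<^sub>o X"
  shows "f \<cdot> clunit C X \<cdot> r = clunit C (tgt f) \<cdot> (cid C (cunit C) \<otimes>\<^sub>m f) \<cdot> r"
proof -
  have "X \<in> cob C" using arr_ob[OF assms(1)] assms(2) by simp
  then have "f \<cdot> clunit C X \<cdot> r = (f \<cdot> clunit C X) \<cdot> r" using assms by simp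
  also have "\<dots> = (clunit C (tgt f) \<cdot> (cid C (cunit C) \<otimes>\<^sub>m f)) \<cdot> r"
    using assms by (simp only: lunit_nat)
  finally show ?thesis using assms by simp
qed

lemma runit_nat_assoc:
  assumes "arr f" "src f = X" "arr r" "tgt r = X \<otimes>\<^sub>o cunit C"
  shows "f \<cdot> crunit C X \<cdot> r = crunit C (tgt f) \<cdot> (f \<otimes>\<^sub>m cid C (cunit C)) \<cdot> r"
proof -
  have "X \<in> cob C" using arr_ob[OF assms(1)] assms(2) by simp
  then have "f \<cdot> crunit C X \<cdot> r = (f \<cdot> crunit C X) \<cdot> r" using assms by simp
  also have "\<dots> = (crunit C (tgt f) \<cdot> (f \<otimes>\<^sub>m cid C (cunit C))) \<cdot> r"
    using assms by (simp only: runit_nat)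
  finally show ?thesis using assms by simp
qed

lemma karoubi_tensor: "tensor_category K"
proof (intro tensor_category.intro karoubi_additive tensor_category_axioms.intro, goal_cases)
  case 1
  then show ?case by (simp add: K_ob idem_id)
next
  case (2 P Q)
  then show ?case by (cases P; cases Q) (simp add: K_ob idem_tensor)
next
  case (3 P Q P' Q' f f')
  then show ?case by (cases P; cases Q; cases P'; cases Q')
    (auto simp: K_ob K_hom idem_tensor, auto simp: idem_def tensor_comp)
next
  case (4 P Q)
  then show ?case by (cases P; cases Q) simp
next
  case (5 P Q S P' Q' S' f g f' g')
  then show ?case by (cases P; cases Q; cases S; cases P'; cases Q'; cases S')
    (auto simp: K_ob K_hom tensor_comp)
next
  case (6 P Q P' Q' f g f')
  then show ?case by (cases P; cases Q; cases P'; cases Q') (auto simp: K_ob K_hom arr_tensor_add)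
next
  case (7 P Q P' Q' f g f')
  then show ?case by (cases P; cases Q; cases P'; cases Q') (auto simp: K_ob K_hom arr_tensor_add)
next
  case (8 P Q P' Q' f f' c)
  then show ?case by (cases P; cases Q; cases P'; cases Q') (auto simp: K_ob K_hom arr_tensor_smult)
next
  case (9 P Q P' Q' f f' c)
  then show ?case by (cases P; cases Q; cases P'; cases Q') (auto simp: K_ob K_hom arr_tensor_smult)
next
  case (10 P Q S)
  then show ?case
    by (cases P; cases Q; cases S; simp add: K_ob)
      (intro K_iso assoc_iso idem_tensor; simp add: idem_def assoc_nat)
next
  case (11 P)
  then show ?case
    by (cases P; simp add: K_ob) (intro K_iso lunit_iso idem_tensor idem_id; simp add: idem_def lunit_nat)
next
  case (12 P)
  then show ?case
    by (cases P; simp add: K_ob) (intro K_iso runit_iso idem_tensor idem_id; simp add: idem_def runit_nat)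
next
  case (13 P Q)
  then show ?case
    by (cases P; cases Q; simp add: K_ob) (intro K_iso braid_iso idem_tensor; simp add: idem_def braid_nat)
next
  case (14 P Q S P' Q' S' f g h)
  then show ?case
    by (cases P; cases Q; cases S; cases P'; cases Q'; cases S')
      (auto simp: K_ob K_hom, auto simp: idem_def tensor_comp assoc_nat_assoc)
next
  case (15 P Q f)
  then show ?case
    by (cases P; cases Q) (auto simp: K_ob K_hom, auto simp: idem_def tensor_comp lunit_nat_assoc)
next
  case (16 P Q f)
  then show ?case
    by (cases P; cases Q) (auto simp: K_ob K_hom, auto simp: idem_def tensor_comp runit_nat_assoc)
next
  case (17 P Q P' Q' f g)
  then show ?case
    by (cases P; cases Q; cases P'; cases Q')
      (auto simp: K_ob K_hom, auto simp: idem_def tensor_comp braid_nat_assoc)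
next
  case (18 P Q S T)
  then show ?case
    by (cases P; cases Q; cases S; cases T) (simp only: K_ob K_simps K_pentagon)
next
  case (19 P Q)
  then show ?case by (cases P; cases Q) (simp only: K_ob K_simps K_triangle)
next
  case (20 P Q S)
  then show ?case by (cases P; cases Q; cases S) (simp only: K_ob K_simps K_hexagon)
next
  case (21 P Q)
  then show ?case
  proof (cases P; cases Q)
    fix X e Y f assume PQ: "P = (X, e)" "Q = (Y, f)"
    with 21 have i: "X \<in> cob C" "arr e" "src e = X" "tgt e = X" "e \<cdot> e = e"
      "Y \<in> cob C" "arr f" "src f = Y" "tgt f = Y" "f \<cdot> f = f" by (auto simp: K_ob idem_def)
    have "(cbraid C Y X \<cdot> (f \<otimes>\<^sub>m e)) \<cdot> cbraid C X Y \<cdot> (e \<otimes>\<^sub>m f) =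
        (cbraid C Y X \<cdot> cbraid C X Y) \<cdot> (e \<otimes>\<^sub>m f)"
      using i by (simp add: braid_nat_assoc tensor_comp)
    also have "\<dots> = e \<otimes>\<^sub>m f" using i by (subst symmetry) simp_all
    finally show ?thesis by (simp only: PQ K_simps)
  qed
qed

end

section \<open>Semisimplicity of the Karoubi envelope\<close>

context typed_category
begin

text \<open>The power of exponent \<open>n + 1\<close>. Starting at exponent 1 avoids naming the
  object whose identity would be the zeroth power.\<close>

definition cpow :: "'a \<Rightarrow> nat \<Rightarrow> 'a" where
  "cpow f n = ((\<cdot>) f ^^ n) f"

lemma cpow_simps [simp]: "cpow f 0 = f" "cpow f (Suc n) = f \<cdot> cpow f n"
  by (simp_all add: cpow_def)

lemma arr_cpow [simp]:
  assumes "arr f" "src f = X" "tgt f = X"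
  shows "arr (cpow f n)" "src (cpow f n) = X" "tgt (cpow f n) = X"
proof -
  have "arr (cpow f n) \<and> src (cpow f n) = X \<and> tgt (cpow f n) = X"
    using assms by (induction n) auto
  then show "arr (cpow f n)" "src (cpow f n) = X" "tgt (cpow f n) = X" by auto
qed

lemma cpow_comp: "arr f \<Longrightarrow> src f = X \<Longrightarrow> tgt f = X \<Longrightarrow> cpow f m \<cdot> cpow f n = cpow f (Suc (m + n))"
  by (induction m) simp_all

end

text \<open>Regular in the sense of von Neumann: lemma \<open>regular\<close> below derives a
  quasi-inverse of every arrow from the two assumptions. The index of \<open>cpow\<close> starts at
  exponent 1, so that \<open>non_nilpotent\<close> concerns all positive powers.\<close>

locale regular_category = typed_category C src tgt
  for C :: "('o, 'a, 'k::field) tensor_cat" (structure) and src tgt :: "'a \<Rightarrow> 'o" +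
  assumes coords: "\<lbrakk>X \<in> cob C; Y \<in> cob C\<rbrakk> \<Longrightarrow> \<exists>n \<phi>. coordinates (cHom C X Y) n \<phi>"
    and non_nilpotent: "\<lbrakk>X \<in> cob C; Y \<in> cob C; f \<in> chom C X Y; f \<noteq> \<zero>\<^bsub>cHom C X Y\<^esub>\<rbrakk>
      \<Longrightarrow> \<exists>g\<in>chom C Y X. \<forall>n. cpow (g \<cdot> f) n \<noteq> \<zero>\<^bsub>cHom C X X\<^esub>"
begin

section \<open>Dimension arguments in hom spaces\<close>

definition subspace :: "'o \<Rightarrow> 'o \<Rightarrow> 'a set \<Rightarrow> bool" where
  "subspace X Y W \<longleftrightarrow> W \<subseteq> chom C X Y \<and> \<zero>\<^bsub>cHom C X Y\<^esub> \<in> W \<and>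
     (\<forall>f\<in>W. \<forall>g\<in>W. \<forall>c. f \<oplus>\<^bsub>cHom C X Y\<^esub> c \<odot>\<^bsub>cHom C X Y\<^esub> g \<in> W)"

text \<open>The chosen coordinates depend on \<open>X\<close> and \<open>Y\<close> only, which makes
  the values for different subspaces of the same hom space comparable.\<close>

definition hdim :: "'o \<Rightarrow> 'o \<Rightarrow> 'a set \<Rightarrow> nat" where
  "hdim X Y W = card (pivots ((SOME \<phi>. \<exists>n. coordinates (cHom C X Y) n \<phi>) ` W))"

lemma hdim_strict_mono:
  assumes XY: "X \<in> cob C" "Y \<in> cob C" and W: "subspace X Y W" "subspace X Y W'" "W \<subset> W'"
  shows "hdim X Y W < hdim X Y W'"
proof -
  define \<phi> where "\<phi> = (SOME \<phi>. \<exists>n. coordinates (cHom C X Y) n \<phi>)"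
  have "\<exists>n. coordinates (cHom C X Y) n \<phi>"
    unfolding \<phi>_def by (rule someI_ex[of "\<lambda>\<phi>. \<exists>n. coordinates (cHom C X Y) n \<phi>"]) (use coords[OF XY] in blast)
  then obtain n where c: "coordinates (cHom C X Y) n \<phi>" by blast
  have lin: "linear_subset (\<phi> ` V)" if V: "subspace X Y V" for V
    unfolding linear_subset_def
  proof (intro conjI ballI allI)
    have "(\<lambda>i. 0) = \<phi> \<zero>\<^bsub>cHom C X Y\<^esub>" using coordinates_zero[OF hom_mod[OF XY] c] by simp
    then show "(\<lambda>i. 0) \<in> \<phi> ` V" using V by (simp add: subspace_def)
    fix u v d assume "u \<in> \<phi> ` V" "v \<in> \<phi> ` V"
    then obtain f g where fg: "f \<in> V" "g \<in> V" "u = \<phi> f" "v = \<phi> g" by blast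
    then have "(\<lambda>i. u i + d * v i) = \<phi> (f \<oplus>\<^bsub>cHom C X Y\<^esub> d \<odot>\<^bsub>cHom C X Y\<^esub> g)"
      using V c by (auto simp: subspace_def coordinates_def subset_iff)
    then show "(\<lambda>i. u i + d * v i) \<in> \<phi> ` V" using V fg by (simp add: subspace_def)
  qed
  have sub: "W \<subseteq> chom C X Y" "W' \<subseteq> chom C X Y" using W by (auto simp: subspace_def)
  have inj: "inj_on \<phi> (chom C X Y)" using c by (simp add: coordinates_def)
  have "\<phi> ` W \<subseteq> \<phi> ` W'" using W by blast
  moreover have "\<phi> ` W \<noteq> \<phi> ` W'" using inj_on_image_eq_iff[OF inj sub] W by blast
  ultimately have "\<phi> ` W \<subset> \<phi> ` W'" by blast
  moreover have "u i = 0" if "u \<in> \<phi> ` W'" "n \<le> i" for u i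
    using that c sub by (auto simp: coordinates_def)
  ultimately show ?thesis
    unfolding hdim_def \<phi>_def[symmetric]
    by (intro card_pivots_strict_mono[OF lin[OF W(1)] lin[OF W(2)], of n])
qed

lemma subspace_left:
  assumes "arr y" "src y = X" "tgt y = Y" "Z \<in> cob C"
  shows "subspace X Z {z \<cdot> y | z. z \<in> chom C Y Z}"
proof -
  have ob: "X \<in> cob C" "Y \<in> cob C" using arr_ob[OF assms(1)] assms by simp_all
  have "\<exists>z. (z1 \<cdot> y) \<oplus>\<^bsub>cHom C X Z\<^esub> c \<odot>\<^bsub>cHom C X Z\<^esub> (z2 \<cdot> y) = z \<cdot> y \<and> z \<in> chom C Y Z"
    if "z1 \<in> chom C Y Z" "z2 \<in> chom C Y Z" for z1 z2 c
    using that assms ob by (intro exI[of _ "z1 \<oplus>\<^bsub>cHom C Y Z\<^esub> c \<odot>\<^bsub>cHom C Y Z\<^esub> z2"]) (simp add: hom_iff)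
  moreover have "\<exists>z. \<zero>\<^bsub>cHom C X Z\<^esub> = z \<cdot> y \<and> z \<in> chom C Y Z"
    using assms ob by (intro exI[of _ "\<zero>\<^bsub>cHom C Y Z\<^esub>"]) (simp add: hom_iff)
  ultimately show ?thesis using assms ob unfolding subspace_def by (auto simp: hom_iff)
qed

lemma subspace_right:
  assumes "arr y" "src y = X" "tgt y = Y" "Z \<in> cob C"
  shows "subspace Z Y {y \<cdot> z | z. z \<in> chom C Z X}"
proof -
  have ob: "X \<in> cob C" "Y \<in> cob C" using arr_ob[OF assms(1)] assms by simp_all
  have "\<exists>z. (y \<cdot> z1) \<oplus>\<^bsub>cHom C Z Y\<^esub> c \<odot>\<^bsub>cHom C Z Y\<^esub> (y \<cdot> z2) = y \<cdot> z \<and> z \<in> chom C Z X"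
    if "z1 \<in> chom C Z X" "z2 \<in> chom C Z X" for z1 z2 c
    using that assms ob by (intro exI[of _ "z1 \<oplus>\<^bsub>cHom C Z X\<^esub> c \<odot>\<^bsub>cHom C Z X\<^esub> z2"]) (simp add: hom_iff)
  moreover have "\<exists>z. \<zero>\<^bsub>cHom C Z Y\<^esub> = y \<cdot> z \<and> z \<in> chom C Z X"
    using assms ob by (intro exI[of _ "\<zero>\<^bsub>cHom C Z X\<^esub>"]) (simp add: hom_iff)
  ultimately show ?thesis using assms ob unfolding subspace_def by (auto simp: hom_iff)
qed

text \<open>From an index of least dimension onwards no inclusion can be strict.\<close>

lemma decreasing_stable:
  assumes XY: "X \<in> cob C" "Y \<in> cob C" and W: "\<And>k. subspace X Y (W k)" "\<And>k. W (Suc k) \<subseteq> W k"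
  shows "\<exists>k. \<forall>j\<ge>k. W j = W k"
proof -
  obtain k where k: "\<And>j. hdim X Y (W k) \<le> hdim X Y (W j)"
    using ex_has_least_nat[of "\<lambda>_. True" 0 "\<lambda>k. hdim X Y (W k)"] by auto
  have "W j = W k" if "j \<ge> k" for j
  proof -
    have "W j \<subseteq> W k" using lift_Suc_antimono_le[of W] W(2) that by blast
    then show ?thesis using hdim_strict_mono[OF XY W(1) W(1), of j k] k[of j] by fastforce
  qed
  then show ?thesis by blast
qed

text \<open>Fitting's lemma: for a high power \<open>y\<close> of \<open>x\<close>, \<open>y = z y y = y y z'\<close>, and then \<open>z y = y z'\<close> is idempotent.\<close>

lemma idempotent_of_non_nilpotent:
  assumes x: "arr x" "src x = X" "tgt x = X" and nn: "\<And>n. cpow x n \<noteq> \<zero>\<^bsub>cHom C X X\<^esub>"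
  shows "\<exists>z k. z \<in> chom C X X \<and> (z \<cdot> cpow x k) \<cdot> z \<cdot> cpow x k = z \<cdot> cpow x k \<and>
    z \<cdot> cpow x k \<noteq> \<zero>\<^bsub>cHom C X X\<^esub>"
proof -
  have X: "X \<in> cob C" using arr_ob[OF x(1)] x by simp
  \<comment> \<open>The left and right ideals generated by the powers of \<open>x\<close> decrease,
    so both chains become stationary.\<close>
  define L where "L k = {z \<cdot> cpow x k | z. z \<in> chom C X X}" for k
  define R where "R k = {cpow x k \<cdot> z | z. z \<in> chom C X X}" for k
  have "\<exists>k. \<forall>j\<ge>k. L j = L k"
  proof (rule decreasing_stable[OF X X])
    show "subspace X X (L k)" for k unfolding L_def by (rule subspace_left) (use x X in auto)
    show "L (Suc k) \<subseteq> L k" for k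
    proof
      fix u assume "u \<in> L (Suc k)"
      then obtain z where z: "z \<in> chom C X X" "u = z \<cdot> x \<cdot> cpow x k" by (auto simp: L_def)
      then have "u = (z \<cdot> x) \<cdot> cpow x k" "z \<cdot> x \<in> chom C X X" using x X by (auto simp: hom_iff)
      then show "u \<in> L k" by (auto simp: L_def)
    qed
  qed
  then obtain k1 where k1: "\<And>j. j \<ge> k1 \<Longrightarrow> L j = L k1" by blast
  have "\<exists>k. \<forall>j\<ge>k. R j = R k"
  proof (rule decreasing_stable[OF X X])
    show "subspace X X (R k)" for k unfolding R_def by (rule subspace_right) (use x X in auto)
    show "R (Suc k) \<subseteq> R k" for k
    proof
      fix u assume "u \<in> R (Suc k)"
      then obtain z where z: "z \<in> chom C X X" "u = cpow x (Suc k) \<cdot> z" unfolding R_def by blast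
      moreover have "cpow x (Suc k) = cpow x k \<cdot> x" using cpow_comp[OF x, of k 0] by simp
      ultimately have "u = cpow x k \<cdot> x \<cdot> z" "x \<cdot> z \<in> chom C X X" using x X
        by (auto simp: hom_iff simp del: cpow_simps(2))
      then show "u \<in> R k" by (auto simp: R_def)
    qed
  qed
  then obtain k2 where k2: "\<And>j. j \<ge> k2 \<Longrightarrow> R j = R k2" by blast
  define k where "k = max k1 k2"
  define y where "y = cpow x k"
  have y: "arr y" "src y = X" "tgt y = X" using x by (auto simp: y_def)
  \<comment> \<open>Exponents exceed indices by one: twice the exponent \<open>k + 1\<close> is the
    exponent with index \<open>k + k + 1\<close>.\<close>
  have yy: "y \<cdot> y = cpow x (Suc (k + k))" using cpow_comp[OF x, of k k] by (simp add: y_def)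
  have "L (Suc (k + k)) = L k" using k1[of k] k1[of "Suc (k + k)"] by (simp add: k_def)
  moreover have "cid C X \<cdot> y \<in> L k" unfolding L_def y_def using X id_closed by blast
  ultimately have "y \<in> L (Suc (k + k))" using y by simp
  then obtain z where z: "z \<in> chom C X X" "y = z \<cdot> y \<cdot> y"
    unfolding L_def yy[symmetric] by blast
  have "R (Suc (k + k)) = R k" using k2[of k] k2[of "Suc (k + k)"] by (simp add: k_def)
  moreover have "y \<cdot> cid C X \<in> R k" unfolding R_def y_def using X id_closed by blast
  ultimately have "y \<in> R (Suc (k + k))" using y by simp
  then obtain z' where z': "z' \<in> chom C X X" "y = (y \<cdot> y) \<cdot> z'"
    unfolding R_def yy[symmetric] by blast
  have t: "arr z" "src z = X" "tgt z = X" "arr z'" "src z' = X" "tgt z' = X"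
    using z(1) z'(1) X by (auto simp: hom_iff)
  \<comment> \<open>The product \<open>z y y z'\<close> is read in two ways.\<close>
  have "z \<cdot> y = z \<cdot> (y \<cdot> y) \<cdot> z'" using z'(2) by simp
  also have "\<dots> = (z \<cdot> y \<cdot> y) \<cdot> z'" using t y by simp
  also have "\<dots> = y \<cdot> z'" using z(2) by simp
  finally have zy: "z \<cdot> y = y \<cdot> z'" .
  have "(z \<cdot> y) \<cdot> z \<cdot> y = (z \<cdot> y) \<cdot> y \<cdot> z'" by (simp only: zy)
  also have "\<dots> = (z \<cdot> y \<cdot> y) \<cdot> z'" using t y by simp
  also have "\<dots> = z \<cdot> y" using z(2) zy by simp
  finally have idem: "(z \<cdot> y) \<cdot> z \<cdot> y = z \<cdot> y" .
  have "z \<cdot> y \<noteq> \<zero>\<^bsub>cHom C X X\<^esub>"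
  proof
    assume 0: "z \<cdot> y = \<zero>\<^bsub>cHom C X X\<^esub>"
    have "y = (z \<cdot> y) \<cdot> y" using z(2) t y by simp
    also have "\<dots> = \<zero>\<^bsub>cHom C X X\<^esub>" unfolding 0 using y X by simp
    finally show False using nn[of k] by (simp add: y_def)
  qed
  then show ?thesis using idem z(1) unfolding y_def by blast
qed

text \<open>Von Neumann regularity, by induction on the left ideal generated by \<open>f\<close>: a nonzero idempotent
  \<open>h f\<close> splits off from \<open>f\<close> the part \<open>f h f\<close>.\<close>

lemma regular:
  assumes "arr f" "src f = X" "tgt f = Y"
  shows "\<exists>g. arr g \<and> src g = Y \<and> tgt g = X \<and> f \<cdot> g \<cdot> f = f"
  using assms
proof (induction "hdim X X {h \<cdot> f | h. h \<in> chom C Y X}" arbitrary: f rule: less_induct)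
  case less
  note f = less.prems
  have XY: "X \<in> cob C" "Y \<in> cob C" using arr_ob[OF f(1)] f by simp_all
  show ?case
  proof (cases "f = \<zero>\<^bsub>cHom C X Y\<^esub>")
    case True
    then show ?thesis using XY by (intro exI[of _ "\<zero>\<^bsub>cHom C Y X\<^esub>"]) simp
  next
    case False
    have "f \<in> chom C X Y" using f XY by (simp add: hom_iff)
    from non_nilpotent[OF XY this False] obtain g
      where g: "g \<in> chom C Y X" "\<And>n. cpow (g \<cdot> f) n \<noteq> \<zero>\<^bsub>cHom C X X\<^esub>" by blast
    then have gt: "arr g" "src g = Y" "tgt g = X" using XY by (auto simp: hom_iff)
    obtain z k where zk: "z \<in> chom C X X"
      "(z \<cdot> cpow (g \<cdot> f) k) \<cdot> z \<cdot> cpow (g \<cdot> f) k = z \<cdot> cpow (g \<cdot> f) k"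
      "z \<cdot> cpow (g \<cdot> f) k \<noteq> \<zero>\<^bsub>cHom C X X\<^esub>"
      using idempotent_of_non_nilpotent[of "g \<cdot> f" X] g(2) gt f by auto
    have zt: "arr z" "src z = X" "tgt z = X" using zk(1) XY by (auto simp: hom_iff)
    \<comment> \<open>Every power of \<open>g \<cdot> f\<close> ends in \<open>f\<close>, so the
      idempotent obtained from Fitting's lemma has the form \<open>h \<cdot> f\<close>.\<close>
    have "\<exists>h. arr h \<and> src h = Y \<and> tgt h = X \<and> cpow (g \<cdot> f) k = h \<cdot> f"
    proof (cases k)
      case 0
      then show ?thesis using gt by auto
    next
      case (Suc n)
      have "cpow (g \<cdot> f) k = cpow (g \<cdot> f) n \<cdot> g \<cdot> f"
        using cpow_comp[of "g \<cdot> f" X n 0] gt f by (simp add: Suc)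
      then show ?thesis using gt f by (intro exI[of _ "cpow (g \<cdot> f) n \<cdot> g"]) simp
    qed
    then obtain h' where h': "arr h'" "src h' = Y" "tgt h' = X" "cpow (g \<cdot> f) k = h' \<cdot> f" by blast
    define h where "h = z \<cdot> h'"
    have h: "arr h" "src h = Y" "tgt h = X" using h' zt by (auto simp: h_def)
    have hf: "z \<cdot> cpow (g \<cdot> f) k = h \<cdot> f" using h' zt f by (simp add: h_def)
    have e2: "h \<cdot> f \<cdot> h \<cdot> f = h \<cdot> f" using zk(2) h f unfolding hf by simp
    have e0: "h \<cdot> f \<noteq> \<zero>\<^bsub>cHom C X X\<^esub>" using zk(3) unfolding hf .
    \<comment> \<open>Since \<open>f'\<close> is killed by the idempotent \<open>h \<cdot> f\<close>
      from the right, this idempotent lies in the left ideal of \<open>f\<close> but not in that of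
      \<open>f'\<close>. The ideal shrinks and the induction hypothesis applies to
      \<open>f'\<close>.\<close>
    define f' where "f' = f \<ominus>\<^bsub>cHom C X Y\<^esub> (f \<cdot> h \<cdot> f)"
    have f': "arr f'" "src f' = X" "tgt f' = Y" using f h by (auto simp: f'_def)
    have f'e: "f' \<cdot> h \<cdot> f = \<zero>\<^bsub>cHom C X Y\<^esub>" using f h by (simp add: f'_def e2)
    have "{u \<cdot> f' | u. u \<in> chom C Y X} \<subset> {u \<cdot> f | u. u \<in> chom C Y X}"
    proof
      show "{u \<cdot> f' | u. u \<in> chom C Y X} \<subseteq> {u \<cdot> f | u. u \<in> chom C Y X}"
      proof clarify
        fix u assume "u \<in> chom C Y X"
        then have u: "arr u" "src u = Y" "tgt u = X" using XY by (auto simp: hom_iff)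
        have "u \<cdot> f' = (u \<ominus>\<^bsub>cHom C Y X\<^esub> (u \<cdot> f \<cdot> h)) \<cdot> f"
          using u f h by (simp add: f'_def)
        moreover have "u \<ominus>\<^bsub>cHom C Y X\<^esub> (u \<cdot> f \<cdot> h) \<in> chom C Y X"
          using u f h XY by (simp add: hom_iff)
        ultimately show "\<exists>v. u \<cdot> f' = v \<cdot> f \<and> v \<in> chom C Y X" by blast
      qed
      have "h \<cdot> f \<in> {u \<cdot> f | u. u \<in> chom C Y X}" using h XY by (auto simp: hom_iff)
      moreover have "h \<cdot> f \<notin> {u \<cdot> f' | u. u \<in> chom C Y X}"
      proof
        assume "h \<cdot> f \<in> {u \<cdot> f' | u. u \<in> chom C Y X}"
        then obtain u where uf: "h \<cdot> f = u \<cdot> f'" and "u \<in> chom C Y X" by auto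
        then have u: "arr u" "src u = Y" "tgt u = X" using XY by (auto simp: hom_iff)
        have "h \<cdot> f = (h \<cdot> f) \<cdot> h \<cdot> f" using e2 h f by simp
        also have "\<dots> = u \<cdot> f' \<cdot> h \<cdot> f" unfolding uf using u f' h f by simp
        also have "\<dots> = \<zero>\<^bsub>cHom C X X\<^esub>" using f'e u XY by simp
        finally show False using e0 by simp
      qed
      ultimately show "{u \<cdot> f' | u. u \<in> chom C Y X} \<noteq> {u \<cdot> f | u. u \<in> chom C Y X}" by blast
    qed
    then have "hdim X X {u \<cdot> f' | u. u \<in> chom C Y X} < hdim X X {u \<cdot> f | u. u \<in> chom C Y X}"
      using f f' XY by (intro hdim_strict_mono subspace_left) auto
    from less.hyps[OF this f'] obtain v where v: "arr v" "src v = Y" "tgt v = X" "f' \<cdot> v \<cdot> f' = f'"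
      by blast
    \<comment> \<open>The arrow \<open>h\<close> is a quasi-inverse on the part
      \<open>f h f\<close>. The quasi-inverse \<open>v\<close> of \<open>f'\<close> is placed
      between complementary projections so that \<open>f r f\<close> sees only \<open>f'\<close>;
      the sum of \<open>h\<close> and \<open>r\<close> then serves for \<open>f\<close>.\<close>
    define r where "r = (cid C X \<ominus>\<^bsub>cHom C X X\<^esub> (h \<cdot> f)) \<cdot> v \<cdot> (cid C Y \<ominus>\<^bsub>cHom C Y Y\<^esub> (f \<cdot> h))"
    have r: "arr r" "src r = Y" "tgt r = X" using v f h XY by (simp_all add: r_def)
    have "f \<cdot> r \<cdot> f = (f \<cdot> (cid C X \<ominus>\<^bsub>cHom C X X\<^esub> (h \<cdot> f))) \<cdot> v \<cdot> ((cid C Y \<ominus>\<^bsub>cHom C Y Y\<^esub> (f \<cdot> h)) \<cdot> f)"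
      using v f h XY by (simp add: r_def del: comp_minus_l comp_minus_r)
    also have "f \<cdot> (cid C X \<ominus>\<^bsub>cHom C X X\<^esub> (h \<cdot> f)) = f'" using f h XY by (simp add: f'_def)
    also have "(cid C Y \<ominus>\<^bsub>cHom C Y Y\<^esub> (f \<cdot> h)) \<cdot> f = f'" using f h XY by (simp add: f'_def)
    finally have "f \<cdot> r \<cdot> f = f'" using v by simp
    then have "f \<cdot> (h \<oplus>\<^bsub>cHom C Y X\<^esub> r) \<cdot> f = (f \<cdot> h \<cdot> f) \<oplus>\<^bsub>cHom C X Y\<^esub> f'"
      using f h r XY by simp
    also have "\<dots> = f" using f h by (simp add: f'_def)
    finally show ?thesis using h r by (intro exI[of _ "h \<oplus>\<^bsub>cHom C Y X\<^esub> r"]) simp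
  qed
qed

section \<open>Kernels, cokernels and split arrows in the envelope\<close>

lemma K_regular:
  assumes P: "idem X e" and Q: "idem Y f" and a: "a \<in> chom K (X, e) (Y, f)"
  shows "\<exists>g\<in>chom K (Y, f) (X, e). a \<cdot> g \<cdot> a = a"
proof -
  note i = P[unfolded idem_def] Q[unfolded idem_def]
  have at: "arr a" "src a = X" "tgt a = Y" "f \<cdot> a = a" "a \<cdot> e = a" using a by (auto simp: K_hom[OF P Q])
  then obtain g where g: "arr g" "src g = Y" "tgt g = X" "a \<cdot> g \<cdot> a = a" using regular by blast
  show ?thesis
    by (rule bexI[of _ "e \<cdot> g \<cdot> f"]) (use at g i in \<open>auto simp: K_hom[OF Q P]\<close>)
qed

lemma idem_complement:
  assumes e: "idem X e" and q: "arr q" "src q = X" "tgt q = X" "q \<cdot> q = q" "e \<cdot> q = q" "q \<cdot> e = q"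
  shows "idem X (e \<ominus>\<^bsub>cHom C X X\<^esub> q)" "idem X q"
    "e \<cdot> (e \<ominus>\<^bsub>cHom C X X\<^esub> q) = e \<ominus>\<^bsub>cHom C X X\<^esub> q" "(e \<ominus>\<^bsub>cHom C X X\<^esub> q) \<cdot> e = e \<ominus>\<^bsub>cHom C X X\<^esub> q"
    "q \<cdot> (e \<ominus>\<^bsub>cHom C X X\<^esub> q) = \<zero>\<^bsub>cHom C X X\<^esub>" "(e \<ominus>\<^bsub>cHom C X X\<^esub> q) \<cdot> q = \<zero>\<^bsub>cHom C X X\<^esub>"
  using e q by (simp_all add: idem_def)

text \<open>With a quasi-inverse \<open>g\<close> the composite \<open>g \<cdot> a\<close> is an
  idempotent that \<open>a\<close> does not distinguish from the identity. The complementary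
  idempotent cuts out exactly what \<open>a\<close> kills, and it serves both as the kernel object
  and as its inclusion.\<close>

lemma K_kernel:
  assumes P: "idem X e" and Q: "idem Y f" and a: "a \<in> chom K (X, e) (Y, f)"
    and g: "g \<in> chom K (Y, f) (X, e)" "a \<cdot> g \<cdot> a = a"
  shows "cat_data.is_kernel K (X, e \<ominus>\<^bsub>cHom C X X\<^esub> (g \<cdot> a)) (e \<ominus>\<^bsub>cHom C X X\<^esub> (g \<cdot> a)) (X, e) a (Y, f)"
proof -
  note i = P[unfolded idem_def] Q[unfolded idem_def]
  have at: "arr a" "src a = X" "tgt a = Y" "f \<cdot> a = a" "a \<cdot> e = a" using a by (auto simp: K_hom[OF P Q])
  have gt: "arr g" "src g = Y" "tgt g = X" "e \<cdot> g = g" "g \<cdot> f = g" using g by (auto simp: K_hom[OF Q P])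
  define d where "d = e \<ominus>\<^bsub>cHom C X X\<^esub> (g \<cdot> a)"
  have d: "idem X d" "e \<cdot> d = d" "d \<cdot> e = d"
  proof -
    have c: "arr (g \<cdot> a)" "src (g \<cdot> a) = X" "tgt (g \<cdot> a) = X" "(g \<cdot> a) \<cdot> g \<cdot> a = g \<cdot> a"
      "e \<cdot> g \<cdot> a = g \<cdot> a" "(g \<cdot> a) \<cdot> e = g \<cdot> a" using at gt i g(2) by simp_all
    show "idem X d" "e \<cdot> d = d" "d \<cdot> e = d" unfolding d_def by (rule idem_complement[OF P c])+
  qed
  note dt = d(1)[unfolded idem_def]
  have "\<exists>!u. u \<in> chom K W (X, d) \<and> d \<cdot>\<^bsub>K\<^esub> u = w"
    if W: "W \<in> cob K" and w: "w \<in> chom K W (X, e)" and 0: "a \<cdot>\<^bsub>K\<^esub> w = \<zero>\<^bsub>cHom K W (Y, f)\<^esub>" for W w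
  proof -
    obtain Z z where WZ: "W = (Z, z)" "idem Z z" using W by (cases W) (auto simp: K_ob)
    have wt: "arr w" "src w = Z" "tgt w = X" "e \<cdot> w = w" "w \<cdot> z = w"
      using w by (auto simp: WZ K_hom[OF WZ(2) P])
    have "Z \<in> cob C" using WZ by (simp add: idem_def)
    have aw: "a \<cdot> w = \<zero>\<^bsub>cHom C Z Y\<^esub>" using 0 by (simp add: WZ)
    have dw: "d \<cdot> w = w" using wt at gt i aw \<open>Z \<in> cob C\<close> by (simp add: d_def)
    show ?thesis
      by (rule ex1I[of _ w]) (use dw wt in \<open>auto simp: WZ(1) K_hom[OF WZ(2) d(1)]\<close>)
  qed
  moreover have "d \<in> chom K (X, d) (X, e)" using d dt by (simp add: K_hom[OF d(1) P])
  moreover have "a \<cdot> d = \<zero>\<^bsub>cHom C X Y\<^esub>" using at gt i g(2) by (simp add: d_def)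
  ultimately show ?thesis
    unfolding cat_data.is_kernel_def d_def[symmetric] using a P Q d(1) by (simp add: K_ob)
qed

lemma K_cokernel:
  assumes P: "idem X e" and Q: "idem Y f" and a: "a \<in> chom K (X, e) (Y, f)"
    and g: "g \<in> chom K (Y, f) (X, e)" "a \<cdot> g \<cdot> a = a"
  shows "cat_data.is_cokernel K (X, e) a (Y, f) (f \<ominus>\<^bsub>cHom C Y Y\<^esub> (a \<cdot> g)) (Y, f \<ominus>\<^bsub>cHom C Y Y\<^esub> (a \<cdot> g))"
proof -
  note i = P[unfolded idem_def] Q[unfolded idem_def]
  have at: "arr a" "src a = X" "tgt a = Y" "f \<cdot> a = a" "a \<cdot> e = a" using a by (auto simp: K_hom[OF P Q])
  have gt: "arr g" "src g = Y" "tgt g = X" "e \<cdot> g = g" "g \<cdot> f = g" using g by (auto simp: K_hom[OF Q P])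
  define d where "d = f \<ominus>\<^bsub>cHom C Y Y\<^esub> (a \<cdot> g)"
  have aga: "a \<cdot> g \<cdot> a \<cdot> g = a \<cdot> g"
  proof -
    have "a \<cdot> g \<cdot> a \<cdot> g = (a \<cdot> g \<cdot> a) \<cdot> g" using at gt by simp
    then show ?thesis by (simp only: g(2))
  qed
  have d: "idem Y d" "f \<cdot> d = d" "d \<cdot> f = d"
  proof -
    have c: "arr (a \<cdot> g)" "src (a \<cdot> g) = Y" "tgt (a \<cdot> g) = Y" "(a \<cdot> g) \<cdot> a \<cdot> g = a \<cdot> g"
      "f \<cdot> a \<cdot> g = a \<cdot> g" "(a \<cdot> g) \<cdot> f = a \<cdot> g" using at gt i aga by simp_all
    show "idem Y d" "f \<cdot> d = d" "d \<cdot> f = d" unfolding d_def by (rule idem_complement[OF Q c])+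
  qed
  note dt = d(1)[unfolded idem_def]
  have "\<exists>!u. u \<in> chom K (Y, d) W \<and> u \<cdot>\<^bsub>K\<^esub> d = w"
    if W: "W \<in> cob K" and w: "w \<in> chom K (Y, f) W" and 0: "w \<cdot>\<^bsub>K\<^esub> a = \<zero>\<^bsub>cHom K (X, e) W\<^esub>" for W w
  proof -
    obtain Z z where WZ: "W = (Z, z)" "idem Z z" using W by (cases W) (auto simp: K_ob)
    have wt: "arr w" "src w = Y" "tgt w = Z" "z \<cdot> w = w" "w \<cdot> f = w"
      using w by (auto simp: WZ K_hom[OF Q WZ(2)])
    have Z: "Z \<in> cob C" using WZ by (simp add: idem_def)
    have wa: "w \<cdot> a = \<zero>\<^bsub>cHom C X Z\<^esub>" using 0 by (simp add: WZ)
    have "w \<cdot> a \<cdot> g = (w \<cdot> a) \<cdot> g" using wt at gt by simp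
    then have "w \<cdot> a \<cdot> g = \<zero>\<^bsub>cHom C Y Z\<^esub>" using gt Z by (simp add: wa)
    then have wd: "w \<cdot> d = w" using wt at gt i by (simp add: d_def)
    show ?thesis
      by (rule ex1I[of _ w]) (use wd wt in \<open>auto simp: WZ(1) K_hom[OF d(1) WZ(2)]\<close>)
  qed
  moreover have "d \<in> chom K (Y, f) (Y, d)" using d dt by (simp add: K_hom[OF Q d(1)])
  moreover have "d \<cdot> a = \<zero>\<^bsub>cHom C X Y\<^esub>" using at gt i g(2) by (simp add: d_def)
  ultimately show ?thesis
    unfolding cat_data.is_cokernel_def d_def[symmetric] using a P Q d(1) by (simp add: K_ob)
qed

text \<open>A quasi-inverse of a monomorphism is a left inverse: in \<open>a g a = a\<close> the
  arrow \<open>a\<close> can be cancelled on the left.\<close>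

lemma K_mono_split:
  assumes P: "idem X e" and Q: "idem Y f" and m: "cat_data.is_mono K (X, e) (Y, f) a"
  shows "\<exists>g\<in>chom K (Y, f) (X, e). g \<cdot> a = e"
proof -
  note i = P[unfolded idem_def] Q[unfolded idem_def]
  have a: "a \<in> chom K (X, e) (Y, f)" using m by (simp add: cat_data.is_mono_def)
  then have at: "arr a" "src a = X" "tgt a = Y" "f \<cdot> a = a" "a \<cdot> e = a" by (auto simp: K_hom[OF P Q])
  obtain g where g: "g \<in> chom K (Y, f) (X, e)" "a \<cdot> g \<cdot> a = a" using K_regular[OF P Q a] by blast
  then have gt: "arr g" "src g = Y" "tgt g = X" "e \<cdot> g = g" "g \<cdot> f = g" by (auto simp: K_hom[OF Q P])
  have "g \<cdot> a \<in> chom K (X, e) (X, e)" "e \<in> chom K (X, e) (X, e)" using at gt i by (auto simp: K_hom[OF P P])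
  moreover have "a \<cdot>\<^bsub>K\<^esub> (g \<cdot> a) = a \<cdot>\<^bsub>K\<^esub> e" using g(2) at by simp
  moreover have "(X, e) \<in> cob K" using P by (simp add: K_ob)
  ultimately have "g \<cdot> a = e" using m unfolding cat_data.is_mono_def by blast
  then show ?thesis using g by blast
qed

lemma K_epi_split:
  assumes P: "idem X e" and Q: "idem Y f" and m: "cat_data.is_epi K (X, e) (Y, f) a"
  shows "\<exists>g\<in>chom K (Y, f) (X, e). a \<cdot> g = f"
proof -
  note i = P[unfolded idem_def] Q[unfolded idem_def]
  have a: "a \<in> chom K (X, e) (Y, f)" using m by (simp add: cat_data.is_epi_def)
  then have at: "arr a" "src a = X" "tgt a = Y" "f \<cdot> a = a" "a \<cdot> e = a" by (auto simp: K_hom[OF P Q])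
  obtain g where g: "g \<in> chom K (Y, f) (X, e)" "a \<cdot> g \<cdot> a = a" using K_regular[OF P Q a] by blast
  then have gt: "arr g" "src g = Y" "tgt g = X" "e \<cdot> g = g" "g \<cdot> f = g" by (auto simp: K_hom[OF Q P])
  have "a \<cdot> g \<in> chom K (Y, f) (Y, f)" "f \<in> chom K (Y, f) (Y, f)" using at gt i by (auto simp: K_hom[OF Q Q])
  moreover have "(a \<cdot> g) \<cdot>\<^bsub>K\<^esub> a = f \<cdot>\<^bsub>K\<^esub> a" using g(2) at gt by simp
  moreover have "(Y, f) \<in> cob K" using Q by (simp add: K_ob)
  ultimately have "a \<cdot> g = f" using m unfolding cat_data.is_epi_def by blast
  then show ?thesis using g by blast
qed

lemma karoubi_abelian: "abelian_category K"
proof (intro abelian_category.intro karoubi_additive abelian_category_axioms.intro, goal_cases)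
  case (1 P Q a)
  then show ?case using K_regular K_kernel by (cases P; cases Q) (simp add: K_ob, blast)
next
  case (2 P Q a)
  then show ?case using K_regular K_cokernel by (cases P; cases Q) (simp add: K_ob, blast)
next
  case (3 P Q a)
  obtain X e Y f where PQ: "P = (X, e)" "Q = (Y, f)" by (cases P; cases Q)
  with 3 have P: "idem X e" and Q: "idem Y f" by (auto simp: K_ob)
  note i = P[unfolded idem_def] Q[unfolded idem_def]
  obtain g where g: "g \<in> chom K (Y, f) (X, e)" "g \<cdot> a = e" using K_mono_split[OF P Q] 3 PQ by blast
  then have gt: "arr g" "src g = Y" "tgt g = X" "e \<cdot> g = g" "g \<cdot> f = g" by (auto simp: K_hom[OF Q P])
  have a: "a \<in> chom K (X, e) (Y, f)" using 3 by (simp add: cat_data.is_mono_def PQ)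
  then have at: "arr a" "src a = X" "tgt a = Y" "f \<cdot> a = a" "a \<cdot> e = a" by (auto simp: K_hom[OF P Q])
  \<comment> \<open>\<open>a \<cdot> g\<close> projects onto the image of \<open>a\<close>; its
    complement \<open>d\<close> has this image as its kernel.\<close>
  define d where "d = f \<ominus>\<^bsub>cHom C Y Y\<^esub> (a \<cdot> g)"
  have d: "d \<in> chom K (Y, f) (Y, f)" using at gt i by (simp add: K_hom[OF Q Q] d_def)
  have "\<exists>!u. u \<in> chom K W (X, e) \<and> a \<cdot>\<^bsub>K\<^esub> u = w"
    if W: "W \<in> cob K" and w: "w \<in> chom K W (Y, f)" and 0: "d \<cdot>\<^bsub>K\<^esub> w = \<zero>\<^bsub>cHom K W (Y, f)\<^esub>" for W w
  proof -
    obtain Z z where WZ: "W = (Z, z)" "idem Z z" using W by (cases W) (auto simp: K_ob)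
    have wt: "arr w" "src w = Z" "tgt w = Y" "f \<cdot> w = w" "w \<cdot> z = w"
      using w by (auto simp: WZ K_hom[OF WZ(2) Q])
    have "w \<ominus>\<^bsub>cHom C Z Y\<^esub> (a \<cdot> g \<cdot> w) = \<zero>\<^bsub>cHom C Z Y\<^esub>"
      using 0 wt at gt i by (simp add: WZ d_def)
    then have agw: "w = a \<cdot> g \<cdot> w" using wt at gt by (simp add: minus_eq_zero_iff)
    show ?thesis
    proof (rule ex1I[of _ "g \<cdot> w"])
      show "g \<cdot> w \<in> chom K W (X, e) \<and> a \<cdot>\<^bsub>K\<^esub> g \<cdot> w = w"
        using agw wt gt i WZ(2) by (simp add: WZ(1) K_hom[OF WZ(2) P] idem_def)
      fix u assume u: "u \<in> chom K W (X, e) \<and> a \<cdot>\<^bsub>K\<^esub> u = w"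
      then have ut: "arr u" "src u = Z" "tgt u = X" "e \<cdot> u = u" by (auto simp: WZ(1) K_hom[OF WZ(2) P])
      have "g \<cdot> w = g \<cdot> a \<cdot> u" using u by simp
      also have "\<dots> = (g \<cdot> a) \<cdot> u" using ut gt at by simp
      finally show "u = g \<cdot> w" using ut by (simp add: g(2))
    qed
  qed
  moreover have "d \<cdot> a = \<zero>\<^bsub>cHom C X Y\<^esub>" using at gt i g(2) by (simp add: d_def)
  ultimately have "cat_data.is_kernel K P a Q d Q"
    unfolding cat_data.is_kernel_def using a d P Q by (simp add: PQ K_ob)
  then show ?case by blast
next
  case (4 P Q a)
  obtain X e Y f where PQ: "P = (X, e)" "Q = (Y, f)" by (cases P; cases Q)
  with 4 have P: "idem X e" and Q: "idem Y f" by (auto simp: K_ob)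
  note i = P[unfolded idem_def] Q[unfolded idem_def]
  obtain g where g: "g \<in> chom K (Y, f) (X, e)" "a \<cdot> g = f" using K_epi_split[OF P Q] 4 PQ by blast
  then have gt: "arr g" "src g = Y" "tgt g = X" "e \<cdot> g = g" "g \<cdot> f = g" by (auto simp: K_hom[OF Q P])
  have a: "a \<in> chom K (X, e) (Y, f)" using 4 by (simp add: cat_data.is_epi_def PQ)
  then have at: "arr a" "src a = X" "tgt a = Y" "f \<cdot> a = a" "a \<cdot> e = a" by (auto simp: K_hom[OF P Q])
  \<comment> \<open>Dually, \<open>g \<cdot> a\<close> is complementary to the kernel of
    \<open>a\<close>, and \<open>a\<close> is the cokernel of the projection \<open>d\<close> onto
    that kernel.\<close>
  define d where "d = e \<ominus>\<^bsub>cHom C X X\<^esub> (g \<cdot> a)"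
  have d: "d \<in> chom K (X, e) (X, e)" using at gt i by (simp add: K_hom[OF P P] d_def)
  have aga: "a \<cdot> g \<cdot> a = a"
  proof -
    have "a \<cdot> g \<cdot> a = (a \<cdot> g) \<cdot> a" using at gt by simp
    then show ?thesis by (simp only: g(2) at)
  qed
  have "\<exists>!u. u \<in> chom K (Y, f) W \<and> u \<cdot>\<^bsub>K\<^esub> a = w"
    if W: "W \<in> cob K" and w: "w \<in> chom K (X, e) W" and 0: "w \<cdot>\<^bsub>K\<^esub> d = \<zero>\<^bsub>cHom K (X, e) W\<^esub>" for W w
  proof -
    obtain Z z where WZ: "W = (Z, z)" "idem Z z" using W by (cases W) (auto simp: K_ob)
    have wt: "arr w" "src w = X" "tgt w = Z" "z \<cdot> w = w" "w \<cdot> e = w"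
      using w by (auto simp: WZ K_hom[OF P WZ(2)])
    have "w \<ominus>\<^bsub>cHom C X Z\<^esub> (w \<cdot> g \<cdot> a) = \<zero>\<^bsub>cHom C X Z\<^esub>"
      using 0 wt at gt i by (simp add: WZ d_def)
    then have wga: "w = w \<cdot> g \<cdot> a" using wt at gt by (simp add: minus_eq_zero_iff)
    show ?thesis
    proof (rule ex1I[of _ "w \<cdot> g"])
      show "w \<cdot> g \<in> chom K (Y, f) W \<and> (w \<cdot> g) \<cdot>\<^bsub>K\<^esub> a = w"
        using wga wt gt at i WZ(2) by (simp add: WZ(1) K_hom[OF Q WZ(2)] idem_def)
      fix u assume u: "u \<in> chom K (Y, f) W \<and> u \<cdot>\<^bsub>K\<^esub> a = w"
      then have ut: "arr u" "src u = Y" "tgt u = Z" "u \<cdot> f = u" by (auto simp: WZ(1) K_hom[OF Q WZ(2)])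
      have "w \<cdot> g = (u \<cdot> a) \<cdot> g" using u by simp
      also have "\<dots> = u \<cdot> a \<cdot> g" using ut gt at by simp
      finally show "u = w \<cdot> g" using ut by (simp add: g(2))
    qed
  qed
  moreover have "a \<cdot> d = \<zero>\<^bsub>cHom C X Y\<^esub>" using at gt i aga by (simp add: d_def)
  ultimately have "cat_data.is_cokernel K P d P a Q"
    unfolding cat_data.is_cokernel_def using a d P Q by (simp add: PQ K_ob)
  then show ?case by blast
qed

section \<open>Minimal idempotents and decompositions into simple objects\<close>

lemma K_zero_object: "idem X e \<Longrightarrow> cat_data.zero_object K (X, e) \<longleftrightarrow> e = \<zero>\<^bsub>cHom C X X\<^esub>"
proof
  assume P: "idem X e"
  note i = P[unfolded idem_def]
  {
    assume "cat_data.zero_object K (X, e)"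
    then have "\<exists>!f. f \<in> chom K (X, e) (X, e)" using P by (simp add: cat_data.zero_object_def K_ob)
    moreover have "e \<in> chom K (X, e) (X, e)" "\<zero>\<^bsub>cHom C X X\<^esub> \<in> chom K (X, e) (X, e)"
      using i by (auto simp: K_hom[OF P P])
    ultimately show "e = \<zero>\<^bsub>cHom C X X\<^esub>" by blast
  next
    assume e: "e = \<zero>\<^bsub>cHom C X X\<^esub>"
    have "(\<exists>!f. f \<in> chom K Q (X, e)) \<and> (\<exists>!f. f \<in> chom K (X, e) Q)" if Q': "Q \<in> cob K" for Q
    proof -
      obtain Y f where QY: "Q = (Y, f)" "idem Y f" using Q' by (cases Q) (auto simp: K_ob)
      have Y: "Y \<in> cob C" "arr f" "src f = Y" "tgt f = Y" using QY by (auto simp: idem_def)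
      have "\<exists>!a. a \<in> chom K (Y, f) (X, e)"
      proof (rule ex1I[of _ "\<zero>\<^bsub>cHom C Y X\<^esub>"])
        fix a assume "a \<in> chom K (Y, f) (X, e)"
        then have a: "arr a" "src a = Y" "tgt a = X" "e \<cdot> a = a"
          by (auto simp: K_hom[OF QY(2) P])
        have "e \<cdot> a = \<zero>\<^bsub>cHom C Y X\<^esub>" using a i by (subst e) simp
        then show "a = \<zero>\<^bsub>cHom C Y X\<^esub>" using a by simp
      qed (use i Y in \<open>simp add: K_hom[OF QY(2) P]\<close>)
      moreover have "\<exists>!a. a \<in> chom K (X, e) (Y, f)"
      proof (rule ex1I[of _ "\<zero>\<^bsub>cHom C X Y\<^esub>"])
        fix a assume "a \<in> chom K (X, e) (Y, f)"
        then have a: "arr a" "src a = X" "tgt a = Y" "a \<cdot> e = a"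
          by (auto simp: K_hom[OF P QY(2)])
        have "a \<cdot> e = \<zero>\<^bsub>cHom C X Y\<^esub>" using a i by (subst e) simp
        then show "a = \<zero>\<^bsub>cHom C X Y\<^esub>" using a by simp
      qed (use i Y in \<open>simp add: K_hom[OF P QY(2)]\<close>)
      ultimately show ?thesis by (simp add: QY)
    qed
    then show "cat_data.zero_object K (X, e)" using P by (simp add: cat_data.zero_object_def K_ob)
  }
qed

text \<open>The usual order of idempotents; the objects \<open>(X, q)\<close> with \<open>q\<close>
  below \<open>e\<close> are the direct summands of \<open>(X, e)\<close> carried by
  \<open>X\<close> itself.\<close>

definition below :: "'o \<Rightarrow> 'a \<Rightarrow> 'a \<Rightarrow> bool" where
  "below X e q \<longleftrightarrow> arr q \<and> src q = X \<and> tgt q = X \<and> q \<cdot> q = q \<and> e \<cdot> q = q \<and> q \<cdot> e = q"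

text \<open>A monomorphism \<open>m\<close> into \<open>(X, e)\<close> has a left inverse
  \<open>g\<close>, so \<open>m \<cdot> g\<close> is an idempotent below \<open>e\<close>. By
  minimality it is 0, and then the source is a zero object, or it is \<open>e\<close>, and then
  \<open>m\<close> is invertible.\<close>

lemma minimal_idempotent_simple:
  assumes P: "idem X e" and e0: "e \<noteq> \<zero>\<^bsub>cHom C X X\<^esub>"
    and min: "\<And>q. below X e q \<Longrightarrow> q \<noteq> \<zero>\<^bsub>cHom C X X\<^esub> \<Longrightarrow> q = e"
  shows "cat_data.simple_object K (X, e)"
proof -
  note i = P[unfolded idem_def]
  have "cat_data.zero_object K Q \<or> cat_data.is_iso K Q (X, e) m"
    if Q': "Q \<in> cob K" and m: "cat_data.is_mono K Q (X, e) m" for Q m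
  proof -
    obtain Y f where QY: "Q = (Y, f)" and Q: "idem Y f" using Q' by (cases Q) (auto simp: K_ob)
    note j = Q[unfolded idem_def]
    obtain g where g: "g \<in> chom K (X, e) (Y, f)" "g \<cdot> m = f" using K_mono_split[OF Q P] m QY by blast
    then have gt: "arr g" "src g = X" "tgt g = Y" "f \<cdot> g = g" "g \<cdot> e = g" by (auto simp: K_hom[OF P Q])
    have mh: "m \<in> chom K (Y, f) (X, e)" using m by (simp add: cat_data.is_mono_def QY)
    then have mt: "arr m" "src m = Y" "tgt m = X" "e \<cdot> m = m" "m \<cdot> f = m" by (auto simp: K_hom[OF Q P])
    have gm: "g \<cdot> m \<cdot> r = f \<cdot> r" if "arr r" "tgt r = Y" for r
      using assoc[of r m g] mt gt that g(2) by simp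
    have mg: "below X e (m \<cdot> g)" using mt gt i by (simp add: below_def gm)
    show ?thesis
    proof (cases "m \<cdot> g = \<zero>\<^bsub>cHom C X X\<^esub>")
      case True
      have "f = f \<cdot> f" using j by simp
      also have "\<dots> = g \<cdot> (m \<cdot> g) \<cdot> m" using mt gt j g(2) by (simp add: gm)
      also have "\<dots> = \<zero>\<^bsub>cHom C Y Y\<^esub>" unfolding True using mt gt i j by simp
      finally show ?thesis using K_zero_object[OF Q] by (simp add: QY)
    next
      case False
      then have "m \<cdot> g = e" using min mg by blast
      then have "cat_data.inverse_maps K Q (X, e) m g"
        using mh g by (simp add: cat_data.inverse_maps_def QY)
      then show ?thesis by (auto simp: cat_data.is_iso_def)
    qed
  qed
  then show ?thesis using P e0 by (simp add: cat_data.simple_object_def K_ob K_zero_object)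
qed

text \<open>Compare the right ideals generated by \<open>q\<close> and \<open>e\<close>. If
  \<open>e\<close> were a multiple of \<open>q\<close>, then \<open>q \<cdot> e = e\<close>, whereas
  \<open>q \<cdot> e = q\<close>.\<close>

lemma below_strict:
  assumes e: "idem X e" and q: "below X e q" "q \<noteq> e"
  shows "hdim X X {q \<cdot> z | z. z \<in> chom C X X} < hdim X X {e \<cdot> z | z. z \<in> chom C X X}"
proof -
  note i = e[unfolded idem_def] q(1)[unfolded below_def]
  have "{q \<cdot> z | z. z \<in> chom C X X} \<subset> {e \<cdot> z | z. z \<in> chom C X X}"
  proof
    show "{q \<cdot> z | z. z \<in> chom C X X} \<subseteq> {e \<cdot> z | z. z \<in> chom C X X}"
    proof clarify
      fix z assume z: "z \<in> chom C X X"
      then have "q \<cdot> z = e \<cdot> q \<cdot> z" "q \<cdot> z \<in> chom C X X" using i by (auto simp: hom_iff)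
      then show "\<exists>y. q \<cdot> z = e \<cdot> y \<and> y \<in> chom C X X" by blast
    qed
    have "e \<cdot> cid C X \<in> {e \<cdot> z | z. z \<in> chom C X X}" using i id_closed by blast
    moreover have "e \<notin> {q \<cdot> z | z. z \<in> chom C X X}"
    proof
      assume "e \<in> {q \<cdot> z | z. z \<in> chom C X X}"
      then obtain z where z: "e = q \<cdot> z" "z \<in> chom C X X" by blast
      have "q \<cdot> e = e" using i z(2) by (subst (1 2) z(1)) (simp add: hom_iff)
      then show False using i q(2) by simp
    qed
    ultimately show "{q \<cdot> z | z. z \<in> chom C X X} \<noteq> {e \<cdot> z | z. z \<in> chom C X X}" using i by auto
  qed
  then show ?thesis using i by (intro hdim_strict_mono subspace_right) auto
qed

text \<open>A nonzero idempotent below \<open>e\<close> whose right ideal has least dimension is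
  minimal, because the order is transitive.\<close>

lemma minimal_idempotent_exists:
  assumes e: "idem X e" "e \<noteq> \<zero>\<^bsub>cHom C X X\<^esub>"
  shows "\<exists>q. below X e q \<and> q \<noteq> \<zero>\<^bsub>cHom C X X\<^esub> \<and> cat_data.simple_object K (X, q)"
proof -
  note i = e(1)[unfolded idem_def]
  have ee: "below X e e" using i by (simp add: below_def)
  obtain q where q: "below X e q" "q \<noteq> \<zero>\<^bsub>cHom C X X\<^esub>"
    and min: "\<And>r. below X e r \<Longrightarrow> r \<noteq> \<zero>\<^bsub>cHom C X X\<^esub> \<Longrightarrow>
      hdim X X {q \<cdot> z | z. z \<in> chom C X X} \<le> hdim X X {r \<cdot> z | z. z \<in> chom C X X}"
    using ex_has_least_nat[of "\<lambda>q. below X e q \<and> q \<noteq> \<zero>\<^bsub>cHom C X X\<^esub>" e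
        "\<lambda>q. hdim X X {q \<cdot> z | z. z \<in> chom C X X}"] ee e(2) by blast
  note j = q(1)[unfolded below_def]
  have qi: "idem X q" using i j by (simp add: idem_def)
  have "r = q" if r: "below X q r" "r \<noteq> \<zero>\<^bsub>cHom C X X\<^esub>" for r
  proof (rule ccontr)
    assume "r \<noteq> q"
    note l = r(1)[unfolded below_def]
    have "e \<cdot> r = e \<cdot> q \<cdot> r" using l by simp
    also have "\<dots> = (e \<cdot> q) \<cdot> r" using i j l by (subst assoc) simp_all
    also have "\<dots> = r" using j l by simp
    finally have er: "e \<cdot> r = r" .
    have "r \<cdot> e = (r \<cdot> q) \<cdot> e" using l by simp
    also have "\<dots> = r \<cdot> q \<cdot> e" using i j l by (subst assoc) simp_all
    also have "\<dots> = r" using j l by simp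
    finally have "below X e r" using l er by (simp add: below_def)
    then show False using min r(2) below_strict[OF qi r(1) \<open>r \<noteq> q\<close>] by fastforce
  qed
  then show ?thesis using minimal_idempotent_simple[OF qi q(2)] q by blast
qed

lemma K_hom_mono:
  assumes "idem X e" "idem X d" "e \<cdot> d = d" "d \<cdot> e = d" "idem Y f"
  shows "chom K (Y, f) (X, d) \<subseteq> chom K (Y, f) (X, e)" "chom K (X, d) (Y, f) \<subseteq> chom K (X, e) (Y, f)"
proof -
  note i = assms(1,2,5)[unfolded idem_def]
  show "chom K (Y, f) (X, d) \<subseteq> chom K (Y, f) (X, e)"
  proof
    fix a assume "a \<in> chom K (Y, f) (X, d)"
    then have a: "arr a" "src a = Y" "tgt a = X" "d \<cdot> a = a" "a \<cdot> f = a"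
      by (auto simp: K_hom[OF assms(5,2)])
    have "e \<cdot> a = (e \<cdot> d) \<cdot> a" using a i by simp
    then show "a \<in> chom K (Y, f) (X, e)" using a by (simp add: K_hom[OF assms(5,1)] assms(3))
  qed
  show "chom K (X, d) (Y, f) \<subseteq> chom K (X, e) (Y, f)"
  proof
    fix a assume "a \<in> chom K (X, d) (Y, f)"
    then have a: "arr a" "src a = X" "tgt a = Y" "f \<cdot> a = a" "a \<cdot> d = a"
      by (auto simp: K_hom[OF assms(2,5)])
    have "a \<cdot> e = (a \<cdot> d) \<cdot> e" using a i by simp
    also have "\<dots> = a \<cdot> d \<cdot> e" using a i by (intro assoc) simp_all
    finally show "a \<in> chom K (X, e) (Y, f)" using a by (simp add: K_hom[OF assms(1,5)] assms(4))
  qed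
qed

text \<open>The orthogonal idempotents \<open>q\<close> and \<open>d\<close> add up to
  \<open>e\<close>. Arrows into or out of \<open>(X, d)\<close> are already arrows into or out of
  \<open>(X, e)\<close>, so the structure maps of the given decomposition are kept and
  \<open>q\<close> is put in front as its own injection and projection.\<close>

lemma K_direct_sum_Cons:
  assumes e: "idem X e" and q: "below X e q" and d: "d = e \<ominus>\<^bsub>cHom C X X\<^esub> q"
    and DS: "cat_data.direct_sum K Ss (X, d)"
  shows "cat_data.direct_sum K ((X, q) # Ss) (X, e)"
proof -
  define n where "n = length Ss"
  note i = e[unfolded idem_def] q[unfolded below_def]
  have iq: "idem X q" and id: "idem X d" and ed: "e \<cdot> d = d" "d \<cdot> e = d"
    and qd: "q \<cdot> d = \<zero>\<^bsub>cHom C X X\<^esub>" "d \<cdot> q = \<zero>\<^bsub>cHom C X X\<^esub>"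
    using idem_complement[OF e] i by (auto simp: d)
  note j = id[unfolded idem_def]
  obtain a b where ab: "\<And>l. l < n \<Longrightarrow> a l \<in> chom K (Ss ! l) (X, d) \<and> b l \<in> chom K (X, d) (Ss ! l)"
    and orth: "\<And>l m. l < n \<Longrightarrow> m < n \<Longrightarrow> b l \<cdot>\<^bsub>K\<^esub> a m =
      (if l = m then cid K (Ss ! l) else \<zero>\<^bsub>cHom K (Ss ! m) (Ss ! l)\<^esub>)"
    and tot: "finsum (cHom K (X, d) (X, d)) (\<lambda>l. a l \<cdot>\<^bsub>K\<^esub> b l) {..<n} = d"
    and Ss: "set Ss \<subseteq> cob K"
    using DS unfolding cat_data.direct_sum_def n_def K_simps by blast
  have S: "idem (fst (Ss ! l)) (snd (Ss ! l))" if "l < n" for l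
    using Ss that by (metis K_ob n_def nth_mem prod.collapse subsetD)
  have So: "fst (Ss ! l) \<in> cob C" if "l < n" for l using S[OF that] by (simp add: idem_def)
  have at: "arr (a l)" "src (a l) = fst (Ss ! l)" "tgt (a l) = X" "d \<cdot> a l = a l"
    "arr (b l)" "src (b l) = X" "tgt (b l) = fst (Ss ! l)" "b l \<cdot> d = b l" if "l < n" for l
    using ab[OF that] K_hom[OF S[OF that] id, of "a l"] K_hom[OF id S[OF that], of "b l"] by auto
  define a' where "a' l = (case l of 0 \<Rightarrow> q | Suc m \<Rightarrow> a m)" for l
  define b' where "b' l = (case l of 0 \<Rightarrow> q | Suc m \<Rightarrow> b m)" for l
  have ab': "a' l \<in> chom K (((X, q) # Ss) ! l) (X, e) \<and> b' l \<in> chom K (X, e) (((X, q) # Ss) ! l)"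
    if l: "l < Suc n" for l
  proof (cases l)
    case 0
    then show ?thesis using i by (simp add: a'_def b'_def K_hom[OF iq e] K_hom[OF e iq])
  next
    case (Suc m)
    then have m: "m < n" using l by simp
    show ?thesis using ab[OF m] K_hom_mono[OF e id ed S[OF m]] by (auto simp: Suc a'_def b'_def)
  qed
  have zero: "q \<cdot> a m = \<zero>\<^bsub>cHom C (fst (Ss ! m)) X\<^esub>" "b m \<cdot> q = \<zero>\<^bsub>cHom C X (fst (Ss ! m))\<^esub>" if m: "m < n" for m
  proof -
    have "q \<cdot> a m = q \<cdot> d \<cdot> a m" using at[OF m] by simp
    also have "\<dots> = (q \<cdot> d) \<cdot> a m" using at[OF m] i j by (subst assoc) simp_all
    finally show "q \<cdot> a m = \<zero>\<^bsub>cHom C (fst (Ss ! m)) X\<^esub>" using at[OF m] i by (simp add: qd)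
    have "b m \<cdot> q = (b m \<cdot> d) \<cdot> q" using at[OF m] by simp
    also have "\<dots> = b m \<cdot> d \<cdot> q" using at[OF m] i j by (subst assoc) simp_all
    finally show "b m \<cdot> q = \<zero>\<^bsub>cHom C X (fst (Ss ! m))\<^esub>" using at[OF m] i by (simp add: qd)
  qed
  have orth': "b' l \<cdot>\<^bsub>K\<^esub> a' m = (if l = m then cid K (((X, q) # Ss) ! l)
      else \<zero>\<^bsub>cHom K (((X, q) # Ss) ! m) (((X, q) # Ss) ! l)\<^esub>)" if lm: "l < Suc n" "m < Suc n" for l m
  proof (cases l; cases m)
    assume "l = 0" "m = 0" then show ?thesis using i by (simp add: a'_def b'_def)
  next
    fix m' assume "l = 0" "m = Suc m'"
    then show ?thesis using zero[of m'] lm K_simps(11)[of "fst (Ss ! m')" "snd (Ss ! m')" X q]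
      by (simp add: a'_def b'_def)
  next
    fix l' assume "l = Suc l'" "m = 0"
    then show ?thesis using zero[of l'] lm K_simps(11)[of X q "fst (Ss ! l')" "snd (Ss ! l')"]
      by (simp add: a'_def b'_def)
  next
    fix l' m' assume "l = Suc l'" "m = Suc m'"
    then show ?thesis using orth[of l' m'] lm by (simp add: a'_def b'_def)
  qed
  have in_d: "(\<lambda>l. a l \<cdot> b l) \<in> {..<n} \<rightarrow> chom K (X, d) (X, d)"
    using at j by (auto simp: K_hom[OF id id])
  then have in_C: "(\<lambda>l. a l \<cdot> b l) \<in> {..<n} \<rightarrow> chom C X X"
    using at i by (auto simp: hom_iff)
  have tot': "finsum (cHom K (X, e) (X, e)) (\<lambda>l. a' l \<cdot>\<^bsub>K\<^esub> b' l) {..<Suc n} = e"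
  proof -
    interpret M: module field_ring "cHom C X X" by (rule hom_mod) (use i in simp_all)
    have "(\<lambda>l. a' l \<cdot> b' l) \<in> {..<Suc n} \<rightarrow> chom K (X, e) (X, e)"
    proof
      fix l assume "l \<in> {..<Suc n}"
      then show "a' l \<cdot> b' l \<in> chom K (X, e) (X, e)"
      proof (cases l)
        case 0 then show ?thesis using i by (simp add: a'_def b'_def K_hom[OF e e])
      next
        case (Suc m)
        then have "m < n" using \<open>l \<in> {..<Suc n}\<close> by simp
        then have "a m \<cdot> b m \<in> chom K (X, d) (X, d)" using in_d by blast
        then have "a m \<cdot> b m \<in> chom K (X, e) (X, d)" using K_hom_mono(2)[OF e id ed id] by blast
        then show ?thesis using K_hom_mono(1)[OF e id ed e] by (auto simp: Suc a'_def b'_def)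
      qed
    qed
    then have "finsum (cHom K (X, e) (X, e)) (\<lambda>l. a' l \<cdot> b' l) {..<Suc n} =
        finsum (cHom C X X) (\<lambda>l. a' l \<cdot> b' l) {..<Suc n}"
      by (rule K_finsum[OF e e finite_lessThan])
    also have "\<dots> = (a' 0 \<cdot> b' 0) \<oplus>\<^bsub>cHom C X X\<^esub>
        finsum (cHom C X X) (\<lambda>l. a' l \<cdot> b' l) (Suc ` {..<n})"
      unfolding lessThan_Suc_eq_insert_0
      by (rule M.finsum_insert) (use i in_C in \<open>auto simp: a'_def b'_def hom_iff\<close>)
    also have "finsum (cHom C X X) (\<lambda>l. a' l \<cdot> b' l) (Suc ` {..<n}) =
        finsum (cHom C X X) (\<lambda>l. a' (Suc l) \<cdot> b' (Suc l)) {..<n}"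
      by (rule M.finsum_reindex) (use in_C in \<open>auto simp: a'_def b'_def\<close>)
    also have "\<dots> = finsum (cHom C X X) (\<lambda>l. a l \<cdot> b l) {..<n}" by (simp add: a'_def b'_def)
    also have "\<dots> = d" using K_finsum[OF id id finite_lessThan in_d] tot by simp
    finally show ?thesis using i by (simp add: a'_def b'_def d)
  qed
  show ?thesis
    unfolding cat_data.direct_sum_def using e iq Ss ab' orth' tot'
    by (intro conjI exI[of _ a'] exI[of _ b']) (simp_all add: K_ob n_def)
qed

text \<open>For the orthogonal decomposition of \<open>e\<close> into \<open>d\<close> and
  \<open>q\<close> the idempotents are arrows as well as objects: \<open>d\<close> is the inclusion
  and \<open>q\<close> the projection.\<close>

lemma K_extend:
  assumes e: "idem X e" and q: "below X e q" and d: "d = e \<ominus>\<^bsub>cHom C X X\<^esub> q"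
  shows "cat_data.short_exact K (X, d) d (X, e) q (X, q)"
proof -
  note i = e[unfolded idem_def] q[unfolded below_def]
  have iq: "idem X q" and id: "idem X d" and ed: "e \<cdot> d = d" "d \<cdot> e = d"
    and qd: "q \<cdot> d = \<zero>\<^bsub>cHom C X X\<^esub>" "d \<cdot> q = \<zero>\<^bsub>cHom C X X\<^esub>"
    using idem_complement[OF e] i by (auto simp: d)
  note j = id[unfolded idem_def]
  have dh: "d \<in> chom K (X, d) (X, e)" "q \<in> chom K (X, e) (X, q)"
    using i j ed by (auto simp: K_hom[OF id e] K_hom[OF e iq])
  have "\<exists>!u. u \<in> chom K W (X, d) \<and> d \<cdot>\<^bsub>K\<^esub> u = w"
    if W: "W \<in> cob K" and w: "w \<in> chom K W (X, e)" and 0: "q \<cdot>\<^bsub>K\<^esub> w = \<zero>\<^bsub>cHom K W (X, q)\<^esub>" for W w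
  proof -
    obtain Z z where WZ: "W = (Z, z)" "idem Z z" using W by (cases W) (auto simp: K_ob)
    have wt: "arr w" "src w = Z" "tgt w = X" "e \<cdot> w = w" "w \<cdot> z = w"
      using w by (auto simp: WZ K_hom[OF WZ(2) e])
    have "q \<cdot> w = \<zero>\<^bsub>cHom C Z X\<^esub>" using 0 by (simp add: WZ)
    then have dw: "d \<cdot> w = w" using wt i by (simp add: d)
    show ?thesis
      by (rule ex1I[of _ w]) (use dw wt in \<open>auto simp: WZ(1) K_hom[OF WZ(2) id]\<close>)
  qed
  moreover have "\<exists>!u. u \<in> chom K (X, q) W \<and> u \<cdot>\<^bsub>K\<^esub> q = w"
    if W: "W \<in> cob K" and w: "w \<in> chom K (X, e) W" and 0: "w \<cdot>\<^bsub>K\<^esub> d = \<zero>\<^bsub>cHom K (X, d) W\<^esub>" for W w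
  proof -
    obtain Z z where WZ: "W = (Z, z)" "idem Z z" using W by (cases W) (auto simp: K_ob)
    have wt: "arr w" "src w = X" "tgt w = Z" "z \<cdot> w = w" "w \<cdot> e = w"
      using w by (auto simp: WZ K_hom[OF e WZ(2)])
    have "w \<ominus>\<^bsub>cHom C X Z\<^esub> (w \<cdot> q) = \<zero>\<^bsub>cHom C X Z\<^esub>" using 0 wt i by (simp add: WZ d)
    then have wq: "w \<cdot> q = w" using wt i by (simp add: minus_eq_zero_iff)
    show ?thesis
      by (rule ex1I[of _ w]) (use wq wt in \<open>auto simp: WZ(1) K_hom[OF iq WZ(2)]\<close>)
  qed
  ultimately show ?thesis
    unfolding cat_data.short_exact_def cat_data.is_kernel_def cat_data.is_cokernel_def
    using e iq id dh qd by (simp add: K_ob)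
qed

text \<open>Split off a minimal idempotent and continue with its complement, whose right ideal is
  smaller. The same splitting extends the composition series and the list of simple
  summands.\<close>

lemma K_semisimple:
  "idem X e \<Longrightarrow> cat_data.finite_length K (X, e) \<and>
    (\<exists>Ss. (\<forall>S\<in>set Ss. cat_data.simple_object K S) \<and> cat_data.direct_sum K Ss (X, e))"
proof (induction "hdim X X {e \<cdot> z | z. z \<in> chom C X X}" arbitrary: e rule: less_induct)
  case less
  note e = less.prems
  note i = e[unfolded idem_def]
  show ?case
  proof (cases "e = \<zero>\<^bsub>cHom C X X\<^esub>")
    case True
    interpret N: module field_ring "cHom K (X, e) (X, e)" using e by (intro K_mod)
    have "cat_data.finite_length K (X, e)"
      by (rule cat_data.finite_length.zero) (use K_zero_object[OF e] True in blast)
    \<comment> \<open>An empty biproduct has no structure maps, so any functions can be given for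
      them.\<close>
    moreover have "cat_data.direct_sum K [] (X, e)"
      unfolding cat_data.direct_sum_def
      by (intro conjI exI[of _ undefined]) (use e N.finsum_empty True in \<open>simp_all add: K_ob\<close>)
    ultimately show ?thesis by (metis empty_iff empty_set)
  next
    case False
    obtain q where q: "below X e q" "q \<noteq> \<zero>\<^bsub>cHom C X X\<^esub>" "cat_data.simple_object K (X, q)"
      using minimal_idempotent_exists[OF e False] by blast
    note j = q(1)[unfolded below_def]
    define d where "d = e \<ominus>\<^bsub>cHom C X X\<^esub> q"
    have d: "idem X d" "e \<cdot> d = d" "d \<cdot> e = d" "q \<cdot> d = \<zero>\<^bsub>cHom C X X\<^esub>"
      using idem_complement[OF e] j by (auto simp: d_def)
    have "below X e d" using d by (simp add: below_def idem_def)
    moreover have "d \<noteq> e" using d(4) q(2) j by auto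
    ultimately have "cat_data.finite_length K (X, d) \<and>
        (\<exists>Ss. (\<forall>S\<in>set Ss. cat_data.simple_object K S) \<and> cat_data.direct_sum K Ss (X, d))"
      by (intro less.hyps below_strict e d(1))
    then obtain Ss where IH: "cat_data.finite_length K (X, d)" "\<forall>S\<in>set Ss. cat_data.simple_object K S"
      "cat_data.direct_sum K Ss (X, d)" by blast
    have "cat_data.finite_length K (X, e)"
      by (rule cat_data.finite_length.extend[OF IH(1) K_extend[OF e q(1) d_def] q(3)])
    moreover have "cat_data.direct_sum K ((X, q) # Ss) (X, e)"
      by (rule K_direct_sum_Cons[OF e q(1) d_def IH(3)])
    ultimately show ?thesis using IH(2) q(3) by (metis set_ConsD)
  qed
qed

theorem karoubi_semisimple:
  assumes unit: "bij_betw (\<lambda>c. c \<odot>\<^bsub>cHom C (cunit C) (cunit C)\<^esub> cid C (cunit C)) UNIV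
      (chom C (cunit C) (cunit C))"
    and dual: "\<And>X e. idem X e \<Longrightarrow> \<exists>Q. cat_data.is_dual K (X, e) Q"
  shows "semisimple_pre_tannakian K"
proof -
  let ?I = "cunit C"
  let ?i = "cid C ?I"
  have id1: "idem ?I ?i" by (rule idem_id) simp
  have homK: "chom K (?I, ?i) (?I, ?i) = chom C ?I ?I"
    by (auto simp: K_hom[OF id1 id1] hom_iff)
  have inj: "c = c'" if "c \<odot>\<^bsub>cHom C ?I ?I\<^esub> ?i = c' \<odot>\<^bsub>cHom C ?I ?I\<^esub> ?i" for c c'
    using unit that by (auto simp: bij_betw_def inj_on_def)
  have zero: "0 \<odot>\<^bsub>cHom C ?I ?I\<^esub> ?i = \<zero>\<^bsub>cHom C ?I ?I\<^esub>" by (rule zero_smult) simp_all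
  interpret M: module field_ring "cHom C ?I ?I" by (intro hom_mod) simp_all
  have one: "1 \<odot>\<^bsub>cHom C ?I ?I\<^esub> ?i = ?i" using M.smult_one[of ?i] id_closed by simp
  \<comment> \<open>Endomorphisms of the unit are scalars, and an idempotent scalar is 0 or 1; hence
    the identity is a minimal idempotent.\<close>
  have simple: "cat_data.simple_object K (?I, ?i)"
  proof (rule minimal_idempotent_simple[OF id1])
    show "?i \<noteq> \<zero>\<^bsub>cHom C ?I ?I\<^esub>" using inj[of 1 0] zero one by auto
    fix q assume q: "below ?I ?i q" "q \<noteq> \<zero>\<^bsub>cHom C ?I ?I\<^esub>"
    note j = q(1)[unfolded below_def]
    have "q \<in> chom C ?I ?I" using j by (simp add: hom_iff)
    then obtain c where c: "q = c \<odot>\<^bsub>cHom C ?I ?I\<^esub> ?i" using unit by (auto simp: bij_betw_def)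
    have "c \<odot>\<^bsub>cHom C ?I ?I\<^esub> q = (c \<odot>\<^bsub>cHom C ?I ?I\<^esub> ?i) \<cdot> q" using j by simp
    also have "\<dots> = q" using j by (simp only: c[symmetric])
    finally have "(c * c) \<odot>\<^bsub>cHom C ?I ?I\<^esub> ?i = c \<odot>\<^bsub>cHom C ?I ?I\<^esub> ?i"
      using M.smult_assoc1[of c c ?i] id_closed by (simp add: c)
    then have "c * c = c" by (rule inj)
    then have "c = 0 \<or> c = 1" by simp
    then show "q = ?i" using q(2) zero one c by auto
  qed
  show ?thesis
  proof (intro semisimple_pre_tannakian.intro semisimple_pre_tannakian_axioms.intro pre_tannakian.intro
      karoubi_tensor karoubi_abelian pre_tannakian_axioms.intro, goal_cases)
    case (1 P)
    then show ?case using K_semisimple by (cases P) (auto simp: K_ob)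
  next
    case (2 P Q)
    obtain X e Y f where PQ: "P = (X, e)" "Q = (Y, f)" by (cases P; cases Q)
    with 2 have P: "idem X e" and Q: "idem Y f" by (auto simp: K_ob)
    have XY: "X \<in> cob C" "Y \<in> cob C" using P Q by (auto simp: idem_def)
    obtain n \<phi> where c: "coordinates (cHom C X Y) n \<phi>" using coords[OF XY] by blast
    have sub: "chom K (X, e) (Y, f) \<subseteq> chom C X Y" by (auto simp: karoubi_def)
    have "coordinates (cHom K (X, e) (Y, f)) n \<phi>"
      using c sub inj_on_subset[of \<phi> "chom C X Y", OF _ sub] by (simp add: coordinates_def subset_iff)
    from finite_spanning_set[OF K_mod[OF P Q] this] show ?case
      by (simp add: cat_data.fin_dim_hom_def PQ)
  next
    case 3
    then show ?case using simple by simp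
  next
    case 4
    then show ?case using unit by (simp add: homK)
  next
    case (5 P)
    then show ?case using dual by (cases P) (simp add: K_ob)
  next
    case (6 P)
    then show ?case using K_semisimple by (cases P) (auto simp: K_ob)
  qed
qed

end

section \<open>The automorphism group\<close>

lemma finite_image_factor:
  assumes "finite (p ` S)" "\<And>x y. x \<in> S \<Longrightarrow> y \<in> S \<Longrightarrow> p x = p y \<Longrightarrow> q x = q y"
  shows "finite (q ` S)"
proof -
  have "q ` S \<subseteq> (\<lambda>c. q (SOME x. x \<in> S \<and> p x = c)) ` p ` S"
  proof
    fix z assume "z \<in> q ` S"
    then obtain x where x: "x \<in> S" "z = q x" by blast
    have "(SOME y. y \<in> S \<and> p y = p x) \<in> S \<and> p (SOME y. y \<in> S \<and> p y = p x) = p x"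
      by (rule someI[of _ x]) (use x in simp)
    then have "z = q (SOME y. y \<in> S \<and> p y = p x)" using assms(2)[OF x(1)] x(2) by auto
    then show "z \<in> (\<lambda>c. q (SOME x. x \<in> S \<and> p x = c)) ` p ` S" using x(1) by blast
  qed
  then show ?thesis using assms(1) by (meson finite_imageI finite_subset)
qed

lemma perm_grp_simps [simp]:
  "carrier (perm_grp U) = U" "x \<otimes>\<^bsub>perm_grp U\<^esub> y = x \<circ> y" "\<one>\<^bsub>perm_grp U\<^esub> = id"
  by (simp_all add: perm_grp_def)

lemma stabilizer_perm_grp: "stabilizer (perm_grp U) \<phi> x = {g \<in> U. \<phi> g x = x}"
  by (simp add: stabilizer_def)

lemma orbit_perm_grp: "orbit (perm_grp U) \<phi> x = (\<lambda>g. \<phi> g x) ` U"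
  by (auto simp: orbit_def)

abbreviation (input) pinv :: "('a \<Rightarrow> 'b) \<Rightarrow> 'b \<Rightarrow> 'a" where "pinv \<equiv> inv_into UNIV"

definition perm_closed :: "('w \<Rightarrow> 'w) set \<Rightarrow> bool" where
  "perm_closed U \<longleftrightarrow> id \<in> U \<and> (\<forall>g\<in>U. bij g \<and> pinv g \<in> U) \<and> (\<forall>g\<in>U. \<forall>h\<in>U. g \<circ> h \<in> U)"

lemma perm_closed_group: assumes "perm_closed U" shows "group (perm_grp U)"
proof (rule groupI)
  fix x assume "x \<in> carrier (perm_grp U)"
  then have "pinv x \<in> U \<and> pinv x \<circ> x = id" using assms by (auto simp: perm_closed_def bij_def)
  then show "\<exists>y\<in>carrier (perm_grp U). y \<otimes>\<^bsub>perm_grp U\<^esub> x = \<one>\<^bsub>perm_grp U\<^esub>" by auto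
qed (use assms in \<open>auto simp: perm_closed_def comp_assoc\<close>)

lemma perm_closed_inv:
  assumes U: "perm_closed U" and g: "g \<in> U" shows "inv\<^bsub>perm_grp U\<^esub> g = pinv g"
proof -
  interpret group "perm_grp U" by (rule perm_closed_group[OF U])
  have "pinv g \<circ> g = id" "pinv g \<in> U" using U g by (auto simp: perm_closed_def bij_def)
  then show ?thesis using inv_equality[of "pinv g" g] g by simp
qed

lemma perm_closed_subgroup:
  assumes "perm_closed G" shows "subgroup U (perm_grp G) \<longleftrightarrow> U \<subseteq> G \<and> perm_closed U"
proof
  assume U: "subgroup U (perm_grp G)"
  interpret G: group "perm_grp G" by (rule perm_closed_group[OF assms])
  have sub: "U \<subseteq> G" using subgroup.subset[OF U] by simp
  moreover have "bij g \<and> pinv g \<in> U" if "g \<in> U" for g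
  proof -
    have "g \<in> G" using sub that by blast
    then show ?thesis using assms that subgroup.m_inv_closed[OF U that] perm_closed_inv[OF assms]
      by (auto simp: perm_closed_def)
  qed
  ultimately show "U \<subseteq> G \<and> perm_closed U"
    using subgroup.one_closed[OF U] subgroup.m_closed[OF U] by (auto simp: perm_closed_def)
next
  assume U: "U \<subseteq> G \<and> perm_closed U"
  interpret G: group "perm_grp G" by (rule perm_closed_group[OF assms])
  show "subgroup U (perm_grp G)"
  proof (rule G.subgroupI)
    fix g assume "g \<in> U"
    then show "inv\<^bsub>perm_grp G\<^esub> g \<in> U"
      using U perm_closed_inv[OF assms, of g] by (auto simp: perm_closed_def)
  qed (use U in \<open>auto simp: perm_closed_def\<close>)
qed

lemma group_action_perm_grp:
  assumes U: "perm_closed U"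
    and closed: "\<And>h x. h \<in> U \<Longrightarrow> x \<in> S \<Longrightarrow> \<phi> h x \<in> S"
    and ext: "\<And>h. h \<in> U \<Longrightarrow> \<phi> h \<in> extensional S"
    and one: "\<And>x. x \<in> S \<Longrightarrow> \<phi> id x = x"
    and comp: "\<And>g h x. g \<in> U \<Longrightarrow> h \<in> U \<Longrightarrow> x \<in> S \<Longrightarrow> \<phi> (g \<circ> h) x = \<phi> g (\<phi> h x)"
  shows "group_action (perm_grp U) S \<phi>"
proof -
  have bij: "\<phi> h \<in> Bij S" if h: "h \<in> U" for h
  proof -
    have h': "pinv h \<in> U" "h \<circ> pinv h = id" "pinv h \<circ> h = id"
      using U h by (auto simp: perm_closed_def bij_def surj_iff)
    have "bij_betw (\<phi> h) S S"
    proof (rule bij_betwI[of _ _ _ "\<phi> (pinv h)"])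
      fix x assume x: "x \<in> S"
      show "\<phi> (pinv h) (\<phi> h x) = x" using comp[OF h'(1) h x] one[OF x] h' by simp
      show "\<phi> h (\<phi> (pinv h) x) = x" using comp[OF h h'(1) x] one[OF x] h' by simp
    qed (use closed h h' in auto)
    then show ?thesis using ext[OF h] by (simp add: Bij_def)
  qed
  have "\<phi> \<in> hom (perm_grp U) (BijGroup S)"
  proof (rule homI)
    fix g h assume "g \<in> carrier (perm_grp U)" "h \<in> carrier (perm_grp U)"
    then have gh: "g \<in> U" "h \<in> U" by auto
    then have "g \<circ> h \<in> U" using U by (auto simp: perm_closed_def)
    have "\<phi> (g \<circ> h) = compose S (\<phi> g) (\<phi> h)"
    proof (rule extensionalityI[of _ S])
      show "\<phi> (g \<circ> h) \<in> extensional S" by (rule ext) fact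
      show "compose S (\<phi> g) (\<phi> h) \<in> extensional S" by (rule compose_extensional)
    qed (simp add: compose_eq comp[OF gh])
    then show "\<phi> (g \<otimes>\<^bsub>perm_grp U\<^esub> h) = \<phi> g \<otimes>\<^bsub>BijGroup S\<^esub> \<phi> h"
      using bij gh by (simp add: BijGroup_def)
  qed (use bij in \<open>auto simp: BijGroup_def\<close>)
  then show ?thesis
    using perm_closed_group[OF U] group_BijGroup[of S]
    by (intro group_action.intro) (simp add: group_hom_def group_hom_axioms_def)
qed

text \<open>The map \<open>\<kappa>\<close> is a name for \<open>of_Z_sixth\<close>; as a parameter
  it ties the field \<open>'k\<close> to the locale.\<close>

locale mu_one =
  fixes R :: "'w \<Rightarrow> 'w \<Rightarrow> 'w \<Rightarrow> 'w \<Rightarrow> bool"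
    and \<mu> :: "('w, 'a univ) gset \<Rightarrow> rat"
    and \<kappa> :: "rat \<Rightarrow> 'k::field"
  assumes limit: "boron_fraisse_limit R"
    and mu: "is_mu1 R \<mu>"
    and kappa: "\<kappa> = of_Z_sixth"
    and char2: "CHAR('k) \<noteq> 2" and char3: "CHAR('k) \<noteq> 3"
begin

abbreviation "G \<equiv> aut R"
abbreviation "E \<equiv> stab_class (aut R)"
abbreviation stab :: "'w set \<Rightarrow> ('w \<Rightarrow> 'w) set" where "stab \<equiv> pstab (aut R)"

lemma aut_iff: "g \<in> G \<longleftrightarrow> bij g \<and> (\<forall>w x y z. R (g w) (g x) (g y) (g z) \<longleftrightarrow> R w x y z)"
  by (auto simp: aut_def rel_iso_def)

lemma G_closed: "perm_closed G"
  unfolding perm_closed_def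
proof (intro conjI ballI)
  show "id \<in> G" by (simp add: aut_iff)
  fix g assume g: "g \<in> G"
  show "bij g" using g by (simp add: aut_iff)
  show "pinv g \<in> G"
    unfolding aut_iff
  proof (intro conjI allI)
    show "bij (pinv g)" using \<open>bij g\<close> by (rule bij_imp_bij_inv)
    fix w x y z
    have "g (pinv g u) = u" for u using \<open>bij g\<close> by (simp add: bij_is_surj surj_f_inv_f)
    then show "R (pinv g w) (pinv g x) (pinv g y) (pinv g z) \<longleftrightarrow> R w x y z"
      using g unfolding aut_iff by metis
  qed
  fix h assume "h \<in> G"
  then show "g \<circ> h \<in> G" using g by (auto simp: aut_iff bij_comp)
qed

lemma G_id: "id \<in> G" and G_comp: "g \<in> G \<Longrightarrow> h \<in> G \<Longrightarrow> g \<circ> h \<in> G" and G_inv: "g \<in> G \<Longrightarrow> pinv g \<in> G"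
  and G_bij: "g \<in> G \<Longrightarrow> bij g"
  using G_closed by (auto simp: perm_closed_def)

lemma inv_cancel: "g \<in> G \<Longrightarrow> pinv g \<circ> g = id" "g \<in> G \<Longrightarrow> g \<circ> pinv g = id"
  "g \<in> G \<Longrightarrow> pinv g (g w) = w" "g \<in> G \<Longrightarrow> g (pinv g w) = w"
  using G_bij[of g] by (auto simp: bij_def surj_iff surj_f_inv_f)

lemma stab_iff: "g \<in> stab A \<longleftrightarrow> g \<in> G \<and> (\<forall>a\<in>A. g a = a)"
  by (simp add: pstab_def)

lemma stab_sub: "stab A \<subseteq> G" by (auto simp: stab_iff)

lemma stab_empty [simp]: "stab {} = G" by (auto simp: stab_iff)

lemma stab_Un: "stab (A \<union> B) = stab A \<inter> stab B" by (auto simp: stab_iff)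

lemma stab_closed: "perm_closed (stab A)"
  unfolding perm_closed_def
proof (intro conjI ballI)
  show "id \<in> stab A" by (simp add: stab_iff G_id)
  fix g assume g: "g \<in> stab A"
  then have "g \<in> G" by (simp add: stab_iff)
  then show "bij g" by (rule G_bij)
  have "pinv g a = a" if "a \<in> A" for a using inv_cancel(3)[OF \<open>g \<in> G\<close>, of a] g that by (simp add: stab_iff)
  then show "pinv g \<in> stab A" using \<open>g \<in> G\<close> by (simp add: stab_iff G_inv)
  fix h assume "h \<in> stab A"
  then show "g \<circ> h \<in> stab A" using g by (auto simp: stab_iff G_comp)
qed

lemma stab_id: "id \<in> stab A" and stab_comp: "g \<in> stab A \<Longrightarrow> h \<in> stab A \<Longrightarrow> g \<circ> h \<in> stab A"
  and stab_inv: "g \<in> stab A \<Longrightarrow> pinv g \<in> stab A"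
  using stab_closed[of A] by (auto simp: perm_closed_def)

lemma open_iff: "open_subgroup G U \<longleftrightarrow> U \<subseteq> G \<and> perm_closed U \<and> (\<exists>A. finite A \<and> stab A \<subseteq> U)"
  by (auto simp: open_subgroup_def perm_closed_subgroup[OF G_closed])

lemma open_stab: "finite A \<Longrightarrow> open_subgroup G (stab A)"
  using stab_sub stab_closed by (auto simp: open_iff)

lemma open_G: "open_subgroup G G" using open_stab[of "{}"] by simp

lemma perm_closed_Int: "perm_closed U \<Longrightarrow> perm_closed V \<Longrightarrow> perm_closed (U \<inter> V)"
  by (auto simp: perm_closed_def)

lemma open_Int: assumes "open_subgroup G U" "open_subgroup G V" shows "open_subgroup G (U \<inter> V)"
proof -
  obtain A B where "finite A" "stab A \<subseteq> U" "finite B" "stab B \<subseteq> V" using assms by (auto simp: open_iff)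
  then have "finite (A \<union> B)" "stab (A \<union> B) \<subseteq> U \<inter> V" by (auto simp: stab_Un)
  then show ?thesis using assms unfolding open_iff by (blast intro: perm_closed_Int)
qed

lemma stab_class_iff: "V \<in> E \<longleftrightarrow> (\<exists>A. finite A \<and> V = stab A)"
  by (auto simp: stab_class_def)

lemma stab_in_class: "finite A \<Longrightarrow> stab A \<in> E"
  by (auto simp: stab_class_iff)

section \<open>Orbits\<close>

definition orb :: "(('w \<Rightarrow> 'w) \<Rightarrow> 'x \<Rightarrow> 'x) \<Rightarrow> 'w set \<Rightarrow> 'x \<Rightarrow> 'x set" where
  "orb a A x = (\<lambda>g. a g x) ` stab A"

text \<open>Equal patterns of coincidences make the map of entries well defined and injective, and
  equal patterns of \<open>R\<close> make it an isomorphism of finite substructures. Homogeneity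
  extends it.\<close>

lemma tuple_homogeneous:
  assumes len: "length t = length t'"
    and eq: "\<And>i j. i < length t \<Longrightarrow> j < length t \<Longrightarrow> t ! i = t ! j \<longleftrightarrow> t' ! i = t' ! j"
    and rel: "\<And>i j k l. i < length t \<Longrightarrow> j < length t \<Longrightarrow> k < length t \<Longrightarrow> l < length t \<Longrightarrow>
      R (t ! i) (t ! j) (t ! k) (t ! l) \<longleftrightarrow> R (t' ! i) (t' ! j) (t' ! k) (t' ! l)"
  shows "\<exists>h\<in>G. \<forall>i<length t. h (t ! i) = t' ! i"
proof -
  define f where "f x = t' ! (SOME i. i < length t \<and> t ! i = x)" for x
  have f: "f (t ! i) = t' ! i" if i: "i < length t" for i
  proof -
    have "(SOME j. j < length t \<and> t ! j = t ! i) < length t \<and> t ! (SOME j. j < length t \<and> t ! j = t ! i) = t ! i"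
      by (rule someI[of _ i]) (use i in simp)
    then show ?thesis using eq i by (auto simp: f_def)
  qed
  have "inj_on f (set t)" by (auto simp: inj_on_def in_set_conv_nth f eq)
  moreover have "f ` set t = set t'" using f len by (force simp: in_set_conv_nth)
  moreover have "R w x y z \<longleftrightarrow> R (f w) (f x) (f y) (f z)"
    if wxyz: "w \<in> set t" "x \<in> set t" "y \<in> set t" "z \<in> set t" for w x y z
  proof -
    obtain i j k l where "i < length t" "j < length t" "k < length t" "l < length t"
      "w = t ! i" "x = t ! j" "y = t ! k" "z = t ! l" using wxyz by (metis in_set_conv_nth)
    then show ?thesis using rel f by simp
  qed
  ultimately have "rel_iso f (set t) R (set t') R" by (simp add: rel_iso_def bij_betw_def)
  then obtain h where "h \<in> G" "\<forall>a\<in>set t. h a = f a"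
    using limit unfolding boron_fraisse_limit_def by (meson List.finite_set)
  then show ?thesis using f by (intro bexI[of _ h]) auto
qed

text \<open>The orbit of \<open>g x\<close> under \<open>stab A\<close> depends only on the
  isomorphism type of the tuple that enumerates \<open>A\<close> and the translate of
  \<open>B\<close> by \<open>g\<close>. A tuple of fixed length has only finitely many
  types.\<close>

lemma oligomorphic:
  assumes A: "finite A" and B: "finite B"
    and act: "\<And>g h. g \<in> G \<Longrightarrow> h \<in> G \<Longrightarrow> a (g \<circ> h) x = a g (a h x)"
    and fixed: "\<And>g. g \<in> stab B \<Longrightarrow> a g x = x"
  shows "finite ((\<lambda>g. orb a A (a g x)) ` G)"
proof -
  obtain al bl where al: "set al = A" and bl: "set bl = B" using A B finite_list by metis
  define t where "t g = al @ map g bl" for g :: "'w \<Rightarrow> 'w"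
  define n where "n = length al + length bl"
  have len: "length (t g) = n" for g by (simp add: t_def n_def)
  \<comment> \<open>The isomorphism type of the tuple: which entries coincide and which quadruples
    are related.\<close>
  define p where "p g = ({(i, j). i < n \<and> j < n \<and> t g ! i = t g ! j},
    {(i, j, k, l). i < n \<and> j < n \<and> k < n \<and> l < n \<and> R (t g ! i) (t g ! j) (t g ! k) (t g ! l)})" for g
  have "p ` G \<subseteq> Pow ({..<n} \<times> {..<n}) \<times> Pow ({..<n} \<times> {..<n} \<times> {..<n} \<times> {..<n})"
    by (auto simp: p_def)
  then have "finite (p ` G)" by (rule finite_subset) simp
  then show ?thesis
  proof (rule finite_image_factor)
    fix g g' assume g: "g \<in> G" and g': "g' \<in> G" and eq: "p g = p g'"
    have "\<exists>h\<in>G. \<forall>i<length (t g). h (t g ! i) = t g' ! i"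
    proof (rule tuple_homogeneous)
      fix i j k l assume ij: "i < length (t g)" "j < length (t g)"
      have "(i, j) \<in> fst (p g) \<longleftrightarrow> (i, j) \<in> fst (p g')" by (simp only: eq)
      then show "t g ! i = t g ! j \<longleftrightarrow> t g' ! i = t g' ! j" using ij by (simp add: p_def len)
      assume kl: "k < length (t g)" "l < length (t g)"
      have "(i, j, k, l) \<in> snd (p g) \<longleftrightarrow> (i, j, k, l) \<in> snd (p g')" by (simp only: eq)
      then show "R (t g ! i) (t g ! j) (t g ! k) (t g ! l) \<longleftrightarrow> R (t g' ! i) (t g' ! j) (t g' ! k) (t g' ! l)"
        using ij kl by (simp add: p_def len)
    qed (simp add: len)
    then obtain h where h: "h \<in> G" "\<And>i. i < n \<Longrightarrow> h (t g ! i) = t g' ! i" by (auto simp: len)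
    have "map h (t g) = t g'" using h(2) by (intro nth_equalityI) (auto simp: len)
    then have m: "map h al = map (\<lambda>x. x) al" "map (h \<circ> g) bl = map g' bl" by (simp_all add: t_def)
    then have hA: "h \<in> stab A" and hg: "\<And>b. b \<in> B \<Longrightarrow> h (g b) = g' b"
      using h(1) al bl unfolding map_eq_conv by (simp_all add: stab_iff)
    \<comment> \<open>On \<open>B\<close> the maps \<open>h \<circ> g\<close> and \<open>g'\<close>
      agree, so they differ by an element fixing \<open>x\<close>.\<close>
    have "pinv g' \<circ> (h \<circ> g) \<in> stab B"
      using h(1) g g' hg inv_cancel(3)[OF g'] by (auto simp: stab_iff G_comp G_inv)
    then have "a (pinv g' \<circ> (h \<circ> g)) x = x" by (rule fixed)
    then have "a g' (a (pinv g' \<circ> (h \<circ> g)) x) = a g' x" by simp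
    moreover have "g' \<circ> (pinv g' \<circ> (h \<circ> g)) = h \<circ> g"
      using inv_cancel(2)[OF g'] by (simp add: o_assoc)
    ultimately have hgx: "a h (a g x) = a g' x"
      using act[of g' "pinv g' \<circ> (h \<circ> g)"] act[of h g] g g' h(1) by (simp add: G_comp G_inv)
    show "orb a A (a g x) = orb a A (a g' x)"
    proof
      show "orb a A (a g' x) \<subseteq> orb a A (a g x)"
      proof
        fix y assume "y \<in> orb a A (a g' x)"
        then obtain k where k: "k \<in> stab A" "y = a k (a g' x)" by (auto simp: orb_def)
        have "y = a k (a (h \<circ> g) x)" using k hgx act[of h g] g h(1) by simp
        also have "\<dots> = a (k \<circ> (h \<circ> g)) x" using act[of k "h \<circ> g"] k g h(1) by (simp add: stab_iff G_comp)
        also have "\<dots> = a ((k \<circ> h) \<circ> g) x" by (simp add: o_assoc)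
        also have "\<dots> = a (k \<circ> h) (a g x)" using act[of "k \<circ> h" g] k g h(1) by (simp add: stab_iff G_comp)
        finally show "y \<in> orb a A (a g x)" using stab_comp[OF k(1) hA] by (auto simp: orb_def)
      qed
      show "orb a A (a g x) \<subseteq> orb a A (a g' x)"
      proof
        fix y assume "y \<in> orb a A (a g x)"
        then obtain k where k: "k \<in> stab A" "y = a k (a g x)" by (auto simp: orb_def)
        have "(k \<circ> pinv h) \<circ> (h \<circ> g) = k \<circ> g"
          using inv_cancel(1)[OF h(1)] by (simp add: o_assoc[symmetric]) (simp add: o_assoc)
        then have "a (k \<circ> pinv h) (a (h \<circ> g) x) = a (k \<circ> g) x"
          using act[of "k \<circ> pinv h" "h \<circ> g"] k g h(1) by (simp add: stab_iff G_comp G_inv)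
        moreover have "a (k \<circ> g) x = y" using act[of k g] k g by (simp add: stab_iff)
        ultimately have "y = a (k \<circ> pinv h) (a g' x)" using act[of h g] g h(1) hgx by simp
        moreover have "k \<circ> pinv h \<in> stab A" using stab_comp[OF k(1) stab_inv[OF hA]] .
        ultimately show "y \<in> orb a A (a g' x)" by (auto simp: orb_def)
      qed
    qed
  qed
qed

text \<open>Smoothness with respect to pointwise stabilizers, made explicit: the function
  \<open>s\<close> gives each point a finite support, and the stabilizer of the point consists of
  the elements of \<open>U\<close> that fix this support pointwise.\<close>

definition acts :: "('w \<Rightarrow> 'w) set \<Rightarrow> 'x set \<Rightarrow> (('w \<Rightarrow> 'w) \<Rightarrow> 'x \<Rightarrow> 'x) \<Rightarrow> ('x \<Rightarrow> 'w set) \<Rightarrow> bool" where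
  "acts U X a s \<longleftrightarrow> (\<forall>h\<in>U. \<forall>x\<in>X. a h x \<in> X) \<and> (\<forall>x\<in>X. a id x = x) \<and>
     (\<forall>g\<in>U. \<forall>h\<in>U. \<forall>x\<in>X. a (g \<circ> h) x = a g (a h x)) \<and>
     (\<forall>x\<in>X. finite (s x) \<and> (\<forall>h\<in>U. a h x = x \<longleftrightarrow> (\<forall>w\<in>s x. h w = w)))"

lemma actsD:
  assumes "acts U X a s"
  shows "h \<in> U \<Longrightarrow> x \<in> X \<Longrightarrow> a h x \<in> X" "x \<in> X \<Longrightarrow> a id x = x"
    "g \<in> U \<Longrightarrow> h \<in> U \<Longrightarrow> x \<in> X \<Longrightarrow> a (g \<circ> h) x = a g (a h x)"
    "x \<in> X \<Longrightarrow> finite (s x)" "h \<in> U \<Longrightarrow> x \<in> X \<Longrightarrow> a h x = x \<longleftrightarrow> (\<forall>w\<in>s x. h w = w)"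
  using assms by (auto simp: acts_def)

lemma acts_subset: "acts U X a s \<Longrightarrow> V \<subseteq> U \<Longrightarrow> Y \<subseteq> X \<Longrightarrow> (\<And>h x. h \<in> V \<Longrightarrow> x \<in> Y \<Longrightarrow> a h x \<in> Y) \<Longrightarrow> acts V Y a s"
  unfolding acts_def by (meson subsetD)

lemma acts_restrict: "acts U X a s \<Longrightarrow> acts U X (\<lambda>h. restrict (a h) X) s"
  unfolding acts_def by auto

lemma orb_self: "acts (stab A) X a s \<Longrightarrow> x \<in> X \<Longrightarrow> x \<in> orb a A x"
  using stab_id by (force simp: orb_def acts_def)

lemma orb_eq:
  assumes a: "acts (stab A) X a s" and x: "x \<in> X" and y: "y \<in> orb a A x" shows "orb a A y = orb a A x"
proof -
  obtain g where g: "g \<in> stab A" "y = a g x" using y by (auto simp: orb_def)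
  have gi: "pinv g \<in> stab A" "pinv g \<circ> g = id" using g stab_inv inv_cancel by (auto simp: stab_iff)
  have "a h y = a (h \<circ> g) x" if "h \<in> stab A" for h using actsD(3)[OF a that g(1) x] g by simp
  moreover have "a h x = a (h \<circ> pinv g) y" if "h \<in> stab A" for h
  proof -
    have "a (h \<circ> pinv g) (a g x) = a ((h \<circ> pinv g) \<circ> g) x"
      using actsD(3)[OF a stab_comp[OF that gi(1)] g(1) x] by simp
    also have "(h \<circ> pinv g) \<circ> g = h" using gi by (simp add: o_assoc[symmetric])
    finally show ?thesis unfolding g(2) by (rule sym)
  qed
  ultimately show ?thesis
    unfolding orb_def using stab_comp[OF _ g(1)] stab_comp[OF _ gi(1)] by (auto simp: image_iff) metis+
qed

lemma orb_sub: "acts (stab A) X a s \<Longrightarrow> x \<in> X \<Longrightarrow> orb a A x \<subseteq> X"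
  by (auto simp: orb_def actsD(1))

text \<open>A sufficient condition for \<open>fin_smooth_hat\<close> that is easy to verify.
  Finitely many orbits are required already for some \<open>stab A\<close> inside the group of
  definition, which gives finitely many orbits for the group itself.\<close>

definition good :: "('w, 'x) gset \<Rightarrow> ('x \<Rightarrow> 'w set) \<Rightarrow> bool" where
  "good Z s \<longleftrightarrow> open_subgroup G (grp Z) \<and> acts (grp Z) (pts Z) (act Z) s \<and>
     (\<forall>h\<in>grp Z. act Z h \<in> extensional (pts Z)) \<and>
     (\<exists>A. finite A \<and> stab A \<subseteq> grp Z \<and> finite (orb (act Z) A ` pts Z))"

lemma good_hat_set:
  assumes "good Z s" shows "hat_set G Z" "finitary Z" "E_smooth_hat G E Z" "E_smooth_act E Z"
proof -
  have U: "open_subgroup G (grp Z)" "perm_closed (grp Z)" "grp Z \<subseteq> G"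
    and a: "acts (grp Z) (pts Z) (act Z) s" using assms by (auto simp: good_def open_iff)
  obtain A where A: "finite A" "stab A \<subseteq> grp Z" "finite (orb (act Z) A ` pts Z)"
    using assms by (auto simp: good_def)
  have st: "stabilizer (perm_grp V) (act Z) x = V \<inter> stab (s x)" if "x \<in> pts Z" "V \<subseteq> grp Z" for x V
  proof (rule Set.set_eqI)
    fix g show "g \<in> stabilizer (perm_grp V) (act Z) x \<longleftrightarrow> g \<in> V \<inter> stab (s x)"
      using actsD(5)[OF a, of g x] that U(3) by (cases "g \<in> V") (auto simp: stabilizer_perm_grp stab_iff)
  qed
  have "group_action (perm_grp (grp Z)) (pts Z) (act Z)"
    by (rule group_action_perm_grp) (use assms U a in \<open>auto simp: good_def acts_def\<close>)
  moreover have "open_subgroup G (stabilizer (perm_grp (grp Z)) (act Z) x)" if "x \<in> pts Z" for x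
    unfolding st[OF that order_refl] using U actsD(4)[OF a that] by (intro open_Int open_stab)
  ultimately show "hat_set G Z" using U by (simp add: hat_set_def)
  show "E_smooth_act E Z"
    unfolding E_smooth_act_def
  proof
    fix x assume x: "x \<in> pts Z"
    show "\<exists>V\<in>E. stabilizer (perm_grp (grp Z)) (act Z) x = grp Z \<inter> V"
      by (intro bexI[where x = "stab (s x)"] st[OF x order_refl] stab_in_class actsD(4)[OF a x])
  qed
  have aA: "acts (stab A) (pts Z) (act Z) s" by (rule acts_subset[OF a A(2)]) (use actsD(1)[OF a] A(2) in auto)
  have "finite ((\<lambda>x. orbit (perm_grp (grp Z)) (act Z) x) ` pts Z)"
  proof (rule finite_image_factor[OF A(3)])
    fix x y assume x: "x \<in> pts Z" and y: "y \<in> pts Z" and eq: "orb (act Z) A x = orb (act Z) A y"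
    then have "y \<in> orb (act Z) A x" using orb_self[OF aA y] by simp
    then obtain g where g: "g \<in> grp Z" "y = act Z g x" using A(2) by (auto simp: orb_def)
    have gi: "pinv g \<in> grp Z" "pinv g \<circ> g = id" using g U inv_cancel by (auto simp: perm_closed_def)
    have "act Z h y = act Z (h \<circ> g) x" if "h \<in> grp Z" for h using actsD(3)[OF a that g(1) x] g by simp
    moreover have "act Z h x = act Z (h \<circ> pinv g) y" if h: "h \<in> grp Z" for h
    proof -
      have "h \<circ> pinv g \<in> grp Z" using U(2) h gi by (auto simp: perm_closed_def)
      then have "act Z (h \<circ> pinv g) (act Z g x) = act Z ((h \<circ> pinv g) \<circ> g) x"
        using actsD(3)[OF a _ g(1) x] by simp
      also have "(h \<circ> pinv g) \<circ> g = h" using gi by (simp add: o_assoc[symmetric])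
      finally show ?thesis unfolding g(2) by (rule sym)
    qed
    moreover have "h \<circ> g \<in> grp Z" "h \<circ> pinv g \<in> grp Z" if "h \<in> grp Z" for h
      using U(2) that g gi by (auto simp: perm_closed_def)
    ultimately show "orbit (perm_grp (grp Z)) (act Z) x = orbit (perm_grp (grp Z)) (act Z) y"
      unfolding orbit_perm_grp by (auto simp: image_iff) metis+
  qed
  moreover have "orbits (perm_grp (grp Z)) (pts Z) (act Z) = (\<lambda>x. orbit (perm_grp (grp Z)) (act Z) x) ` pts Z"
    by (auto simp: orbits_def)
  ultimately show "finitary Z" by (simp add: finitary_def)
  show "E_smooth_hat G E Z"
    unfolding E_smooth_hat_def
  proof (intro exI[of _ "stab A"] conjI open_stab A)
    show "E_smooth_act E (sub_gset Z (stab A) (pts Z))"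
      unfolding E_smooth_act_def sub_gset_def
    proof
      fix x assume "x \<in> pts \<lparr>grp = stab A, pts = pts Z, act = \<lambda>h. restrict (act Z h) (pts Z)\<rparr>"
      then have x: "x \<in> pts Z" by simp
      have "stabilizer (perm_grp (stab A)) (\<lambda>h. restrict (act Z h) (pts Z)) x = stab A \<inter> stab (s x)"
        using st[OF x A(2)] x by (simp add: stabilizer_perm_grp)
      then show "\<exists>V\<in>E. stabilizer (perm_grp (grp \<lparr>grp = stab A, pts = pts Z, act = \<lambda>h. restrict (act Z h) (pts Z)\<rparr>))
           (act \<lparr>grp = stab A, pts = pts Z, act = \<lambda>h. restrict (act Z h) (pts Z)\<rparr>) x =
          grp \<lparr>grp = stab A, pts = pts Z, act = \<lambda>h. restrict (act Z h) (pts Z)\<rparr> \<inter> V"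
        unfolding gset.simps by (intro bexI[where x = "stab (s x)"] stab_in_class actsD(4)[OF a x])
    qed
  qed
qed

lemma good_fin_smooth: "good Z s \<Longrightarrow> fin_smooth_hat G E Z"
  using good_hat_set by (auto simp: fin_smooth_hat_def)

lemma measure: "gset_measure G E \<mu>" and mu_Z_sixth: "fin_smooth_hat G E X \<Longrightarrow> \<mu> X \<in> Z_sixth"
  and mu_coset: "\<lbrakk>finite B; A \<subseteq> B; fin_smooth_hat G E X; hat_iso G X (coset_gset G A B)\<rbrakk>
    \<Longrightarrow> \<mu> X = nu (card B) / nu (card A)"
  using mu by (auto simp: is_mu1_def)

text \<open>Since \<open>\<nu>(n + 1) \<noteq> \<nu>(n)\<close>, the existence of the measure shows that pointwise stabilizers of different
  finite sets differ.\<close>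

lemma stab_insert_neq:
  assumes B: "finite B" and b: "b \<notin> B" shows "stab (insert b B) \<noteq> stab B"
proof
  assume eq: "stab (insert b B) = stab B"
  define X :: "('w, 'a univ) gset" where "X = point_gset (stab B)"
  have Xs: "grp X = stab B" "pts X = {UPoint}" "act X = (\<lambda>h. \<lambda>x\<in>{UPoint}. x)"
    by (simp_all add: X_def point_gset_def)
  have "good X (\<lambda>x. {})"
    unfolding good_def acts_def Xs using open_stab[OF B] B by auto
  then have fin: "fin_smooth_hat G E X" by (rule good_fin_smooth)
  have "\<mu> X = 1" using gset_measure.one_point[OF measure fin] Xs by simp
  \<comment> \<open>With equal stabilizers the coset space is a single point. Its measure is then 1,
    but it is also prescribed as a quotient of consecutive values of \<open>nu\<close>.\<close>
  moreover have "hat_iso G X (coset_gset G B (insert b B))"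
  proof -
    have co: "g <#\<^bsub>perm_grp G\<^esub> stab B = stab B" if g: "g \<in> stab B" for g
    proof -
      have gi: "pinv g \<in> stab B" "g \<circ> pinv g = id" using g stab_inv inv_cancel by (auto simp: stab_iff)
      have "h = g \<circ> (pinv g \<circ> h)" for h using gi by (simp add: o_assoc)
      then show ?thesis
        using stab_comp[OF g] stab_comp[OF gi(1)] by (auto simp: l_coset_def)
    qed
    define Q where "Q = (\<lambda>g. g <#\<^bsub>perm_grp G\<^esub> stab (insert b B)) ` stab B"
    have Q: "Q = {stab B}" using co stab_id[of B] by (auto simp: eq Q_def)
    have cs: "coset_gset G B (insert b B) = \<lparr>grp = stab B, pts = Q, act = (\<lambda>h. \<lambda>C\<in>Q. h <#\<^bsub>perm_grp G\<^esub> C)\<rparr>"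
      by (simp add: coset_gset_def Q_def Let_def)
    show ?thesis
      unfolding hat_iso_def cs
      by (rule exI[of _ "\<lambda>_. stab B"], rule exI[of _ "stab B"])
        (use open_stab[OF B] in \<open>auto simp: Xs Q co bij_betw_def\<close>)
  qed
  ultimately have "nu (Suc (card B)) / nu (card B) = 1"
    using mu_coset[of "insert b B" B X] B b fin by auto
  moreover have "nu (Suc n) \<noteq> nu n" for n
  proof -
    have "nu n \<noteq> 0" by (simp add: nu_def)
    moreover have "nu (Suc n) = - 1 / 2 * nu n" if "n \<ge> 2" using that by (simp add: nu_def)
    moreover have "n = 0 \<or> n = 1 \<or> n \<ge> 2" by linarith
    ultimately show ?thesis by (auto simp del: One_nat_def) (auto simp: nu_def power2_eq_square)
  qed
  moreover have "nu (card B) \<noteq> 0" by (simp add: nu_def)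
  ultimately show False by (metis divide_eq_1_iff)
qed

lemma stab_inj: assumes "finite A" "finite B" "stab A = stab B" shows "A = B"
proof -
  have "b \<in> B'" if "b \<in> A'" "finite B'" "stab A' = stab B'" for b and A' B' :: "'w set"
  proof (rule ccontr)
    assume "b \<notin> B'"
    moreover have "stab (insert b B') = stab B'" using that by (auto simp: stab_iff set_eq_iff)
    ultimately show False using stab_insert_neq that by blast
  qed
  then show ?thesis using assms by blast
qed

end

section \<open>Integration as a weighted sum over orbits\<close>

context mu_one
begin

section \<open>The values of the measure in the field\<close>

definition nuk :: "nat \<Rightarrow> 'k" where
  "nuk n = (if n = 0 then 1 else if n = 1 then 3 / 2 else 3 * (- 1 / 2) ^ n)"

lemma two_three: "(2 :: 'k) \<noteq> 0" "(3 :: 'k) \<noteq> 0"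
proof -
  have nz: "(of_nat p :: 'k) \<noteq> 0" if "prime p" "CHAR('k) \<noteq> p" for p :: nat
  proof
    assume "(of_nat p :: 'k) = 0"
    then have "CHAR('k) dvd p" by (simp add: of_nat_eq_0_iff_char_dvd)
    moreover have "CHAR('k) \<noteq> 1" using CHAR_not_1' by auto
    ultimately show False using that by (auto simp: prime_nat_iff)
  qed
  show "(2 :: 'k) \<noteq> 0" using nz[of 2] char2 by simp
  show "(3 :: 'k) \<noteq> 0" using nz[of 3] char3 by simp
qed

lemma nuk_nonzero [simp]: "nuk n \<noteq> 0"
  using two_three by (simp add: nuk_def)

text \<open>\<open>of_Z_sixth\<close> looks at the reduced fraction. Its denominator divides
  \<open>b\<close>, hence is nonzero in \<open>'k\<close> as well, and cross multiplication can be
  carried out there.\<close>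

lemma kappa_frac:
  assumes b: "(of_int b :: 'k) \<noteq> 0" shows "\<kappa> (of_int a / of_int b) = of_int a / of_int b"
proof -
  have b0: "b \<noteq> 0" using b by auto
  obtain n d where nd: "quotient_of (of_int a / of_int b) = (n, d)" by fastforce
  have d: "d > 0" "coprime n d" and eq: "(of_int a / of_int b :: rat) = of_int n / of_int d"
    using quotient_of_denom_pos[OF nd] quotient_of_coprime[OF nd] quotient_of_div[OF nd] by auto
  have "(of_int (a * d) :: rat) = of_int (n * b)" using eq b0 d by (simp add: field_simps)
  then have ad: "a * d = n * b" by (simp only: of_int_eq_iff)
  then have "d dvd n * b" by (metis dvd_triv_right)
  then have "d dvd b" using d(2) by (simp add: coprime_commute coprime_dvd_mult_right_iff)
  then obtain c where "b = d * c" by (elim dvdE)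
  then have "(of_int d :: 'k) \<noteq> 0" using b by auto
  moreover have "(of_int a :: 'k) * of_int d = of_int n * of_int b" using ad by (metis of_int_mult)
  ultimately show ?thesis using b by (simp add: kappa of_Z_sixth_def nd field_simps)
qed

lemma six: "(of_int (6 ^ n) :: 'k) \<noteq> 0"
proof -
  have "(6 :: 'k) = 2 * 3" by simp
  then have "(6 :: 'k) \<noteq> 0" using two_three by (metis mult_eq_0_iff)
  then show ?thesis by simp
qed

lemma Z_sixthE: assumes "x \<in> Z_sixth" obtains a n where "x = of_int a / of_int (6 ^ n)"
  using assms by (auto simp: Z_sixth_def)

lemma kappa_add: assumes "x \<in> Z_sixth" "y \<in> Z_sixth" shows "\<kappa> (x + y) = \<kappa> x + \<kappa> y" "x + y \<in> Z_sixth"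
proof -
  obtain a n b m where x: "x = of_int a / of_int (6 ^ n)" and y: "y = of_int b / of_int (6 ^ m)"
    using assms by (metis Z_sixthE)
  have xy: "x + y = of_int (a * 6 ^ m + b * 6 ^ n) / of_int (6 ^ (n + m))"
    by (simp add: x y field_simps power_add)
  have "\<kappa> (x + y) = of_int (a * 6 ^ m + b * 6 ^ n) / of_int (6 ^ (n + m))"
    unfolding xy by (rule kappa_frac[OF six])
  also have "\<dots> = of_int a / of_int (6 ^ n) + of_int b / of_int (6 ^ m)"
    using six[of n] six[of m] by (simp add: field_simps power_add)
  finally show "\<kappa> (x + y) = \<kappa> x + \<kappa> y" unfolding x y kappa_frac[OF six] .
  show "x + y \<in> Z_sixth" unfolding xy Z_sixth_def of_int_power[of 6] of_int_numeral by blast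
qed

lemma kappa_0: "\<kappa> 0 = 0" using kappa_frac[of 1 0] by simp

lemma kappa_sum: "finite I \<Longrightarrow> (\<And>i. i \<in> I \<Longrightarrow> f i \<in> Z_sixth) \<Longrightarrow>
    \<kappa> (sum f I) = (\<Sum>i\<in>I. \<kappa> (f i)) \<and> sum f I \<in> Z_sixth"
proof (induction I rule: finite_induct)
  case empty
  have "(0 :: rat) = of_int 0 / 6 ^ 0" by simp
  then show ?case unfolding Z_sixth_def by (auto simp: kappa_0 intro!: exI[of _ 0])
next
  case (insert i I)
  then show ?case using kappa_add[of "f i" "sum f I"] by simp
qed

text \<open>Values of \<open>nu\<close> are quotients of integers that, up to sign, are products of
  powers of 2 and 3; none of these vanishes in \<open>'k\<close>.\<close>

lemma kappa_nu: "\<kappa> (nu m / nu n) = nuk m / nuk n"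
proof -
  define N :: "nat \<Rightarrow> int" where "N n = (if n = 0 then 1 else if n = 1 then 3 else 3 * (- 1) ^ n)" for n
  define D :: "nat \<Rightarrow> int" where "D n = 2 ^ n" for n
  have nu: "nu n = of_int (N n) / of_int (D n)" for n
    unfolding nu_def N_def D_def power_divide by simp
  have nk: "nuk n = of_int (N n) / of_int (D n)" for n
    unfolding nuk_def N_def D_def power_divide by simp
  have D0: "(of_int (D n) :: 'k) \<noteq> 0" "D n \<noteq> 0" for n using two_three by (simp_all add: D_def)
  have N0: "(of_int (N n) :: 'k) \<noteq> 0" "N n \<noteq> 0" for n using two_three by (simp_all add: N_def)
  have "nu m / nu n = of_int (N m * D n) / of_int (D m * N n)" by (simp add: nu)
  moreover have "(of_int (D m * N n) :: 'k) \<noteq> 0" using D0 N0 by simp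
  ultimately have "\<kappa> (nu m / nu n) = of_int (N m * D n) / of_int (D m * N n)" by (metis kappa_frac)
  then show ?thesis by (simp add: nk)
qed

text \<open>The canonical support of a point. It is unique because \<open>stab_inj\<close> recovers
  a finite set from its pointwise stabilizer.\<close>

definition supp :: "('w, 'x) gset \<Rightarrow> 'x \<Rightarrow> 'w set" where
  "supp Z x = (THE B. finite B \<and> (\<forall>g\<in>G. act Z g x = x \<longleftrightarrow> (\<forall>w\<in>B. g w = w)))"

lemma acts_supp_eq:
  assumes "acts G (pts Z) (act Z) s" "x \<in> pts Z" shows "supp Z x = s x"
  unfolding supp_def
proof (rule the_equality)
  show "finite (s x) \<and> (\<forall>g\<in>G. (act Z g x = x) = (\<forall>w\<in>s x. g w = w))"
    using assms by (simp add: acts_def)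
  fix B assume B: "finite B \<and> (\<forall>g\<in>G. (act Z g x = x) = (\<forall>w\<in>B. g w = w))"
  have "stab B = stab (s x)" using B actsD(5)[OF assms(1) _ assms(2)] by (auto simp: pstab_def)
  then show "B = s x" using stab_inj B actsD(4)[OF assms] by blast
qed

text \<open>The objects of the permutation category, as \<open>ob_iff\<close> shows, with supports
  in place of smoothness.\<close>

definition ob :: "('w, 'x) gset \<Rightarrow> bool" where
  "ob Z \<longleftrightarrow> grp Z = G \<and> acts G (pts Z) (act Z) (supp Z) \<and>
     (\<forall>h\<in>G. act Z h \<in> extensional (pts Z)) \<and> finite (orb (act Z) {} ` pts Z)"

lemma good_ob: assumes "good Z s" "grp Z = G" "finite (orb (act Z) {} ` pts Z)" shows "ob Z"
proof -
  have a: "acts G (pts Z) (act Z) s" using assms by (simp add: good_def)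
  have "acts G (pts Z) (act Z) (supp Z)"
    using a acts_supp_eq[OF a] unfolding acts_def by auto
  then show ?thesis using assms by (auto simp: ob_def good_def)
qed

lemma ob_good: "ob Z \<Longrightarrow> good Z (supp Z)"
  unfolding good_def ob_def using open_G by (auto intro!: exI[of _ "{}"])

lemma ob_iff: "ob Z \<longleftrightarrow> grp Z = G \<and> hat_set G Z \<and> finitary Z \<and> E_smooth_act E Z"
proof
  assume "ob Z"
  then show "grp Z = G \<and> hat_set G Z \<and> finitary Z \<and> E_smooth_act E Z"
    using good_hat_set[OF ob_good] by (auto simp: ob_def)
next
  assume Z: "grp Z = G \<and> hat_set G Z \<and> finitary Z \<and> E_smooth_act E Z"
  interpret A: group_action "perm_grp G" "pts Z" "act Z" using Z by (auto simp: hat_set_def)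
  have "\<exists>B. finite B \<and> (\<forall>g\<in>G. act Z g x = x \<longleftrightarrow> (\<forall>w\<in>B. g w = w))" if x: "x \<in> pts Z" for x
  proof -
    have "\<exists>V\<in>E. stabilizer (perm_grp G) (act Z) x = G \<inter> V"
      using Z x by (auto simp: E_smooth_act_def)
    then obtain V where V: "V \<in> E" "stabilizer (perm_grp G) (act Z) x = G \<inter> V" by blast
    obtain B where "finite B" "V = stab B" using V(1) unfolding stab_class_iff by blast
    with V(2) have B: "finite B" "stabilizer (perm_grp G) (act Z) x = G \<inter> stab B" by simp_all
    then have "act Z g x = x \<longleftrightarrow> (\<forall>w\<in>B. g w = w)" if "g \<in> G" for g
    proof -
      have "g \<in> stabilizer (perm_grp G) (act Z) x \<longleftrightarrow> g \<in> G \<inter> stab B" by (simp only: B(2))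
      then show ?thesis using that by (simp add: stabilizer_perm_grp stab_iff)
    qed
    then show ?thesis using B(1) by (intro exI[of _ B]) simp
  qed
  then obtain s where s: "\<And>x. x \<in> pts Z \<Longrightarrow> finite (s x) \<and> (\<forall>g\<in>G. act Z g x = x \<longleftrightarrow> (\<forall>w\<in>s x. g w = w))"
    by metis
  have a: "acts G (pts Z) (act Z) s"
    unfolding acts_def
  proof (intro conjI ballI)
    fix x assume x: "x \<in> pts Z"
    show "act Z id x = x" using A.id_eq_one x by (metis perm_grp_simps(3) restrict_apply')
    show "finite (s x)" using s[OF x] by blast
    fix h assume h: "h \<in> G"
    show "act Z h x = x \<longleftrightarrow> (\<forall>w\<in>s x. h w = w)" using s[OF x] h by blast
    show "act Z h x \<in> pts Z" using A.element_image[of h x] x h by simp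
    fix g assume "g \<in> G"
    then show "act Z (g \<circ> h) x = act Z g (act Z h x)" using A.composition_rule[of x g h] x h by simp
  next
  qed (use s in blast)?
  have fin: "finite (orb (act Z) {} ` pts Z)"
  proof -
    have "orbits (perm_grp G) (pts Z) (act Z) = orb (act Z) {} ` pts Z"
      by (auto simp: orbits_def orbit_perm_grp orb_def)
    then show ?thesis using Z by (auto simp: finitary_def)
  qed
  have "act Z h \<in> extensional (pts Z)" if "h \<in> G" for h
    using A.bij_prop0[of h] that by (auto simp: Bij_def)
  then have "good Z s"
    unfolding good_def using Z a fin open_G by (auto intro!: exI[of _ "{}"])
  then show "ob Z" using good_ob Z fin by blast
qed

text \<open>The stabilizer of the translate by \<open>g\<close> is the conjugate stabilizer, which
  is the pointwise stabilizer of the translated support. By \<open>stab_inj\<close> the two supports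
  coincide.\<close>

lemma acts_equivariant:
  assumes a: "acts G X a s" and g: "g \<in> G" and x: "x \<in> X" shows "s (a g x) = g ` s x"
proof (rule stab_inj)
  have gx: "a g x \<in> X" by (rule actsD(1)[OF a g x])
  show "finite (s (a g x))" by (rule actsD(4)[OF a gx])
  show "finite (g ` s x)" using actsD(4)[OF a x] by simp
  have "h \<in> stab (s (a g x)) \<longleftrightarrow> h \<in> stab (g ` s x)" if h: "h \<in> G" for h
  proof -
    have gi: "pinv g \<in> G" "pinv g \<circ> (h \<circ> g) \<in> G" "h \<circ> g \<in> G" using g h G_inv G_comp by auto
    have "h \<in> stab (s (a g x)) \<longleftrightarrow> a h (a g x) = a g x"
      using actsD(5)[OF a h gx] h by (simp add: stab_iff)
    also have "\<dots> \<longleftrightarrow> a (h \<circ> g) x = a g x" by (simp add: actsD(3)[OF a h g x])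
    also have "\<dots> \<longleftrightarrow> a (pinv g \<circ> (h \<circ> g)) x = x"
    proof
      assume "a (h \<circ> g) x = a g x"
      then have "a (pinv g) (a (h \<circ> g) x) = a (pinv g) (a g x)" by simp
      then show "a (pinv g \<circ> (h \<circ> g)) x = x"
        using actsD(3)[OF a gi(1) gi(3) x] actsD(3)[OF a gi(1) g x] actsD(2)[OF a x] inv_cancel(1)[OF g]
        by simp
    next
      assume "a (pinv g \<circ> (h \<circ> g)) x = x"
      then have "a g (a (pinv g \<circ> (h \<circ> g)) x) = a g x" by simp
      then have "a (g \<circ> (pinv g \<circ> (h \<circ> g))) x = a g x" using actsD(3)[OF a g gi(2) x] by simp
      moreover have "g \<circ> (pinv g \<circ> (h \<circ> g)) = h \<circ> g" using inv_cancel(2)[OF g] by (simp add: o_assoc)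
      ultimately show "a (h \<circ> g) x = a g x" by simp
    qed
    also have "\<dots> \<longleftrightarrow> (\<forall>w\<in>s x. (pinv g \<circ> (h \<circ> g)) w = w)" by (rule actsD(5)[OF a gi(2) x])
    also have "\<dots> \<longleftrightarrow> (\<forall>w\<in>s x. h (g w) = g w)"
      using inv_cancel(3,4)[OF g] by (metis comp_apply)
    finally show ?thesis using h by (simp add: stab_iff)
  qed
  then show "stab (s (a g x)) = stab (g ` s x)" using stab_sub by blast
qed

section \<open>Integrals relative to a finite set\<close>

definition fin_acts :: "'x set \<Rightarrow> (('w \<Rightarrow> 'w) \<Rightarrow> 'x \<Rightarrow> 'x) \<Rightarrow> ('x \<Rightarrow> 'w set) \<Rightarrow> bool" where
  "fin_acts X a s \<longleftrightarrow> acts G X a s \<and> finite (orb a {} ` X)"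

lemma acts_stab: "acts G X a s \<Longrightarrow> acts (stab A) X a s"
  using stab_sub by (auto simp: acts_def subset_iff)

text \<open>There are finitely many orbits of \<open>G\<close>, and by \<open>oligomorphic\<close>
  each of them splits into finitely many orbits of \<open>stab A\<close>.\<close>

lemma finite_orbits:
  assumes X: "fin_acts X a s" and A: "finite A" shows "finite (orb a A ` X)"
proof -
  have a: "acts G X a s" using X by (simp add: fin_acts_def)
  have "orb a A ` X \<subseteq> (\<Union>\<omega>\<in>orb a {} ` X. orb a A ` \<omega>)"
    using orb_self[of "{}" X a s] a by fastforce
  moreover have "finite (orb a A ` \<omega>)" if \<omega>: "\<omega> \<in> orb a {} ` X" for \<omega>
  proof -
    obtain x where x: "x \<in> X" "\<omega> = (\<lambda>g. a g x) ` G" using \<omega> by (auto simp: orb_def)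
    have "finite ((\<lambda>g. orb a A (a g x)) ` G)"
      by (rule oligomorphic[OF A actsD(4)[OF a x(1)]])
        (use actsD(5)[OF a _ x(1)] actsD(3)[OF a _ _ x(1)] in \<open>auto simp: stab_iff\<close>)
    then show ?thesis by (simp add: x(2) image_image)
  qed
  ultimately show ?thesis using X by (meson finite_UN fin_acts_def finite_subset)
qed

lemma ob_fin_acts: "ob Z \<Longrightarrow> fin_acts (pts Z) (act Z) (supp Z)"
  by (simp add: ob_def fin_acts_def)

definition rep :: "'x set \<Rightarrow> 'x" where
  "rep \<omega> = (SOME x. x \<in> \<omega>)"

lemma rep_orbit:
  assumes a: "acts G X a s" and \<omega>: "\<omega> \<in> orb a A ` X"
  shows "rep \<omega> \<in> \<omega>" "rep \<omega> \<in> X" "orb a A (rep \<omega>) = \<omega>"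
proof -
  note aA = acts_stab[OF a, of A]
  obtain x where x: "x \<in> X" "\<omega> = orb a A x" using \<omega> by blast
  show r: "rep \<omega> \<in> \<omega>" unfolding rep_def by (rule someI[of _ x]) (use orb_self[OF aA x(1)] x in simp)
  then show "rep \<omega> \<in> X" using orb_sub[OF aA x(1)] x by blast
  show "orb a A (rep \<omega>) = \<omega>" using orb_eq[OF aA x(1)] r x by simp
qed

definition invar :: "'w set \<Rightarrow> 'x set \<Rightarrow> (('w \<Rightarrow> 'w) \<Rightarrow> 'x \<Rightarrow> 'x) \<Rightarrow> ('x \<Rightarrow> 'c) \<Rightarrow> bool" where
  "invar A X a f \<longleftrightarrow> (\<forall>g\<in>stab A. \<forall>x\<in>X. f (a g x) = f x)"

lemma invar_orbit: "acts G X a s \<Longrightarrow> invar A X a f \<Longrightarrow> x \<in> X \<Longrightarrow> y \<in> orb a A x \<Longrightarrow> f y = f x"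
  by (auto simp: invar_def orb_def)

lemma invar_rep: "acts G X a s \<Longrightarrow> invar A X a f \<Longrightarrow> x \<in> X \<Longrightarrow> f (rep (orb a A x)) = f x"
  by (rule invar_orbit) (auto intro: rep_orbit(1))

text \<open>The image in \<open>'k\<close> of the measure of \<open>G(A)/G(A \<union> B)\<close>,
  that is, of the orbit under \<open>stab A\<close> of a point with support
  \<open>B\<close>.\<close>

definition wt :: "'w set \<Rightarrow> 'w set \<Rightarrow> 'k" where
  "wt A B = nuk (card (A \<union> B)) / nuk (card A)"

text \<open>The integral of a function invariant under \<open>stab A\<close>, as a sum over the
  orbits of \<open>stab A\<close>. For objects, \<open>gset_integral_eq\<close> shows that the value
  does not depend on the choice of \<open>A\<close>; the freedom to enlarge \<open>A\<close> is what
  makes iterated integrals manageable.\<close>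

definition integ :: "'w set \<Rightarrow> 'x set \<Rightarrow> (('w \<Rightarrow> 'w) \<Rightarrow> 'x \<Rightarrow> 'x) \<Rightarrow> ('x \<Rightarrow> 'w set) \<Rightarrow> ('x \<Rightarrow> 'k) \<Rightarrow> 'k" where
  "integ A X a s f = (\<Sum>\<omega>\<in>orb a A ` X. f (rep \<omega>) * wt A (s (rep \<omega>)))"

lemma card_Un_image:
  assumes "g \<in> stab A" shows "card (A \<union> g ` B) = card (A \<union> B)"
proof -
  have "g ` (A \<union> B) = A \<union> g ` B" using assms by (force simp: stab_iff)
  moreover have "g \<in> G" using assms by (simp add: stab_iff)
  then have "inj_on g (A \<union> B)" using inj_on_subset[OF bij_is_inj[OF G_bij] subset_UNIV] by blast
  ultimately show ?thesis using card_image by metis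
qed

lemma invar_card: assumes "acts G X a s" shows "invar A X a (\<lambda>x. card (A \<union> s x))"
  unfolding invar_def
proof (intro ballI)
  fix g x assume g: "g \<in> stab A" and x: "x \<in> X"
  have "g \<in> G" using g by (simp add: stab_iff)
  then show "card (A \<union> s (a g x)) = card (A \<union> s x)"
    using acts_equivariant[OF assms _ x] card_Un_image[OF g] by simp
qed

lemma invar_wt: "acts G X a s \<Longrightarrow> invar A X a (\<lambda>x. wt A (s x))"
  using invar_card[of X a s A] by (simp add: invar_def wt_def)

section \<open>Measures of stable subsets\<close>

lemma good_sub:
  assumes X: "ob X" and U: "open_subgroup G U" and S: "S \<subseteq> pts X"
    and stable: "\<And>h x. h \<in> U \<Longrightarrow> x \<in> S \<Longrightarrow> act X h x \<in> S"
  shows "good (sub_gset X U S) (supp X)"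
proof -
  have sel: "grp (sub_gset X U S) = U" "pts (sub_gset X U S) = S"
    "act (sub_gset X U S) = (\<lambda>h. restrict (act X h) S)" by (simp_all add: sub_gset_def)
  obtain A where A: "finite A" "stab A \<subseteq> U" and UG: "U \<subseteq> G" using U by (auto simp: open_iff)
  have a: "acts G (pts X) (act X) (supp X)" using X by (simp add: ob_def)
  have "acts U S (act X) (supp X)" by (rule acts_subset[OF a UG S stable])
  then have "acts U S (\<lambda>h. restrict (act X h) S) (supp X)" by (rule acts_restrict)
  moreover have "orb (\<lambda>h. restrict (act X h) S) A x = orb (act X) A x" if "x \<in> S" for x
    using that by (simp add: orb_def)
  then have "orb (\<lambda>h. restrict (act X h) S) A ` S \<subseteq> orb (act X) A ` pts X" using S by force
  then have "finite (orb (\<lambda>h. restrict (act X h) S) A ` S)"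
    using finite_orbits[OF ob_fin_acts[OF X] A(1)] by (rule finite_subset)
  ultimately show ?thesis unfolding good_def sel using U A by auto
qed

text \<open>The orbit is isomorphic to a coset space whose measure is prescribed: the stabilizer of
  \<open>x\<close> in \<open>stab A\<close> is the pointwise stabilizer of \<open>A\<close> together
  with the support of \<open>x\<close>.\<close>

lemma mu_orbit:
  assumes X: "ob X" and A: "finite A" and x: "x \<in> pts X"
  shows "\<mu> (sub_gset X (stab A) (orb (act X) A x)) = nu (card (A \<union> supp X x)) / nu (card A)"
proof -
  define S where "S = orb (act X) A x"
  have a: "acts G (pts X) (act X) (supp X)" using X by (simp add: ob_def)
  note aA = acts_stab[OF a, of A]
  have S: "S \<subseteq> pts X" unfolding S_def by (rule orb_sub[OF aA x])
  have stable: "act X h y \<in> S" if h: "h \<in> stab A" and y: "y \<in> S" for h y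
  proof -
    obtain g where g: "g \<in> stab A" "y = act X g x" using y by (auto simp: S_def orb_def)
    then have "act X h y = act X (h \<circ> g) x" using actsD(3)[OF aA h g(1) x] by simp
    then show ?thesis using stab_comp[OF h g(1)] by (auto simp: S_def orb_def)
  qed
  have good: "good (sub_gset X (stab A) S) (supp X)" by (rule good_sub[OF X open_stab[OF A] S stable])
  define B where "B = A \<union> supp X x"
  have B: "finite B" "A \<subseteq> B" using A actsD(4)[OF a x] by (auto simp: B_def)
  \<comment> \<open>The elements carrying \<open>x\<close> to \<open>y\<close> form a coset of the
    stabilizer of \<open>x\<close>. Working with this set avoids choosing a group element for each
    point.\<close>
  define f where "f y = {g \<in> stab A. act X g x = y}" for y
  have co: "f (act X g x) = g <#\<^bsub>perm_grp G\<^esub> stab B" if g: "g \<in> stab A" for g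
  proof -
    have gi: "pinv g \<in> stab A" "g \<circ> pinv g = id" "pinv g \<circ> g = id"
      using g stab_inv inv_cancel by (auto simp: stab_iff)
    have "h \<in> f (act X g x) \<longleftrightarrow> (\<exists>k\<in>stab B. h = g \<circ> k)" for h
    proof
      assume h: "h \<in> f (act X g x)"
      then have hA: "h \<in> stab A" "act X h x = act X g x" by (auto simp: f_def)
      have k: "pinv g \<circ> h \<in> stab A" by (rule stab_comp[OF gi(1) hA(1)])
      have "act X (pinv g \<circ> h) x = act X (pinv g) (act X g x)"
        using actsD(3)[OF aA gi(1) hA(1) x] hA by simp
      also have "\<dots> = x" using actsD(3)[OF aA gi(1) g x] actsD(2)[OF aA x] gi(3) by simp
      finally have "pinv g \<circ> h \<in> stab B"
        using k actsD(5)[OF aA k x] by (auto simp: B_def stab_iff)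
      moreover have "h = g \<circ> (pinv g \<circ> h)" using gi(2) by (simp add: o_assoc)
      ultimately show "\<exists>k\<in>stab B. h = g \<circ> k" by blast
    next
      assume "\<exists>k\<in>stab B. h = g \<circ> k"
      then obtain k where k: "k \<in> stab B" "h = g \<circ> k" by blast
      have kA: "k \<in> stab A" using k(1) by (auto simp: B_def stab_Un)
      have "act X k x = x" using actsD(5)[OF aA kA x] k(1) by (auto simp: B_def stab_iff)
      then have "act X h x = act X g x" using actsD(3)[OF aA g kA x] k by simp
      then show "h \<in> f (act X g x)" using stab_comp[OF g kA] k by (simp add: f_def)
    qed
    then show ?thesis by (auto simp: l_coset_def)
  qed
  define Q where "Q = (\<lambda>g. g <#\<^bsub>perm_grp G\<^esub> stab B) ` stab A"
  have cs: "coset_gset G A B = \<lparr>grp = stab A, pts = Q, act = (\<lambda>h. \<lambda>C\<in>Q. h <#\<^bsub>perm_grp G\<^esub> C)\<rparr>"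
    by (simp add: coset_gset_def Q_def Let_def)
  have fQ: "f ` S = Q"
    using co by (force simp: S_def orb_def Q_def)
  have inj: "inj_on f S"
  proof (rule inj_onI)
    fix y z assume "y \<in> S" "z \<in> S" and eq: "f y = f z"
    then obtain g where "g \<in> f y" by (auto simp: S_def orb_def f_def)
    then show "y = z" using eq by (auto simp: f_def)
  qed
  have equiv: "f (act X h y) = h <#\<^bsub>perm_grp G\<^esub> f y" if h: "h \<in> stab A" and y: "y \<in> S" for h y
  proof -
    obtain g where g: "g \<in> stab A" "y = act X g x" using y by (auto simp: S_def orb_def)
    have "f (act X h y) = (h \<circ> g) <#\<^bsub>perm_grp G\<^esub> stab B"
      using co[OF stab_comp[OF h g(1)]] actsD(3)[OF aA h g(1) x] g(2) by simp
    also have "\<dots> = h <#\<^bsub>perm_grp G\<^esub> (g <#\<^bsub>perm_grp G\<^esub> stab B)"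
      by (auto simp: l_coset_def o_assoc)
    finally show ?thesis using co[OF g(1)] g(2) by simp
  qed
  have "hat_iso G (sub_gset X (stab A) S) (coset_gset G A B)"
    unfolding hat_iso_def cs
  proof (intro exI[of _ f] exI[of _ "stab A"] conjI ballI)
    show "bij_betw f (pts (sub_gset X (stab A) S)) (pts \<lparr>grp = stab A, pts = Q, act = \<lambda>h. \<lambda>C\<in>Q. h <#\<^bsub>perm_grp G\<^esub> C\<rparr>)"
      using inj fQ by (simp add: bij_betw_def sub_gset_def)
    show "open_subgroup G (stab A)" by (rule open_stab[OF A])
    show "stab A \<subseteq> grp (sub_gset X (stab A) S) \<inter> grp \<lparr>grp = stab A, pts = Q, act = \<lambda>h. \<lambda>C\<in>Q. h <#\<^bsub>perm_grp G\<^esub> C\<rparr>"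
      by (simp add: sub_gset_def)
    fix h y assume "h \<in> stab A" "y \<in> pts (sub_gset X (stab A) S)"
    then have h: "h \<in> stab A" and y: "y \<in> S" by (auto simp: sub_gset_def)
    then have "f y \<in> Q" using fQ by blast
    then show "f (act (sub_gset X (stab A) S) h y) = act \<lparr>grp = stab A, pts = Q, act = \<lambda>h. \<lambda>C\<in>Q. h <#\<^bsub>perm_grp G\<^esub> C\<rparr> h (f y)"
      using equiv[OF h y] y by (simp add: sub_gset_def)
  qed
  from mu_coset[OF B good_fin_smooth[OF good] this] show ?thesis by (simp add: S_def B_def)
qed

text \<open>The axiom \<open>additive\<close> concerns sums with tagged points. A disjoint union
  inside \<open>X\<close> is transported to such a sum by an isomorphism that attaches the
  tags.\<close>

lemma mu_union:
  assumes X: "ob X" and A: "finite A" and S: "S \<subseteq> pts X" "T \<subseteq> pts X" "S \<inter> T = {}"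
    and stable: "\<And>h x. h \<in> stab A \<Longrightarrow> x \<in> S \<Longrightarrow> act X h x \<in> S" "\<And>h x. h \<in> stab A \<Longrightarrow> x \<in> T \<Longrightarrow> act X h x \<in> T"
  shows "\<mu> (sub_gset X (stab A) (S \<union> T)) = \<mu> (sub_gset X (stab A) S) + \<mu> (sub_gset X (stab A) T)"
proof -
  let ?s = "\<lambda>S. sub_gset X (stab A) S"
  have gS: "good (?s S) (supp X)" by (rule good_sub[OF X open_stab[OF A] S(1) stable(1)])
  have gT: "good (?s T) (supp X)" by (rule good_sub[OF X open_stab[OF A] S(2) stable(2)])
  have gST: "good (?s (S \<union> T)) (supp X)"
    by (rule good_sub[OF X open_stab[OF A]]) (use S stable in auto)
  define W where "W = sum_gset (?s S) (?s T)"
  define P where "P = UInl ` S \<union> UInr ` T"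
  define b where "b h = (\<lambda>p\<in>P. case p of UInl x \<Rightarrow> UInl (act X h x) | UInr y \<Rightarrow> UInr (act X h y))" for h
  have bl: "b h (UInl x) = UInl (act X h x)" if "x \<in> S" for x h using that by (simp add: b_def P_def)
  have br: "b h (UInr x) = UInr (act X h x)" if "x \<in> T" for x h using that by (auto simp: b_def P_def)
  have W: "grp W = stab A" "pts W = P" "act W h p = b h p" if "p \<in> P" for p h
    using that by (auto simp: W_def sum_gset_def sub_gset_def P_def b_def Let_def)
  have W1: "grp W = stab A" "pts W = P" by (auto simp: W_def sum_gset_def sub_gset_def P_def Let_def)
  have W2: "act W h \<in> extensional P" for h by (auto simp: W_def sum_gset_def sub_gset_def P_def Let_def)
  define t where "t p = (case p of UInl x \<Rightarrow> supp X x | UInr y \<Rightarrow> supp X y)" for p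
  have a: "acts (stab A) (pts X) (act X) (supp X)" using X acts_stab by (auto simp: ob_def)
  have aW: "acts (stab A) P (act W) t"
    unfolding acts_def
  proof (intro conjI ballI)
    fix p assume p: "p \<in> P"
    then consider x where "p = UInl x" "x \<in> S" | x where "p = UInr x" "x \<in> T" by (auto simp: P_def)
    note c = this
    show "act W id p = p" using c W(3)[OF p] bl br actsD(2)[OF a] S by cases auto
    show "finite (t p)" using c actsD(4)[OF a] S by cases (auto simp: t_def)
    fix h assume h: "h \<in> stab A"
    show hp: "act W h p \<in> P" using c W(3)[OF p] bl br stable h by cases (auto simp: P_def)
    show "act W h p = p \<longleftrightarrow> (\<forall>w\<in>t p. h w = w)"
      using c W(3)[OF p] bl br actsD(5)[OF a h] S by cases (auto simp: t_def)
    fix g assume g: "g \<in> stab A"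
    show "act W (g \<circ> h) p = act W g (act W h p)" if "p \<in> P" for p
      using that
    proof -
      assume p: "p \<in> P"
      then consider x where "p = UInl x" "x \<in> S" | x where "p = UInr x" "x \<in> T" by (auto simp: P_def)
      then show ?thesis
      proof cases
        case (1 x)
        then have "UInl (act X h x) \<in> P" using stable h by (auto simp: P_def)
        then show ?thesis using 1 W(3)[OF p] W(3) bl stable(1)[OF h] actsD(3)[OF a g h] S by auto
      next
        case (2 x)
        then have "UInr (act X h x) \<in> P" using stable h by (auto simp: P_def)
        then show ?thesis using 2 W(3)[OF p] W(3) br stable(2)[OF h] actsD(3)[OF a g h] S by auto
      qed
    qed
  qed
  have oW: "orb (act W) A ` P \<subseteq> (\<lambda>\<omega>. UInl ` \<omega>) ` orb (act X) A ` pts X \<union> (\<lambda>\<omega>. UInr ` \<omega>) ` orb (act X) A ` pts X"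
  proof
    fix \<omega> assume "\<omega> \<in> orb (act W) A ` P"
    then obtain p where p: "p \<in> P" "\<omega> = orb (act W) A p" by blast
    then consider x where "p = UInl x" "x \<in> S" | x where "p = UInr x" "x \<in> T" by (auto simp: P_def)
    then show "\<omega> \<in> (\<lambda>\<omega>. UInl ` \<omega>) ` orb (act X) A ` pts X \<union> (\<lambda>\<omega>. UInr ` \<omega>) ` orb (act X) A ` pts X"
    proof cases
      case (1 x)
      then have "\<omega> = UInl ` orb (act X) A x" using p W(3)[OF p(1)] bl by (simp add: orb_def image_image)
      then show ?thesis using 1 S by blast
    next
      case (2 x)
      then have "\<omega> = UInr ` orb (act X) A x" using p W(3)[OF p(1)] br by (simp add: orb_def image_image)
      then show ?thesis using 2 S by blast
    qed
  qed
  have "finite (orb (act W) A ` P)"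
    by (rule finite_subset[OF oW]) (use finite_orbits[OF ob_fin_acts[OF X] A] in simp)
  then have gW: "good W t"
    unfolding good_def W1 using aW A open_stab[OF A] W2 by auto
  have "hat_iso G (?s (S \<union> T)) W"
    unfolding hat_iso_def
  proof (intro exI[of _ "\<lambda>x. if x \<in> S then UInl x else UInr x"] exI[of _ "stab A"] conjI ballI)
    show "bij_betw (\<lambda>x. if x \<in> S then UInl x else UInr x) (pts (?s (S \<union> T))) (pts W)"
      unfolding bij_betw_def W1 using S(3) by (auto simp: sub_gset_def P_def inj_on_def)
    show "open_subgroup G (stab A)" by (rule open_stab[OF A])
    show "stab A \<subseteq> grp (?s (S \<union> T)) \<inter> grp W" by (simp add: W1 sub_gset_def)
    fix h x assume h: "h \<in> stab A" and "x \<in> pts (?s (S \<union> T))"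
    then consider "x \<in> S" | "x \<in> T" "x \<notin> S" by (auto simp: sub_gset_def)
    then show "(if act (?s (S \<union> T)) h x \<in> S then UInl (act (?s (S \<union> T)) h x) else UInr (act (?s (S \<union> T)) h x)) =
        act W h (if x \<in> S then UInl x else UInr x)"
    proof cases
      case 1
      then show ?thesis using stable(1)[OF h] W(3)[of "UInl x" h] bl by (simp add: sub_gset_def P_def)
    next
      case 2
      then have "act X h x \<in> T" "act X h x \<notin> S" using stable(2)[OF h] S(3) by auto
      then show ?thesis using 2 W(3)[of "UInr x" h] br by (simp add: sub_gset_def P_def)
    qed
  qed
  then have "\<mu> (?s (S \<union> T)) = \<mu> W"
    by (rule gset_measure.iso_invariant[OF measure good_fin_smooth[OF gST] good_fin_smooth[OF gW]])
  then show ?thesis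
    using gset_measure.additive[OF measure good_fin_smooth[OF gS] good_fin_smooth[OF gT]] by (simp add: W_def)
qed

text \<open>Additivity over the orbits is proved for rational values first. The map
  \<open>\<kappa>\<close> is additive only on \<open>Z_sixth\<close>, so the measure of every orbit
  has to be located there before the sum is taken to \<open>'k\<close>.\<close>

lemma mu_sub_stab:
  assumes X: "ob X" and A: "finite A" and fin: "finite \<O>" and \<O>: "\<O> \<subseteq> orb (act X) A ` pts X"
  shows "\<mu> (sub_gset X (stab A) (\<Union>\<O>)) = (\<Sum>\<omega>\<in>\<O>. nu (card (A \<union> supp X (rep \<omega>))) / nu (card A)) \<and>
    \<kappa> (\<mu> (sub_gset X (stab A) (\<Union>\<O>))) = (\<Sum>\<omega>\<in>\<O>. wt A (supp X (rep \<omega>)))"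
proof -
  have a: "acts G (pts X) (act X) (supp X)" using X by (simp add: ob_def)
  note aA = acts_stab[OF a, of A]
  have stab_O: "act X h x \<in> \<omega>" if \<omega>: "\<omega> \<in> orb (act X) A ` pts X" and h: "h \<in> stab A" and x: "x \<in> \<omega>" for \<omega> h x
  proof -
    obtain y where y: "y \<in> pts X" "\<omega> = orb (act X) A y" using \<omega> by blast
    then have "x \<in> pts X" "orb (act X) A x = \<omega>" using orb_eq[OF aA y(1)] orb_sub[OF aA y(1)] x by auto
    then show ?thesis using h by (auto simp: orb_def)
  qed
  have O_sub: "\<omega> \<subseteq> pts X" if "\<omega> \<in> orb (act X) A ` pts X" for \<omega> using that orb_sub[OF aA] by blast
  have disj: "\<omega> \<inter> \<omega>' = {}" if \<omega>: "\<omega> \<in> orb (act X) A ` pts X" "\<omega>' \<in> orb (act X) A ` pts X" "\<omega> \<noteq> \<omega>'" for \<omega> \<omega>'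
  proof (rule ccontr)
    assume "\<omega> \<inter> \<omega>' \<noteq> {}"
    then obtain z where "z \<in> \<omega>" "z \<in> \<omega>'" by blast
    then have "orb (act X) A z = \<omega>" "orb (act X) A z = \<omega>'" using \<omega> orb_eq[OF aA] by auto
    then show False using \<omega>(3) by simp
  qed
  have val: "\<mu> (sub_gset X (stab A) \<omega>) = nu (card (A \<union> supp X (rep \<omega>))) / nu (card A)"
    if \<omega>: "\<omega> \<in> orb (act X) A ` pts X" for \<omega>
    using mu_orbit[OF X A rep_orbit(2)[OF a \<omega>]] rep_orbit(3)[OF a \<omega>] by simp
  have Z: "\<mu> (sub_gset X (stab A) \<omega>) \<in> Z_sixth" if \<omega>: "\<omega> \<in> orb (act X) A ` pts X" for \<omega>
    by (rule mu_Z_sixth, rule good_fin_smooth, rule good_sub[OF X open_stab[OF A] O_sub[OF \<omega>] stab_O[OF \<omega>]])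
  \<comment> \<open>The empty set is the disjoint union of itself with itself, so its measure equals
    its double.\<close>
  have empty: "\<mu> (sub_gset X (stab A) {}) = 0"
    using mu_union[OF X A, of "{}" "{}"] by simp
  have main: "\<mu> (sub_gset X (stab A) (\<Union>\<O>)) = (\<Sum>\<omega>\<in>\<O>. \<mu> (sub_gset X (stab A) \<omega>))"
    using fin \<O>
  proof (induction \<O>)
    case empty
    then show ?case using \<open>\<mu> (sub_gset X (stab A) {}) = 0\<close> by simp
  next
    case (insert \<omega> \<O>')
    have "\<mu> (sub_gset X (stab A) (\<omega> \<union> \<Union>\<O>')) = \<mu> (sub_gset X (stab A) \<omega>) + \<mu> (sub_gset X (stab A) (\<Union>\<O>'))"
    proof (rule mu_union[OF X A])
      show "\<omega> \<subseteq> pts X" using insert.prems O_sub by blast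
      show "\<Union>\<O>' \<subseteq> pts X" using insert.prems O_sub by blast
      have "\<omega> \<inter> \<omega>' = {}" if "\<omega>' \<in> \<O>'" for \<omega>' using disj[of \<omega> \<omega>'] insert.prems insert.hyps(2) that by auto
      then show "\<omega> \<inter> \<Union>\<O>' = {}" by blast
    next
      fix h x assume h: "h \<in> stab A"
      show "x \<in> \<omega> \<Longrightarrow> act X h x \<in> \<omega>" using stab_O[of \<omega> h x] insert.prems h by simp
      assume "x \<in> \<Union>\<O>'"
      then obtain \<omega>' where "\<omega>' \<in> \<O>'" "x \<in> \<omega>'" by blast
      then show "act X h x \<in> \<Union>\<O>'" using stab_O[of \<omega>' h x] insert.prems h by auto
    qed
    then show ?case using insert by simp
  qed
  have "\<kappa> (\<Sum>\<omega>\<in>\<O>. \<mu> (sub_gset X (stab A) \<omega>)) = (\<Sum>\<omega>\<in>\<O>. \<kappa> (\<mu> (sub_gset X (stab A) \<omega>)))"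
    using kappa_sum[OF fin, of "\<lambda>\<omega>. \<mu> (sub_gset X (stab A) \<omega>)"] Z \<O> by blast
  also have "\<dots> = (\<Sum>\<omega>\<in>\<O>. wt A (supp X (rep \<omega>)))"
    using val \<O> by (intro sum.cong) (auto simp: kappa_nu wt_def subset_iff)
  finally have "\<kappa> (\<mu> (sub_gset X (stab A) (\<Union>\<O>))) = (\<Sum>\<omega>\<in>\<O>. wt A (supp X (rep \<omega>)))" by (simp only: main)
  moreover have "(\<Sum>\<omega>\<in>\<O>. \<mu> (sub_gset X (stab A) \<omega>)) = (\<Sum>\<omega>\<in>\<O>. nu (card (A \<union> supp X (rep \<omega>))) / nu (card A))"
    using val \<O> by (intro sum.cong) (auto simp: subset_iff)
  ultimately show ?thesis using main by simp
qed

text \<open>The identity map is an isomorphism after shrinking the group of definition.\<close>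

lemma mu_restrict:
  assumes X: "ob X" and U: "open_subgroup G U" and A: "finite A" "stab A \<subseteq> U" and S: "S \<subseteq> pts X"
    and stable: "\<And>h x. h \<in> U \<Longrightarrow> x \<in> S \<Longrightarrow> act X h x \<in> S"
  shows "\<mu> (sub_gset X U S) = \<mu> (sub_gset X (stab A) S)"
proof (rule gset_measure.iso_invariant[OF measure])
  show "fin_smooth_hat G E (sub_gset X U S)" by (rule good_fin_smooth[OF good_sub[OF X U S stable]])
  show "fin_smooth_hat G E (sub_gset X (stab A) S)"
    by (rule good_fin_smooth[OF good_sub[OF X open_stab[OF A(1)] S]]) (use stable A in blast)
  show "hat_iso G (sub_gset X U S) (sub_gset X (stab A) S)"
    unfolding hat_iso_def
    by (intro exI[of _ "\<lambda>x. x"] exI[of _ "stab A"]) (use A open_stab[OF A(1)] in \<open>auto simp: sub_gset_def bij_betw_def\<close>)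
qed

text \<open>The definition sums over the values of \<open>f\<close> and measures each level set
  under the full invariance group \<open>U\<close>. That group contains \<open>stab A\<close>, so
  each level set can be measured by its orbits under \<open>stab A\<close>; collecting orbits with
  the same value of \<open>f\<close> gives the sum over all orbits.\<close>

lemma gset_integral_eq:
  assumes X: "ob X" and A: "finite A" and f: "invar A (pts X) (act X) f"
  shows "gset_integral (\<lambda>Z. \<kappa> (\<mu> Z)) X f = integ A (pts X) (act X) (supp X) f"
proof -
  have a: "acts G (pts X) (act X) (supp X)" and gX: "grp X = G" using X by (simp_all add: ob_def)
  note aA = acts_stab[OF a, of A]
  define U where "U = invariance_group X f"
  define S where "S c = {x \<in> pts X. f x = c}" for c
  define \<O> where "\<O> = orb (act X) A ` pts X"
  have AU: "stab A \<subseteq> U" using f stab_sub by (auto simp: U_def invariance_group_def gX invar_def)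
  have UG: "U \<subseteq> G" by (auto simp: U_def invariance_group_def gX)
  have Uf: "f (act X h x) = f x" if "h \<in> U" "x \<in> pts X" for h x
    using that by (simp add: U_def invariance_group_def)
  have "perm_closed U"
    unfolding perm_closed_def
  proof (intro conjI ballI)
    show "id \<in> U" using actsD(2)[OF a] G_id by (simp add: U_def invariance_group_def gX)
    fix g assume g: "g \<in> U"
    then have gG: "g \<in> G" using UG by blast
    show "bij g" by (rule G_bij[OF gG])
    have "f (act X (pinv g) x) = f x" if x: "x \<in> pts X" for x
    proof -
      have "act X (pinv g) x \<in> pts X" by (rule actsD(1)[OF a G_inv[OF gG] x])
      from Uf[OF g this] show ?thesis
        using actsD(3)[OF a gG G_inv[OF gG] x] actsD(2)[OF a x] inv_cancel(2)[OF gG] by simp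
    qed
    then show "pinv g \<in> U" using G_inv[OF gG] by (simp add: U_def invariance_group_def gX)
    fix h assume h: "h \<in> U"
    then have hG: "h \<in> G" using UG by blast
    have "f (act X (g \<circ> h) x) = f x" if x: "x \<in> pts X" for x
      using actsD(3)[OF a gG hG x] Uf[OF g actsD(1)[OF a hG x]] Uf[OF h x] by simp
    then show "g \<circ> h \<in> U" using G_comp[OF gG hG] by (simp add: U_def invariance_group_def gX)
  qed
  then have openU: "open_subgroup G U" using AU UG A by (auto simp: open_iff)
  have fin: "finite \<O>" unfolding \<O>_def by (rule finite_orbits[OF ob_fin_acts[OF X] A])
  have f_rep: "f (rep (orb (act X) A x)) = f x" if "x \<in> pts X" for x by (rule invar_rep[OF a f that])
  have S_eq: "S c = \<Union>{\<omega> \<in> \<O>. f (rep \<omega>) = c}" for c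
  proof
    show "S c \<subseteq> \<Union>{\<omega> \<in> \<O>. f (rep \<omega>) = c}"
      using orb_self[OF aA] f_rep by (auto simp: S_def \<O>_def)
    show "\<Union>{\<omega> \<in> \<O>. f (rep \<omega>) = c} \<subseteq> S c"
    proof clarify
      fix x \<omega> assume x: "x \<in> \<omega>" "\<omega> \<in> \<O>" "c = f (rep \<omega>)"
      then obtain y where y: "y \<in> pts X" "\<omega> = orb (act X) A y" by (auto simp: \<O>_def)
      then show "x \<in> S (f (rep \<omega>))"
        using x(1) invar_orbit[OF a f y(1)] orb_sub[OF aA y(1)] f_rep[OF y(1)] by (auto simp: S_def)
    qed
  qed
  have kS: "\<kappa> (\<mu> (sub_gset X U (S c))) = (\<Sum>\<omega>\<in>{\<omega> \<in> \<O>. f (rep \<omega>) = c}. wt A (supp X (rep \<omega>)))" for c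
  proof -
    have "\<mu> (sub_gset X U (S c)) = \<mu> (sub_gset X (stab A) (S c))"
      by (rule mu_restrict[OF X openU A AU]) (use Uf actsD(1)[OF a] UG in \<open>auto simp: S_def\<close>)
    moreover have "\<kappa> (\<mu> (sub_gset X (stab A) (S c))) = (\<Sum>\<omega>\<in>{\<omega> \<in> \<O>. f (rep \<omega>) = c}. wt A (supp X (rep \<omega>)))"
      unfolding S_eq by (rule conjunct2[OF mu_sub_stab[OF X A]]) (use fin in \<open>auto simp: \<O>_def\<close>)
    ultimately show ?thesis by simp
  qed
  have im: "f ` pts X = (\<lambda>\<omega>. f (rep \<omega>)) ` \<O>"
    using f_rep by (auto simp: \<O>_def image_image cong: image_cong)
  have "gset_integral (\<lambda>Z. \<kappa> (\<mu> Z)) X f =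
      (\<Sum>c\<in>f ` pts X - {0}. c * (\<Sum>\<omega>\<in>{\<omega> \<in> \<O>. f (rep \<omega>) = c}. wt A (supp X (rep \<omega>))))"
    unfolding gset_integral_def using kS by (simp add: U_def S_def)
  also have "\<dots> = (\<Sum>c\<in>f ` pts X. c * (\<Sum>\<omega>\<in>{\<omega> \<in> \<O>. f (rep \<omega>) = c}. wt A (supp X (rep \<omega>))))"
    by (rule sum.mono_neutral_left) (use im fin in auto)
  also have "\<dots> = (\<Sum>c\<in>f ` pts X. \<Sum>\<omega>\<in>{\<omega> \<in> \<O>. f (rep \<omega>) = c}. f (rep \<omega>) * wt A (supp X (rep \<omega>)))"
    by (simp add: sum_distrib_left)
  also have "\<dots> = (\<Sum>\<omega>\<in>\<O>. f (rep \<omega>) * wt A (supp X (rep \<omega>)))"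
    by (rule sum.group) (use im fin in auto)
  finally show ?thesis by (simp add: integ_def \<O>_def)
qed

section \<open>Rules of integration\<close>

lemma fin_actsD: "fin_acts X a s \<Longrightarrow> acts G X a s"
  by (simp add: fin_acts_def)

lemma rep_in: "acts G X a s \<Longrightarrow> x \<in> X \<Longrightarrow> rep (orb a A x) \<in> X"
  by (rule rep_orbit(2)) auto

lemma integ_cong:
  assumes "acts G X a s" "\<And>x. x \<in> X \<Longrightarrow> f x = g x" shows "integ A X a s f = integ A X a s g"
  unfolding integ_def using assms rep_orbit(2)[OF assms(1)] by (intro sum.cong) auto

lemma integ_add: "integ A X a s (\<lambda>x. f x + g x) = integ A X a s f + integ A X a s g"
  by (simp add: integ_def distrib_right sum.distrib)

lemma integ_cmult: "integ A X a s (\<lambda>x. c * f x) = c * integ A X a s f"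
  by (simp add: integ_def sum_distrib_left mult.assoc)

lemma integ_multc: "integ A X a s (\<lambda>x. f x * c) = integ A X a s f * c"
  using integ_cmult[of A X a s c f] by (simp add: mult.commute)

lemma integ_zero: "integ A X a s (\<lambda>x. 0) = 0"
  by (simp add: integ_def)

lemma wt_self: "B \<subseteq> A \<Longrightarrow> wt A B = 1"
  by (simp add: wt_def sup_absorb1)

lemma wt_mult: "wt A B * wt (A \<union> B) C = wt A (B \<union> C)"
  by (simp add: wt_def Un_assoc)

lemma orb_fixed:
  assumes "acts G X a s" "x \<in> X" "s x \<subseteq> A" shows "orb a A x = {x}"
proof -
  have "a g x = x" if "g \<in> stab A" for g
    using actsD(5)[OF assms(1) _ assms(2), of g] that assms(3) by (auto simp: stab_iff)
  then show ?thesis using stab_id[of A] by (auto simp: orb_def)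
qed

text \<open>A point whose support lies in \<open>A\<close> is an orbit by itself and has weight
  1.\<close>

lemma integ_delta:
  assumes X: "fin_acts X a s" and A: "finite A" and x0: "x0 \<in> X" "s x0 \<subseteq> A"
    and f: "\<And>x. x \<in> X \<Longrightarrow> x \<noteq> x0 \<Longrightarrow> f x = 0"
  shows "integ A X a s f = f x0"
proof -
  note a = fin_actsD[OF X]
  have fin: "finite (orb a A ` X)" by (rule finite_orbits[OF X A])
  have o: "orb a A x0 = {x0}" by (rule orb_fixed[OF a x0])
  have "rep \<omega> = x0 \<longleftrightarrow> \<omega> = {x0}" if \<omega>: "\<omega> \<in> orb a A ` X" for \<omega>
    using rep_orbit[OF a \<omega>] o by auto
  then have "integ A X a s f = (\<Sum>\<omega>\<in>orb a A ` X. if \<omega> = {x0} then f x0 else 0)"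
    unfolding integ_def using rep_orbit(2)[OF a] f x0
    by (intro sum.cong refl) (auto simp: wt_self rep_def[of "{x0}"])
  also have "\<dots> = f x0" using fin o x0 by (simp add: sum.delta) force
  finally show ?thesis .
qed

lemma integ_bij:
  assumes a: "acts G X a s" and b: "acts G Y b t" and h: "bij_betw h X Y"
    and eq: "\<And>g x. g \<in> G \<Longrightarrow> x \<in> X \<Longrightarrow> h (a g x) = b g (h x)" and st: "\<And>x. x \<in> X \<Longrightarrow> t (h x) = s x"
    and f: "invar A Y b f"
  shows "integ A X a s (\<lambda>x. f (h x)) = integ A Y b t f"
proof -
  have hX: "h x \<in> Y" if "x \<in> X" for x using h that by (auto simp: bij_betw_def)
  have im: "h ` orb a A x = orb b A (h x)" if "x \<in> X" for x
    unfolding orb_def image_image using eq that stab_sub by (intro image_cong) auto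
  have sub: "\<omega> \<subseteq> X" if "\<omega> \<in> orb a A ` X" for \<omega> using that orb_sub[OF acts_stab[OF a]] by blast
  have "bij_betw ((`) h) (orb a A ` X) (orb b A ` Y)"
    unfolding bij_betw_def
  proof
    show "inj_on ((`) h) (orb a A ` X)"
    proof (rule inj_onI)
      fix \<omega> \<omega>' assume "\<omega> \<in> orb a A ` X" "\<omega>' \<in> orb a A ` X" "h ` \<omega> = h ` \<omega>'"
      then show "\<omega> = \<omega>'" using inj_on_image_eq_iff[OF bij_betw_imp_inj_on[OF h]] sub by blast
    qed
    have "(`) h ` orb a A ` X = (\<lambda>x. orb b A (h x)) ` X" unfolding image_image using im by (intro image_cong) auto
    also have "\<dots> = orb b A ` h ` X" by (simp add: image_image)
    finally show "(`) h ` orb a A ` X = orb b A ` Y" using bij_betw_imp_surj_on[OF h] by simp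
  qed
  then have "integ A Y b t f = (\<Sum>\<omega>\<in>orb a A ` X. f (rep (h ` \<omega>)) * wt A (t (rep (h ` \<omega>))))"
    unfolding integ_def by (rule sum.reindex_bij_betw[symmetric])
  also have "\<dots> = (\<Sum>\<omega>\<in>orb a A ` X. f (h (rep \<omega>)) * wt A (s (rep \<omega>)))"
  proof (intro sum.cong refl)
    fix \<omega> assume \<omega>: "\<omega> \<in> orb a A ` X"
    have r: "rep \<omega> \<in> X" "h ` \<omega> = orb b A (h (rep \<omega>))"
      using rep_orbit(2)[OF a \<omega>] im[OF rep_orbit(2)[OF a \<omega>]] by (simp_all only: rep_orbit(3)[OF a \<omega>])
    show "f (rep (h ` \<omega>)) * wt A (t (rep (h ` \<omega>))) = f (h (rep \<omega>)) * wt A (s (rep \<omega>))"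
      unfolding r(2) using invar_rep[OF b f hX[OF r(1)]] invar_rep[OF b invar_wt[OF b] hX[OF r(1)]] st[OF r(1)]
      by simp
  qed
  finally show ?thesis by (simp add: integ_def)
qed

lemma integ_conj:
  assumes b: "acts G Y b t" and g: "g \<in> G" and f: "invar (g ` A) Y b f"
  shows "integ (g ` A) Y b t f = integ A Y b t (\<lambda>y. f (b g y))"
proof -
  have gi: "pinv g \<in> G" by (rule G_inv[OF g])
  have bgi: "b (pinv g) (b g y) = y" "b g (b (pinv g) y) = y" if "y \<in> Y" for y
    using actsD(3)[OF b gi g that] actsD(3)[OF b g gi that] actsD(2)[OF b that] inv_cancel[OF g] by auto
  have bij: "bij_betw (b g) Y Y"
    by (rule bij_betwI[of _ _ _ "b (pinv g)"]) (use bgi actsD(1)[OF b] g gi in auto)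
  have conj: "g \<circ> k \<circ> pinv g \<in> stab (g ` A)" if "k \<in> stab A" for k
    using that g gi inv_cancel[OF g] by (auto simp: stab_iff intro!: G_comp)
  have conj': "pinv g \<circ> k \<circ> g \<in> stab A" if "k \<in> stab (g ` A)" for k
    using that g gi inv_cancel[OF g] by (auto simp: stab_iff intro!: G_comp)
  have im: "b g ` orb b A y = orb b (g ` A) (b g y)" if y: "y \<in> Y" for y
  proof -
    have 1: "b g (b k y) = b (g \<circ> k \<circ> pinv g) (b g y)" if k: "k \<in> G" for k
    proof -
      have "(g \<circ> k \<circ> pinv g) \<circ> g = g \<circ> k" using inv_cancel(1)[OF g] by (simp add: o_assoc[symmetric])
      then show ?thesis
        using actsD(3)[OF b G_comp[OF G_comp[OF g k] gi] g y] actsD(3)[OF b g k y] by simp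
    qed
    show ?thesis
    proof
      show "b g ` orb b A y \<subseteq> orb b (g ` A) (b g y)"
        using 1 conj by (auto simp: orb_def stab_iff[of _ A])
      show "orb b (g ` A) (b g y) \<subseteq> b g ` orb b A y"
      proof
        fix z assume "z \<in> orb b (g ` A) (b g y)"
        then obtain k where k: "k \<in> stab (g ` A)" "z = b k (b g y)" by (auto simp: orb_def)
        have kG: "k \<in> G" using k by (simp add: stab_iff)
        have "g \<circ> (pinv g \<circ> k \<circ> g) = k \<circ> g" using inv_cancel(2)[OF g] by (simp add: o_assoc)
        then have "z = b g (b (pinv g \<circ> k \<circ> g) y)"
          using actsD(3)[OF b kG g y] actsD(3)[OF b g G_comp[OF G_comp[OF gi kG] g] y] k(2) by simp
        then show "z \<in> b g ` orb b A y" using conj'[OF k(1)] by (auto simp: orb_def)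
      qed
    qed
  qed
  have sub: "\<omega> \<subseteq> Y" if "\<omega> \<in> orb b A ` Y" for \<omega> using that orb_sub[OF acts_stab[OF b]] by blast
  have "bij_betw ((`) (b g)) (orb b A ` Y) (orb b (g ` A) ` Y)"
    unfolding bij_betw_def
  proof
    show "inj_on ((`) (b g)) (orb b A ` Y)"
    proof (rule inj_onI)
      fix \<omega> \<omega>' assume "\<omega> \<in> orb b A ` Y" "\<omega>' \<in> orb b A ` Y" "b g ` \<omega> = b g ` \<omega>'"
      then show "\<omega> = \<omega>'" using inj_on_image_eq_iff[OF bij_betw_imp_inj_on[OF bij]] sub by blast
    qed
    have "(`) (b g) ` orb b A ` Y = (\<lambda>x. orb b (g ` A) (b g x)) ` Y"
      unfolding image_image using im by (intro image_cong) auto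
    also have "\<dots> = orb b (g ` A) ` b g ` Y" by (simp add: image_image)
    finally show "(`) (b g) ` orb b A ` Y = orb b (g ` A) ` Y" using bij_betw_imp_surj_on[OF bij] by simp
  qed
  then have "integ (g ` A) Y b t f = (\<Sum>\<omega>\<in>orb b A ` Y. f (rep (b g ` \<omega>)) * wt (g ` A) (t (rep (b g ` \<omega>))))"
    unfolding integ_def by (rule sum.reindex_bij_betw[symmetric])
  also have "\<dots> = (\<Sum>\<omega>\<in>orb b A ` Y. f (b g (rep \<omega>)) * wt A (t (rep \<omega>)))"
  proof (intro sum.cong refl)
    fix \<omega> assume \<omega>: "\<omega> \<in> orb b A ` Y"
    have r: "rep \<omega> \<in> Y" "b g ` \<omega> = orb b (g ` A) (b g (rep \<omega>))"
      using rep_orbit(2)[OF b \<omega>] im[OF rep_orbit(2)[OF b \<omega>]] by (simp_all only: rep_orbit(3)[OF b \<omega>])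
    have gY: "b g (rep \<omega>) \<in> Y" by (rule actsD(1)[OF b g r(1)])
    have inj: "inj g" using G_bij[OF g] by (rule bij_is_inj)
    have "wt (g ` A) (t (b g (rep \<omega>))) = wt A (t (rep \<omega>))"
      using acts_equivariant[OF b g r(1)] card_image[OF inj_on_subset[OF inj subset_UNIV], of A]
        card_image[OF inj_on_subset[OF inj subset_UNIV], of "A \<union> t (rep \<omega>)"]
      by (simp add: wt_def image_Un)
    then show "f (rep (b g ` \<omega>)) * wt (g ` A) (t (rep (b g ` \<omega>))) = f (b g (rep \<omega>)) * wt A (t (rep \<omega>))"
      unfolding r(2) using invar_rep[OF b f gY] invar_rep[OF b invar_wt[OF b] gY] by simp
  qed
  finally show ?thesis by (simp add: integ_def)
qed

section \<open>Products and Fubini's theorem\<close>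

definition pact :: "(('w \<Rightarrow> 'w) \<Rightarrow> 'x \<Rightarrow> 'x) \<Rightarrow> (('w \<Rightarrow> 'w) \<Rightarrow> 'y \<Rightarrow> 'y) \<Rightarrow> ('w \<Rightarrow> 'w) \<Rightarrow> 'x \<times> 'y \<Rightarrow> 'x \<times> 'y" where
  "pact a b g p = (a g (fst p), b g (snd p))"

definition psupp :: "('x \<Rightarrow> 'w set) \<Rightarrow> ('y \<Rightarrow> 'w set) \<Rightarrow> 'x \<times> 'y \<Rightarrow> 'w set" where
  "psupp s t p = s (fst p) \<union> t (snd p)"

lemma acts_prod: "acts G X a s \<Longrightarrow> acts G Y b t \<Longrightarrow> acts G (X \<times> Y) (pact a b) (psupp s t)"
  unfolding acts_def pact_def psupp_def by auto

text \<open>Fubini is built into the weights: an orbit on \<open>X \<times> Y\<close> is an orbit on \<open>X\<close> together with an orbit on \<open>Y\<close>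
  of the stabilizer of a point of the former, and weights are multiplicative.\<close>

lemma orbits_prod:
  assumes a: "acts G X a s" and b: "acts G Y b t"
  shows "bij_betw (\<lambda>(P, Q). orb (pact a b) A (rep P, rep Q))
    (SIGMA P:orb a A ` X. orb b (A \<union> s (rep P)) ` Y) (orb (pact a b) A ` (X \<times> Y))"
proof -
  note ab = acts_prod[OF a b]
  note aA = acts_stab[OF a, of A] and abA = acts_stab[OF ab, of A]
  show ?thesis
    unfolding bij_betw_def
  proof
    show "inj_on (\<lambda>(P, Q). orb (pact a b) A (rep P, rep Q)) (SIGMA P:orb a A ` X. orb b (A \<union> s (rep P)) ` Y)"
    proof (rule inj_onI, clarify)
      fix P Q P' Q' x x' y y'
      assume eq: "orb (pact a b) A (rep (orb a A x), rep (orb b (A \<union> s (rep (orb a A x))) y)) =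
          orb (pact a b) A (rep (orb a A x'), rep (orb b (A \<union> s (rep (orb a A x'))) y'))"
        and xy: "x \<in> X" "x' \<in> X" "y \<in> Y" "y' \<in> Y"
      define P P' where "P = orb a A x" and "P' = orb a A x'"
      define Q Q' where "Q = orb b (A \<union> s (rep P)) y" and "Q' = orb b (A \<union> s (rep P')) y'"
      have P: "P \<in> orb a A ` X" "P' \<in> orb a A ` X" using xy by (auto simp: P_def P'_def)
      have Q: "Q \<in> orb b (A \<union> s (rep P)) ` Y" "Q' \<in> orb b (A \<union> s (rep P')) ` Y" using xy by (auto simp: Q_def Q'_def)
      note rP = rep_orbit[OF a P(1)] and rP' = rep_orbit[OF a P(2)]
        and rQ = rep_orbit[OF b Q(1)] and rQ' = rep_orbit[OF b Q(2)]
      have "(rep P, rep Q) \<in> orb (pact a b) A (rep P, rep Q)" using orb_self[OF abA] rP rQ by blast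
      then have "(rep P, rep Q) \<in> orb (pact a b) A (rep P', rep Q')" using eq by (simp add: P_def P'_def Q_def Q'_def)
      then obtain g where g: "g \<in> stab A" "rep P = a g (rep P')" "rep Q = b g (rep Q')"
        by (auto simp: orb_def pact_def)
      then have "rep P \<in> orb a A (rep P')" by (auto simp: orb_def)
      then have PP: "P = P'" using orb_eq[OF aA rP'(2)] rP(3) rP'(3) by simp
      \<comment> \<open>The element \<open>g\<close> fixes the chosen point of the first orbit,
        hence its support; so it belongs to the smaller group whose orbits are compared in the
        second coordinate.\<close>
      have "\<forall>w\<in>s (rep P). g w = w" using actsD(5)[OF aA g(1) rP(2)] g(2) PP by simp
      then have "g \<in> stab (A \<union> s (rep P))" using g(1) by (auto simp: stab_iff)
      then have "rep Q \<in> orb b (A \<union> s (rep P)) (rep Q')" using g(3) by (auto simp: orb_def)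
      then have "Q = Q'" using orb_eq[OF acts_stab[OF b] rQ'(2)] rQ(3) rQ'(3) PP by metis
      then show "orb a A x = orb a A x' \<and> orb b (A \<union> s (rep (orb a A x))) y = orb b (A \<union> s (rep (orb a A x'))) y'"
        using PP by (simp add: P_def P'_def Q_def Q'_def)
    qed
    show "(\<lambda>(P, Q). orb (pact a b) A (rep P, rep Q)) ` (SIGMA P:orb a A ` X. orb b (A \<union> s (rep P)) ` Y) =
        orb (pact a b) A ` (X \<times> Y)"
    proof
      show "(\<lambda>(P, Q). orb (pact a b) A (rep P, rep Q)) ` (SIGMA P:orb a A ` X. orb b (A \<union> s (rep P)) ` Y) \<subseteq>
          orb (pact a b) A ` (X \<times> Y)"
        using rep_in[OF a] rep_in[OF b] by auto
      show "orb (pact a b) A ` (X \<times> Y) \<subseteq>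
          (\<lambda>(P, Q). orb (pact a b) A (rep P, rep Q)) ` (SIGMA P:orb a A ` X. orb b (A \<union> s (rep P)) ` Y)"
      proof clarify
        fix x y assume xy: "x \<in> X" "y \<in> Y"
        define P where "P = orb a A x"
        have P: "P \<in> orb a A ` X" using xy by (simp add: P_def)
        note rP = rep_orbit[OF a P]
        \<comment> \<open>Move the pair until its first coordinate is the chosen representative, and
          then adjust the second coordinate by an element fixing the first.\<close>
        obtain g where g: "g \<in> stab A" "rep P = a g x" using rP(1) by (auto simp: P_def orb_def)
        have gG: "g \<in> G" using g by (simp add: stab_iff)
        define Q where "Q = orb b (A \<union> s (rep P)) (b g y)"
        have gy: "b g y \<in> Y" by (rule actsD(1)[OF b gG xy(2)])
        then have Q: "Q \<in> orb b (A \<union> s (rep P)) ` Y" by (simp add: Q_def)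
        obtain h where h: "h \<in> stab (A \<union> s (rep P))" "rep Q = b h (b g y)"
          using rep_orbit(1)[OF b Q] by (auto simp: Q_def orb_def)
        have hA: "h \<in> stab A" using h(1) by (auto simp: stab_iff)
        have "a h (rep P) = rep P" using actsD(5)[OF aA hA rP(2)] h(1) by (auto simp: stab_iff)
        then have "(rep P, rep Q) = pact a b (h \<circ> g) (x, y)"
          using g(2) h(2) actsD(3)[OF aA hA g(1) xy(1)] actsD(3)[OF acts_stab[OF b] hA g(1) xy(2)]
          by (simp add: pact_def)
        then have "(rep P, rep Q) \<in> orb (pact a b) A (x, y)" using stab_comp[OF hA g(1)] by (auto simp: orb_def)
        then have "orb (pact a b) A (x, y) = orb (pact a b) A (rep P, rep Q)"
          using orb_eq[OF abA] xy by blast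
        then show "orb (pact a b) A (x, y) \<in>
            (\<lambda>(P, Q). orb (pact a b) A (rep P, rep Q)) ` (SIGMA P:orb a A ` X. orb b (A \<union> s (rep P)) ` Y)"
          using P Q by force
      qed
    qed
  qed
qed

lemma fin_acts_prod:
  assumes "fin_acts X a s" "fin_acts Y b t" shows "fin_acts (X \<times> Y) (pact a b) (psupp s t)"
proof -
  note a = fin_actsD[OF assms(1)] and b = fin_actsD[OF assms(2)]
  have "finite (SIGMA P:orb a {} ` X. orb b ({} \<union> s (rep P)) ` Y)"
    using finite_orbits[OF assms(1), of "{}"] finite_orbits[OF assms(2)] actsD(4)[OF a] rep_orbit(2)[OF a]
    by (intro finite_SigmaI) auto
  then show ?thesis using orbits_prod[OF a b, of "{}"] acts_prod[OF a b]
    by (simp add: fin_acts_def bij_betw_finite)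
qed

lemma integ_Fubini:
  assumes X: "fin_acts X a s" and Y: "fin_acts Y b t" and A: "finite A" and f: "invar A (X \<times> Y) (pact a b) f"
  shows "integ A (X \<times> Y) (pact a b) (psupp s t) f =
    integ A X a s (\<lambda>x. integ (A \<union> s x) Y b t (\<lambda>y. f (x, y)))"
proof -
  note a = fin_actsD[OF X] and b = fin_actsD[OF Y]
  note ab = acts_prod[OF a b]
  have "integ A (X \<times> Y) (pact a b) (psupp s t) f =
    (\<Sum>(P, Q)\<in>(SIGMA P:orb a A ` X. orb b (A \<union> s (rep P)) ` Y).
      f (rep (orb (pact a b) A (rep P, rep Q))) * wt A (psupp s t (rep (orb (pact a b) A (rep P, rep Q)))))"
    unfolding integ_def by (subst sum.reindex_bij_betw[OF orbits_prod[OF a b], symmetric]) (simp add: case_prod_unfold)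
  also have "\<dots> = (\<Sum>(P, Q)\<in>(SIGMA P:orb a A ` X. orb b (A \<union> s (rep P)) ` Y).
      f (rep P, rep Q) * wt (A \<union> s (rep P)) (t (rep Q)) * wt A (s (rep P)))"
  proof (intro sum.cong refl, clarify)
    fix x y assume xy: "x \<in> X" "y \<in> Y"
    let ?P = "orb a A x"
    let ?Q = "orb b (A \<union> s (rep ?P)) y"
    have m: "(rep ?P, rep ?Q) \<in> X \<times> Y" using rep_in[OF a] rep_in[OF b] xy by auto
    show "f (rep (orb (pact a b) A (rep ?P, rep ?Q))) * wt A (psupp s t (rep (orb (pact a b) A (rep ?P, rep ?Q)))) =
      f (rep ?P, rep ?Q) * wt (A \<union> s (rep ?P)) (t (rep ?Q)) * wt A (s (rep ?P))"
      using invar_rep[OF ab f m] invar_rep[OF ab invar_wt[OF ab] m] wt_mult[of A "s (rep ?P)" "t (rep ?Q)"]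
      by (simp add: psupp_def mult_ac)
  qed
  also have "\<dots> = (\<Sum>P\<in>orb a A ` X. \<Sum>Q\<in>orb b (A \<union> s (rep P)) ` Y.
      f (rep P, rep Q) * wt (A \<union> s (rep P)) (t (rep Q)) * wt A (s (rep P)))"
    using finite_orbits[OF X A] finite_orbits[OF Y] A actsD(4)[OF a] rep_orbit(2)[OF a]
    by (intro sum.Sigma[symmetric]) auto
  also have "\<dots> = integ A X a s (\<lambda>x. integ (A \<union> s x) Y b t (\<lambda>y. f (x, y)))"
    unfolding integ_def by (simp add: sum_distrib_right)
  finally show ?thesis .
qed

lemma integ_swap:
  assumes X: "fin_acts X a s" and Y: "fin_acts Y b t" and A: "finite A"
    and f: "\<And>g x y. g \<in> stab A \<Longrightarrow> x \<in> X \<Longrightarrow> y \<in> Y \<Longrightarrow> f (a g x) (b g y) = f x y"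
  shows "integ A X a s (\<lambda>x. integ (A \<union> s x) Y b t (\<lambda>y. f x y)) =
    integ A Y b t (\<lambda>y. integ (A \<union> t y) X a s (\<lambda>x. f x y))"
proof -
  note a = fin_actsD[OF X] and b = fin_actsD[OF Y]
  have 1: "invar A (X \<times> Y) (pact a b) (\<lambda>p. f (fst p) (snd p))" using f by (auto simp: invar_def pact_def)
  have 2: "invar A (Y \<times> X) (pact b a) (\<lambda>p. f (snd p) (fst p))" using f by (auto simp: invar_def pact_def)
  have "integ A (X \<times> Y) (pact a b) (psupp s t) (\<lambda>p. f (snd (prod.swap p)) (fst (prod.swap p))) =
      integ A (Y \<times> X) (pact b a) (psupp t s) (\<lambda>p. f (snd p) (fst p))"
    by (rule integ_bij[OF acts_prod[OF a b] acts_prod[OF b a] _ _ _ 2])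
      (auto simp: bij_betw_def inj_on_def pact_def psupp_def)
  then show ?thesis using integ_Fubini[OF X Y A 1] integ_Fubini[OF Y X A 2] by simp
qed

section \<open>Matrices\<close>

definition eqm :: "('w, 'x) gset \<Rightarrow> ('w, 'x) gset \<Rightarrow> ('x \<Rightarrow> 'x \<Rightarrow> 'k) \<Rightarrow> bool" where
  "eqm X Y A \<longleftrightarrow> (\<forall>y x. (y, x) \<notin> pts Y \<times> pts X \<longrightarrow> A y x = 0) \<and>
     (\<forall>g\<in>G. \<forall>y\<in>pts Y. \<forall>x\<in>pts X. A (act Y g y) (act X g x) = A y x)"

lemma eqmD: assumes "eqm X Y A"
  shows "y \<notin> pts Y \<Longrightarrow> A y x = 0" "x \<notin> pts X \<Longrightarrow> A y x = 0"
    "g \<in> G \<Longrightarrow> y \<in> pts Y \<Longrightarrow> x \<in> pts X \<Longrightarrow> A (act Y g y) (act X g x) = A y x"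
  using assms by (auto simp: eqm_def)

abbreviation km :: "('w, 'a univ) gset \<Rightarrow> 'k" where "km \<equiv> \<lambda>Z. \<kappa> (\<mu> Z)"

definition mm :: "('w, 'a univ) gset \<Rightarrow> ('a univ \<Rightarrow> 'a univ \<Rightarrow> 'k) \<Rightarrow> ('a univ \<Rightarrow> 'a univ \<Rightarrow> 'k) \<Rightarrow> 'a univ \<Rightarrow> 'a univ \<Rightarrow> 'k" where
  "mm Y B A z x = gset_integral km Y (\<lambda>y. B z y * A y x)"

lemma obD: assumes "ob X"
  shows "acts G (pts X) (act X) (supp X)" "fin_acts (pts X) (act X) (supp X)" "grp X = G"
    "g \<in> G \<Longrightarrow> x \<in> pts X \<Longrightarrow> act X g x \<in> pts X" "x \<in> pts X \<Longrightarrow> finite (supp X x)"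
    "g \<in> G \<Longrightarrow> x \<in> pts X \<Longrightarrow> supp X (act X g x) = g ` supp X x"
    "g \<in> stab D \<Longrightarrow> x \<in> pts X \<Longrightarrow> supp X x \<subseteq> D \<Longrightarrow> act X g x = x"
proof -
  show a: "acts G (pts X) (act X) (supp X)" "grp X = G" using assms by (simp_all add: ob_def)
  show "fin_acts (pts X) (act X) (supp X)" by (rule ob_fin_acts[OF assms])
  show "g \<in> G \<Longrightarrow> x \<in> pts X \<Longrightarrow> act X g x \<in> pts X" by (rule actsD(1)[OF a(1)])
  show "x \<in> pts X \<Longrightarrow> finite (supp X x)" by (rule actsD(4)[OF a(1)])
  show "g \<in> G \<Longrightarrow> x \<in> pts X \<Longrightarrow> supp X (act X g x) = g ` supp X x" by (rule acts_equivariant[OF a(1)])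
  show "g \<in> stab D \<Longrightarrow> x \<in> pts X \<Longrightarrow> supp X x \<subseteq> D \<Longrightarrow> act X g x = x"
    using actsD(5)[OF a(1), of g x] by (auto simp: stab_iff)
qed

lemma mm_invar:
  assumes "ob X" "ob Y" "ob Z" "eqm X Y A" "eqm Y Z B" "z \<in> pts Z" "x \<in> pts X" "supp Z z \<union> supp X x \<subseteq> D"
  shows "invar D (pts Y) (act Y) (\<lambda>y. B z y * A y x)"
  unfolding invar_def
proof (intro ballI)
  fix g y assume g: "g \<in> stab D" and y: "y \<in> pts Y"
  have gG: "g \<in> G" using g by (simp add: stab_iff)
  have "act Z g z = z" "act X g x = x" using obD(7)[OF assms(3) g] obD(7)[OF assms(1) g] assms by auto
  then show "B z (act Y g y) * A (act Y g y) x = B z y * A y x"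
    using eqmD(3)[OF assms(4) gG y assms(7)] eqmD(3)[OF assms(5) gG assms(6) y] by simp
qed

text \<open>An entry of the product may be integrated relative to any finite \<open>D\<close> that
  contains both supports. Fubini's theorem forces such a larger \<open>D\<close> on the inner
  integral.\<close>

lemma mm_eq:
  assumes "ob X" "ob Y" "ob Z" "eqm X Y A" "eqm Y Z B" "z \<in> pts Z" "x \<in> pts X"
    "finite D" "supp Z z \<union> supp X x \<subseteq> D"
  shows "mm Y B A z x = integ D (pts Y) (act Y) (supp Y) (\<lambda>y. B z y * A y x)"
  unfolding mm_def by (rule gset_integral_eq[OF assms(2,8) mm_invar[OF assms(1-7,9)]])

lemma gset_integral_zero: "gset_integral m Y (\<lambda>y. 0) = 0"
  by (auto simp: gset_integral_def intro!: sum.neutral)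

lemma mm_out:
  assumes "eqm X Y A" "eqm Y Z B" "z \<notin> pts Z \<or> x \<notin> pts X" shows "mm Y B A z x = 0"
proof -
  have "(\<lambda>y. B z y * A y x) = (\<lambda>y. 0)" using eqmD[OF assms(1)] eqmD[OF assms(2)] assms(3) by auto
  then show ?thesis by (simp add: mm_def gset_integral_zero)
qed

lemma eqm_mm:
  assumes X: "ob X" and Y: "ob Y" and Z: "ob Z" and A: "eqm X Y A" and B: "eqm Y Z B"
  shows "eqm X Z (mm Y B A)"
  unfolding eqm_def
proof (intro conjI allI impI ballI)
  fix z x assume "(z, x) \<notin> pts Z \<times> pts X"
  then show "mm Y B A z x = 0" using mm_out[OF A B] by auto
next
  fix g z x assume g: "g \<in> G" and z: "z \<in> pts Z" and x: "x \<in> pts X"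
  define D where "D = supp Z z \<union> supp X x"
  have D: "finite D" "supp Z z \<union> supp X x \<subseteq> D" using obD(5)[OF Z z] obD(5)[OF X x] by (auto simp: D_def)
  have gz: "act Z g z \<in> pts Z" "act X g x \<in> pts X" using obD(4)[OF Z g z] obD(4)[OF X g x] .
  have gD: "supp Z (act Z g z) \<union> supp X (act X g x) \<subseteq> g ` D"
    using obD(6)[OF Z g z] obD(6)[OF X g x] by (auto simp: D_def)
  have "mm Y B A (act Z g z) (act X g x) =
      integ (g ` D) (pts Y) (act Y) (supp Y) (\<lambda>y. B (act Z g z) y * A y (act X g x))"
    by (rule mm_eq[OF X Y Z A B gz _ gD]) (use D in simp)
  also have "\<dots> = integ D (pts Y) (act Y) (supp Y) (\<lambda>y. B (act Z g z) (act Y g y) * A (act Y g y) (act X g x))"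
    by (rule integ_conj[OF obD(1)[OF Y] g mm_invar[OF X Y Z A B gz gD]])
  also have "\<dots> = integ D (pts Y) (act Y) (supp Y) (\<lambda>y. B z y * A y x)"
    by (rule integ_cong[OF obD(1)[OF Y]]) (use eqmD(3)[OF A g _ x] eqmD(3)[OF B g z] in simp)
  also have "\<dots> = mm Y B A z x" by (rule mm_eq[OF X Y Z A B z x D, symmetric])
  finally show "mm Y B A (act Z g z) (act X g x) = mm Y B A z x" .
qed

text \<open>Both sides are double integrals of \<open>C z y * B y x * A x w\<close>, taken in the
  two orders.\<close>

lemma mm_assoc:
  assumes W: "ob W" and X: "ob X" and Y: "ob Y" and Z: "ob Z"
    and A: "eqm W X A" and B: "eqm X Y B" and C: "eqm Y Z C"
  shows "mm X (mm Y C B) A = mm Y C (mm X B A)"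
proof (intro ext)
  fix z w
  note CB = eqm_mm[OF X Y Z B C] and BA = eqm_mm[OF W X Y A B]
  show "mm X (mm Y C B) A z w = mm Y C (mm X B A) z w"
  proof (cases "z \<in> pts Z \<and> w \<in> pts W")
    case False
    then show ?thesis using mm_out[OF A CB] mm_out[OF BA C] by auto
  next
    case True
    then have z: "z \<in> pts Z" and w: "w \<in> pts W" by auto
    define D where "D = supp Z z \<union> supp W w"
    have D: "finite D" "supp Z z \<union> supp W w \<subseteq> D" using obD(5)[OF Z z] obD(5)[OF W w] by (auto simp: D_def)
    have "mm X (mm Y C B) A z w = integ D (pts X) (act X) (supp X) (\<lambda>x. mm Y C B z x * A x w)"
      by (rule mm_eq[OF W X Z A CB z w D])
    also have "\<dots> = integ D (pts X) (act X) (supp X)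
        (\<lambda>x. integ (D \<union> supp X x) (pts Y) (act Y) (supp Y) (\<lambda>y. C z y * B y x * A x w))"
    proof (rule integ_cong[OF obD(1)[OF X]])
      fix x assume x: "x \<in> pts X"
      have "mm Y C B z x = integ (D \<union> supp X x) (pts Y) (act Y) (supp Y) (\<lambda>y. C z y * B y x)"
        by (rule mm_eq[OF X Y Z B C z x]) (use D obD(5)[OF X x] in auto)
      then show "mm Y C B z x * A x w =
          integ (D \<union> supp X x) (pts Y) (act Y) (supp Y) (\<lambda>y. C z y * B y x * A x w)"
        by (simp add: integ_multc)
    qed
    also have "\<dots> = integ D (pts Y) (act Y) (supp Y)
        (\<lambda>y. integ (D \<union> supp Y y) (pts X) (act X) (supp X) (\<lambda>x. C z y * B y x * A x w))"
    proof (rule integ_swap[OF obD(2)[OF X] obD(2)[OF Y] D(1)])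
      fix g x y assume g: "g \<in> stab D" and x: "x \<in> pts X" and y: "y \<in> pts Y"
      have gG: "g \<in> G" using g by (simp add: stab_iff)
      have "act Z g z = z" "act W g w = w" using obD(7)[OF Z g z] obD(7)[OF W g w] D by auto
      then show "C z (act Y g y) * B (act Y g y) (act X g x) * A (act X g x) w = C z y * B y x * A x w"
        using eqmD(3)[OF C gG z y] eqmD(3)[OF B gG y x] eqmD(3)[OF A gG x w] by simp
    qed
    also have "\<dots> = integ D (pts Y) (act Y) (supp Y) (\<lambda>y. C z y * mm X B A y w)"
    proof (rule integ_cong[OF obD(1)[OF Y]])
      fix y assume y: "y \<in> pts Y"
      have "mm X B A y w = integ (D \<union> supp Y y) (pts X) (act X) (supp X) (\<lambda>x. B y x * A x w)"
        by (rule mm_eq[OF W X Y A B y w]) (use D obD(5)[OF Y y] in auto)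
      then show "integ (D \<union> supp Y y) (pts X) (act X) (supp X) (\<lambda>x. C z y * B y x * A x w) = C z y * mm X B A y w"
        by (simp add: integ_cmult mult.assoc)
    qed
    also have "\<dots> = mm Y C (mm X B A) z w" by (rule mm_eq[OF W Y Z BA C z w D, symmetric])
    finally show ?thesis .
  qed
qed

lemma mm_add_left:
  assumes "ob X" "ob Y" "ob Z" "eqm X Y A" "eqm Y Z B" "eqm Y Z B'"
  shows "mm Y (\<lambda>z y. B z y + B' z y) A = (\<lambda>z x. mm Y B A z x + mm Y B' A z x)"
proof (intro ext)
  fix z x
  have S: "eqm Y Z (\<lambda>z y. B z y + B' z y)" using assms(5,6) by (auto simp: eqm_def)
  show "mm Y (\<lambda>z y. B z y + B' z y) A z x = mm Y B A z x + mm Y B' A z x"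
  proof (cases "z \<in> pts Z \<and> x \<in> pts X")
    case False
    then show ?thesis using mm_out[OF assms(4) S] mm_out[OF assms(4,5)] mm_out[OF assms(4,6)] by auto
  next
    case True
    then have zx: "z \<in> pts Z" "x \<in> pts X" by auto
    have D: "finite (supp Z z \<union> supp X x)"
      using obD(5)[OF assms(3) zx(1)] obD(5)[OF assms(1) zx(2)] by simp
    show ?thesis
      using mm_eq[OF assms(1-4) S zx D order_refl] mm_eq[OF assms(1-5) zx D order_refl]
        mm_eq[OF assms(1-4,6) zx D order_refl] by (simp add: integ_add distrib_right)
  qed
qed

lemma mm_add_right:
  assumes "ob X" "ob Y" "ob Z" "eqm X Y A" "eqm X Y A'" "eqm Y Z B"
  shows "mm Y B (\<lambda>z y. A z y + A' z y) = (\<lambda>z x. mm Y B A z x + mm Y B A' z x)"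
proof (intro ext)
  fix z x
  have S: "eqm X Y (\<lambda>z y. A z y + A' z y)" using assms(4,5) by (auto simp: eqm_def)
  show "mm Y B (\<lambda>z y. A z y + A' z y) z x = mm Y B A z x + mm Y B A' z x"
  proof (cases "z \<in> pts Z \<and> x \<in> pts X")
    case False
    then show ?thesis using mm_out[OF S assms(6)] mm_out[OF assms(4,6)] mm_out[OF assms(5,6)] by auto
  next
    case True
    then have zx: "z \<in> pts Z" "x \<in> pts X" by auto
    have D: "finite (supp Z z \<union> supp X x)"
      using obD(5)[OF assms(3) zx(1)] obD(5)[OF assms(1) zx(2)] by simp
    show ?thesis
      using mm_eq[OF assms(1-3) S assms(6) zx D order_refl] mm_eq[OF assms(1-4,6) zx D order_refl]
        mm_eq[OF assms(1-3,5,6) zx D order_refl] by (simp add: integ_add distrib_left)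
  qed
qed

lemma mm_smult:
  assumes "ob X" "ob Y" "ob Z" "eqm X Y A" "eqm Y Z B"
  shows "mm Y (\<lambda>z y. c * B z y) A = (\<lambda>z x. c * mm Y B A z x)" "mm Y B (\<lambda>y x. c * A y x) = (\<lambda>z x. c * mm Y B A z x)"
proof -
  have S: "eqm Y Z (\<lambda>z y. c * B z y)" "eqm X Y (\<lambda>z y. c * A z y)" using assms(4,5) by (auto simp: eqm_def)
  have "mm Y (\<lambda>z y. c * B z y) A z x = c * mm Y B A z x \<and> mm Y B (\<lambda>y x. c * A y x) z x = c * mm Y B A z x" for z x
  proof (cases "z \<in> pts Z \<and> x \<in> pts X")
    case False
    then show ?thesis using mm_out[OF assms(4) S(1)] mm_out[OF assms(4,5)] mm_out[OF S(2) assms(5)] by auto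
  next
    case True
    then have zx: "z \<in> pts Z" "x \<in> pts X" by auto
    have D: "finite (supp Z z \<union> supp X x)"
      using obD(5)[OF assms(3) zx(1)] obD(5)[OF assms(1) zx(2)] by simp
    show ?thesis
      using mm_eq[OF assms(1-4) S(1) zx D order_refl] mm_eq[OF assms(1-5) zx D order_refl]
        mm_eq[OF assms(1-3) S(2) assms(5) zx D order_refl] by (simp add: integ_cmult mult.assoc mult.left_commute[of _ c])
  qed
  then show "mm Y (\<lambda>z y. c * B z y) A = (\<lambda>z x. c * mm Y B A z x)" "mm Y B (\<lambda>y x. c * A y x) = (\<lambda>z x. c * mm Y B A z x)"
    by auto
qed

section \<open>Graphs of equivariant functions\<close>

definition eqf :: "('w, 'x) gset \<Rightarrow> ('w, 'x) gset \<Rightarrow> ('x \<Rightarrow> 'x) \<Rightarrow> bool" where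
  "eqf X Y f \<longleftrightarrow> (\<forall>x\<in>pts X. f x \<in> pts Y) \<and> (\<forall>g\<in>G. \<forall>x\<in>pts X. f (act X g x) = act Y g (f x))"

definition gm :: "('w, 'x) gset \<Rightarrow> ('x \<Rightarrow> 'x) \<Rightarrow> 'x \<Rightarrow> 'x \<Rightarrow> 'k" where
  "gm X f y x = (if x \<in> pts X \<and> y = f x then 1 else 0)"

lemma act_inj: "ob X \<Longrightarrow> g \<in> G \<Longrightarrow> x \<in> pts X \<Longrightarrow> y \<in> pts X \<Longrightarrow> act X g x = act X g y \<longleftrightarrow> x = y"
  using actsD(2,3)[OF obD(1)] G_inv inv_cancel(1) by metis

lemma eqm_gm: assumes "ob X" "ob Y" "eqf X Y f" shows "eqm X Y (gm X f)"
  unfolding eqm_def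
proof (intro conjI allI impI ballI)
  fix y x assume "(y, x) \<notin> pts Y \<times> pts X"
  then show "gm X f y x = 0" using assms(3) by (auto simp: gm_def eqf_def)
next
  fix g y x assume g: "g \<in> G" and y: "y \<in> pts Y" and x: "x \<in> pts X"
  then have "act Y g y = f (act X g x) \<longleftrightarrow> y = f x"
    using assms(3) act_inj[OF assms(2) g y, of "f x"] by (simp add: eqf_def)
  then show "gm X f (act Y g y) (act X g x) = gm X f y x"
    using obD(4)[OF assms(1) g x] x by (simp add: gm_def)
qed

lemma mm_gm_right:
  assumes X: "ob X" and Y: "ob Y" and Z: "ob Z" and f: "eqf X Y f" and B: "eqm Y Z B"
  shows "mm Y B (gm X f) z x = (if x \<in> pts X then B z (f x) else 0)"
proof (cases "z \<in> pts Z \<and> x \<in> pts X")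
  case False
  then show ?thesis using mm_out[OF eqm_gm[OF X Y f] B] eqmD(1)[OF B] by auto
next
  case True
  then have z: "z \<in> pts Z" and x: "x \<in> pts X" by auto
  have fx: "f x \<in> pts Y" using f x by (simp add: eqf_def)
  \<comment> \<open>The support of \<open>f x\<close> is added so that \<open>f x\<close> becomes an
    orbit of weight 1.\<close>
  let ?D = "supp Z z \<union> supp X x \<union> supp Y (f x)"
  have D: "finite ?D" using obD(5)[OF Z z] obD(5)[OF X x] obD(5)[OF Y fx] by simp
  have "mm Y B (gm X f) z x = integ ?D (pts Y) (act Y) (supp Y) (\<lambda>y. B z y * gm X f y x)"
    by (rule mm_eq[OF X Y Z eqm_gm[OF X Y f] B z x D]) auto
  also have "\<dots> = B z (f x) * gm X f (f x) x"
    by (rule integ_delta[OF obD(2)[OF Y] D fx]) (auto simp: gm_def)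
  finally show ?thesis using x by (simp add: gm_def)
qed

text \<open>By injectivity the row of the graph at \<open>f x\<close> has its only nonzero entry at
  \<open>x\<close>.\<close>

lemma mm_gm_left:
  assumes W: "ob W" and X: "ob X" and Y: "ob Y" and f: "eqf X Y f" and inj: "inj_on f (pts X)" and A: "eqm W X A"
  shows "x \<in> pts X \<Longrightarrow> mm X (gm X f) A (f x) w = A x w"
    and "y \<notin> f ` pts X \<Longrightarrow> mm X (gm X f) A y w = 0"
proof -
  note F = eqm_gm[OF X Y f]
  {
    assume x: "x \<in> pts X"
    have fx: "f x \<in> pts Y" using f x by (simp add: eqf_def)
    show "mm X (gm X f) A (f x) w = A x w"
    proof (cases "w \<in> pts W")
      case False
      then show ?thesis using mm_out[OF A F] eqmD(2)[OF A] by auto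
    next
      case w: True
      let ?D = "supp Y (f x) \<union> supp W w \<union> supp X x"
      have D: "finite ?D" using obD(5)[OF W w] obD(5)[OF X x] obD(5)[OF Y fx] by simp
      have "mm X (gm X f) A (f x) w = integ ?D (pts X) (act X) (supp X) (\<lambda>u. gm X f (f x) u * A u w)"
        by (rule mm_eq[OF W X Y A F fx w D]) auto
      also have "\<dots> = gm X f (f x) x * A x w"
        by (rule integ_delta[OF obD(2)[OF X] D x]) (use inj x in \<open>auto simp: gm_def inj_on_def\<close>)
      finally show ?thesis using x by (simp add: gm_def)
    qed
  }
  assume "y \<notin> f ` pts X"
  then have "(\<lambda>u. gm X f y u * A u w) = (\<lambda>u. 0)" by (auto simp: gm_def fun_eq_iff)
  then show "mm X (gm X f) A y w = 0" by (simp add: mm_def gset_integral_zero)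
qed

section \<open>The permutation category\<close>

lemma obI:
  assumes a: "acts G (pts Z) (act Z) s" and grp: "grp Z = G" and ext: "\<And>h. h \<in> G \<Longrightarrow> act Z h \<in> extensional (pts Z)"
    and fin: "finite (orb (act Z) {} ` pts Z)"
  shows "ob Z" and "x \<in> pts Z \<Longrightarrow> supp Z x = s x"
proof -
  have "good Z s" unfolding good_def grp
  proof (intro conjI ballI ext open_G a exI[of _ "{}"])
    show "finite (orb (act Z) {} ` pts Z)" by (rule fin)
  qed simp_all
  then show "ob Z" using grp fin by (rule good_ob)
  show "x \<in> pts Z \<Longrightarrow> supp Z x = s x" using acts_supp_eq[OF a] .
qed

section \<open>Products of objects and tensor products of matrices\<close>

lemma prod_pts: "pts (prod_gset X Y) = {UPair x y | x y. x \<in> pts X \<and> y \<in> pts Y}"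
  by (simp add: prod_gset_def Let_def)

lemma prod_pts_iff [simp]: "UPair x y \<in> pts (prod_gset X Y) \<longleftrightarrow> x \<in> pts X \<and> y \<in> pts Y"
  by (simp add: prod_pts)

lemma prod_grp [simp]: "grp (prod_gset X Y) = grp X \<inter> grp Y"
  by (simp add: prod_gset_def Let_def)

lemma prod_ptsE:
  assumes "s \<in> pts (prod_gset X Y)" obtains x y where "s = UPair x y" "x \<in> pts X" "y \<in> pts Y"
  using assms by (auto simp: prod_pts)

lemma prod_act [simp]:
  "x \<in> pts X \<Longrightarrow> y \<in> pts Y \<Longrightarrow> act (prod_gset X Y) g (UPair x y) = UPair (act X g x) (act Y g y)"
  by (auto simp: prod_gset_def Let_def)

lemma prod_bij: "bij_betw (\<lambda>(x, y). UPair x y) (pts X \<times> pts Y) (pts (prod_gset X Y))"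
  by (auto simp: bij_betw_def inj_on_def prod_pts image_iff)

lemma prod_acts:
  assumes X: "ob X" and Y: "ob Y"
  shows "acts G (pts (prod_gset X Y)) (act (prod_gset X Y))
    (\<lambda>s. case s of UPair x y \<Rightarrow> supp X x \<union> supp Y y)"
  unfolding acts_def
  by (auto elim!: prod_ptsE simp: actsD[OF obD(1)[OF X]] actsD[OF obD(1)[OF Y]] obD(4)[OF X] obD(4)[OF Y])

lemma ob_prod:
  assumes X: "ob X" and Y: "ob Y"
  shows "ob (prod_gset X Y)"
    and "x \<in> pts X \<Longrightarrow> y \<in> pts Y \<Longrightarrow> supp (prod_gset X Y) (UPair x y) = supp X x \<union> supp Y y"
proof -
  let ?P = "prod_gset X Y"
  have ext: "act ?P h \<in> extensional (pts ?P)" for h by (simp add: prod_gset_def Let_def)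
  have "orb (act ?P) {} (UPair x y) = (\<lambda>(x, y). UPair x y) ` orb (pact (act X) (act Y)) {} (x, y)"
    if "x \<in> pts X" "y \<in> pts Y" for x y
    using that by (auto simp: orb_def pact_def image_image)
  then have "orb (act ?P) {} ` pts ?P \<subseteq>
      (\<lambda>Q. (\<lambda>(x, y). UPair x y) ` Q) ` orb (pact (act X) (act Y)) {} ` (pts X \<times> pts Y)"
    by (force simp: prod_pts)
  then have fin: "finite (orb (act ?P) {} ` pts ?P)"
    using fin_acts_prod[OF obD(2)[OF X] obD(2)[OF Y]] unfolding fin_acts_def by (meson finite_imageI finite_subset)
  note * = obI[OF prod_acts[OF X Y] _ ext fin]
  have G: "grp ?P = G" using X Y by (simp add: ob_def)
  show "ob ?P" by (rule *(1)[OF G])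
  show "x \<in> pts X \<Longrightarrow> y \<in> pts Y \<Longrightarrow> supp ?P (UPair x y) = supp X x \<union> supp Y y"
    using *(2)[OF G, of "UPair x y"] by simp
qed

lemma prod_integ:
  assumes X: "ob X" and Y: "ob Y" and D: "finite D"
    and f: "invar D (pts (prod_gset X Y)) (act (prod_gset X Y)) f"
  shows "integ D (pts (prod_gset X Y)) (act (prod_gset X Y)) (supp (prod_gset X Y)) f =
    integ D (pts X) (act X) (supp X) (\<lambda>x. integ (D \<union> supp X x) (pts Y) (act Y) (supp Y) (\<lambda>y. f (UPair x y)))"
proof -
  have "integ D (pts X \<times> pts Y) (pact (act X) (act Y)) (psupp (supp X) (supp Y)) (\<lambda>p. f ((\<lambda>(x, y). UPair x y) p)) =
      integ D (pts (prod_gset X Y)) (act (prod_gset X Y)) (supp (prod_gset X Y)) f"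
    using prod_bij[of X Y]
    by (intro integ_bij acts_prod obD(1) X Y ob_prod(1) f) (auto simp: pact_def psupp_def ob_prod(2)[OF X Y])
  moreover have "integ D (pts X \<times> pts Y) (pact (act X) (act Y)) (psupp (supp X) (supp Y)) (\<lambda>p. f ((\<lambda>(x, y). UPair x y) p)) =
    integ D (pts X) (act X) (supp X) (\<lambda>x. integ (D \<union> supp X x) (pts Y) (act Y) (supp Y)
      (\<lambda>y. f ((\<lambda>(x, y). UPair x y) (x, y))))"
  proof (rule integ_Fubini[OF obD(2)[OF X] obD(2)[OF Y] D])
    show "invar D (pts X \<times> pts Y) (pact (act X) (act Y)) (\<lambda>p. f ((\<lambda>(x, y). UPair x y) p))"
      using f prod_act[of _ X _ Y] by (auto simp: invar_def pact_def simp flip: prod_act)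
  qed
  ultimately show ?thesis by simp
qed

lemma point_simps [simp]: "pts (point_gset U) = {UPoint}" "grp (point_gset U) = U"
  "act (point_gset U) g UPoint = UPoint"
  by (auto simp: point_gset_def)

lemma ob_point: "ob (point_gset G)" and supp_point [simp]: "supp (point_gset G) UPoint = {}"
proof -
  have a: "acts G (pts (point_gset G)) (act (point_gset G)) (\<lambda>_. {})"
    by (auto simp: acts_def)
  have e: "act (point_gset G) h \<in> extensional (pts (point_gset G))" for h by (simp add: point_gset_def)
  note * = obI[OF a _ e]
  show "ob (point_gset G)" "supp (point_gset G) UPoint = {}" using * by simp_all
qed

definition mt :: "('a univ \<Rightarrow> 'a univ \<Rightarrow> 'k) \<Rightarrow> ('a univ \<Rightarrow> 'a univ \<Rightarrow> 'k) \<Rightarrow> 'a univ \<Rightarrow> 'a univ \<Rightarrow> 'k" where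
  "mt A B y x = (case (y, x) of (UPair y1 y2, UPair x1 x2) \<Rightarrow> A y1 x1 * B y2 x2 | _ \<Rightarrow> 0)"

lemma mt_pair [simp]: "mt A B (UPair y y') (UPair x x') = A y x * B y' x'"
  by (simp add: mt_def)

lemma eqm_mt:
  assumes A: "eqm X Y A" and B: "eqm X' Y' B"
  shows "eqm (prod_gset X X') (prod_gset Y Y') (mt A B)"
  unfolding eqm_def
proof (intro conjI allI impI ballI)
  show "mt A B y x = 0" if "(y, x) \<notin> pts (prod_gset Y Y') \<times> pts (prod_gset X X')" for y x
    using that eqmD(1,2)[OF A] eqmD(1,2)[OF B]
    by (auto simp: mt_def prod_pts split: univ.splits)
qed (auto elim!: prod_ptsE simp: eqmD(3)[OF A] eqmD(3)[OF B])

text \<open>By Fubini's theorem the integral over the product of the middle objects becomes an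
  iterated integral, and the integrand is a product of one factor for each variable.\<close>

lemma mm_mt:
  assumes X: "ob X" "ob X'" and Y: "ob Y" "ob Y'" and Z: "ob Z" "ob Z'"
    and A: "eqm X Y A" "eqm X' Y' A'" and B: "eqm Y Z B" "eqm Y' Z' B'"
  shows "mm (prod_gset Y Y') (mt B B') (mt A A') = mt (mm Y B A) (mm Y' B' A')"
proof (intro ext)
  fix z x
  note e = eqm_mt[OF A] eqm_mt[OF B]
  show "mm (prod_gset Y Y') (mt B B') (mt A A') z x = mt (mm Y B A) (mm Y' B' A') z x"
  proof (cases "z \<in> pts (prod_gset Z Z') \<and> x \<in> pts (prod_gset X X')")
    case True
    then obtain z1 z2 x1 x2 where z: "z = UPair z1 z2" "z1 \<in> pts Z" "z2 \<in> pts Z'"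
      and x: "x = UPair x1 x2" "x1 \<in> pts X" "x2 \<in> pts X'" by (auto elim!: prod_ptsE)
    define D where "D = supp Z z1 \<union> supp Z' z2 \<union> (supp X x1 \<union> supp X' x2)"
    have D: "finite D" using x z X Z by (auto simp: D_def obD)
    have sD: "supp (prod_gset Z Z') z \<union> supp (prod_gset X X') x \<subseteq> D"
      using x z X Z by (simp add: ob_prod(2) D_def)
    note o = ob_prod(1)[OF X] ob_prod(1)[OF Y] ob_prod(1)[OF Z]
    have "mm (prod_gset Y Y') (mt B B') (mt A A') z x =
        integ D (pts (prod_gset Y Y')) (act (prod_gset Y Y')) (supp (prod_gset Y Y')) (\<lambda>y. mt B B' z y * mt A A' y x)"
      using True by (intro mm_eq[OF o e] D sD) auto
    also have "\<dots> = integ D (pts Y) (act Y) (supp Y) (\<lambda>y1. integ (D \<union> supp Y y1) (pts Y') (act Y') (supp Y')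
        (\<lambda>y2. mt B B' z (UPair y1 y2) * mt A A' (UPair y1 y2) x))"
      using True by (intro prod_integ Y D mm_invar[OF o e _ _ sD]) auto
    also have "\<dots> = integ D (pts Y) (act Y) (supp Y) (\<lambda>y1. B z1 y1 * A y1 x1 * mm Y' B' A' z2 x2)"
    proof (rule integ_cong[OF obD(1)[OF Y(1)]])
      fix y1 assume y1: "y1 \<in> pts Y"
      have "mm Y' B' A' z2 x2 = integ (D \<union> supp Y y1) (pts Y') (act Y') (supp Y') (\<lambda>y2. B' z2 y2 * A' y2 x2)"
        using x z y1 D by (intro mm_eq[OF X(2) Y(2) Z(2) A(2) B(2)]) (auto simp: D_def obD[OF Y(1)])
      then show "integ (D \<union> supp Y y1) (pts Y') (act Y') (supp Y') (\<lambda>y2. mt B B' z (UPair y1 y2) * mt A A' (UPair y1 y2) x)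
          = B z1 y1 * A y1 x1 * mm Y' B' A' z2 x2"
        by (simp add: z x integ_cmult[symmetric] algebra_simps)
    qed
    also have "\<dots> = mm Y B A z1 x1 * mm Y' B' A' z2 x2"
      using x z D by (subst mm_eq[OF X(1) Y(1) Z(1) A(1) B(1), of _ _ D]) (auto simp: D_def integ_multc)
    finally show ?thesis by (simp add: x z)
  next
    case False
    then show ?thesis using mm_out[OF e] eqmD(1,2)[OF eqm_mt[OF eqm_mm[OF X(1) Y(1) Z(1) A(1) B(1)]
      eqm_mm[OF X(2) Y(2) Z(2) A(2) B(2)]]] by auto
  qed
qed

lemma gm_cong: "(\<And>x. x \<in> pts X \<Longrightarrow> f x = f' x) \<Longrightarrow> gm X f = gm X f'"
  by (auto simp: gm_def fun_eq_iff)

lemma gm_comp: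
  assumes X: "ob X" and Y: "ob Y" and Z: "ob Z" and f: "eqf X Y f" and g: "eqf Y Z g"
  shows "mm Y (gm Y g) (gm X f) = gm X (\<lambda>x. g (f x))"
  using f by (intro ext) (auto simp: mm_gm_right[OF X Y Z f eqm_gm[OF Y Z g]] gm_def eqf_def)

definition pf :: "('a univ \<Rightarrow> 'a univ) \<Rightarrow> ('a univ \<Rightarrow> 'a univ) \<Rightarrow> 'a univ \<Rightarrow> 'a univ" where
  "pf f f' s = (case s of UPair x y \<Rightarrow> UPair (f x) (f' y))"

lemma pf_pair [simp]: "pf f f' (UPair x y) = UPair (f x) (f' y)"
  by (simp add: pf_def)

lemma mt_gm: "mt (gm X f) (gm X' f') = gm (prod_gset X X') (pf f f')"
  by (auto simp: fun_eq_iff mt_def gm_def prod_pts split: univ.split)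

lemma eqf_pf: "eqf X Y f \<Longrightarrow> eqf X' Y' f' \<Longrightarrow> eqf (prod_gset X X') (prod_gset Y Y') (pf f f')"
  by (auto simp: eqf_def elim!: prod_ptsE)

lemma eqf_id: "eqf X X id" by (simp add: eqf_def)

text \<open>Naturality of a constraint given by functions: composition with a graph merely renames
  rows or columns, so it suffices to compare entries along \<open>\<alpha>\<close> and
  \<open>\<beta>\<close>.\<close>

lemma graph_natural:
  assumes P: "ob P" "ob P'" and Q: "ob Q" "ob Q'" and \<alpha>: "eqf P P' \<alpha>"
    and \<beta>: "eqf Q Q' \<beta>" "bij_betw \<beta> (pts Q) (pts Q')"
    and M: "eqm P Q M" and M': "eqm P' Q' M'"
    and eq: "\<And>q p. q \<in> pts Q \<Longrightarrow> p \<in> pts P \<Longrightarrow> M' (\<beta> q) (\<alpha> p) = M q p"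
  shows "mm P' M' (gm P \<alpha>) = mm Q (gm Q \<beta>) M"
proof (intro ext)
  fix q' p
  show "mm P' M' (gm P \<alpha>) q' p = mm Q (gm Q \<beta>) M q' p"
  proof (cases "q' \<in> pts Q' \<and> p \<in> pts P")
    case True
    then obtain q where q: "q' = \<beta> q" "q \<in> pts Q" using \<beta>(2) by (auto simp: bij_betw_def)
    then show ?thesis using True eq[of q p] \<beta>(2)
      by (simp add: mm_gm_right[OF P Q(2) \<alpha> M'] mm_gm_left(1)[OF P(1) Q \<beta>(1) _ M] bij_betw_def)
  next
    case False
    then show ?thesis using mm_out[OF eqm_gm[OF P \<alpha>] M'] mm_out[OF M eqm_gm[OF Q \<beta>(1)]] by auto
  qed
qed

section \<open>The linear category of matrices\<close>

abbreviation PC :: "(('w, 'a univ) gset, ('w, 'a univ, 'k) pmat, 'k) tensor_cat" where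
  "PC \<equiv> perm_cat G E km"

lemma hom_iff: "M \<in> carrier (perm_Hom G X Y) \<longleftrightarrow> (\<exists>A. M = PMat X Y A \<and> eqm X Y A)"
  by (auto simp: perm_Hom_def eqm_def)

lemma PMat_hom: "PMat X Y A \<in> carrier (perm_Hom G X Y) \<longleftrightarrow> eqm X Y A"
  by (auto simp: hom_iff)

lemma graph_mat_eq: "graph_mat X Y f = PMat X Y (gm X f)"
  by (simp add: graph_mat_def gm_def fun_eq_iff)

lemma mat_comp_eq: "mat_comp km (PMat Y' Z B) (PMat X Y A) = PMat X Z (mm Y B A)"
  by (simp add: mat_comp_def mm_def fun_eq_iff)

lemma mat_tensor_eq: "mat_tensor (PMat X Y A) (PMat X' Y' B) = PMat (prod_gset X X') (prod_gset Y Y') (mt A B)"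
  by (auto simp: mat_tensor_def mt_def fun_eq_iff split: univ.split)

lemma perm_Hom_ops [simp]: "\<zero>\<^bsub>perm_Hom G X Y\<^esub> = PMat X Y (\<lambda>y x. 0)"
  "PMat X Y A \<oplus>\<^bsub>perm_Hom G X Y\<^esub> PMat X Y B = PMat X Y (\<lambda>y x. A y x + B y x)"
  "c \<odot>\<^bsub>perm_Hom G X Y\<^esub> PMat X Y A = PMat X Y (\<lambda>y x. c * A y x)"
  by (simp_all add: perm_Hom_def)

lemma PC_simps: "X \<in> cob PC \<longleftrightarrow> ob X" "cHom PC = perm_Hom G" "cid PC X = PMat X X (gm X id)" "ccomp PC = mat_comp km"
  "tob PC = prod_gset" "tmor PC = mat_tensor" "cunit PC = point_gset G"
  "cassoc PC X Y Z = PMat (prod_gset (prod_gset X Y) Z) (prod_gset X (prod_gset Y Z))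
     (gm (prod_gset (prod_gset X Y) Z) (\<lambda>s. case s of UPair (UPair x y) z \<Rightarrow> UPair x (UPair y z)))"
  "clunit PC X = PMat (prod_gset (point_gset G) X) X (gm (prod_gset (point_gset G) X) (\<lambda>s. case s of UPair t x \<Rightarrow> x))"
  "crunit PC X = PMat (prod_gset X (point_gset G)) X (gm (prod_gset X (point_gset G)) (\<lambda>s. case s of UPair x t \<Rightarrow> x))"
  "cbraid PC X Y = PMat (prod_gset X Y) (prod_gset Y X) (gm (prod_gset X Y) (\<lambda>s. case s of UPair x y \<Rightarrow> UPair y x))"
  by (simp_all add: perm_cat_def ob_iff graph_mat_eq)

lemma eqm_add: "eqm X Y A \<Longrightarrow> eqm X Y B \<Longrightarrow> eqm X Y (\<lambda>y x. A y x + B y x)"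
  and eqm_smult: "eqm X Y A \<Longrightarrow> eqm X Y (\<lambda>y x. c * A y x)"
  and eqm_zero: "eqm X Y (\<lambda>y x. 0)"
  by (auto simp: eqm_def)

lemma perm_Hom_module: "module field_ring (perm_Hom G X Y :: ('k, ('w, 'a univ, 'k) pmat) module)"
proof (intro moduleI cring_field_ring abelian_groupI)
  fix M :: "('w, 'a univ, 'k) pmat" assume "M \<in> carrier (perm_Hom G X Y)"
  then obtain A where A: "M = PMat X Y A" "eqm X Y A" by (auto simp: hom_iff)
  show "\<exists>N\<in>carrier (perm_Hom G X Y). N \<oplus>\<^bsub>perm_Hom G X Y\<^esub> M = \<zero>\<^bsub>perm_Hom G X Y\<^esub>"
    using eqm_smult[OF A(2), of "- 1"] by (intro bexI[of _ "PMat X Y (\<lambda>y x. - 1 * A y x)"]) (auto simp: A PMat_hom)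
qed (auto simp: hom_iff eqm_add eqm_smult eqm_zero fun_eq_iff algebra_simps)

lemma mm_id:
  assumes X: "ob X" and Y: "ob Y" and A: "eqm X Y A"
  shows "mm Y (gm Y id) A = A" "mm X A (gm X id) = A"
proof -
  show "mm X A (gm X id) = A"
    using eqmD(2)[OF A] by (intro ext) (auto simp: mm_gm_right[OF X X Y eqf_id A])
  show "mm Y (gm Y id) A = A"
  proof (intro ext)
    fix y x
    show "mm Y (gm Y id) A y x = A y x"
      using mm_gm_left[OF X Y Y eqf_id _ A, of y x] eqmD(1)[OF A, of y x] by (cases "y \<in> pts Y") auto
  qed
qed

lemma PC_linear: "linear_category PC"
proof (rule linear_category.intro)
  fix X :: "('w, 'a univ) gset" assume "X \<in> cob PC"
  then show "cid PC X \<in> chom PC X X" by (simp add: PC_simps PMat_hom eqm_gm eqf_id)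
qed (auto simp: PC_simps perm_Hom_module hom_iff mat_comp_eq eqm_mm mm_id mm_assoc mm_add_left mm_add_right mm_smult)

section \<open>Direct sums\<close>

lemma finsum_PMat:
  fixes X Y :: "('w, 'a univ) gset"
  assumes "finite I" "\<And>j. j \<in> I \<Longrightarrow> eqm X Y (A j)"
  shows "finsum (perm_Hom G X Y) (\<lambda>j. PMat X Y (A j)) I = PMat X Y (\<lambda>y x. \<Sum>j\<in>I. A j y x)
    \<and> eqm X Y (\<lambda>y x. \<Sum>j\<in>I. A j y x)"
  using assms
proof (induction I)
  case empty
  interpret M: module field_ring "perm_Hom G X Y :: ('k, ('w, 'a univ, 'k) pmat) module" by (rule perm_Hom_module)
  show ?case by (simp add: eqm_zero)
next
  case (insert i I)
  interpret M: module field_ring "perm_Hom G X Y :: ('k, ('w, 'a univ, 'k) pmat) module" by (rule perm_Hom_module)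
  have "finsum (perm_Hom G X Y) (\<lambda>j. PMat X Y (A j)) (insert i I) =
      PMat X Y (A i) \<oplus>\<^bsub>perm_Hom G X Y\<^esub> finsum (perm_Hom G X Y) (\<lambda>j. PMat X Y (A j)) I"
    using insert by (intro M.finsum_insert) (auto simp: PMat_hom)
  moreover have e: "eqm X Y (A i)" "eqm X Y (\<lambda>y x. \<Sum>j\<in>I. A j y x)" using insert by auto
  ultimately show ?case using insert eqm_add[OF e] by simp
qed

lemma eqm_transpose: "eqm X Y A \<Longrightarrow> eqm Y X (\<lambda>x y. A y x)"
  by (auto simp: eqm_def)

text \<open>Unary numerals inside \<open>'a univ\<close>; they label the summands of a sum of
  arbitrary finite length.\<close>

primrec tag :: "nat \<Rightarrow> 'a univ" where
  "tag 0 = UPoint"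
| "tag (Suc n) = UInl (tag n)"

lemma inj_tag: "inj tag"
proof (rule injI)
  show "m = n" if "tag m = (tag n :: 'a univ)" for m n using that
  proof (induction m arbitrary: n)
    case 0 then show ?case by (cases n) auto
  next
    case (Suc m) then show ?case by (cases n) auto
  qed
qed

lemma tag_eq [simp]: "tag m = tag n \<longleftrightarrow> m = n"
  using inj_tag by (simp add: inj_eq)

definition list_sum :: "('w, 'a univ) gset list \<Rightarrow> ('w, 'a univ) gset" where
  "list_sum Xs = (let S = {UPair (tag j) x | j x. j < length Xs \<and> x \<in> pts (Xs ! j)} in
    \<lparr>grp = G, pts = S,
     act = (\<lambda>g. \<lambda>s\<in>S. case s of UPair t x \<Rightarrow> UPair t (act (Xs ! pinv tag t) g x))\<rparr>)"

lemma list_sum_pts: "pts (list_sum Xs) = {UPair (tag j) x | j x. j < length Xs \<and> x \<in> pts (Xs ! j)}"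
  by (simp add: list_sum_def Let_def)

lemma list_sum_act: "j < length Xs \<Longrightarrow> x \<in> pts (Xs ! j) \<Longrightarrow>
    act (list_sum Xs) g (UPair (tag j) x) = UPair (tag j) (act (Xs ! j) g x)"
  by (auto simp: list_sum_def Let_def inv_f_f[OF inj_tag])

lemma ob_list_sum: assumes "\<And>j. j < length Xs \<Longrightarrow> ob (Xs ! j)" shows "ob (list_sum Xs)"
proof (rule obI(1))
  let ?S = "list_sum Xs"
  show "acts G (pts ?S) (act ?S) (\<lambda>s. case s of UPair t x \<Rightarrow> supp (Xs ! pinv tag t) x)"
    unfolding acts_def
    by (auto simp: list_sum_pts list_sum_act inv_f_f[OF inj_tag] obD(4)[OF assms] actsD[OF obD(1)[OF assms]])
  show "act ?S h \<in> extensional (pts ?S)" for h by (simp add: list_sum_def Let_def)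
  have orb: "orb (act ?S) {} (UPair (tag j) x) = UPair (tag j) ` orb (act (Xs ! j)) {} x"
    if "j < length Xs" "x \<in> pts (Xs ! j)" for j x
    using that by (auto simp: orb_def list_sum_act image_image)
  have "orb (act ?S) {} s \<in> (\<Union>j<length Xs. (`) (UPair (tag j)) ` orb (act (Xs ! j)) {} ` pts (Xs ! j))"
    if "s \<in> pts ?S" for s
  proof -
    from that obtain j x where "s = UPair (tag j) x" "j < length Xs" "x \<in> pts (Xs ! j)"
      by (auto simp: list_sum_pts)
    then show ?thesis by (intro UN_I[of j]) (simp_all add: orb)
  qed
  then have "orb (act ?S) {} ` pts ?S \<subseteq> (\<Union>j<length Xs. (`) (UPair (tag j)) ` orb (act (Xs ! j)) {} ` pts (Xs ! j))"
    by (rule image_subsetI)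
  moreover have "finite (orb (act (Xs ! j)) {} ` pts (Xs ! j))" if "j < length Xs" for j
    using assms[OF that] by (simp add: ob_def)
  then have "finite (\<Union>j<length Xs. (`) (UPair (tag j)) ` orb (act (Xs ! j)) {} ` pts (Xs ! j))" by simp
  ultimately show "finite (orb (act ?S) {} ` pts ?S)" by (rule finite_subset)
qed (simp add: list_sum_def Let_def)

text \<open>The injections are the graphs of the inclusions and the projections are their
  transposes. The product of the \<open>j\<close>-th injection and projection is the indicator of
  the diagonal over the \<open>j\<close>-th summand, and these indicators add up to the
  identity.\<close>

lemma list_sum_direct:
  assumes Xs: "set Xs \<subseteq> cob PC" shows "cat_data.direct_sum PC Xs (list_sum Xs)"
proof -
  let ?S = "list_sum Xs" and ?\<iota> = "\<lambda>j. UPair (tag j)"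
  define I where "I j = gm (Xs ! j) (?\<iota> j)" for j
  define P where "P j x s = I j s x" for j x s
  have ob: "ob (Xs ! j)" if "j < length Xs" for j using subsetD[OF Xs nth_mem[OF that]] by (simp add: PC_simps)
  have S: "ob ?S" by (rule ob_list_sum[OF ob])
  have \<iota>: "eqf (Xs ! j) ?S (?\<iota> j)" if "j < length Xs" for j
    using that by (auto simp: eqf_def list_sum_pts list_sum_act)
  have I: "eqm (Xs ! j) ?S (I j)" if "j < length Xs" for j
    unfolding I_def by (rule eqm_gm[OF ob[OF that] S \<iota>[OF that]])
  have P: "eqm ?S (Xs ! j) (P j)" if "j < length Xs" for j
    using eqm_transpose[OF I[OF that]] by (simp add: P_def[abs_def])
  have PI: "mm ?S (P j) (I l) = (if j = l then gm (Xs ! j) id else (\<lambda>y x. 0))"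
    if "j < length Xs" "l < length Xs" for j l
    unfolding I_def using that
    by (intro ext) (auto simp: mm_gm_right[OF ob[OF that(2)] S ob[OF that(1)] \<iota>[OF that(2)] P[OF that(1)]] P_def I_def gm_def)
  have IP: "mm (Xs ! j) (I j) (P j) y x = (if y \<in> pts ?S \<and> x = y \<and> fst (case y of UPair t u \<Rightarrow> (t, u)) = tag j then 1 else 0)"
    if j: "j < length Xs" for j y x
  proof (cases "y \<in> ?\<iota> j ` pts (Xs ! j)")
    case True
    then obtain u where u: "y = ?\<iota> j u" "u \<in> pts (Xs ! j)" by auto
    then show ?thesis using mm_gm_left(1)[OF S ob[OF j] S \<iota>[OF j] _ P[OF j] u(2), of x] j
      by (auto simp: inj_on_def I_def[symmetric] P_def list_sum_pts) (auto simp: I_def gm_def)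
  next
    case False
    then show ?thesis using mm_gm_left(2)[OF S ob[OF j] S \<iota>[OF j] _ P[OF j] False, of x] j
      by (auto simp: inj_on_def I_def[symmetric] list_sum_pts)
  qed
  have "(\<Sum>j<length Xs. mm (Xs ! j) (I j) (P j) y x) = gm ?S id y x" for y x
  proof (cases "y \<in> pts ?S \<and> x = y")
    case True
    then obtain l u where l: "y = ?\<iota> l u" "l < length Xs" "u \<in> pts (Xs ! l)" by (auto simp: list_sum_pts)
    have "(\<Sum>j<length Xs. mm (Xs ! j) (I j) (P j) y x) = (\<Sum>j<length Xs. if j = l then 1 else 0)"
      using l True by (intro sum.cong) (auto simp: IP)
    then show ?thesis using True l by (simp add: gm_def)
  next
    case False
    then show ?thesis by (auto simp: IP gm_def intro!: sum.neutral)
  qed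
  then have "(\<lambda>y x. \<Sum>j<length Xs. mm (Xs ! j) (I j) (P j) y x) = gm ?S id" by (simp add: fun_eq_iff)
  moreover have "finsum (perm_Hom G ?S ?S) (\<lambda>j. PMat ?S ?S (mm (Xs ! j) (I j) (P j))) {..<length Xs} =
      PMat ?S ?S (\<lambda>y x. \<Sum>j<length Xs. mm (Xs ! j) (I j) (P j) y x)"
    using finsum_PMat[of "{..<length Xs}" ?S ?S "\<lambda>j. mm (Xs ! j) (I j) (P j)"] eqm_mm[OF S ob S P I] by simp
  ultimately have fs: "finsum (perm_Hom G ?S ?S) (\<lambda>j. PMat ?S ?S (mm (Xs ! j) (I j) (P j))) {..<length Xs} = cid PC ?S"
    by (simp add: PC_simps)
  show ?thesis unfolding cat_data.direct_sum_def
    by (intro conjI exI[of _ "\<lambda>j. PMat (Xs ! j) ?S (I j)"] exI[of _ "\<lambda>j. PMat ?S (Xs ! j) (P j)"])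
      (use Xs S fs in \<open>auto simp: PC_simps PMat_hom I P mat_comp_eq PI\<close>)
qed

lemma PC_additive: "additive_category PC"
  using PC_linear list_sum_direct by (auto simp: additive_category_def additive_category_axioms_def)

text \<open>All constraints of the permutation category are graphs of equivariant functions.
  Composites and tensor products of graphs are graphs, so the coherence laws reduce to equations
  between functions on points.\<close>

definition is_graph :: "('w, 'a univ, 'k) pmat \<Rightarrow> ('w, 'a univ) gset \<Rightarrow> ('w, 'a univ) gset \<Rightarrow> ('a univ \<Rightarrow> 'a univ) \<Rightarrow> bool" where
  "is_graph M X Y f \<longleftrightarrow> M = PMat X Y (gm X f) \<and> ob X \<and> ob Y \<and> eqf X Y f"

lemma is_graph_comp: "is_graph M X Y f \<Longrightarrow> is_graph N Y Z g \<Longrightarrow> is_graph (ccomp PC N M) X Z (\<lambda>x. g (f x))"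
  by (auto simp: is_graph_def PC_simps mat_comp_eq gm_comp) (auto simp: eqf_def)

lemma is_graph_tensor: "is_graph M X Y f \<Longrightarrow> is_graph N X' Y' f' \<Longrightarrow>
    is_graph (tmor PC M N) (tob PC X X') (tob PC Y Y') (pf f f')"
  by (auto simp: is_graph_def PC_simps mat_tensor_eq mt_gm ob_prod eqf_pf)

lemma is_graph_structure:
  assumes "ob X" "ob Y" "ob Z"
  shows "is_graph (cid PC X) X X id"
    "is_graph (cassoc PC X Y Z) (tob PC (tob PC X Y) Z) (tob PC X (tob PC Y Z))
       (\<lambda>s. case s of UPair (UPair x y) z \<Rightarrow> UPair x (UPair y z))"
    "is_graph (clunit PC X) (tob PC (cunit PC) X) X (\<lambda>s. case s of UPair t x \<Rightarrow> x)"
    "is_graph (crunit PC X) (tob PC X (cunit PC)) X (\<lambda>s. case s of UPair x t \<Rightarrow> x)"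
    "is_graph (cbraid PC X Y) (tob PC X Y) (tob PC Y X) (\<lambda>s. case s of UPair x y \<Rightarrow> UPair y x)"
  using assms by (auto simp: is_graph_def PC_simps ob_prod ob_point eqf_def elim!: prod_ptsE)

lemma is_graph_eq:
  "is_graph M X Y f \<Longrightarrow> is_graph N X Y f' \<Longrightarrow> (\<And>x. x \<in> pts X \<Longrightarrow> f x = f' x) \<Longrightarrow> M = N"
  by (auto simp: is_graph_def intro: gm_cong)

lemma is_graph_inverse:
  assumes M: "is_graph M X Y f" and g: "eqf Y X g" and gf: "\<And>x. x \<in> pts X \<Longrightarrow> g (f x) = x" and fg: "\<And>y. y \<in> pts Y \<Longrightarrow> f (g y) = y"
  shows "cat_data.inverse_maps PC X Y M (PMat Y X (gm Y g))"
proof -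
  have N: "is_graph (PMat Y X (gm Y g)) Y X g" using M g by (auto simp: is_graph_def)
  note X = is_graph_structure(1)[of X X X] and Y = is_graph_structure(1)[of Y Y Y]
  have "ccomp PC (PMat Y X (gm Y g)) M = cid PC X"
    by (rule is_graph_eq[OF is_graph_comp[OF M N] X]) (use M gf in \<open>auto simp: is_graph_def\<close>)
  moreover have "ccomp PC M (PMat Y X (gm Y g)) = cid PC Y"
    by (rule is_graph_eq[OF is_graph_comp[OF N M] Y]) (use M fg in \<open>auto simp: is_graph_def\<close>)
  ultimately show ?thesis using M N
    by (auto simp: cat_data.inverse_maps_def PC_simps hom_iff is_graph_def eqm_gm)
qed

lemma assoc_inverse:
  assumes X: "ob X" and Y: "ob Y" and Z: "ob Z"
  shows "cat_data.inverse_maps PC (tob PC (tob PC X Y) Z) (tob PC X (tob PC Y Z)) (cassoc PC X Y Z)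
    (PMat (tob PC X (tob PC Y Z)) (tob PC (tob PC X Y) Z) (gm (tob PC X (tob PC Y Z))
       (\<lambda>s. case s of UPair x (UPair y z) \<Rightarrow> UPair (UPair x y) z)))"
  by (rule is_graph_inverse[OF is_graph_structure(2)[OF X Y Z]]) (auto simp: PC_simps eqf_def elim!: prod_ptsE)

lemma PC_hom: "M \<in> chom PC X Y \<longleftrightarrow> (\<exists>A. M = PMat X Y A \<and> eqm X Y A)"
  by (simp add: PC_simps hom_iff)

lemma mt_cases:
  assumes "\<And>y y' x x'. F (UPair y y') (UPair x x') = H (UPair y y') (UPair x x')"
    and "\<And>y x. (\<nexists>y1 y2 x1 x2. y = UPair y1 y2 \<and> x = UPair x1 x2) \<Longrightarrow> F y x = H y x"
  shows "F = H"
  using assms by (metis ext)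

lemma mt_no_pair: "(\<nexists>y1 y2 x1 x2. y = UPair y1 y2 \<and> x = UPair x1 x2) \<Longrightarrow> mt A B y x = 0"
  by (auto simp: mt_def split: univ.split)

lemma mt_linear: "mt (\<lambda>y x. A y x + B y x) C = (\<lambda>y x. mt A C y x + mt B C y x)"
  "mt C (\<lambda>y x. A y x + B y x) = (\<lambda>y x. mt C A y x + mt C B y x)"
  "mt (\<lambda>y x. c * A y x) C = (\<lambda>y x. c * mt A C y x)" "mt C (\<lambda>y x. c * A y x) = (\<lambda>y x. c * mt C A y x)"
  by (rule mt_cases; simp add: mt_no_pair algebra_simps)+

lemma ob_tob: "ob X \<Longrightarrow> ob Y \<Longrightarrow> ob (tob PC X Y)" and ob_cunit: "ob (cunit PC)"
  by (simp_all add: PC_simps ob_prod(1) ob_point)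

lemma tob_ptsE:
  assumes "s \<in> pts (tob PC X Y)" obtains x y where "s = UPair x y" "x \<in> pts X" "y \<in> pts Y"
  using assms by (auto simp: PC_simps elim!: prod_ptsE)

lemma graph_coherence:
  assumes o: "ob W" "ob X" "ob Y" "ob Z"
  shows "ccomp PC (cassoc PC W X (tob PC Y Z)) (cassoc PC (tob PC W X) Y Z) =
      ccomp PC (tmor PC (cid PC W) (cassoc PC X Y Z))
        (ccomp PC (cassoc PC W (tob PC X Y) Z) (tmor PC (cassoc PC W X Y) (cid PC Z)))"
    and "ccomp PC (tmor PC (cid PC X) (clunit PC Y)) (cassoc PC X (cunit PC) Y) = tmor PC (crunit PC X) (cid PC Y)"
    and "ccomp PC (cassoc PC Y Z X) (ccomp PC (cbraid PC X (tob PC Y Z)) (cassoc PC X Y Z)) =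
      ccomp PC (tmor PC (cid PC Y) (cbraid PC X Z)) (ccomp PC (cassoc PC Y X Z) (tmor PC (cbraid PC X Y) (cid PC Z)))"
    and "ccomp PC (cbraid PC Y X) (cbraid PC X Y) = cid PC (tob PC X Y)"
    and "tmor PC (cid PC X) (cid PC Y) = cid PC (tob PC X Y)"
  by (rule is_graph_eq, (assumption | rule o is_graph_comp is_graph_tensor is_graph_structure ob_tob ob_cunit)+,
      auto elim!: tob_ptsE)+

lemma PC_iso:
  assumes X: "ob X" and Y: "ob Y" and Z: "ob Z"
  shows "cat_data.is_iso PC (tob PC (tob PC X Y) Z) (tob PC X (tob PC Y Z)) (cassoc PC X Y Z)"
    "cat_data.is_iso PC (tob PC (cunit PC) X) X (clunit PC X)"
    "cat_data.is_iso PC (tob PC X (cunit PC)) X (crunit PC X)"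
    "cat_data.is_iso PC (tob PC X Y) (tob PC Y X) (cbraid PC X Y)"
proof -
  note s = is_graph_structure[OF X Y Z]
  show "cat_data.is_iso PC (tob PC (tob PC X Y) Z) (tob PC X (tob PC Y Z)) (cassoc PC X Y Z)"
    unfolding cat_data.is_iso_def using assoc_inverse[OF X Y Z] ..
  show "cat_data.is_iso PC (tob PC (cunit PC) X) X (clunit PC X)"
    unfolding cat_data.is_iso_def
    by (rule exI, rule is_graph_inverse[OF s(3), of "UPair UPoint"]) (auto simp: PC_simps eqf_def elim!: prod_ptsE)
  show "cat_data.is_iso PC (tob PC X (cunit PC)) X (crunit PC X)"
    unfolding cat_data.is_iso_def
    by (rule exI, rule is_graph_inverse[OF s(4), of "\<lambda>x. UPair x UPoint"]) (auto simp: PC_simps eqf_def elim!: prod_ptsE)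
  show "cat_data.is_iso PC (tob PC X Y) (tob PC Y X) (cbraid PC X Y)"
    unfolding cat_data.is_iso_def
    by (rule exI, rule is_graph_inverse[OF s(5), of "\<lambda>s. case s of UPair x y \<Rightarrow> UPair y x"])
      (auto simp: PC_simps eqf_def elim!: prod_ptsE)
qed

lemma structure_bij:
  "bij_betw (\<lambda>s. case s of UPair (UPair x y) z \<Rightarrow> UPair x (UPair y z))
     (pts (prod_gset (prod_gset X Y) Z)) (pts (prod_gset X (prod_gset Y Z)))"
  "bij_betw (\<lambda>s. case s of UPair t x \<Rightarrow> x) (pts (prod_gset (point_gset U) X)) (pts X)"
  "bij_betw (\<lambda>s. case s of UPair x t \<Rightarrow> x) (pts (prod_gset X (point_gset U))) (pts X)"
  "bij_betw (\<lambda>s. case s of UPair x y \<Rightarrow> UPair y x) (pts (prod_gset X Y)) (pts (prod_gset Y X))"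
proof -
  show "bij_betw (\<lambda>s. case s of UPair (UPair x y) z \<Rightarrow> UPair x (UPair y z))
     (pts (prod_gset (prod_gset X Y) Z)) (pts (prod_gset X (prod_gset Y Z)))"
    by (rule bij_betwI[where g = "\<lambda>s. case s of UPair x (UPair y z) \<Rightarrow> UPair (UPair x y) z"])
      (auto elim!: prod_ptsE)
  show "bij_betw (\<lambda>s. case s of UPair t x \<Rightarrow> x) (pts (prod_gset (point_gset U) X)) (pts X)"
    by (rule bij_betwI[where g = "UPair UPoint"]) (auto elim!: prod_ptsE)
  show "bij_betw (\<lambda>s. case s of UPair x t \<Rightarrow> x) (pts (prod_gset X (point_gset U))) (pts X)"
    by (rule bij_betwI[where g = "\<lambda>x. UPair x UPoint"]) (auto elim!: prod_ptsE)
  show "bij_betw (\<lambda>s. case s of UPair x y \<Rightarrow> UPair y x) (pts (prod_gset X Y)) (pts (prod_gset Y X))"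
    by (rule bij_betwI[where g = "\<lambda>s. case s of UPair x y \<Rightarrow> UPair y x"]) (auto elim!: prod_ptsE)
qed

lemma structure_natural:
  assumes A: "eqm X X' A" and B: "eqm Y Y' B" and C: "eqm Z Z' C"
    and X: "ob X" "ob X'" and Y: "ob Y" "ob Y'" and Z: "ob Z" "ob Z'"
  shows "ccomp PC (cassoc PC X' Y' Z') (tmor PC (tmor PC (PMat X X' A) (PMat Y Y' B)) (PMat Z Z' C)) =
      ccomp PC (tmor PC (PMat X X' A) (tmor PC (PMat Y Y' B) (PMat Z Z' C))) (cassoc PC X Y Z)"
    "ccomp PC (clunit PC X') (tmor PC (cid PC (cunit PC)) (PMat X X' A)) = ccomp PC (PMat X X' A) (clunit PC X)"
    "ccomp PC (crunit PC X') (tmor PC (PMat X X' A) (cid PC (cunit PC))) = ccomp PC (PMat X X' A) (crunit PC X)"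
    "ccomp PC (cbraid PC X' Y') (tmor PC (PMat X X' A) (PMat Y Y' B)) =
      ccomp PC (tmor PC (PMat Y Y' B) (PMat X X' A)) (cbraid PC X Y)"
proof -
  note s = is_graph_structure[OF X(1) Y(1) Z(1)] and s' = is_graph_structure[OF X(2) Y(2) Z(2)]
  note e = s[unfolded is_graph_def PC_simps] s'[unfolded is_graph_def PC_simps]
  have i: "eqm (point_gset G) (point_gset G) (gm (point_gset G) id)" by (intro eqm_gm ob_point eqf_id)
  have "mm (prod_gset X (prod_gset Y Z)) (mt A (mt B C)) (gm (prod_gset (prod_gset X Y) Z) (\<lambda>s. case s of UPair (UPair x y) z \<Rightarrow> UPair x (UPair y z)))
    = mm (prod_gset (prod_gset X' Y') Z') (gm (prod_gset (prod_gset X' Y') Z') (\<lambda>s. case s of UPair (UPair x y) z \<Rightarrow> UPair x (UPair y z))) (mt (mt A B) C)"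
    using e A B C X Y Z
    by (intro graph_natural[where Q' = "prod_gset X' (prod_gset Y' Z')"] eqm_mt ob_prod(1))
      (auto elim!: prod_ptsE intro: structure_bij simp: mult_ac)
  then show "ccomp PC (cassoc PC X' Y' Z') (tmor PC (tmor PC (PMat X X' A) (PMat Y Y' B)) (PMat Z Z' C)) =
      ccomp PC (tmor PC (PMat X X' A) (tmor PC (PMat Y Y' B) (PMat Z Z' C))) (cassoc PC X Y Z)"
    by (simp add: PC_simps mat_tensor_eq mat_comp_eq)
  have "mm X A (gm (prod_gset (point_gset G) X) (\<lambda>s. case s of UPair t x \<Rightarrow> x))
    = mm (prod_gset (point_gset G) X') (gm (prod_gset (point_gset G) X') (\<lambda>s. case s of UPair t x \<Rightarrow> x)) (mt (gm (point_gset G) id) A)"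
    using e A X i
    by (intro graph_natural[where Q' = X'] eqm_mt ob_prod(1) ob_point)
      (auto elim!: prod_ptsE intro: structure_bij simp: gm_def)
  then show "ccomp PC (clunit PC X') (tmor PC (cid PC (cunit PC)) (PMat X X' A)) = ccomp PC (PMat X X' A) (clunit PC X)"
    by (simp add: PC_simps mat_tensor_eq mat_comp_eq)
  have "mm X A (gm (prod_gset X (point_gset G)) (\<lambda>s. case s of UPair x t \<Rightarrow> x))
    = mm (prod_gset X' (point_gset G)) (gm (prod_gset X' (point_gset G)) (\<lambda>s. case s of UPair x t \<Rightarrow> x)) (mt A (gm (point_gset G) id))"
    using e A X i
    by (intro graph_natural[where Q' = X'] eqm_mt ob_prod(1) ob_point)
      (auto elim!: prod_ptsE intro: structure_bij simp: gm_def)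
  then show "ccomp PC (crunit PC X') (tmor PC (PMat X X' A) (cid PC (cunit PC))) = ccomp PC (PMat X X' A) (crunit PC X)"
    by (simp add: PC_simps mat_tensor_eq mat_comp_eq)
  have "mm (prod_gset Y X) (mt B A) (gm (prod_gset X Y) (\<lambda>s. case s of UPair x y \<Rightarrow> UPair y x))
    = mm (prod_gset X' Y') (gm (prod_gset X' Y') (\<lambda>s. case s of UPair x y \<Rightarrow> UPair y x)) (mt A B)"
    using e A B X Y
    by (intro graph_natural[where Q' = "prod_gset Y' X'"] eqm_mt ob_prod(1))
      (auto elim!: prod_ptsE intro: structure_bij simp: mult_ac)
  then show "ccomp PC (cbraid PC X' Y') (tmor PC (PMat X X' A) (PMat Y Y' B)) =
      ccomp PC (tmor PC (PMat Y Y' B) (PMat X X' A)) (cbraid PC X Y)"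
    by (simp add: PC_simps mat_tensor_eq mat_comp_eq)
qed

lemma PC_tensor: "tensor_category PC"
proof (rule tensor_category.intro[OF PC_additive tensor_category_axioms.intro])
  show "cunit PC \<in> cob PC" by (simp add: PC_simps ob_point)
qed (auto simp only: PC_simps(1) PC_hom structure_natural graph_coherence PC_iso ob_tob ob_cunit;
    auto simp: PC_simps mat_tensor_eq mat_comp_eq eqm_mt mm_mt mt_linear)+

lemma PC_typed: "typed_category PC msrc mtgt"
  by (intro typed_category.intro PC_tensor typed_category_axioms.intro) (auto simp: PC_hom)

text \<open>An invariant matrix is determined by its values at representatives of the finitely many
  orbits on \<open>pts Y \<times> pts X\<close>.\<close>

lemma PC_coordinates:
  assumes X: "ob X" and Y: "ob Y" shows "\<exists>n \<phi>. coordinates (cHom PC X Y) n \<phi>"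
proof -
  let ?S = "pts Y \<times> pts X" and ?a = "pact (act Y) (act X)"
  have fa: "fin_acts ?S ?a (psupp (supp Y) (supp X))" by (intro fin_acts_prod obD X Y)
  then have a: "acts G ?S ?a (psupp (supp Y) (supp X))" and fin: "finite (orb ?a {} ` ?S)"
    by (auto simp: fin_acts_def)
  obtain h n where h: "bij_betw h {0..<n::nat} (orb ?a {} ` ?S)" using ex_bij_betw_nat_finite[OF fin] by blast
  define \<phi> :: "('w, 'a univ, 'k) pmat \<Rightarrow> nat \<Rightarrow> 'k"
    where "\<phi> M i = (if i < n then ment M (fst (rep (h i))) (snd (rep (h i))) else 0)" for M i
  have "M = N" if M: "M \<in> carrier (perm_Hom G X Y)" and N: "N \<in> carrier (perm_Hom G X Y)" and eq: "\<phi> M = \<phi> N" for M N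
  proof -
    obtain A B where A: "M = PMat X Y A" "eqm X Y A" and B: "N = PMat X Y B" "eqm X Y B"
      using M N by (auto simp: hom_iff)
    have "A y x = B y x" if yx: "y \<in> pts Y" "x \<in> pts X" for y x
    proof -
      have "orb ?a {} (y, x) \<in> h ` {0..<n}" using yx bij_betw_imp_surj_on[OF h] by auto
      then obtain i where i: "i < n" "h i = orb ?a {} (y, x)" by auto
      have "invar {} ?S ?a (\<lambda>p. C (fst p) (snd p))" if "eqm X Y C" for C :: "'a univ \<Rightarrow> 'a univ \<Rightarrow> 'k"
        using eqmD(3)[OF that] by (auto simp: invar_def pact_def)
      then have "C (fst (rep (h i))) (snd (rep (h i))) = C y x" if "eqm X Y C" for C
        using invar_rep[OF a, of "{}" "\<lambda>p. C (fst p) (snd p)" "(y, x)"] that yx i by simp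
      from this[OF A(2)] this[OF B(2)] fun_cong[OF eq, of i] i show ?thesis by (simp add: \<phi>_def A B)
    qed
    moreover have "A y x = B y x" if "y \<notin> pts Y \<or> x \<notin> pts X" for y x
      using that eqmD(1,2)[OF A(2)] eqmD(1,2)[OF B(2)] by auto
    ultimately show ?thesis unfolding A B by (auto simp: fun_eq_iff)
  qed
  then have "inj_on \<phi> (carrier (perm_Hom G X Y))" by (rule inj_onI)
  then have "coordinates (perm_Hom G X Y) n \<phi>"
    by (auto simp: coordinates_def hom_iff \<phi>_def fun_eq_iff)
  then show ?thesis by (auto simp: PC_simps)
qed

lemma PC_unit_end: "bij_betw (\<lambda>c. c \<odot>\<^bsub>cHom PC (cunit PC) (cunit PC)\<^esub> cid PC (cunit PC)) UNIV
    (chom PC (cunit PC) (cunit PC))"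
proof (rule bij_betwI[where g = "\<lambda>M. ment M UPoint UPoint"])
  let ?P = "point_gset G :: ('w, 'a univ) gset"
  have id: "eqm ?P ?P (gm ?P id)" by (intro eqm_gm ob_point eqf_id)
  show "(\<lambda>c. c \<odot>\<^bsub>cHom PC (cunit PC) (cunit PC)\<^esub> cid PC (cunit PC)) \<in> UNIV \<rightarrow> chom PC (cunit PC) (cunit PC)"
    using eqm_smult[OF id] by (auto simp: PC_simps PMat_hom)
  show "ment M UPoint UPoint \<odot>\<^bsub>cHom PC (cunit PC) (cunit PC)\<^esub> cid PC (cunit PC) = M"
    if M: "M \<in> chom PC (cunit PC) (cunit PC)" for M
  proof -
    obtain A where A: "M = PMat ?P ?P A" "eqm ?P ?P A" using M by (auto simp: PC_hom PC_simps(7))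
    have "A UPoint UPoint * gm ?P id y x = A y x" for y x
      using eqmD(1,2)[OF A(2)] by (cases "y = UPoint"; cases "x = UPoint"; simp add: gm_def)
    then show ?thesis by (simp add: A PC_simps)
  qed
qed (auto simp: PC_simps gm_def)

section \<open>Duals\<close>

text \<open>For the identity matrix this is the usual evaluation, the indicator of the diagonal. In
  the envelope the idempotent \<open>A\<close> itself is the identity of \<open>(X, A)\<close> and
  takes its place.\<close>

definition evm :: "('a univ \<Rightarrow> 'a univ \<Rightarrow> 'k) \<Rightarrow> 'a univ \<Rightarrow> 'a univ \<Rightarrow> 'k" where
  "evm A t s = (case (t, s) of (UPoint, UPair x y) \<Rightarrow> A x y | _ \<Rightarrow> 0)"

lemma evm_pair [simp]: "evm A UPoint (UPair x y) = A x y" by (simp add: evm_def)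

lemma eqm_evm: assumes A: "eqm X X A" shows "eqm (prod_gset X X) (point_gset G) (evm A)"
  unfolding eqm_def
proof (intro conjI allI impI ballI)
  show "evm A t s = 0" if "(t, s) \<notin> pts (point_gset G) \<times> pts (prod_gset X X)" for t s
    using that eqmD(1,2)[OF A] by (auto simp: evm_def prod_pts split: univ.splits)
qed (auto elim!: prod_ptsE simp: eqmD(3)[OF A])

lemma eqm_eqI:
  assumes "eqm X Y A" "eqm X Y B" "\<And>y x. y \<in> pts Y \<Longrightarrow> x \<in> pts X \<Longrightarrow> A y x = B y x" shows "A = B"
proof (intro ext)
  fix y x
  show "A y x = B y x"
    using assms(3) eqmD(1,2)[OF assms(1)] eqmD(1,2)[OF assms(2)] by (cases "y \<in> pts Y"; cases "x \<in> pts X"; simp)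
qed

context
  fixes X :: "('w, 'a univ) gset" and A :: "'a univ \<Rightarrow> 'a univ \<Rightarrow> 'k"
  assumes X: "ob X" and A: "eqm X X A" and idem: "mm X A A = A"
begin

lemma idem_integ:
  assumes "u \<in> pts X" "v \<in> pts X" "finite D" "supp X u \<union> supp X v \<subseteq> D"
  shows "integ D (pts X) (act X) (supp X) (\<lambda>y. A u y * A y v) = A u v"
  using mm_eq[OF X X X A A assms] idem by simp

text \<open>The integrand is a product along the path \<open>u, a, b, v\<close>, so the integral is
  an entry of the third power of \<open>A\<close>, which is \<open>A\<close>. With one more
  intermediate point the next lemma uses the fourth power.\<close>

lemma idem_integ2:
  assumes uv: "u \<in> pts X" "v \<in> pts X" and D: "finite D" "supp X u \<union> supp X v \<subseteq> D"
    and f: "\<And>a b. a \<in> pts X \<Longrightarrow> b \<in> pts X \<Longrightarrow> f (UPair a b) = A u a * A a b * A b v"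
  shows "integ D (pts (prod_gset X X)) (act (prod_gset X X)) (supp (prod_gset X X)) f = A u v"
proof -
  have fix': "act X g u = u" "act X g v = v" if "g \<in> stab D" for g
    using obD(7)[OF X that] uv D by auto
  have "invar D (pts (prod_gset X X)) (act (prod_gset X X)) f"
    unfolding invar_def
  proof (intro ballI)
    fix g s assume g: "g \<in> stab D" and "s \<in> pts (prod_gset X X)"
    then obtain a b where s: "s = UPair a b" "a \<in> pts X" "b \<in> pts X" by (auto elim!: prod_ptsE)
    have gG: "g \<in> G" using g by (simp add: stab_iff)
    have "A u (act X g a) = A u a" "A (act X g b) v = A b v"
      using eqmD(3)[OF A gG, of u a] eqmD(3)[OF A gG, of b v] uv s fix'[OF g] by simp_all
    then show "f (act (prod_gset X X) g s) = f s"
      using s gG by (simp add: f obD(4)[OF X] eqmD(3)[OF A])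
  qed
  then have "integ D (pts (prod_gset X X)) (act (prod_gset X X)) (supp (prod_gset X X)) f =
      integ D (pts X) (act X) (supp X) (\<lambda>a. integ (D \<union> supp X a) (pts X) (act X) (supp X) (\<lambda>b. f (UPair a b)))"
    by (rule prod_integ[OF X X D(1)])
  also have "\<dots> = integ D (pts X) (act X) (supp X) (\<lambda>a. A u a * A a v)"
  proof (rule integ_cong[OF obD(1)[OF X]])
    fix a assume a: "a \<in> pts X"
    have "integ (D \<union> supp X a) (pts X) (act X) (supp X) (\<lambda>b. f (UPair a b)) =
      integ (D \<union> supp X a) (pts X) (act X) (supp X) (\<lambda>b. A u a * (A a b * A b v))"
      using a by (intro integ_cong[OF obD(1)[OF X]]) (simp add: f mult.assoc)
    also have "\<dots> = A u a * A a v"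
      unfolding integ_cmult using a uv D by (subst idem_integ) (auto simp: obD(5)[OF X])
    finally show "integ (D \<union> supp X a) (pts X) (act X) (supp X) (\<lambda>b. f (UPair a b)) = A u a * A a v" .
  qed
  also have "\<dots> = A u v" by (rule idem_integ[OF uv D])
  finally show ?thesis .
qed

lemma idem_integ3:
  assumes uv: "u \<in> pts X" "v \<in> pts X" and D: "finite D" "supp X u \<union> supp X v \<subseteq> D"
    and f: "\<And>a b c. a \<in> pts X \<Longrightarrow> b \<in> pts X \<Longrightarrow> c \<in> pts X \<Longrightarrow> f (UPair a (UPair b c)) = A u a * A a b * A b c * A c v"
    and inv: "invar D (pts (prod_gset X (prod_gset X X))) (act (prod_gset X (prod_gset X X))) f"
  shows "integ D (pts (prod_gset X (prod_gset X X))) (act (prod_gset X (prod_gset X X)))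
    (supp (prod_gset X (prod_gset X X))) f = A u v"
proof -
  let ?XX = "prod_gset X X"
  have "integ D (pts (prod_gset X ?XX)) (act (prod_gset X ?XX)) (supp (prod_gset X ?XX)) f =
      integ D (pts X) (act X) (supp X) (\<lambda>a. integ (D \<union> supp X a) (pts ?XX) (act ?XX) (supp ?XX) (\<lambda>s. f (UPair a s)))"
    by (rule prod_integ[OF X ob_prod(1)[OF X X] D(1) inv])
  also have "\<dots> = integ D (pts X) (act X) (supp X) (\<lambda>a. A u a * A a v)"
  proof (rule integ_cong[OF obD(1)[OF X]])
    fix a assume a: "a \<in> pts X"
    let ?f = "\<lambda>s. case s of UPair b c \<Rightarrow> A a b * A b c * A c v"
    have "integ (D \<union> supp X a) (pts ?XX) (act ?XX) (supp ?XX) (\<lambda>s. f (UPair a s)) =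
      integ (D \<union> supp X a) (pts ?XX) (act ?XX) (supp ?XX) (\<lambda>s. A u a * ?f s)"
      using a by (intro integ_cong[OF obD(1)[OF ob_prod(1)[OF X X]]]) (auto elim!: prod_ptsE simp: f mult.assoc)
    also have "\<dots> = A u a * A a v"
      unfolding integ_cmult using a uv D by (subst idem_integ2[of a v]) (auto simp: obD(5)[OF X])
    finally show "integ (D \<union> supp X a) (pts ?XX) (act ?XX) (supp ?XX) (\<lambda>s. f (UPair a s)) = A u a * A a v" .
  qed
  also have "\<dots> = A u v" by (rule idem_integ[OF uv D])
  finally show ?thesis .
qed

abbreviation (input) "XX \<equiv> prod_gset X X"
abbreviation (input) "At \<equiv> \<lambda>x y. A y x"
abbreviation (input) "cvm \<equiv> \<lambda>s t. evm A t s"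

lemma idem_eqm: "eqm X X At" "eqm XX (point_gset G) (evm A)" "eqm (point_gset G) XX cvm"
  "eqm (point_gset G) (point_gset G) (gm (point_gset G) id)"
  using eqm_transpose[OF A] eqm_evm[OF A] eqm_transpose[OF eqm_evm[OF A]] eqm_gm[OF ob_point ob_point eqf_id] by auto

lemma idem_transpose: "mm X At At = At"
proof (intro ext)
  fix y x
  have "mm X At At y x = mm X A A x y" by (simp add: mm_def mult.commute)
  then show "mm X At At y x = At y x" by (simp add: idem)
qed

lemma ob_XX: "ob XX" by (rule ob_prod(1)[OF X X])

lemma supp_XX: "x \<in> pts X \<Longrightarrow> y \<in> pts X \<Longrightarrow> supp XX (UPair x y) = supp X x \<union> supp X y"
  by (rule ob_prod(2)[OF X X])

text \<open>This makes \<open>evm A\<close> an arrow of the envelope out of the tensor product of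
  the transposed object and \<open>(X, A)\<close>.\<close>

lemma evm_absorb: "mm XX (evm A) (mt At A) = evm A"
proof (rule eqm_eqI)
  let ?P = "point_gset G :: ('w, 'a univ) gset"
  have e: "eqm XX XX (mt At A)" by (intro eqm_mt idem_eqm A)
  show "eqm XX ?P (mm XX (evm A) (mt At A))" by (intro eqm_mm ob_XX ob_point e idem_eqm)
  show "eqm XX ?P (evm A)" by (rule idem_eqm)
  fix t s assume t: "t \<in> pts ?P" and "s \<in> pts XX"
  then obtain x y where s: "s = UPair x y" "x \<in> pts X" "y \<in> pts X" by (auto elim!: prod_ptsE)
  let ?D = "supp X x \<union> supp X y"
  have "mm XX (evm A) (mt At A) t s = integ ?D (pts XX) (act XX) (supp XX) (\<lambda>u. evm A t u * mt At A u s)"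
    using t s by (intro mm_eq[OF ob_XX ob_XX ob_point e idem_eqm(2)]) (auto simp: obD(5)[OF X] supp_XX)
  also have "\<dots> = A x y" using t s by (intro idem_integ2) (auto simp: obD(5)[OF X])
  finally show "mm XX (evm A) (mt At A) t s = evm A t s" using t s by simp
qed

lemma cvm_absorb: "mm XX (mt A At) cvm = cvm"
proof (rule eqm_eqI)
  let ?P = "point_gset G :: ('w, 'a univ) gset"
  have e: "eqm XX XX (mt A At)" by (intro eqm_mt idem_eqm A)
  show "eqm ?P XX (mm XX (mt A At) cvm)" by (intro eqm_mm ob_XX ob_point e idem_eqm)
  show "eqm ?P XX cvm" by (rule idem_eqm)
  fix t s assume t: "t \<in> pts ?P" and "s \<in> pts XX"
  then obtain x y where s: "s = UPair x y" "x \<in> pts X" "y \<in> pts X" by (auto elim!: prod_ptsE)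
  let ?D = "supp X x \<union> supp X y"
  have "mm XX (mt A At) cvm s t = integ ?D (pts XX) (act XX) (supp XX) (\<lambda>u. mt A At s u * evm A t u)"
    using t s by (intro mm_eq[OF ob_point ob_XX ob_XX idem_eqm(3) e]) (auto simp: obD(5)[OF X] supp_XX)
  also have "\<dots> = A x y" using t s by (intro idem_integ2) (auto simp: obD(5)[OF X])
  finally show "mm XX (mt A At) cvm s t = evm A t s" using t s by simp
qed

text \<open>The common core of both zigzag identities: once the entries of the factors are arranged
  as a path from \<open>u\<close> to \<open>v\<close> through three intermediate points, the product
  has the entry \<open>A u v\<close>.\<close>

lemma mm_triple:
  assumes W: "ob W" and Z: "ob Z" and M: "eqm (prod_gset X XX) Z M" and N: "eqm W (prod_gset X XX) N"
    and zw: "z \<in> pts Z" "w \<in> pts W" and uv: "u \<in> pts X" "v \<in> pts X" and D: "supp Z z \<union> supp W w = supp X u \<union> supp X v"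
    and f: "\<And>a b c. a \<in> pts X \<Longrightarrow> b \<in> pts X \<Longrightarrow> c \<in> pts X \<Longrightarrow>
      M z (UPair a (UPair b c)) * N (UPair a (UPair b c)) w = A u a * A a b * A b c * A c v"
  shows "mm (prod_gset X XX) M N z w = A u v"
proof -
  have "mm (prod_gset X XX) M N z w =
      integ (supp X u \<union> supp X v) (pts (prod_gset X XX)) (act (prod_gset X XX)) (supp (prod_gset X XX)) (\<lambda>s. M z s * N s w)"
    using zw uv D by (intro mm_eq[OF W ob_prod(1)[OF X ob_XX] Z N M]) (auto simp: obD(5)[OF X])
  also have "\<dots> = A u v"
    using zw uv D f
    by (intro idem_integ3 mm_invar[OF W ob_prod(1)[OF X ob_XX] Z N M]) (auto simp: obD(5)[OF X])
  finally show ?thesis .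
qed

abbreviation (input) "eX \<equiv> PMat X X A"
abbreviation (input) "tX \<equiv> PMat X X At"
abbreviation (input) "evX \<equiv> PMat XX (point_gset G) (evm A)"
abbreviation (input) "cvX \<equiv> PMat (point_gset G) XX cvm"

text \<open>The constraints only rename indices. After regrouping into two factors, the entry at
  \<open>z\<close> and \<open>x\<close> is the integral of the product along a path from
  \<open>z\<close> to \<open>x\<close> through the points \<open>b\<close>, \<open>c\<close>,
  \<open>d\<close> of the middle object.\<close>

lemma zigzag_first:
  "ccomp PC (crunit PC X) (ccomp PC (tmor PC eX evX) (ccomp PC (cassoc PC X X X) (tmor PC cvX eX))) =
    ccomp PC (clunit PC X) (tmor PC (cid PC (cunit PC)) eX)"
proof -
  let ?P = "point_gset G :: ('w, 'a univ) gset"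
  let ?XP = "prod_gset X ?P" and ?PX = "prod_gset ?P X" and ?A = "prod_gset XX X" and ?B = "prod_gset X XX"
  let ?r = "\<lambda>s :: 'a univ. case s of UPair x t \<Rightarrow> x" and ?l = "\<lambda>s :: 'a univ. case s of UPair t x \<Rightarrow> x"
  let ?a = "\<lambda>s :: 'a univ. case s of UPair (UPair x y) z \<Rightarrow> UPair x (UPair y z)"
  note st = is_graph_structure[OF X X X, unfolded is_graph_def PC_simps]
  note o = X ob_point ob_XX ob_prod(1)[OF X ob_point] ob_prod(1)[OF ob_point X] ob_prod(1)[OF ob_XX X] ob_prod(1)[OF X ob_XX]
  have r: "eqf ?XP X ?r" and l: "eqf ?PX X ?l" and a: "eqf ?A ?B ?a" using st by simp_all
  have inj: "inj_on ?r (pts ?XP)" "inj_on ?l (pts ?PX)" "inj_on ?a (pts ?A)"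
    by (rule structure_bij[THEN bij_betw_imp_inj_on])+
  have gr: "eqm ?XP X (gm ?XP ?r)" and gl: "eqm ?PX X (gm ?PX ?l)" and ga: "eqm ?A ?B (gm ?A ?a)"
    by (intro eqm_gm o r l a)+
  have E: "eqm ?B ?XP (mt A (evm A))" and C: "eqm ?PX ?A (mt cvm A)" and I: "eqm ?PX ?PX (mt (gm ?P id) A)"
    by (intro eqm_mt A idem_eqm)+
  let ?M = "mm ?XP (gm ?XP ?r) (mt A (evm A))" and ?N = "mm ?A (gm ?A ?a) (mt cvm A)"
  have M: "eqm ?B X ?M" and N: "eqm ?PX ?B ?N" and L: "eqm ?PX X (mm ?PX (gm ?PX ?l) (mt (gm ?P id) A))"
    by (intro eqm_mm o gr gl ga E C I)+
  \<comment> \<open>The unit constraint drops the point \<open>UPoint\<close>, so it just renames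
    the rows.\<close>
  have Mval: "?M z s = mt A (evm A) (UPair z UPoint) s" if "z \<in> pts X" for z s
    using mm_gm_left(1)[OF o(7) o(4) X r inj(1) E, of "UPair z UPoint" s] that by simp
  have Nval: "?N (UPair b (UPair c d)) s = mt cvm A (UPair (UPair b c) d) s" if "b \<in> pts X" "c \<in> pts X" "d \<in> pts X" for b c d s
    using mm_gm_left(1)[OF o(5) o(6) o(7) a inj(3) C, of "UPair (UPair b c) d" s] that by simp
  have "mm ?B ?M ?N = mm ?PX (gm ?PX ?l) (mt (gm ?P id) A)"
  proof (rule eqm_eqI[OF eqm_mm[OF o(5) o(7) X N M] L])
    fix z s assume z: "z \<in> pts X" and "s \<in> pts ?PX"
    then obtain x where s: "s = UPair UPoint x" "x \<in> pts X" by (auto elim!: prod_ptsE)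
    have "mm ?B ?M ?N z s = A z x"
      by (rule mm_triple[OF o(5) X M N])
        (use z s in \<open>auto simp: Mval Nval ob_prod(2)[OF ob_point X]\<close>)
    moreover have "mm ?PX (gm ?PX ?l) (mt (gm ?P id) A) z s = A z x"
      using mm_gm_left(1)[OF o(5) o(5) X l inj(2) I, of "UPair UPoint z" s] z s by (simp add: gm_def)
    ultimately show "mm ?B ?M ?N z s = mm ?PX (gm ?PX ?l) (mt (gm ?P id) A) z s" by simp
  qed
  moreover have "mm ?B ?M ?N = mm ?XP (gm ?XP ?r) (mm ?B (mt A (evm A)) ?N)"
    by (rule mm_assoc[OF o(5) o(7) o(4) X N E gr])
  ultimately show ?thesis by (simp add: PC_simps mat_tensor_eq mat_comp_eq)
qed

text \<open>As in the first identity, but the outer factors are transposed, so the path runs from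
  the column index \<open>x\<close> to the row index \<open>z\<close>.\<close>

lemma zigzag_second:
  defines "\<beta> \<equiv> PMat (prod_gset X XX) (prod_gset XX X) (gm (prod_gset X XX)
    (\<lambda>s. case s of UPair x (UPair y z) \<Rightarrow> UPair (UPair x y) z))"
  shows "ccomp PC (clunit PC X) (ccomp PC (tmor PC evX tX) (ccomp PC \<beta> (tmor PC tX cvX))) =
    ccomp PC (crunit PC X) (tmor PC tX (cid PC (cunit PC)))"
proof -
  let ?P = "point_gset G :: ('w, 'a univ) gset"
  let ?XP = "prod_gset X ?P" and ?PX = "prod_gset ?P X" and ?A = "prod_gset XX X" and ?B = "prod_gset X XX"
  let ?r = "\<lambda>s :: 'a univ. case s of UPair x t \<Rightarrow> x" and ?l = "\<lambda>s :: 'a univ. case s of UPair t x \<Rightarrow> x"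
  let ?b = "\<lambda>s :: 'a univ. case s of UPair x (UPair y z) \<Rightarrow> UPair (UPair x y) z"
  note st = is_graph_structure[OF X X X, unfolded is_graph_def PC_simps]
  note o = X ob_point ob_XX ob_prod(1)[OF X ob_point] ob_prod(1)[OF ob_point X] ob_prod(1)[OF ob_XX X] ob_prod(1)[OF X ob_XX]
  have r: "eqf ?XP X ?r" and l: "eqf ?PX X ?l" using st by simp_all
  have b: "eqf ?B ?A ?b" by (auto simp: eqf_def elim!: prod_ptsE)
  have inj: "inj_on ?r (pts ?XP)" "inj_on ?l (pts ?PX)"
    by (rule structure_bij[THEN bij_betw_imp_inj_on])+
  have gr: "eqm ?XP X (gm ?XP ?r)" and gl: "eqm ?PX X (gm ?PX ?l)" and gb: "eqm ?B ?A (gm ?B ?b)"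
    by (intro eqm_gm o r l b)+
  have E: "eqm ?A ?PX (mt (evm A) At)" and C: "eqm ?XP ?B (mt At cvm)" and I: "eqm ?XP ?XP (mt At (gm ?P id))"
    by (intro eqm_mt A idem_eqm)+
  let ?E = "mm ?PX (gm ?PX ?l) (mt (evm A) At)"
  have E': "eqm ?A X ?E" by (intro eqm_mm o gl E)
  let ?M = "mm ?A ?E (gm ?B ?b)"
  have M: "eqm ?B X ?M" by (intro eqm_mm o E' gb)
  have L: "eqm ?XP X (mm ?XP (gm ?XP ?r) (mt At (gm ?P id)))" by (intro eqm_mm o gr I)
  have Mval: "?M z (UPair c (UPair d e)) = mt (evm A) At (UPair UPoint z) (UPair (UPair c d) e)"
    if "z \<in> pts X" "c \<in> pts X" "d \<in> pts X" "e \<in> pts X" for z c d e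
    using mm_gm_left(1)[OF o(6) o(5) X l inj(2) E, of "UPair UPoint z"] that
    by (simp add: mm_gm_right[OF o(7) o(6) X b E'])
  have "mm ?B ?M (mt At cvm) = mm ?XP (gm ?XP ?r) (mt At (gm ?P id))"
  proof (rule eqm_eqI[OF eqm_mm[OF o(4) o(7) X C M] L])
    fix z s assume z: "z \<in> pts X" and "s \<in> pts ?XP"
    then obtain x where s: "s = UPair x UPoint" "x \<in> pts X" by (auto elim!: prod_ptsE)
    have "mm ?B ?M (mt At cvm) z s = A x z"
      by (rule mm_triple[OF o(4) X M C])
        (use z s in \<open>auto simp: Mval ob_prod(2)[OF X ob_point]\<close>)
    moreover have "mm ?XP (gm ?XP ?r) (mt At (gm ?P id)) z s = A x z"
      using mm_gm_left(1)[OF o(4) o(4) X r inj(1) I, of "UPair z UPoint" s] z s by (simp add: gm_def)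
    ultimately show "mm ?B ?M (mt At cvm) z s = mm ?XP (gm ?XP ?r) (mt At (gm ?P id)) z s" by simp
  qed
  moreover have "mm ?B ?M (mt At cvm) = mm ?A ?E (mm ?B (gm ?B ?b) (mt At cvm))"
    by (rule mm_assoc[OF o(4) o(7) o(6) X C gb E'])
  moreover have "\<dots> = mm ?PX (gm ?PX ?l) (mm ?A (mt (evm A) At) (mm ?B (gm ?B ?b) (mt At cvm)))"
    by (rule mm_assoc[OF o(4) o(6) o(5) X eqm_mm[OF o(4) o(7) o(6) C gb] E gl])
  ultimately show ?thesis by (simp add: PC_simps mat_tensor_eq mat_comp_eq \<beta>_def)
qed

end

text \<open>The dual of \<open>(X, e)\<close> is \<open>X\<close> with the transposed
  idempotent.\<close>

theorem PC_dual:
  assumes "typed_category.idem PC msrc mtgt X e" shows "\<exists>Q. cat_data.is_dual (karoubi PC) (X, e) Q"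
proof -
  interpret T: typed_category PC msrc mtgt by (rule PC_typed)
  have X: "ob X" and e: "T.arr e" "msrc e = X" "mtgt e = X" and ee: "ccomp PC e e = e"
    using assms by (auto simp: T.idem_def PC_simps)
  have "e \<in> chom PC X X" using T.arr_homI[OF e] .
  then obtain A where eA: "e = PMat X X A" and A: "eqm X X A" by (auto simp: PC_hom)
  have idem: "mm X A A = A" using ee by (simp add: eA PC_simps mat_comp_eq)
  note q = idem_eqm[OF X A idem]
  let ?P = "point_gset G :: ('w, 'a univ) gset"
  have arr: "T.arr (PMat Y Z B) \<and> msrc (PMat Y Z B) = Y \<and> mtgt (PMat Y Z B) = Z"
    if "ob Y" "ob Z" "eqm Y Z B" for Y Z B
    using that T.hom_iff[of Y Z "PMat Y Z B"] by (auto simp: PC_simps PMat_hom)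
  define t where "t = PMat X X (\<lambda>x y. A y x)"
  define ev where "ev = PMat (prod_gset X X) ?P (evm A)"
  define cv where "cv = PMat ?P (prod_gset X X) (\<lambda>s t. evm A t s)"
  have t: "T.arr t" "msrc t = X" "mtgt t = X" unfolding t_def using arr[OF X X q(1)] by auto
  have ev: "T.arr ev" "msrc ev = tob PC X X" "mtgt ev = cunit PC"
    unfolding ev_def using arr[OF ob_prod(1)[OF X X] ob_point q(2)] by (auto simp: PC_simps)
  have cv: "T.arr cv" "msrc cv = cunit PC" "mtgt cv = tob PC X X"
    unfolding cv_def using arr[OF ob_point ob_prod(1)[OF X X] q(3)] by (auto simp: PC_simps)
  have tt: "ccomp PC t t = t"
    using idem_transpose[OF X A idem] by (simp add: t_def PC_simps mat_comp_eq)
  have eva: "ccomp PC ev (tmor PC t e) = ev"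
    using evm_absorb[OF X A idem] by (simp add: t_def ev_def eA PC_simps mat_tensor_eq mat_comp_eq)
  have cva: "ccomp PC (tmor PC e t) cv = cv"
    using cvm_absorb[OF X A idem] by (simp add: t_def cv_def eA PC_simps mat_tensor_eq mat_comp_eq)
  have ob: "X \<in> cob PC" "cunit PC \<in> cob PC" using X by (auto simp: PC_simps ob_point)
  have iX: "T.idem X e" and it: "T.idem X t" and i1: "T.idem (cunit PC) (cid PC (cunit PC))"
    using assms t tt ob by (auto simp: T.idem_def)
  note it2 = T.idem_tensor[OF it iX] T.idem_tensor[OF iX it]
  note z1 = zigzag_first[OF X A idem, folded eA ev_def cv_def]
  note z2 = zigzag_second[OF X A idem, folded t_def ev_def cv_def]
  define \<beta> where "\<beta> = (PMat (prod_gset X (prod_gset X X)) (prod_gset (prod_gset X X) X) (gm (prod_gset X (prod_gset X X))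
    (\<lambda>s. case s of UPair x (UPair y z) \<Rightarrow> UPair (UPair x y) z)) :: ('w, 'a univ, 'k) pmat)"
  have inv: "T.inverse_maps (tob PC (tob PC X X) X) (tob PC X (tob PC X X)) (cassoc PC X X X) \<beta>"
    using assoc_inverse[OF X X X] by (simp add: \<beta>_def PC_simps)
  then have \<beta>: "T.arr \<beta>" "msrc \<beta> = tob PC X (tob PC X X)" "mtgt \<beta> = tob PC (tob PC X X) X"
    using ob by (auto simp: T.inverse_maps_def T.hom_iff)
  note facts = e t ev cv \<beta> ob
  let ?E = "tmor PC (tmor PC t e) t" and ?E' = "tmor PC t (tmor PC e t)"
  have k: "cat_data.inverse_maps T.K (tob PC (tob PC X X) X, ?E) (tob PC X (tob PC X X), ?E')
      (ccomp PC (cassoc PC X X X) ?E) (ccomp PC ?E \<beta>)"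
    by (rule T.K_inverse[OF inv T.idem_tensor[OF it2(1) it] T.idem_tensor[OF it it2(2)]])
      (use facts in \<open>simp add: T.assoc_nat\<close>)
  \<comment> \<open>The constraints of the envelope carry extra idempotents. Those next to
    \<open>ev\<close> and \<open>cv\<close> are absorbed by them, which leaves the zigzag identities
    already proved.\<close>
  have kz1: "ccomp PC (ccomp PC (crunit PC X) (tmor PC e (cid PC (cunit PC))))
      (ccomp PC (tmor PC e ev) (ccomp PC (ccomp PC (cassoc PC X X X) (tmor PC (tmor PC e t) e)) (tmor PC cv e)))
      = ccomp PC (clunit PC X) (tmor PC (cid PC (cunit PC)) e)"
    using facts by (simp add: T.tensor_comp T.tensor_comp_assoc ee cva z1)
  have kz2: "ccomp PC (ccomp PC (clunit PC X) (tmor PC (cid PC (cunit PC)) t))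
      (ccomp PC (tmor PC ev t) (ccomp PC (ccomp PC ?E \<beta>) (tmor PC t cv)))
      = ccomp PC (crunit PC X) (tmor PC t (cid PC (cunit PC)))"
    using facts z2 by (simp add: T.tensor_comp_assoc tt eva \<beta>_def)
  have kev: "ev \<in> chom T.K (tob PC X X, tmor PC t e) (cunit PC, cid PC (cunit PC))"
    using facts eva by (subst T.K_hom[OF it2(1) i1]) auto
  have kcv: "cv \<in> chom T.K (cunit PC, cid PC (cunit PC)) (tob PC X X, tmor PC e t)"
    using facts cva by (subst T.K_hom[OF i1 it2(2)]) auto
  have kQ: "(X, t) \<in> cob T.K" using it by (simp add: T.K_ob)
  have "cat_data.is_dual T.K (X, e) (X, t)"
    unfolding cat_data.is_dual_def T.K_simps
    by (intro conjI kQ, rule bexI[OF _ kev], rule bexI[OF _ kcv], intro conjI exI[of _ "ccomp PC ?E \<beta>"] kz1 kz2 k)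
  then show ?thesis by blast
qed

end

section \<open>Traces and Frobenius\<close>

text \<open>The point \<open>x\<close> has the periods \<open>p\<close> and \<open>j - i\<close>.
  They are coprime, so by Bezout's identity 1 is a period.\<close>

lemma funpow_period:
  assumes p: "prime p" and per: "(s ^^ p) x = x" and ij: "i < j" "j < p" and eq: "(s ^^ i) x = (s ^^ j) x"
  shows "s x = x"
proof -
  define d where "d = j - i"
  have "(s ^^ d) x = x"
  proof -
    have "(s ^^ (p - i + j)) x = (s ^^ (p - i)) ((s ^^ i) x)" unfolding eq by (simp add: funpow_add)
    also have "\<dots> = (s ^^ (p - i + i)) x" by (simp only: funpow_add o_apply)
    also have "\<dots> = x" using ij per by simp
    finally have "(s ^^ (p - i + j)) x = x" .
    moreover have "p - i + j = d + p" using ij by (simp add: d_def)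
    ultimately show ?thesis using per by (simp add: funpow_add)
  qed
  then have d: "(s ^^ (d * a)) x = x" for a by (induction a) (simp_all add: funpow_add)
  have q: "(s ^^ (p * b)) x = x" for b using per by (induction b) (simp_all add: funpow_add)
  have "coprime p d" using p ij by (intro prime_imp_coprime) (auto simp: d_def dest: dvd_imp_le)
  then obtain a b where "d * a = p * b + 1"
    using bezout_nat[of d p] ij by (auto simp: d_def gcd.commute coprime_iff_gcd_eq_1)
  then have "(s ^^ (d * a)) x = s ((s ^^ (p * b)) x)" by simp
  then show ?thesis by (simp add: d q)
qed

lemma prime_cycle:
  assumes p: "prime p" and per: "(s ^^ p) x = x" and ne: "s x \<noteq> x"
  shows "inj_on (\<lambda>i. (s ^^ i) x) {..<p}"
    and "y \<in> (\<lambda>i. (s ^^ i) x) ` {..<p} \<Longrightarrow> s y \<in> (\<lambda>i. (s ^^ i) x) ` {..<p}"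
    and "y \<in> (\<lambda>i. (s ^^ i) x) ` {..<p} \<Longrightarrow> \<exists>k. x = (s ^^ k) y"
    and "y \<in> (\<lambda>i. (s ^^ i) x) ` {..<p} \<Longrightarrow> (s ^^ p) y = y"
proof -
  show "inj_on (\<lambda>i. (s ^^ i) x) {..<p}"
  proof (rule inj_onI)
    show "i = j" if "i \<in> {..<p}" "j \<in> {..<p}" "(s ^^ i) x = (s ^^ j) x" for i j
      using that funpow_period[OF p per, of i j] funpow_period[OF p per, of j i] ne
      by (cases i j rule: linorder_cases) auto
  qed
  assume "y \<in> (\<lambda>i. (s ^^ i) x) ` {..<p}"
  then obtain i where i: "y = (s ^^ i) x" "i < p" by auto
  have "(s ^^ (p - i)) y = (s ^^ (p - i + i)) x" unfolding i(1) by (simp only: funpow_add o_apply)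
  then show "\<exists>k. x = (s ^^ k) y" using i per by (metis le_add_diff_inverse2 less_imp_le_nat)
  have "(s ^^ p) y = (s ^^ (p + i)) x" unfolding i(1) by (simp add: funpow_add)
  also have "\<dots> = (s ^^ (i + p)) x" by (simp add: add.commute)
  finally show "(s ^^ p) y = y" using per i(1) by (simp add: funpow_add)
  show "s y \<in> (\<lambda>i. (s ^^ i) x) ` {..<p}"
  proof (cases "Suc i < p")
    case True
    then show ?thesis using i by (intro image_eqI[of _ _ "Suc i"]) auto
  next
    case False
    then have "Suc i = p" using i by simp
    then have "s y = (s ^^ 0) x" using per i by (metis funpow.simps(2) funpow_0 o_apply)
    then show ?thesis using i by (intro image_eqI[of _ _ 0]) auto
  qed
qed

context place
begin

text \<open>A point that is not fixed lies on a cycle of \<open>p\<close> points with the same value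
  of \<open>F\<close>, which together contribute a multiple of \<open>p\<close>. The cycles are
  removed one at a time.\<close>

lemma sum_rotation:
  assumes "finite S" "s ` S \<subseteq> S" "\<And>x. x \<in> S \<Longrightarrow> (s ^^ p) x = x" "\<And>x. x \<in> S \<Longrightarrow> F (s x) = F x" "\<And>x. x \<in> S \<Longrightarrow> F x \<in> V"
  shows "cong_p (sum F S) (sum F {x \<in> S. s x = x})"
  using assms
proof (induction "card S" arbitrary: S rule: less_induct)
  case less
  show ?case
  proof (cases "\<forall>x\<in>S. s x = x")
    case True
    then have "{x \<in> S. s x = x} = S" by auto
    then show ?thesis by simp
  next
    case False
    then obtain x where x: "x \<in> S" "s x \<noteq> x" by blast
    have iter: "(s ^^ i) y \<in> S \<and> F ((s ^^ i) y) = F y" if "y \<in> S" for y i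
      using that less.prems(2,4) by (induction i) auto
    define C where "C = (\<lambda>i. (s ^^ i) x) ` {..<p}"
    note cycle = prime_cycle[OF prime_p less.prems(3)[OF x(1)] x(2), folded C_def]
    have C: "C \<subseteq> S" "finite C" using iter[OF x(1)] by (auto simp: C_def)
    have "sum F C = of_nat p * F x"
      unfolding C_def sum.reindex[OF cycle(1)] using iter[OF x(1)] by simp
    \<comment> \<open>The complement of \<open>C\<close> is stable under \<open>s\<close>: a point
      mapped into \<open>C\<close> is recovered from its image by \<open>p - 1\<close> further
      applications of \<open>s\<close>.\<close>
    have sC: "y \<in> C" if "y \<in> S" "s y \<in> C" for y
    proof -
      have "(s ^^ i) (s y) \<in> C" for i using that(2) cycle(2) by (induction i) auto
      then have "(s ^^ Suc (p - 1)) y \<in> C" by (simp only: funpow_Suc_right o_apply)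
      then show ?thesis using less.prems(3)[OF that(1)] p_ge_5 by simp
    qed
    have fix_C: "s y \<noteq> y" if y: "y \<in> C" for y
    proof
      assume sy: "s y = y"
      have "(s ^^ j) y = y" for j using sy by (induction j) auto
      then show False using cycle(3)[OF y] sy x(2) by auto
    qed
    have "x \<in> C" using p_ge_5 by (auto simp: C_def intro!: image_eqI[of _ _ 0])
    then have "card (S - C) < card S" using C x less.prems(1) by (intro psubset_card_mono) auto
    then have "cong_p (sum F (S - C)) (sum F {y \<in> S - C. s y = y})"
      using less.prems sC by (intro less.hyps) auto
    moreover have "{y \<in> S - C. s y = y} = {y \<in> S. s y = y}" using fix_C by auto
    moreover have "sum F S = sum F (S - C) + of_nat p * F x"
      using sum.subset_diff[OF C(1) less.prems(1), of F] \<open>sum F C = of_nat p * F x\<close> by simp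
    ultimately show ?thesis using cong_trans[OF cong_multiple] less.prems(5)[OF x(1)] by simp
  qed
qed

end

text \<open>A finite set of nonzero elements has a member of least valuation, and it divides all the
  others in \<open>V\<close>.\<close>

lemma exists_dominant:
  assumes V: "\<And>x y. x \<in> V \<Longrightarrow> y \<in> V \<Longrightarrow> x * y \<in> (V :: 'k::field set)" "1 \<in> V" "\<And>x. x \<in> V \<or> inverse x \<in> V"
    and W: "finite W" "W \<noteq> {}" "0 \<notin> W"
  shows "\<exists>w\<in>W. \<forall>v\<in>W. inverse w * v \<in> V"
  using W
proof (induction W rule: finite_ne_induct)
  case (singleton x)
  then show ?case using V(2) by simp
next
  case (insert u W)
  then obtain w where w: "w \<in> W" "\<And>v. v \<in> W \<Longrightarrow> inverse w * v \<in> V" by auto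
  have ne: "u \<noteq> 0" "w \<noteq> 0" using insert.prems w(1) by auto
  show ?case
  proof (cases "inverse u * w \<in> V")
    case True
    have "inverse u * v \<in> V" if "v \<in> W" for v
      using V(1)[OF True w(2)[OF that]] ne by (simp add: field_simps)
    then show ?thesis using ne V(2) by (intro bexI[of _ u]) auto
  next
    case False
    then have "inverse w * u \<in> V" using V(3)[of "inverse u * w"] by (simp add: mult.commute)
    then show ?thesis using w by (intro bexI[of _ w]) auto
  qed
qed

context mu_one
begin

section \<open>Matrix powers and traces as integrals over tuples\<close>

definition lists_of :: "'x set \<Rightarrow> nat \<Rightarrow> 'x list set" where
  "lists_of X n = {l. length l = n \<and> set l \<subseteq> X}"

definition lact :: "(('w \<Rightarrow> 'w) \<Rightarrow> 'x \<Rightarrow> 'x) \<Rightarrow> ('w \<Rightarrow> 'w) \<Rightarrow> 'x list \<Rightarrow> 'x list" where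
  "lact a g l = map (a g) l"

definition lsupp :: "('x \<Rightarrow> 'w set) \<Rightarrow> 'x list \<Rightarrow> 'w set" where
  "lsupp s l = (\<Union>x\<in>set l. s x)"

lemma acts_lists:
  assumes a: "acts G X a s" shows "acts G (lists_of X n) (lact a) (lsupp s)"
  unfolding acts_def
proof (intro conjI ballI)
  fix l assume l: "l \<in> lists_of X n"
  show "finite (lsupp s l)" using l actsD(4)[OF a] by (auto simp: lsupp_def lists_of_def)
  show "lact a id l = l" using l actsD(2)[OF a] by (auto simp: lact_def lists_of_def intro!: map_idI)
  fix h assume h: "h \<in> G"
  show "lact a h l \<in> lists_of X n" using l h actsD(1)[OF a] by (auto simp: lact_def lists_of_def)
  have "lact a h l = l \<longleftrightarrow> (\<forall>x\<in>set l. a h x = x)" by (induction l) (auto simp: lact_def)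
  also have "\<dots> \<longleftrightarrow> (\<forall>w\<in>lsupp s l. h w = w)"
    using l actsD(5)[OF a h] by (auto simp: lsupp_def lists_of_def)
  finally show "lact a h l = l \<longleftrightarrow> (\<forall>w\<in>lsupp s l. h w = w)" .
next
  fix g h l assume "g \<in> G" "h \<in> G" "l \<in> lists_of X n"
  then show "lact a (g \<circ> h) l = lact a g (lact a h l)"
    using actsD(3)[OF a] by (auto simp: lact_def lists_of_def)
qed

lemma lists_bij: "bij_betw (\<lambda>(x, l). x # l) (X \<times> lists_of X n) (lists_of X (Suc n))"
  by (rule bij_betwI[where g = "\<lambda>l. (hd l, tl l)"]) (auto simp: lists_of_def length_Suc_conv)

lemma fin_acts_lists:
  assumes X: "fin_acts X a s" shows "fin_acts (lists_of X n) (lact a) (lsupp s)"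
proof (induction n)
  case 0
  have "lists_of X 0 = {[]}" by (auto simp: lists_of_def)
  then show ?case using acts_lists[OF fin_actsD[OF X], of 0] by (simp add: fin_acts_def)
next
  case (Suc n)
  have "orb (lact a) {} (x # l) = (\<lambda>(x, l). x # l) ` orb (pact a (lact a)) {} (x, l)" for x l
    by (auto simp: orb_def pact_def lact_def image_image)
  then have "orb (lact a) {} ` lists_of X (Suc n) =
      (\<lambda>P. (\<lambda>(x, l). x # l) ` P) ` orb (pact a (lact a)) {} ` (X \<times> lists_of X n)"
    unfolding bij_betw_imp_surj_on[OF lists_bij, symmetric] image_image by (intro image_cong) auto
  then show ?case using fin_acts_prod[OF X Suc] acts_lists[OF fin_actsD[OF X]] by (simp add: fin_acts_def)
qed

lemma integ_Cons:
  assumes X: "fin_acts X a s" and A: "finite A" and f: "invar A (lists_of X (Suc n)) (lact a) f"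
  shows "integ A (lists_of X (Suc n)) (lact a) (lsupp s) f =
    integ A X a s (\<lambda>x. integ (A \<union> s x) (lists_of X n) (lact a) (lsupp s) (\<lambda>l. f (x # l)))"
proof -
  note L = fin_acts_lists[OF X]
  have "integ A (X \<times> lists_of X n) (pact a (lact a)) (psupp s (lsupp s)) (\<lambda>p. f ((\<lambda>(x, l). x # l) p)) =
      integ A (lists_of X (Suc n)) (lact a) (lsupp s) f"
    by (intro integ_bij acts_prod fin_actsD[OF X] fin_actsD[OF L] lists_bij f)
      (auto simp: pact_def psupp_def lact_def lsupp_def)
  moreover have "integ A (X \<times> lists_of X n) (pact a (lact a)) (psupp s (lsupp s)) (\<lambda>p. f ((\<lambda>(x, l). x # l) p)) =
    integ A X a s (\<lambda>x. integ (A \<union> s x) (lists_of X n) (lact a) (lsupp s) (\<lambda>l. f ((\<lambda>(x, l). x # l) (x, l))))"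
  proof (rule integ_Fubini[OF X L A])
    have "f (a g x # lact a g l) = f (x # l)" if "g \<in> stab A" "x \<in> X" "l \<in> lists_of X n" for g x l
    proof -
      have "x # l \<in> lists_of X (Suc n)" using that by (auto simp: lists_of_def)
      moreover have "lact a g (x # l) = a g x # lact a g l" by (simp add: lact_def)
      ultimately show ?thesis using f that(1) unfolding invar_def by metis
    qed
    then show "invar A (X \<times> lists_of X n) (pact a (lact a)) (\<lambda>p. f ((\<lambda>(x, l). x # l) p))"
      by (auto simp: invar_def pact_def)
  qed
  ultimately show ?thesis by simp
qed

text \<open>The product of the entries along the path with ends \<open>x\<close> and
  \<open>z\<close> and the list as intermediate points, which is the integrand of a matrix
  power.\<close>

primrec chain :: "('x \<Rightarrow> 'x \<Rightarrow> 'k) \<Rightarrow> 'x \<Rightarrow> 'x list \<Rightarrow> 'x \<Rightarrow> 'k" where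
  "chain A x [] z = A x z"
| "chain A x (y # ys) z = A x y * chain A y ys z"

lemma chain_snoc: "chain A x (l @ [w]) z = chain A x l w * A w z"
  by (induction l arbitrary: x) (simp_all add: mult.assoc)

lemma chain_invar:
  assumes X: "ob X" and A: "eqm X X A" and g: "g \<in> G"
  shows "x \<in> pts X \<Longrightarrow> z \<in> pts X \<Longrightarrow> set l \<subseteq> pts X \<Longrightarrow>
    chain A (act X g x) (lact (act X) g l) (act X g z) = chain A x l z"
  using eqmD(3)[OF A g] by (induction l arbitrary: x) (auto simp: lact_def)

text \<open>The power of exponent \<open>n + 1\<close>, in step with \<open>cpow\<close>.\<close>

definition mpow :: "('w, 'a univ) gset \<Rightarrow> ('a univ \<Rightarrow> 'a univ \<Rightarrow> 'k) \<Rightarrow> nat \<Rightarrow> 'a univ \<Rightarrow> 'a univ \<Rightarrow> 'k" where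
  "mpow X A n = (mm X A ^^ n) A"

lemma mpow_simps [simp]: "mpow X A 0 = A" "mpow X A (Suc n) = mm X A (mpow X A n)"
  by (simp_all add: mpow_def)

lemma eqm_mpow: "ob X \<Longrightarrow> eqm X X A \<Longrightarrow> eqm X X (mpow X A n)"
  by (induction n) (auto intro: eqm_mm)

lemma mpow_add: "ob X \<Longrightarrow> eqm X X A \<Longrightarrow> mm X (mpow X A m) (mpow X A n) = mpow X A (Suc (m + n))"
  by (induction m) (simp_all add: mm_assoc eqm_mpow)

text \<open>The exponents multiply: \<open>(m + 1) * (n + 1)\<close> exceeds the index on the right
  by one.\<close>

lemma mpow_mpow: "ob X \<Longrightarrow> eqm X X A \<Longrightarrow> mpow X (mpow X A m) n = mpow X A (m + n * Suc m)"
  by (induction n) (simp_all add: mpow_add algebra_simps)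

text \<open>Iterated use of Fubini's theorem: the power of exponent \<open>n + 1\<close> integrates
  over \<open>n\<close> intermediate points.\<close>

lemma mpow_chain:
  assumes X: "ob X" and A: "eqm X X A"
  shows "x \<in> pts X \<Longrightarrow> z \<in> pts X \<Longrightarrow> finite D \<Longrightarrow> supp X x \<union> supp X z \<subseteq> D \<Longrightarrow>
    mpow X A n x z = integ D (lists_of (pts X) n) (lact (act X)) (lsupp (supp X)) (\<lambda>l. chain A x l z)"
proof (induction n arbitrary: x D)
  case 0
  have "integ D (lists_of (pts X) 0) (lact (act X)) (lsupp (supp X)) (\<lambda>l. chain A x l z) = chain A x [] z"
    using 0 by (intro integ_delta[OF fin_acts_lists[OF obD(2)[OF X]]]) (auto simp: lists_of_def lsupp_def)
  then show ?case by simp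
next
  case (Suc n)
  have "mpow X A (Suc n) x z = integ D (pts X) (act X) (supp X) (\<lambda>y. A x y * mpow X A n y z)"
    using Suc by (simp add: mm_eq[OF X X X eqm_mpow[OF X A] A])
  also have "\<dots> = integ D (pts X) (act X) (supp X) (\<lambda>y. integ (D \<union> supp X y) (lists_of (pts X) n) (lact (act X))
      (lsupp (supp X)) (\<lambda>l. chain A x (y # l) z))"
  proof (rule integ_cong[OF obD(1)[OF X]])
    fix y assume y: "y \<in> pts X"
    have "mpow X A n y z = integ (D \<union> supp X y) (lists_of (pts X) n) (lact (act X)) (lsupp (supp X)) (\<lambda>l. chain A y l z)"
      using Suc.prems y by (intro Suc.IH) (auto simp: obD(5)[OF X])
    then show "A x y * mpow X A n y z = integ (D \<union> supp X y) (lists_of (pts X) n) (lact (act X))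
      (lsupp (supp X)) (\<lambda>l. chain A x (y # l) z)" by (simp add: integ_cmult)
  qed
  also have "\<dots> = integ D (lists_of (pts X) (Suc n)) (lact (act X)) (lsupp (supp X)) (\<lambda>l. chain A x l z)"
  proof (rule integ_Cons[OF obD(2)[OF X] Suc.prems(3), symmetric])
    have "chain A x (lact (act X) g l) z = chain A x l z" if "g \<in> stab D" "set l \<subseteq> pts X" for g l
      using chain_invar[OF X A _ Suc.prems(1,2) that(2), of g] obD(7)[OF X that(1)] Suc.prems that(1)
      by (simp add: stab_iff)
    then show "invar D (lists_of (pts X) (Suc n)) (lact (act X)) (\<lambda>l. chain A x l z)"
      by (auto simp: invar_def lists_of_def)
  qed
  finally show ?case .
qed

definition tr :: "('w, 'a univ) gset \<Rightarrow> ('a univ \<Rightarrow> 'a univ \<Rightarrow> 'k) \<Rightarrow> 'k" where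
  "tr X A = integ {} (pts X) (act X) (supp X) (\<lambda>x. A x x)"

text \<open>The product of the entries around the closed path through the list, which is used for
  nonempty lists only. Its invariance under rotation is the symmetry exploited below.\<close>

definition cyc :: "('x \<Rightarrow> 'x \<Rightarrow> 'k) \<Rightarrow> 'x list \<Rightarrow> 'k" where
  "cyc A l = chain A (hd l) (tl l) (hd l)"

lemma cyc_rotate1: "cyc A (rotate1 l) = cyc A l"
proof (cases l)
  case (Cons x xs)
  then show ?thesis by (cases xs) (simp_all add: cyc_def chain_snoc)
qed simp

lemma cyc_invar:
  assumes X: "ob X" and A: "eqm X X A"
  shows "invar {} (lists_of (pts X) (Suc n)) (lact (act X)) (cyc A)"
proof -
  have "cyc A (lact (act X) g l) = cyc A l" if "g \<in> G" "l \<in> lists_of (pts X) (Suc n)" for g l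
    using that chain_invar[OF X A that(1), of "hd l" "hd l" "tl l"]
    by (cases l) (auto simp: cyc_def lists_of_def lact_def)
  then show ?thesis by (simp add: invar_def)
qed

lemma tr_mpow:
  assumes X: "ob X" and A: "eqm X X A"
  shows "tr X (mpow X A n) = integ {} (lists_of (pts X) (Suc n)) (lact (act X)) (lsupp (supp X)) (cyc A)"
proof -
  have "integ {} (lists_of (pts X) (Suc n)) (lact (act X)) (lsupp (supp X)) (cyc A) = integ {} (pts X) (act X) (supp X)
      (\<lambda>x. integ ({} \<union> supp X x) (lists_of (pts X) n) (lact (act X)) (lsupp (supp X)) (\<lambda>l. cyc A (x # l)))"
    by (rule integ_Cons[OF obD(2)[OF X] _ cyc_invar[OF X A]]) simp
  also have "\<dots> = tr X (mpow X A n)"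
    unfolding tr_def
  proof (rule integ_cong[OF obD(1)[OF X]])
    fix x assume x: "x \<in> pts X"
    show "integ ({} \<union> supp X x) (lists_of (pts X) n) (lact (act X)) (lsupp (supp X)) (\<lambda>l. cyc A (x # l)) = mpow X A n x x"
      using mpow_chain[OF X A x x, of "supp X x" n] x by (simp add: cyc_def obD(5)[OF X])
  qed
  finally show ?thesis by simp
qed

text \<open>Since \<open>g\<close> acts on \<open>l\<close> as the rotation, its \<open>p\<close>-th
  power fixes every entry. If \<open>g\<close> moved the first entry, it would move some
  \<open>b\<close> in the support of that entry; the \<open>p\<close>-th power of \<open>g\<close>
  fixes \<open>b\<close>, so \<open>g\<close> would permute \<open>p\<close> points cyclically,
  against \<open>no_prime_rotation\<close>. Hence \<open>g\<close> fixes the first entry, and each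
  entry equals the next.\<close>

lemma rotation_fixed:
  assumes X: "ob X" and p: "prime p" "p \<ge> 5" and l: "l \<in> lists_of (pts X) p" and g: "g \<in> G"
    and eq: "lact (act X) g l = rotate1 l"
  shows "l = replicate p (hd l)"
proof -
  let ?x = "hd l"
  have len: "length l = p" "set l \<subseteq> pts X" using l by (auto simp: lists_of_def)
  have "l \<noteq> []" using len p(2) by auto
  then have l0: "l ! 0 = ?x" "l \<noteq> []" by (simp_all add: hd_conv_nth)
  have x: "?x \<in> pts X" using len l0 by auto
  have gi: "g ^^ i \<in> G" for i by (induction i) (simp_all only: funpow.simps G_id G_comp[OF g])
  have rot: "lact (act X) (g ^^ i) l = rotate i l" for i
  proof (induction i)
    case 0
    have "g ^^ 0 = id" by (rule ext) simp
    then show ?case by (simp only: actsD(2)[OF acts_lists[OF obD(1)[OF X]] l]) simp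
  next
    case (Suc i)
    have "lact (act X) (g ^^ Suc i) l = lact (act X) g (lact (act X) (g ^^ i) l)"
      unfolding funpow.simps by (rule actsD(3)[OF acts_lists[OF obD(1)[OF X]] g gi l])
    also have "\<dots> = lact (act X) g (rotate i l)" by (simp only: Suc)
    also have "\<dots> = rotate i (lact (act X) g l)" by (simp add: lact_def rotate_map)
    also have "\<dots> = rotate (Suc i) l" unfolding eq by (simp add: rotate1_rotate_swap)
    finally show ?case .
  qed
  have "act X g ?x = ?x"
  proof (rule ccontr)
    assume "act X g ?x \<noteq> ?x"
    then obtain b where b: "b \<in> supp X ?x" "g b \<noteq> b" using actsD(5)[OF obD(1)[OF X] g x] by auto
    have "lact (act X) (g ^^ p) l = l" using rot[of p] len by simp
    then have "act X (g ^^ p) ?x = ?x" using l0(2) by (metis lact_def list.map_sel(1))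
    then have per: "(g ^^ p) b = b" using actsD(5)[OF obD(1)[OF X] gi x] b(1) by auto
    define C where "C = (\<lambda>i. (g ^^ i) b) ` {..<p}"
    note cycle = prime_cycle[OF p(1) per b(2), folded C_def]
    show False
    proof (rule no_prime_rotation[OF _ p, of C R g])
      show "boron_structure C R" using limit by (simp add: boron_fraisse_limit_def C_def)
      show "card C = p" unfolding C_def using card_image[OF cycle(1)] by simp
      show "\<exists>i. c = (g ^^ i) a" if "a \<in> C" "c \<in> C" for a c
      proof -
        obtain k where k: "b = (g ^^ k) a" using cycle(3)[OF \<open>a \<in> C\<close>] by blast
        obtain i where "c = (g ^^ i) b" using \<open>c \<in> C\<close> by (auto simp: C_def)
        then have "c = (g ^^ (i + k)) a" by (simp add: k funpow_add)
        then show ?thesis by blast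
      qed
      show "g ` C \<subseteq> C" using cycle(2) by blast
      show "(g ^^ p) a = a" if "a \<in> C" for a using cycle(4)[OF that] .
      show "R (g w) (g x) (g y) (g z) \<longleftrightarrow> R w x y z" for w x y z using g by (simp add: aut_iff)
    qed
  qed
  moreover have "l ! Suc i = act X g (l ! i)" if "Suc i < p" for i
  proof -
    have "rotate1 l ! i = l ! Suc i" using that len by (simp add: nth_rotate1)
    moreover have "lact (act X) g l ! i = act X g (l ! i)" using that len by (simp add: lact_def)
    ultimately show ?thesis using eq by simp
  qed
  ultimately have "l ! i = ?x" if "i < p" for i using that l0 by (induction i) auto
  then show ?thesis using len by (intro nth_equalityI) auto
qed

lemma cyc_replicate: "n > 0 \<Longrightarrow> cyc A (replicate n x) = A x x ^ n"
proof -
  have "chain A x (replicate n x) x = A x x ^ Suc n" for n by (induction n) simp_all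
  then show "n > 0 \<Longrightarrow> cyc A (replicate n x) = A x x ^ n" by (cases n) (auto simp: cyc_def)
qed

section \<open>Integrality and the Frobenius congruence for traces\<close>

context
  fixes V p assumes place: "place (V :: 'k set) p"
begin

interpretation place V p by (rule place)

text \<open>Up to sign, the values of \<open>nu\<close> and their inverses are products of 2, 3 and
  the inverses of these. The inverses are included because the weights are quotients.\<close>

lemma nuk_frob: "nuk n \<in> frob_fixed" "inverse (nuk n) \<in> frob_fixed"
proof -
  have pow: "x ^ n \<in> frob_fixed" if "x \<in> frob_fixed" for x n
    using that frob_fixed_of_nat[of 1] by (induction n) (auto intro: frob_fixed_mult)
  note nat = frob_fixed_of_nat[of 2] frob_fixed_of_nat[of 3] frob_fixed_of_nat[of 1]
  have "nuk n = (if n = 0 then of_nat 1 else if n = 1 then of_nat 3 * inverse 2 else of_nat 3 * (- inverse 2) ^ n)"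
    by (simp add: nuk_def field_simps)
  moreover have "of_nat 3 * inverse 2 \<in> frob_fixed" "of_nat 3 * (- inverse 2) ^ n \<in> frob_fixed"
    by (intro frob_fixed_mult pow frob_fixed_uminus nat two_three_units(1))+
  ultimately show "nuk n \<in> frob_fixed" using nat(3) by (simp only: split: if_split) blast
  have "inverse (nuk n) = (if n = 0 then of_nat 1 else if n = 1 then of_nat 2 * inverse 3 else inverse 3 * (- of_nat 2) ^ n)"
    using two_three_units(3,4) inverse_6(2) by (simp add: nuk_def field_simps flip: power_mult_distrib)
  moreover have "of_nat 2 * inverse 3 \<in> frob_fixed" "inverse 3 * (- of_nat 2) ^ n \<in> frob_fixed"
    by (intro frob_fixed_mult pow frob_fixed_uminus nat two_three_units(2))+
  ultimately show "inverse (nuk n) \<in> frob_fixed" using nat(3) by (simp only: split: if_split) blast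
qed

lemma wt_frob: "wt A B \<in> frob_fixed"
  by (auto simp: wt_def divide_inverse intro!: frob_fixed_mult nuk_frob)

lemma wt_V: "wt A B \<in> V"
  using wt_frob[of A B] by (simp add: frob_fixed_def)

lemma integ_V: "acts G X a s \<Longrightarrow> (\<And>x. x \<in> X \<Longrightarrow> f x \<in> V) \<Longrightarrow> integ A X a s f \<in> V"
  unfolding integ_def by (intro V_closed wt_V) (auto dest: rep_in)

lemma mm_V:
  assumes "ob X" "ob Y" "ob Z" "eqm X Y A" "eqm Y Z B" "z \<in> pts Z" "x \<in> pts X"
    "\<And>y. y \<in> pts Y \<Longrightarrow> A y x \<in> V" "\<And>y. y \<in> pts Y \<Longrightarrow> B z y \<in> V"
  shows "mm Y B A z x \<in> V"
  using assms obD(1)[OF assms(2)]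
  by (subst mm_eq[OF assms(1-7), of "supp Z z \<union> supp X x"]) (auto intro!: integ_V V_closed simp: obD(5))

lemma mpow_V:
  assumes "ob X" "eqm X X A" "\<And>x y. x \<in> pts X \<Longrightarrow> y \<in> pts X \<Longrightarrow> A x y \<in> V"
  shows "x \<in> pts X \<Longrightarrow> y \<in> pts X \<Longrightarrow> mpow X A n x y \<in> V"
  using assms by (induction n arbitrary: x y) (auto intro!: mm_V eqm_mpow)

text \<open>The index \<open>p - 1\<close> stands for the exponent \<open>p\<close>, so the left
  side integrates \<open>cyc A\<close> over \<open>p\<close>-tuples.\<close>

lemma trace_frobenius:
  assumes X: "ob X" and A: "eqm X X A" and AV: "\<And>x y. x \<in> pts X \<Longrightarrow> y \<in> pts X \<Longrightarrow> A x y \<in> V"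
  shows "cong_p (tr X (mpow X A (p - 1))) (tr X A ^ p)"
proof -
  have p0: "p > 0" using p_ge_5 by simp
  define L where "L = lists_of (pts X) p"
  define \<L> where "\<L> = orb (lact (act X)) {} ` L"
  define F where "F \<omega> = cyc A (rep \<omega>) * wt {} (lsupp (supp X) (rep \<omega>))" for \<omega>
  have fa: "fin_acts L (lact (act X)) (lsupp (supp X))" unfolding L_def by (rule fin_acts_lists[OF obD(2)[OF X]])
  note a = fin_actsD[OF fa] and b = obD(1)[OF X]
  have LI: "x \<in> L \<longleftrightarrow> length x = p \<and> set x \<subseteq> pts X" for x by (simp add: L_def lists_of_def)
  have "tr X (mpow X A (p - 1)) = sum F \<L>"
    using tr_mpow[OF X A, of "p - 1"] p0 by (simp add: integ_def F_def \<L>_def L_def)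
  have F: "F (orb (lact (act X)) {} l) = cyc A l * wt {} (lsupp (supp X) l)" if l: "l \<in> L" for l
  proof -
    have "invar {} L (lact (act X)) (cyc A)" using cyc_invar[OF X A, of "p - 1"] p0 by (simp add: L_def)
    from invar_rep[OF a this l] invar_rep[OF a invar_wt[OF a] l] show ?thesis by (simp add: F_def)
  qed
  have rot: "rotate1 ` orb (lact (act X)) {} l = orb (lact (act X)) {} (rotate1 l)" for l
    by (auto simp: orb_def lact_def rotate1_map image_image)
  have rotL: "l \<in> L \<Longrightarrow> rotate1 l \<in> L" for l by (simp add: LI)
  \<comment> \<open>Rotation commutes with the action, so it permutes the orbits of tuples, and it
    changes neither the cyclic product nor the support of a tuple.\<close>
  have c1: "cong_p (sum F \<L>) (sum F {\<omega> \<in> \<L>. rotate1 ` \<omega> = \<omega>})"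
  proof (rule sum_rotation)
    show "finite \<L>" using fa by (simp add: \<L>_def fin_acts_def)
    show "(`) rotate1 ` \<L> \<subseteq> \<L>" by (auto simp: \<L>_def rot rotL)
    show "F (rotate1 ` \<omega>) = F \<omega>" if "\<omega> \<in> \<L>" for \<omega>
      using that by (auto simp: \<L>_def rot rotL F cyc_rotate1 lsupp_def)
    show "F \<omega> \<in> V" if \<omega>: "\<omega> \<in> \<L>" for \<omega>
    proof -
      obtain l where l: "l \<in> L" "\<omega> = orb (lact (act X)) {} l" using \<omega> by (auto simp: \<L>_def)
      have "chain A x k z \<in> V" if "x \<in> pts X" "z \<in> pts X" "set k \<subseteq> pts X" for x k z
        using that by (induction k arbitrary: x) (auto intro!: V_closed AV)
      moreover have "hd l \<in> pts X" "set (tl l) \<subseteq> pts X" using l p0 by (cases l; auto simp: LI)+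
      ultimately show ?thesis using l by (auto simp: F cyc_def intro!: V_closed wt_V)
    qed
    show "((`) rotate1 ^^ p) \<omega> = \<omega>" if \<omega>: "\<omega> \<in> \<L>" for \<omega>
    proof -
      have "((`) rotate1 ^^ n) \<omega> = rotate n ` \<omega>" for n by (induction n) (auto simp: image_image)
      moreover have "\<omega> \<subseteq> L" using \<omega> orb_sub[OF acts_stab[OF a], of _ "{}"] by (auto simp: \<L>_def)
      then have "rotate p l = l" if "l \<in> \<omega>" for l using that by (auto simp: LI)
      ultimately show ?thesis by simp
    qed
  qed
  \<comment> \<open>An orbit fixed by the rotation contains a tuple that some group element rotates,
    and \<open>rotation_fixed\<close> makes that tuple constant. A constant tuple has the support of
    its entry, so orbits of constant tuples correspond to orbits of points with the same
    weights.\<close>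
  have c2: "sum F {\<omega> \<in> \<L>. rotate1 ` \<omega> = \<omega>} =
      (\<Sum>P\<in>orb (act X) {} ` pts X. A (rep P) (rep P) ^ p * wt {} (supp X (rep P)))"
  proof -
    have rl: "replicate p x \<in> L" if "x \<in> pts X" for x using that by (auto simp: LI)
    have lr: "lact (act X) g (replicate p x) = replicate p (act X g x)" for g x by (simp add: lact_def)
    have self: "y \<in> orb (act X) {} y" if "y \<in> pts X" for y by (rule orb_self[OF acts_stab[OF b] that])
    have eq: "orb (lact (act X)) {} (replicate p x) = orb (lact (act X)) {} (replicate p y)"
      if xy: "x \<in> orb (act X) {} y" "y \<in> pts X" for x y
    proof -
      obtain g where "g \<in> G" "x = act X g y" using xy(1) by (auto simp: orb_def)
      then have "replicate p x \<in> orb (lact (act X)) {} (replicate p y)"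
        unfolding orb_def by (intro image_eqI[of _ _ g]) (simp_all add: lr)
      then show ?thesis by (rule orb_eq[OF acts_stab[OF a] rl[OF xy(2)]])
    qed
    have bij: "bij_betw (\<lambda>P. orb (lact (act X)) {} (replicate p (rep P))) (orb (act X) {} ` pts X) {\<omega> \<in> \<L>. rotate1 ` \<omega> = \<omega>}"
    proof (rule bij_betw_imageI[OF inj_onI subset_antisym[OF subsetI subsetI]])
      fix P Q assume PQ: "P \<in> orb (act X) {} ` pts X" "Q \<in> orb (act X) {} ` pts X"
        and e: "orb (lact (act X)) {} (replicate p (rep P)) = orb (lact (act X)) {} (replicate p (rep Q))"
      note r = rep_orbit[OF b PQ(1)] rep_orbit[OF b PQ(2)]
      have "replicate p (rep P) \<in> orb (lact (act X)) {} (replicate p (rep Q))"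
        using orb_self[OF acts_stab[OF a] rl[OF r(2)], of "{}"] e by simp
      then obtain g where "g \<in> G" "replicate p (rep P) = replicate p (act X g (rep Q))"
        unfolding orb_def by (auto simp: lr)
      then have "rep P \<in> orb (act X) {} (rep Q)" using p0 by (auto simp: orb_def replicate_eq_replicate)
      then show "P = Q" using orb_eq[OF acts_stab[OF b] r(5)] r(3,6) by metis
    next
      fix \<omega> assume "\<omega> \<in> (\<lambda>P. orb (lact (act X)) {} (replicate p (rep P))) ` orb (act X) {} ` pts X"
      then obtain P where P: "P \<in> orb (act X) {} ` pts X" "\<omega> = orb (lact (act X)) {} (replicate p (rep P))" by blast
      then show "\<omega> \<in> {\<omega> \<in> \<L>. rotate1 ` \<omega> = \<omega>}"
        using rl[OF rep_orbit(2)[OF b P(1)]] by (auto simp: \<L>_def rot)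
    next
      fix \<omega> assume "\<omega> \<in> {\<omega> \<in> \<L>. rotate1 ` \<omega> = \<omega>}"
      then obtain l where l: "l \<in> L" "\<omega> = orb (lact (act X)) {} l" "orb (lact (act X)) {} (rotate1 l) = orb (lact (act X)) {} l"
        by (auto simp: \<L>_def rot)
      have "rotate1 l \<in> orb (lact (act X)) {} l"
        using orb_self[OF acts_stab[OF a] rotL[OF l(1)], of "{}"] l(3) by simp
      then obtain g where "g \<in> G" "lact (act X) g l = rotate1 l" by (auto simp: orb_def)
      then have lx: "l = replicate p (hd l)"
        using l(1) unfolding L_def by (intro rotation_fixed[OF X prime_p p_ge_5])
      have x: "hd l \<in> pts X" using l(1) p0 by (cases l) (auto simp: LI)
      let ?P = "orb (act X) {} (hd l)"
      have P: "?P \<in> orb (act X) {} ` pts X" using x by simp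
      have "\<omega> = orb (lact (act X)) {} (replicate p (rep ?P))"
        using eq[OF rep_orbit(1)[OF b P] x] l(2) lx by simp
      then show "\<omega> \<in> (\<lambda>P. orb (lact (act X)) {} (replicate p (rep P))) ` orb (act X) {} ` pts X" using P by blast
    qed
    show ?thesis
      unfolding sum.reindex_bij_betw[OF bij, symmetric]
    proof (rule sum.cong[OF refl])
      fix P assume "P \<in> orb (act X) {} ` pts X"
      from rl[OF rep_orbit(2)[OF b this]]
      show "F (orb (lact (act X)) {} (replicate p (rep P))) = A (rep P) (rep P) ^ p * wt {} (supp X (rep P))"
        using p0 by (simp add: F cyc_replicate lsupp_def)
    qed
  qed
  have c3: "cong_p (tr X A ^ p) (\<Sum>P\<in>orb (act X) {} ` pts X. (A (rep P) (rep P) * wt {} (supp X (rep P))) ^ p)"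
    unfolding tr_def integ_def by (rule frobenius_sum) (auto intro!: V_closed wt_V AV rep_in[OF b])
  \<comment> \<open>The weights may be taken out of the \<open>p\<close>-th power because they lie
    in \<open>frob_fixed\<close>.\<close>
  have c4: "cong_p (\<Sum>P\<in>orb (act X) {} ` pts X. (A (rep P) (rep P) * wt {} (supp X (rep P))) ^ p)
      (\<Sum>P\<in>orb (act X) {} ` pts X. A (rep P) (rep P) ^ p * wt {} (supp X (rep P)))"
    unfolding power_mult_distrib
  proof (intro cong_sum cong_mult_left V_closed(7) AV)
    show "cong_p (wt {} (supp X (rep P)) ^ p) (wt {} (supp X (rep P)))" for P
      using wt_frob[of "{}" "supp X (rep P)"] by (simp add: frob_fixed_def)
  qed (auto intro: rep_in[OF b])
  show ?thesis
    unfolding \<open>tr X (mpow X A (p - 1)) = sum F \<L>\<close>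
    using cong_trans[OF c1[unfolded c2] cong_sym[OF cong_trans[OF c3 c4]]] .
qed

text \<open>Iterating \<open>trace_frobenius\<close> compares the trace of the power of exponent
  \<open>p ^ t\<close> with the same power of the trace. If a power of \<open>A\<close> vanished,
  then for large \<open>t\<close> a power of a unit would be divisible by \<open>p\<close>.\<close>

lemma trace_unit_not_nilpotent:
  assumes X: "ob X" and A: "eqm X X A" and AV: "\<And>x y. x \<in> pts X \<Longrightarrow> y \<in> pts X \<Longrightarrow> A x y \<in> V"
    and unit: "tr X A \<noteq> 0" "tr X A \<in> V" "inverse (tr X A) \<in> V"
  shows "mpow X A n \<noteq> (\<lambda>y x. 0)"
proof
  have p0: "p > 0" using p_ge_5 by simp
  have cong: "cong_p (tr X (mpow X A (p ^ t - 1))) (tr X A ^ (p ^ t))" for t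
  proof (induction t)
    case (Suc t)
    let ?B = "mpow X A (p ^ t - 1)"
    have BV: "?B x y \<in> V" if "x \<in> pts X" "y \<in> pts X" for x y using mpow_V[OF X A AV that] .
    have "cong_p (tr X (mpow X ?B (p - 1))) (tr X ?B ^ p)"
      by (rule trace_frobenius[OF X eqm_mpow[OF X A] BV])
    moreover have "tr X ?B \<in> V" unfolding tr_def by (intro integ_V[OF obD(1)[OF X]] BV)
    then have "cong_p (tr X ?B ^ p) ((tr X A ^ (p ^ t)) ^ p)"
      by (intro cong_power Suc V_closed unit)
    \<comment> \<open>The indices of exponents \<open>p ^ t\<close> and \<open>p\<close> combine to
      the index of exponent \<open>p ^ Suc t\<close>.\<close>
    moreover have "p ^ t - 1 + (p - 1) * Suc (p ^ t - 1) = p ^ Suc t - 1"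
    proof -
      obtain q where q: "p ^ t = Suc q" using p0 by (metis gr0_implies_Suc zero_less_power)
      obtain r where r: "p = Suc r" using p0 gr0_implies_Suc by blast
      show ?thesis unfolding power_Suc q by (simp add: r)
    qed
    ultimately show ?case
      using cong_trans by (simp add: mpow_mpow[OF X A] power_mult[symmetric] mult.commute)
  qed simp
  assume zero: "mpow X A n = (\<lambda>y x. 0)"
  have zeros: "mpow X A (n + k) = (\<lambda>y x. 0)" for k
  proof (induction k)
    case (Suc k)
    then show ?case by (auto simp: mm_def gset_integral_zero fun_eq_iff)
  qed (simp add: zero)
  \<comment> \<open>The exponent \<open>p ^ n\<close> is large enough for the power to vanish, given
    that the power with index \<open>n\<close> does.\<close>
  have "n < 2 ^ n" by (rule less_exp)
  also have "(2 :: nat) ^ n \<le> p ^ n" using p_ge_5 by (intro power_mono) auto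
  finally have "mpow X A (p ^ n - 1) = (\<lambda>y x. 0)" using zeros[of "p ^ n - 1 - n"] by simp
  then have "cong_p 0 (tr X A ^ (p ^ n))" using cong[of n] by (simp add: tr_def integ_zero)
  then obtain v where v: "v \<in> V" "0 - tr X A ^ (p ^ n) = of_nat p * v" by (auto simp: cong_p_def)
  have "of_nat p * (v * - (inverse (tr X A) ^ (p ^ n))) = (0 - tr X A ^ (p ^ n)) * - (inverse (tr X A) ^ (p ^ n))"
    by (simp only: v(2) mult.assoc)
  also have "\<dots> = 1" using unit(1) by (simp flip: power_mult_distrib)
  finally show False using p_nonunit v(1) unit(3) by (metis V_closed(4,6,7))
qed

end

section \<open>A product that is not nilpotent\<close>

lemma char_prime: obtains p where "prime p" "p \<ge> 5" "CHAR('k) = 0 \<or> CHAR('k) = p"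
proof (cases "CHAR('k) = 0")
  case True
  have "prime (5::nat)" by simp
  then show ?thesis using that True by blast
next
  case False
  then have p: "prime CHAR('k)" by (intro prime_CHAR_semidom) simp
  moreover have "CHAR('k) \<noteq> 4" using p by auto
  ultimately have "CHAR('k) \<ge> 5" using char2 char3 prime_ge_2_nat[OF p] by linarith
  then show ?thesis using that p by blast
qed

lemma orb_invariant:
  assumes a: "acts (stab A) X a s" and z: "z \<in> X" and g: "g \<in> stab A" and x: "x \<in> X"
  shows "a g x \<in> orb a A z \<longleftrightarrow> x \<in> orb a A z"
proof -
  have gx: "a g x \<in> orb a A x" using g by (auto simp: orb_def)
  have "orb a A (a g x) = orb a A x" by (rule orb_eq[OF a x gx])
  moreover have "a g x \<in> orb a A (a g x)" using actsD(1)[OF a g x] by (rule orb_self[OF a])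
  moreover have "x \<in> orb a A x" using x by (rule orb_self[OF a])
  ultimately show ?thesis using orb_eq[OF a z] gx by metis
qed

text \<open>The matrix \<open>H\<close> is chosen such that the product with \<open>F\<close> has
  entries in \<open>V\<close> and the integrand of its trace is the indicator of one orbit. The
  trace is then a value of \<open>nu\<close>, hence a unit of \<open>V\<close>.\<close>

lemma trace_nonzero_multiple:
  assumes X: "ob X" and Y: "ob Y" and F: "eqm X Y F" and ne: "F \<noteq> (\<lambda>y x. 0)"
  shows "\<exists>H. eqm Y X H \<and> (\<forall>n. mpow X (mm Y H F) n \<noteq> (\<lambda>y x. 0))"
proof -
  obtain p where p: "prime p" "p \<ge> 5" "CHAR('k) = 0 \<or> CHAR('k) = p" by (rule char_prime)
  obtain V :: "'k set" where place: "place V p" using place_exists[OF p] by blast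
  interpret place V p by (rule place)
  let ?S = "pts X \<times> pts Y" and ?a = "pact (act X) (act Y)" and ?s = "psupp (supp X) (supp Y)"
  note fa = fin_acts_prod[OF obD(2)[OF X] obD(2)[OF Y]]
  note a = fin_actsD[OF fa]
  define f where "f q = F (snd q) (fst q)" for q
  have f: "invar {} ?S ?a f" using eqmD(3)[OF F] by (auto simp: invar_def f_def pact_def)
  have "finite (f ` ?S)"
  proof (rule finite_image_factor)
    show "finite (orb ?a {} ` ?S)" using fa by (simp add: fin_acts_def)
    show "f q = f r" if "q \<in> ?S" "r \<in> ?S" "orb ?a {} q = orb ?a {} r" for q r
      using invar_rep[OF a f that(1)] invar_rep[OF a f that(2)] that(3) by simp
  qed
  moreover obtain y1 x1 where "F y1 x1 \<noteq> 0" using ne by (auto simp: fun_eq_iff)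
  then have "(x1, y1) \<in> ?S" "f (x1, y1) \<noteq> 0" using eqmD(1,2)[OF F] by (auto simp: f_def)
  then have "f ` ?S - {0} \<noteq> {}" by blast
  ultimately have "\<exists>w\<in>f ` ?S - {0}. \<forall>v\<in>f ` ?S - {0}. inverse w * v \<in> V"
    by (intro exists_dominant V_closed(1,6) valuation) auto
  then obtain w where w: "w \<in> f ` ?S - {0}" "\<And>v. v \<in> f ` ?S - {0} \<Longrightarrow> inverse w * v \<in> V" by blast
  then obtain q0 where q0: "q0 \<in> ?S" "w = f q0" by blast
  \<comment> \<open>The division by \<open>w\<close> is put into \<open>H\<close>, so that
    \<open>F\<close> itself can stay unscaled.\<close>
  define H where "H x y = (if (x, y) \<in> orb ?a {} q0 then inverse w else 0)" for x y
  have sub: "orb ?a {} q0 \<subseteq> ?S" by (rule orb_sub[OF acts_stab[OF a] q0(1)])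
  have H: "eqm Y X H"
    unfolding eqm_def
  proof (intro conjI allI impI ballI)
    show "H x y = 0" if "(x, y) \<notin> pts X \<times> pts Y" for x y using that sub by (auto simp: H_def)
    show "H (act X g x) (act Y g y) = H x y" if "g \<in> G" "x \<in> pts X" "y \<in> pts Y" for g x y
      using orb_invariant[OF acts_stab[OF a] q0(1), where g = g and x = "(x, y)"] that by (simp add: H_def pact_def)
  qed
  have FV: "inverse w * F y x \<in> V" if "x \<in> pts X" "y \<in> pts Y" for x y
    using w(2)[of "F y x"] that V_closed(2) by (cases "F y x = 0") (auto simp: f_def image_iff)
  define B where "B = mm Y H F"
  have B: "eqm X X B" unfolding B_def by (rule eqm_mm[OF X Y X F H])
  have Beq: "B z x = integ D (pts Y) (act Y) (supp Y) (\<lambda>y. H z y * F y x)"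
    if "z \<in> pts X" "x \<in> pts X" "finite D" "supp X z \<union> supp X x \<subseteq> D" for z x D
    unfolding B_def by (rule mm_eq[OF X Y X F H that])
  have "B z x \<in> V" if zx: "z \<in> pts X" "x \<in> pts X" for z x
  proof -
    have "H z y * F y x \<in> V" if "y \<in> pts Y" for y using FV[OF zx(2) that] V_closed(2) by (simp add: H_def)
    then have "integ (supp X z \<union> supp X x) (pts Y) (act Y) (supp Y) (\<lambda>y. H z y * F y x) \<in> V"
      by (rule integ_V[OF place obD(1)[OF Y]])
    then show ?thesis using Beq[OF zx, of "supp X z \<union> supp X x"] zx by (simp add: obD(5)[OF X])
  qed
  moreover have tr: "tr X B = nuk (card (?s (rep (orb ?a {} q0))))"
  proof -
    define h where "h q = H (fst q) (snd q) * F (snd q) (fst q)" for q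
    \<comment> \<open>On the orbit of \<open>q0\<close> the matrix \<open>F\<close> is constantly
      \<open>w\<close>, which cancels the factor in \<open>H\<close>.\<close>
    have hq: "h q = (if q \<in> orb ?a {} q0 then 1 else 0)" if "q \<in> ?S" for q
    proof (cases "q \<in> orb ?a {} q0")
      case True
      then have "f q = w" using invar_orbit[OF a f q0(1)] q0(2) by simp
      then show ?thesis using True w(1) by (simp add: h_def H_def f_def)
    qed (simp add: h_def H_def)
    have "tr X B = integ {} (pts X) (act X) (supp X) (\<lambda>x. integ ({} \<union> supp X x) (pts Y) (act Y) (supp Y) (\<lambda>y. h (x, y)))"
      unfolding tr_def
    proof (rule integ_cong[OF obD(1)[OF X]])
      fix x assume x: "x \<in> pts X"
      show "B x x = integ ({} \<union> supp X x) (pts Y) (act Y) (supp Y) (\<lambda>y. h (x, y))"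
        using Beq[OF x x, of "supp X x"] x by (simp add: obD(5)[OF X] h_def)
    qed
    also have "\<dots> = integ {} ?S ?a ?s h"
    proof (rule integ_Fubini[OF obD(2)[OF X] obD(2)[OF Y], symmetric])
      show "invar {} ?S ?a h"
        using eqmD(3)[OF F] eqmD(3)[OF H] by (auto simp: invar_def h_def pact_def)
    qed simp
    also have "\<dots> = (\<Sum>\<omega>\<in>orb ?a {} ` ?S. if \<omega> = orb ?a {} q0 then wt {} (?s (rep \<omega>)) else 0)"
      unfolding integ_def
    proof (rule sum.cong[OF refl])
      fix \<omega> assume \<omega>: "\<omega> \<in> orb ?a {} ` ?S"
      note r = rep_orbit[OF a \<omega>]
      have "rep \<omega> \<in> orb ?a {} q0 \<longleftrightarrow> \<omega> = orb ?a {} q0"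
        using r orb_eq[OF acts_stab[OF a] q0(1)] by metis
      then show "h (rep \<omega>) * wt {} (?s (rep \<omega>)) = (if \<omega> = orb ?a {} q0 then wt {} (?s (rep \<omega>)) else 0)"
        using hq[OF r(2)] by simp
    qed
    also have "\<dots> = wt {} (?s (rep (orb ?a {} q0)))" using fa q0(1) by (simp add: fin_acts_def)
    finally show ?thesis by (simp add: wt_def nuk_def)
  qed
  moreover have "tr X B \<in> V" "inverse (tr X B) \<in> V" "tr X B \<noteq> 0"
    unfolding tr using nuk_frob[OF place] by (auto simp: frob_fixed_def)
  ultimately have "mpow X B n \<noteq> (\<lambda>y x. 0)" for n by (intro trace_unit_not_nilpotent[OF place X B])
  then show ?thesis using H unfolding B_def by blast
qed

theorem karoubi_PC: "semisimple_pre_tannakian (karoubi PC)"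
proof -
  interpret T: typed_category PC msrc mtgt by (rule PC_typed)
  have pow: "T.cpow (PMat X X A) n = PMat X X (mpow X A n)" for X A n
    by (induction n) (simp_all add: PC_simps mat_comp_eq)
  interpret T: regular_category PC msrc mtgt
  proof unfold_locales
    fix X Y assume XY: "X \<in> cob PC" "Y \<in> cob PC"
    then have o: "ob X" "ob Y" by (simp_all add: PC_simps)
    show "\<exists>n \<phi>. coordinates (cHom PC X Y) n \<phi>" by (rule PC_coordinates[OF o])
    fix f assume f: "f \<in> chom PC X Y" "f \<noteq> \<zero>\<^bsub>cHom PC X Y\<^esub>"
    then obtain F where F: "f = PMat X Y F" "eqm X Y F" by (auto simp: PC_hom)
    then have "F \<noteq> (\<lambda>y x. 0)" using f(2) by (auto simp: PC_simps)
    then obtain H where H: "eqm Y X H" "\<And>n. mpow X (mm Y H F) n \<noteq> (\<lambda>y x. 0)"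
      using trace_nonzero_multiple[OF o F(2)] by blast
    have "ccomp PC (PMat Y X H) f = PMat X X (mm Y H F)" by (simp add: F(1) PC_simps mat_comp_eq)
    then have "\<forall>n. T.cpow (ccomp PC (PMat Y X H) f) n \<noteq> \<zero>\<^bsub>cHom PC X X\<^esub>"
      using H(2) by (simp add: pow PC_simps)
    moreover have "PMat Y X H \<in> chom PC Y X" using H(1) by (simp add: PC_simps PMat_hom)
    ultimately show "\<exists>g\<in>chom PC Y X. \<forall>n. T.cpow (ccomp PC g f) n \<noteq> \<zero>\<^bsub>cHom PC X X\<^esub>" by blast
  qed
  show ?thesis by (rule T.karoubi_semisimple[OF PC_unit_end PC_dual])
qed

end

theorem theorem17p10:
  fixes R :: "'w \<Rightarrow> 'w \<Rightarrow> 'w \<Rightarrow> 'w \<Rightarrow> bool"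
    and \<mu>\<^sub>1 :: "('w, 'a univ) gset \<Rightarrow> rat"
  assumes "boron_fraisse_limit R"
    and "CHAR('k::field) \<noteq> 2"
    and "CHAR('k) \<noteq> 3"
    and "is_mu1 R \<mu>\<^sub>1"
  shows "semisimple_pre_tannakian
    (karoubi (perm_cat (aut R) (stab_class (aut R)) (\<lambda>X. of_Z_sixth (\<mu>\<^sub>1 X) :: 'k)))"
proof -
  interpret mu_one R \<mu>\<^sub>1 "of_Z_sixth :: rat \<Rightarrow> 'k"
    using assms by unfold_locales auto
  show ?thesis by (rule karoubi_PC)
qed

end
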